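(* Let $N\ge1$, $b>-N/2$, $n\in\{1,\dots,N\}$, and let $D_{b,n}$ be the operator on $\mathcal S(\mathbb R^N)$ defined in the context. For $f\in\mathcal S(\mathbb R^N)$, $D_{b,n}f$ admits the following two expressions: $$D_{b,n}f(x)=\frac{\partial f}{\partial x_n}(x)+\frac{2b}{\mathrm{vol}(S^{N-1})}\int_{|y|=|x|}\frac{x_n-y_n}{|x-y|^N}\bigl(f(x)-f(y)\bigr)\,dy\qquad(x\neq0),$$ $$D_{b,n}f(x)=\frac{\partial f}{\partial x_n}(x)+\frac b{\mathrm{vol}(S^{N-1})}\int_{S^{N-1}}\xi_n\frac{f(x)-f(\sigma_\xi(x))}{\langle\xi,x\rangle}\,d\xi.$$ Here $d\xi$ is the standard $O(N)$-invariant measure on $S^{N-1}$ (of total mass $\mathrm{vol}(S^{N-1})$), $\sigma_\xi(x)=x-2\langle x,\xi\rangle\xi$ is the reflection, and $dy$ is the $O(N)$-invariant measure on $\{y\in\mathbb R^N:|y|=|x|\}$ corresponding to $d\xi$, normalized as the image of $|x|^{N-2}d\eta$ under $\eta\mapsto|x|\eta$ ($\eta\in S^{N-1}$).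
   Context: $x_n$ denotes the $n$-th coordinate (and multiplication by it); $E=\sum_kx_k\partial_{x_k}$. $\mathcal H^m(\mathbb R^N)$ is the space of homogeneous harmonic polynomials of degree $m$ on $\mathbb R^N$ (complex coefficients); $\lambda_{N,m}:=\frac{N-2}{2}+m$; $L_\ell^{(\nu)}(t):=\sum_{k=0}^{\ell}\frac{(-1)^k\Gamma(\nu+\ell+1)}{\Gamma(\nu+k+1)(\ell-k)!}\frac{t^k}{k!}$. For $p\in\mathcal H^m(\mathbb R^N)$: $\Phi_{b,\ell,p}(x):=e^{-|x|^2/2}L_\ell^{(b+\lambda_{N,m})}(|x|^2)p(x)$. $W_{b,alg}$ is the complex linear span of all $\Phi_{b,\ell,p}$. $H_b:=\Delta+\frac{2b}{|x|^2}\mathcal R$ on $W_{b,alg}$, where $\mathcal R$ is linear with $\mathcal R(f(|x|^2)p(x))=E(f(|x|^2))p(x)$ for $p\in\mathcal H^m(\mathbb R^N)$. $\Omega_b$ is the unique unitary representation of the universal covering $\widetilde{SL}(2,\mathbb R)$ on $L^2(\mathbb R^N,|x|^{2b}dx)$ whose differential on $W_{b,alg}$ is $\begin{pmatrix}0&1\\0&0\end{pmatrix}\mapsto\frac i2|x|^2$, $\begin{pmatrix}0&0\\1&0\end{pmatrix}\mapsto\frac i2H_b$, $\begin{pmatrix}1&0\\0&-1\end{pmatrix}\mapsto E+\frac{N+2b}2$, with $\Omega_b(e^{t\left(\begin{smallmatrix}0&-1\\1&0\end{smallmatrix}\right)})\Phi_{b,\ell,p}=e^{-it(b+\lambda_{N,m}+2\ell+1)}\Phi_{b,\ell,p}$.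 Its space of smooth vectors is $\mathcal S(\mathbb R^N)$, and $H_b$ is extended to $\mathcal S(\mathbb R^N)$ by $\frac i2H_b=d\Omega_b\begin{pmatrix}0&0\\1&0\end{pmatrix}$. Define $D_{b,n}:=\left[\frac{H_b-|x|^2}2,x_n\right]:\mathcal S(\mathbb R^N)\to\mathcal S(\mathbb R^N)$. The quotient $\frac{f(x)-f(\sigma_\xi(x))}{\langle\xi,x\rangle}$ is understood as its smooth extension across $\langle\xi,x\rangle=0$, i.e. as $2\int_0^1\langle\xi,\nabla f(x-2s\langle x,\xi\rangle\xi)\rangle\,ds$. For $N=1$, $S^0=\{\pm1\}$ with counting measure. *)

theory Defs
  imports "HOL-Analysis.Analysis" "HOL-Algebra.Group"
begin

section \<open>Differential operators, Schwartz functions, harmonic polynomials\<close>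

definition partial :: "'n::finite \<Rightarrow> (real^'n \<Rightarrow> complex) \<Rightarrow> real^'n \<Rightarrow> complex" where
  "partial k f x = frechet_derivative f (at x) (axis k 1)"

definition Euler :: "(real^'n::finite \<Rightarrow> complex) \<Rightarrow> real^'n \<Rightarrow> complex" where
  "Euler f x = (\<Sum>k\<in>UNIV. of_real (x $ k) * partial k f x)"

definition Laplacian :: "(real^'n::finite \<Rightarrow> complex) \<Rightarrow> real^'n \<Rightarrow> complex" where
  "Laplacian f x = (\<Sum>k\<in>UNIV. partial k (partial k f) x)"

primrec iter_partial :: "'n::finite list \<Rightarrow> (real^'n \<Rightarrow> complex) \<Rightarrow> real^'n \<Rightarrow> complex" where
  "iter_partial [] f = f"
| "iter_partial (k # ks) f = partial k (iter_partial ks f)"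

definition schwartz :: "(real^'n::finite \<Rightarrow> complex) set" where
  "schwartz = {f. \<forall>ks. (\<forall>x. iter_partial ks f differentiable (at x)) \<and>
     (\<forall>j::nat. bounded (range (\<lambda>x. of_real (norm x ^ j) * iter_partial ks f x)))}"

definition harmonic_poly :: "nat \<Rightarrow> (real^'n::finite \<Rightarrow> complex) set" where
  "harmonic_poly m = {p. polynomial_function p \<and>
     (\<forall>c x. p (c *\<^sub>R x) = of_real (c ^ m) * p x) \<and> (\<forall>x. Laplacian p x = 0)}"


section \<open>The space \<open>W_alg b\<close> and the operator \<open>H_alg b\<close>\<close>

definition Laguerre :: "nat \<Rightarrow> real \<Rightarrow> real \<Rightarrow> real" where
  "Laguerre l \<nu> t = (\<Sum>k\<le>l. (-1) ^ k * Gamma (\<nu> + real l + 1) /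
     (Gamma (\<nu> + real k + 1) * fact (l - k)) * (t ^ k / fact k))"

definition lam :: "nat \<Rightarrow> nat \<Rightarrow> real" where
  "lam N m = (real N - 2) / 2 + real m"

(* The degree m of p is passed explicitly, since it is not determined by p when p = 0. *)
definition Phi :: "real \<Rightarrow> nat \<Rightarrow> nat \<Rightarrow> (real^'n::finite \<Rightarrow> complex) \<Rightarrow> real^'n \<Rightarrow> complex" where
  "Phi b l m p x =
     of_real (exp (- (norm x)\<^sup>2 / 2) * Laguerre l (b + lam CARD('n) m) ((norm x)\<^sup>2)) * p x"

definition W_alg :: "real \<Rightarrow> (real^'n::finite \<Rightarrow> complex) set" where
  "W_alg b = {f. \<exists>K::nat. \<exists>c l m p. (\<forall>i<K. p i \<in> harmonic_poly (m i)) \<and>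
     f = (\<lambda>x. \<Sum>i<K. c i * Phi b (l i) (m i) (p i) x)}"

(* This determines R on W_alg b, because the functions Phi b l m p that span W_alg b
   are of the form F(|x|^2) p(x). *)
definition is_radial_Euler ::
  "real \<Rightarrow> ((real^'n::finite \<Rightarrow> complex) \<Rightarrow> real^'n \<Rightarrow> complex) \<Rightarrow> bool" where
  "is_radial_Euler b R \<longleftrightarrow>
     (\<forall>f\<in>W_alg b. \<forall>g\<in>W_alg b. \<forall>c d.
        R (\<lambda>x. c * f x + d * g x) = (\<lambda>x. c * R f x + d * R g x)) \<and>
     (\<forall>F :: real \<Rightarrow> complex. \<forall>m. \<forall>p\<in>harmonic_poly m.
        (\<forall>u. F differentiable (at u)) \<longrightarrow> (\<lambda>x. F ((norm x)\<^sup>2) * p x) \<in> W_alg b \<longrightarrow>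
        R (\<lambda>x. F ((norm x)\<^sup>2) * p x) = (\<lambda>x. Euler (\<lambda>y. F ((norm y)\<^sup>2)) x * p x))"

(* The value at x = 0 follows the convention a / 0 = 0; below, H_alg b R f is only
   used as an element of L^2, where this single point does not matter. *)
definition H_alg :: "real \<Rightarrow> ((real^'n::finite \<Rightarrow> complex) \<Rightarrow> real^'n \<Rightarrow> complex) \<Rightarrow>
    (real^'n \<Rightarrow> complex) \<Rightarrow> real^'n \<Rightarrow> complex" where
  "H_alg b R f x = Laplacian f x + of_real (2 * b / (norm x)\<^sup>2) * R f x"


section \<open>The universal covering group of \<open>SL(2,\<real>)\<close>\<close>

definition SL2 :: "(real^2^2) set" where
  "SL2 = {A. det A = 1}"

definition sl2 :: "(real^2^2) set" where
  "sl2 = {X. trace X = 0}"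

definition mat22 :: "real \<Rightarrow> real \<Rightarrow> real \<Rightarrow> real \<Rightarrow> real^2^2" where
  "mat22 a b c d = vector [vector [a, b], vector [c, d]]"

definition is_universal_cover_SL2 ::
  "('g::topological_space) monoid \<Rightarrow> ('g \<Rightarrow> real^2^2) \<Rightarrow> bool" where
  "is_universal_cover_SL2 G \<pi> \<longleftrightarrow>
     group G \<and>
     continuous_on (carrier G \<times> carrier G) (\<lambda>(g, h). g \<otimes>\<^bsub>G\<^esub> h) \<and>
     continuous_on (carrier G) (\<lambda>g. inv\<^bsub>G\<^esub> g) \<and>
     (\<forall>g\<in>carrier G. \<forall>h\<in>carrier G. \<pi> (g \<otimes>\<^bsub>G\<^esub> h) = \<pi> g ** \<pi> h) \<and>
     covering_space (carrier G) \<pi> SL2 \<and>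
     simply_connected (carrier G)"

(* The curve exp(tX) in the covering group G: the one-parameter subgroup with initial
   velocity X. It exists and is unique for each X in sl2. *)
definition is_exp_curve ::
  "('g::topological_space) monoid \<Rightarrow> ('g \<Rightarrow> real^2^2) \<Rightarrow> real^2^2 \<Rightarrow> (real \<Rightarrow> 'g) \<Rightarrow> bool" where
  "is_exp_curve G \<pi> X \<gamma> \<longleftrightarrow>
     (\<forall>t. \<gamma> t \<in> carrier G) \<and>
     (\<forall>s t. \<gamma> (s + t) = \<gamma> s \<otimes>\<^bsub>G\<^esub> \<gamma> t) \<and>
     continuous_on UNIV \<gamma> \<and>
     ((\<lambda>t. \<pi> (\<gamma> t)) has_vector_derivative X) (at 0)"


section \<open>Unitary representations on \<open>L\<^sup>2\<close>\<close>

(* Elements of L^2(M) are represented by functions; equality in L^2(M) is equality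
   almost everywhere. *)

definition L2 :: "'a measure \<Rightarrow> ('a \<Rightarrow> complex) set" where
  "L2 M = {f \<in> borel_measurable M. integrable M (\<lambda>x. (cmod (f x))\<^sup>2)}"

definition L2_norm :: "'a measure \<Rightarrow> ('a \<Rightarrow> complex) \<Rightarrow> real" where
  "L2_norm M f = sqrt (LINT x|M. (cmod (f x))\<^sup>2)"

definition L2_inner :: "'a measure \<Rightarrow> ('a \<Rightarrow> complex) \<Rightarrow> ('a \<Rightarrow> complex) \<Rightarrow> complex" where
  "L2_inner M f g = (LINT x|M. f x * cnj (g x))"

definition is_unitary_rep ::
  "('g::topological_space) monoid \<Rightarrow> 'a measure \<Rightarrow>
   ('g \<Rightarrow> ('a \<Rightarrow> complex) \<Rightarrow> 'a \<Rightarrow> complex) \<Rightarrow> bool" where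
  "is_unitary_rep G M \<Omega> \<longleftrightarrow>
     (\<forall>g\<in>carrier G. \<forall>f\<in>L2 M. \<Omega> g f \<in> L2 M) \<and>
     (\<forall>g\<in>carrier G. \<forall>f\<in>L2 M. \<forall>f'\<in>L2 M.
        (AE x in M. f x = f' x) \<longrightarrow> (AE x in M. \<Omega> g f x = \<Omega> g f' x)) \<and>
     (\<forall>g\<in>carrier G. \<forall>f\<in>L2 M. \<forall>f'\<in>L2 M. \<forall>c d.
        AE x in M. \<Omega> g (\<lambda>y. c * f y + d * f' y) x = c * \<Omega> g f x + d * \<Omega> g f' x) \<and>
     (\<forall>g\<in>carrier G. \<forall>f\<in>L2 M. \<forall>f'\<in>L2 M.
        L2_inner M (\<Omega> g f) (\<Omega> g f') = L2_inner M f f') \<and>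
     (\<forall>f\<in>L2 M. AE x in M. \<Omega> \<one>\<^bsub>G\<^esub> f x = f x) \<and>
     (\<forall>g\<in>carrier G. \<forall>h\<in>carrier G. \<forall>f\<in>L2 M.
        AE x in M. \<Omega> (g \<otimes>\<^bsub>G\<^esub> h) f x = \<Omega> g (\<Omega> h f) x) \<and>
     (\<forall>f\<in>L2 M. \<forall>g\<in>carrier G.
        ((\<lambda>h. L2_norm M (\<lambda>x. \<Omega> h f x - \<Omega> g f x)) \<longlongrightarrow> 0) (at g within carrier G))"

(* f lies in the domain of the differential of \<Omega> at X, with value h. *)
definition has_differential ::
  "('g::topological_space) monoid \<Rightarrow> ('g \<Rightarrow> real^2^2) \<Rightarrow> 'a measure \<Rightarrow>
   ('g \<Rightarrow> ('a \<Rightarrow> complex) \<Rightarrow> 'a \<Rightarrow> complex) \<Rightarrow>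
   real^2^2 \<Rightarrow> ('a \<Rightarrow> complex) \<Rightarrow> ('a \<Rightarrow> complex) \<Rightarrow> bool" where
  "has_differential G \<pi> M \<Omega> X f h \<longleftrightarrow> f \<in> L2 M \<and> h \<in> L2 M \<and>
     (\<exists>\<gamma>. is_exp_curve G \<pi> X \<gamma> \<and>
        ((\<lambda>t. L2_norm M (\<lambda>x. (\<Omega> (\<gamma> t) f x - f x) / of_real t - h x)) \<longlongrightarrow> 0) (at 0))"

(* Smoothness of the orbit map g \<mapsto> \<Omega> g f, expressed by the left-invariant vector fields:
   the derivative of the orbit map of f along X is the orbit map of the differential of
   \<Omega> at X applied to f, so f is a smooth vector iff all iterated differentials of f exist;
   these f form the largest set V as below, which is a subspace. *)
definition smooth_vectors ::
  "('g::topological_space) monoid \<Rightarrow> ('g \<Rightarrow> real^2^2) \<Rightarrow> 'a measure \<Rightarrow>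
   ('g \<Rightarrow> ('a \<Rightarrow> complex) \<Rightarrow> 'a \<Rightarrow> complex) \<Rightarrow> ('a \<Rightarrow> complex) set" where
  "smooth_vectors G \<pi> M \<Omega> =
     \<Union>{V. V \<subseteq> L2 M \<and> (\<forall>f\<in>V. \<forall>X\<in>sl2. \<exists>h\<in>V. has_differential G \<pi> M \<Omega> X f h)}"


section \<open>The representation \<open>\<Omega>\<^sub>b\<close> and the operators \<open>H_b\<close>, \<open>D_{b,n}\<close>\<close>

definition weighted :: "real \<Rightarrow> (real^'n::finite) measure" where
  "weighted b = density lborel (\<lambda>x. ennreal (norm x powr (2 * b)))"

definition is_Omega ::
  "('g::topological_space) monoid \<Rightarrow> ('g \<Rightarrow> real^2^2) \<Rightarrow> real \<Rightarrow>
   ((real^'n::finite \<Rightarrow> complex) \<Rightarrow> real^'n \<Rightarrow> complex) \<Rightarrow>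
   ('g \<Rightarrow> (real^'n \<Rightarrow> complex) \<Rightarrow> real^'n \<Rightarrow> complex) \<Rightarrow> bool" where
  "is_Omega G \<pi> b R \<Omega> \<longleftrightarrow>
     is_unitary_rep G (weighted b) \<Omega> \<and>
     (\<forall>f\<in>W_alg b.
        has_differential G \<pi> (weighted b) \<Omega> (mat22 0 1 0 0) f
          (\<lambda>x. \<i> / 2 * of_real ((norm x)\<^sup>2) * f x) \<and>
        has_differential G \<pi> (weighted b) \<Omega> (mat22 0 0 1 0) f
          (\<lambda>x. \<i> / 2 * H_alg b R f x) \<and>
        has_differential G \<pi> (weighted b) \<Omega> (mat22 1 0 0 (-1)) f
          (\<lambda>x. Euler f x + of_real ((real CARD('n) + 2 * b) / 2) * f x)) \<and>
     (\<forall>\<gamma> t l m. \<forall>p\<in>harmonic_poly m. is_exp_curve G \<pi> (mat22 0 (-1) 1 0) \<gamma> \<longrightarrow>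
        (AE x in weighted b. \<Omega> (\<gamma> t) (Phi b l m p) x =
           exp (- \<i> * of_real (t * (b + lam CARD('n) m + 2 * real l + 1))) * Phi b l m p x))"

definition smooth_vectors_are_schwartz ::
  "('g::topological_space) monoid \<Rightarrow> ('g \<Rightarrow> real^2^2) \<Rightarrow> real \<Rightarrow>
   ('g \<Rightarrow> (real^'n::finite \<Rightarrow> complex) \<Rightarrow> real^'n \<Rightarrow> complex) \<Rightarrow> bool" where
  "smooth_vectors_are_schwartz G \<pi> b \<Omega> \<longleftrightarrow>
     smooth_vectors G \<pi> (weighted b) \<Omega> =
       {f \<in> L2 (weighted b). \<exists>g\<in>schwartz. AE x in weighted b. f x = g x}"

(* The extension of H_b to the Schwartz space; the Schwartz representative of an L^2 class
   is unique because it is continuous. *)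
definition H_op ::
  "('g::topological_space) monoid \<Rightarrow> ('g \<Rightarrow> real^2^2) \<Rightarrow> real \<Rightarrow>
   ('g \<Rightarrow> (real^'n::finite \<Rightarrow> complex) \<Rightarrow> real^'n \<Rightarrow> complex) \<Rightarrow>
   (real^'n \<Rightarrow> complex) \<Rightarrow> real^'n \<Rightarrow> complex" where
  "H_op G \<pi> b \<Omega> f = (THE g. g \<in> schwartz \<and>
     has_differential G \<pi> (weighted b) \<Omega> (mat22 0 0 1 0) f (\<lambda>x. \<i> / 2 * g x))"

definition mult_coord :: "'n::finite \<Rightarrow> (real^'n \<Rightarrow> complex) \<Rightarrow> real^'n \<Rightarrow> complex" where
  "mult_coord n f x = of_real (x $ n) * f x"

definition half_H_minus ::
  "('g::topological_space) monoid \<Rightarrow> ('g \<Rightarrow> real^2^2) \<Rightarrow> real \<Rightarrow>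
   ('g \<Rightarrow> (real^'n::finite \<Rightarrow> complex) \<Rightarrow> real^'n \<Rightarrow> complex) \<Rightarrow>
   (real^'n \<Rightarrow> complex) \<Rightarrow> real^'n \<Rightarrow> complex" where
  "half_H_minus G \<pi> b \<Omega> f x = (H_op G \<pi> b \<Omega> f x - of_real ((norm x)\<^sup>2) * f x) / 2"

definition D_op ::
  "('g::topological_space) monoid \<Rightarrow> ('g \<Rightarrow> real^2^2) \<Rightarrow> real \<Rightarrow>
   ('g \<Rightarrow> (real^'n::finite \<Rightarrow> complex) \<Rightarrow> real^'n \<Rightarrow> complex) \<Rightarrow>
   'n \<Rightarrow> (real^'n \<Rightarrow> complex) \<Rightarrow> real^'n \<Rightarrow> complex" where
  "D_op G \<pi> b \<Omega> n f x =
     half_H_minus G \<pi> b \<Omega> (mult_coord n f) x - mult_coord n (half_H_minus G \<pi> b \<Omega> f) x"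


section \<open>Surface measures, reflections\<close>

(* Cone measure: a subset A of the unit sphere has mass N times the volume of the cone
   {r * a | a \<in> A, 0 < r < 1}. For N = 1 this is counting measure on {-1, 1}. As a measure
   on the Borel sets of R^N it is concentrated on the sphere. *)
definition sphere_measure :: "(real^'n::finite) measure" where
  "sphere_measure =
     distr (density lborel (\<lambda>x. of_nat CARD('n) * indicator (ball 0 1) x)) borel sgn"

definition sphere_vol :: "'n::finite itself \<Rightarrow> real" where
  "sphere_vol _ = measure (sphere_measure :: (real^'n) measure) UNIV"

definition sphere_measure_radius :: "real \<Rightarrow> (real^'n::finite) measure" where
  "sphere_measure_radius r =
     distr (scale_measure (ennreal (r powr (real CARD('n) - 2))) sphere_measure) borel
       (\<lambda>\<eta>. r *\<^sub>R \<eta>)"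

definition reflection :: "real^'n::finite \<Rightarrow> real^'n \<Rightarrow> real^'n" where
  "reflection \<xi> x = x - (2 * (x \<bullet> \<xi>)) *\<^sub>R \<xi>"

(* (f(x) - f(reflection \<xi> x)) / <\<xi>,x>, extended smoothly across <\<xi>,x> = 0;
   see reflection_quotient_eq. *)
definition reflection_quotient ::
  "(real^'n::finite \<Rightarrow> complex) \<Rightarrow> real^'n \<Rightarrow> real^'n \<Rightarrow> complex" where
  "reflection_quotient f x \<xi> = 2 * integral {0..1} (\<lambda>s.
     \<Sum>k\<in>UNIV. of_real (\<xi> $ k) * partial k f (x - (2 * s * (x \<bullet> \<xi>)) *\<^sub>R \<xi>))"

lemma frechet_derivative_eq_sum_partial:
  fixes f :: "real^'n::finite \<Rightarrow> complex"
  assumes "f differentiable (at x)"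
  shows "frechet_derivative f (at x) v = (\<Sum>k\<in>UNIV. of_real (v $ k) * partial k f x)"
proof -
  have lin: "linear (frechet_derivative f (at x))"
    using assms by (rule linear_frechet_derivative)
  have "v = (\<Sum>k\<in>UNIV. v $ k *\<^sub>R axis k 1)"
    using basis_expansion[of v] by (simp add: scalar_mult_eq_scaleR)
  then have "frechet_derivative f (at x) v =
      frechet_derivative f (at x) (\<Sum>k\<in>UNIV. v $ k *\<^sub>R axis k 1)"
    by simp
  also have "\<dots> = (\<Sum>k\<in>UNIV. of_real (v $ k) * partial k f x)"
    unfolding linear_sum[OF lin] linear_scale[OF lin] partial_def
    by (simp add: scaleR_conv_of_real)
  finally show ?thesis .
qed

lemma reflection_quotient_eq:
  fixes f :: "real^'n::finite \<Rightarrow> complex"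
  assumes f: "\<And>y. f differentiable (at y)" and nz: "\<xi> \<bullet> x \<noteq> 0"
  shows "reflection_quotient f x \<xi> = (f x - f (reflection \<xi> x)) / of_real (\<xi> \<bullet> x)"
proof -
  define c where "c = x \<bullet> \<xi>"
  define z where "z s = x - (2 * s * c) *\<^sub>R \<xi>" for s :: real
  define g where "g s = (\<Sum>k\<in>UNIV. of_real (\<xi> $ k) * partial k f (z s))" for s
  have z': "(z has_derivative (\<lambda>h. - (2 * h * c) *\<^sub>R \<xi>)) (at s within {0..1})" for s
    unfolding z_def by (auto intro!: derivative_eq_intros)
  have "((f \<circ> z) has_derivative (\<lambda>h. h *\<^sub>R (- of_real (2 * c) * g s))) (at s within {0..1})" for s
  proof -
    have lin: "linear (frechet_derivative f (at (z s)))"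
      using f by (rule linear_frechet_derivative)
    have "(f has_derivative frechet_derivative f (at (z s))) (at (z s))"
      using f frechet_derivative_works by blast
    from diff_chain_within[OF z' has_derivative_at_withinI[OF this]]
    have "((f \<circ> z) has_derivative
        (frechet_derivative f (at (z s)) \<circ> (\<lambda>h. - (2 * h * c) *\<^sub>R \<xi>))) (at s within {0..1})" .
    moreover have "frechet_derivative f (at (z s)) \<xi> = g s"
      unfolding g_def by (rule frechet_derivative_eq_sum_partial[OF f])
    then have "frechet_derivative f (at (z s)) \<circ> (\<lambda>h. - (2 * h * c) *\<^sub>R \<xi>) =
        (\<lambda>h. h *\<^sub>R (- of_real (2 * c) * g s))"
      unfolding o_def linear_scale[OF lin]
      by (intro ext) (simp add: scaleR_conv_of_real)
    ultimately show ?thesis by simp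
  qed
  then have "((\<lambda>s. - of_real (2 * c) * g s) has_integral (f \<circ> z) 1 - (f \<circ> z) 0) {0..1}"
    by (intro fundamental_theorem_of_calculus) (simp_all add: has_vector_derivative_def o_def)
  from has_integral_mult_right[OF this, of "- 1 / of_real c"]
  have "((\<lambda>s. 2 * g s) has_integral (- 1 / of_real c * (f (z 1) - f (z 0)))) {0..1}"
    using nz by (simp add: c_def inner_commute)
  moreover have "- 1 / of_real c * (f (z 1) - f (z 0)) = (f (z 0) - f (z 1)) / of_real c"
    by (simp add: diff_divide_distrib)
  ultimately have "((\<lambda>s. 2 * g s) has_integral (f (z 0) - f (z 1)) / of_real c) {0..1}"
    by simp
  then have "integral {0..1} (\<lambda>s. 2 * g s) = (f (z 0) - f (z 1)) / of_real c"
    by (rule integral_unique)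
  then show ?thesis
    by (simp add: reflection_quotient_def reflection_def g_def z_def c_def inner_commute)
qed

lemma sphere_vol_eq:
  "sphere_vol TYPE('n::finite) = real CARD('n) * unit_ball_vol (real CARD('n))"
proof -
  have "(\<lambda>x::real^'n. x /\<^sub>R norm x) \<in> borel_measurable borel"
    by measurable
  then have [measurable]: "(sgn :: real^'n \<Rightarrow> _) \<in> borel_measurable borel"
    by (simp add: sgn_div_norm[abs_def])
  have [measurable]: "ball 0 1 \<in> sets (borel :: (real^'n) measure)"
    by simp
  have "emeasure (sphere_measure :: (real^'n) measure) UNIV =
      (\<integral>\<^sup>+x. of_nat CARD('n) * indicator (ball 0 1) x \<partial>(lborel :: (real^'n) measure))"
    unfolding sphere_measure_def 
    by (simp add: emeasure_distr emeasure_density)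
  also have "\<dots> = of_nat CARD('n) * emeasure lborel (ball 0 1 :: (real^'n) set)"
    by (subst nn_integral_cmult_indicator) simp_all
  also have "\<dots> = ennreal (real CARD('n) * unit_ball_vol (real CARD('n)))"
    by (simp add: emeasure_ball ennreal_mult ennreal_of_nat_eq_real_of_nat)
  finally show ?thesis
    by (simp add: sphere_vol_def measure_def)
qed

end

theory Submission
  imports Defs
begin

text \<open>
  Let \<open>T f x = \<partial>\<^sub>n f x + (b / vol) \<integral> \<xi>\<^sub>n (f x - f (\<sigma>\<^sub>\<xi> x)) / \<langle>\<xi>, x\<rangle> d\<xi>\<close>. The operator \<open>D_op\<close> is known only
  through the representation, so the identity \<open>D_op f = T f\<close> is proved weakly: both sides are paired in
  \<open>L\<^sup>2(|x|\<^sup>2\<^sup>b dx)\<close> with the functions \<open>w = |x|\<^sup>2\<^sup>k exp(-|x|\<^sup>2/2) p(x)\<close>, \<open>p\<close> harmonic and homogeneous of degree \<open>m\<close>.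
  These lie in \<open>W_alg b\<close>, because the Laguerre polynomials and the monomials are related by a triangular matrix.

  The representation enters only through unitarity. It makes \<open>(i/2) H_b\<close> skew-adjoint
  (\<open>has_differential_skew_adjoint\<close>), so that pairing \<open>H_op f\<close> with \<open>w\<close> amounts to pairing \<open>f\<close> with the explicit
  function \<open>H_alg b R w\<close>; this needs that the curve \<open>exp(tX)\<close> in the covering group is determined by \<open>X\<close>
  (\<open>exp_curve_unique\<close>). Next, \<open>x\<^sub>n p = q\<^sub>+ + |x|\<^sup>2 q\<^sub>-\<close> with \<open>q\<^sub>+\<close>, \<open>q\<^sub>-\<close> harmonic and
  \<open>q\<^sub>- = \<partial>\<^sub>n p / (N + 2 m - 2)\<close> (\<open>raising_harmonic\<close>). Since \<open>\<R>\<close> differentiates only the radial factor, this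
  decomposition gives \<open>[H_b / 2, x\<^sub>n] w = \<partial>\<^sub>n w + 2 b |x|\<^sup>2\<^sup>k exp(-|x|\<^sup>2/2) q\<^sub>-\<close> (\<open>H_alg_commutator\<close>), and the transpose of
  \<open>D_op\<close> on the functions \<open>w\<close> is the negative of this operator (\<open>D_op_pairing\<close>).

  On the other side the transpose of \<open>T\<close> is computed directly. If \<open>2 b + 2 k\<close> is large, then \<open>|x|\<^sup>2\<^sup>b w\<close> is
  continuously differentiable and integration by parts has no boundary term at the origin. For the integral term,
  one substitutes \<open>\<sigma>\<^sub>\<xi> x\<close> for \<open>x\<close> at fixed \<open>\<xi>\<close>: the kernel \<open>1/\<langle>\<xi>, x\<rangle>\<close> changes its sign and the weight does not
  change, so the operator is skew-symmetric up to the principal value of \<open>2 \<integral> \<xi>\<^sub>n / \<langle>\<xi>, x\<rangle> d\<xi> = 2 vol x\<^sub>n / |x|\<^sup>2\<close>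
  (\<open>integral_refl_int_duality\<close>).
  Multiplied by \<open>b / vol\<close>, this extra term cancels the derivative of \<open>|x|\<^sup>2\<^sup>b\<close>. What remains to compare
  are the terms with \<open>q\<^sub>-\<close>, and they agree because
  \<open>\<integral> \<xi>\<^sub>n (p x - p (\<sigma>\<^sub>\<xi> x)) / \<langle>\<xi>, x\<rangle> d\<xi> = 2 vol q\<^sub>-(x)\<close> for harmonic \<open>p\<close> (\<open>spherical_reflection_average\<close>). The proof
  of that identity expands \<open>p (x + \<eta>)\<close> into harmonic components in \<open>\<eta>\<close>, which reduces it to moments
  \<open>\<integral> \<xi>\<^sub>n \<langle>x, \<xi>\<rangle>\<^sup>k q(\<xi>) d\<xi>\<close>; these follow from Gaussian integration by parts.

  Hence \<open>D_op f - T f\<close>, a bounded continuous function, is orthogonal to all \<open>w\<close> with \<open>k\<close> large, and it vanishes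
  because these functions are still complete (\<open>test_functions_dense\<close>). Continuity also gives the value at \<open>0\<close>. This
  is the expression with reflections. The expression as an integral over \<open>|y| = |x|\<close> is the same integral in the
  variable \<open>y = \<sigma>\<^sub>\<xi> x\<close>: for a unit vector \<open>e\<close> the image of \<open>d\<xi>\<close> under \<open>\<xi> \<mapsto> \<sigma>\<^sub>\<xi> e\<close> has density \<open>|e - \<eta>|\<^sup>2\<^sup>-\<^sup>N\<close>
  (\<open>distr_reflection_sphere\<close>).
\<close>

section \<open>Partial derivatives\<close>

lemma partial_eqI:
  assumes "(f has_derivative D) (at x)"
  shows "partial k f x = D (axis k 1)"
  unfolding partial_def using frechet_derivative_at[OF assms] by simp

lemma has_derivative_partial:
  fixes f :: "real^'n::finite \<Rightarrow> complex"
  assumes "f differentiable (at x)"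
  shows "(f has_derivative (\<lambda>h. \<Sum>k\<in>UNIV. of_real (h $ k) * partial k f x)) (at x)"
  using assms frechet_derivative_works[of f "at x"]
  by (simp add: frechet_derivative_eq_sum_partial[OF assms, symmetric])

lemma differentiable_mult_complex:
  fixes f g :: "'a::real_normed_vector \<Rightarrow> complex"
  assumes "f differentiable (at x)" "g differentiable (at x)"
  shows "(\<lambda>x. f x * g x) differentiable (at x)"
  using assms unfolding differentiable_def by (blast intro: has_derivative_mult)

lemma differentiable_of_real_coord [simp]:
  "(\<lambda>x::real^'n::finite. complex_of_real (x $ n)) differentiable (at x)"
proof -
  have "bounded_linear (\<lambda>x::real^'n. complex_of_real (x $ n))"
    using bounded_linear_compose[OF bounded_linear_of_real bounded_linear_vec_nth] .
  then show ?thesis by (rule bounded_linear_imp_differentiable)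
qed

lemma partial_add:
  assumes "f differentiable (at x)" "g differentiable (at x)"
  shows "partial k (\<lambda>x. f x + g x) x = partial k f x + partial k g x"
proof -
  have "((\<lambda>x. f x + g x) has_derivative (\<lambda>h. frechet_derivative f (at x) h + frechet_derivative g (at x) h)) (at x)"
    using has_derivative_add assms frechet_derivative_works by blast
  from partial_eqI[OF this] show ?thesis by (simp add: partial_def)
qed

lemma partial_mult:
  assumes "f differentiable (at x)" "g differentiable (at x)"
  shows "partial k (\<lambda>x. f x * g x) x = partial k f x * g x + f x * partial k g x"
proof -
  have "((\<lambda>x. f x * g x) has_derivative (\<lambda>h. f x * frechet_derivative g (at x) h + frechet_derivative f (at x) h * g x)) (at x)"
    using has_derivative_mult assms frechet_derivative_works by blast
  from partial_eqI[OF this] show ?thesis by (simp add: partial_def add.commute)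
qed

lemma partial_const [simp]: "partial k (\<lambda>x. c) x = 0"
  by (rule trans[OF partial_eqI[OF has_derivative_const]]) simp

lemma partial_cmult:
  assumes "f differentiable (at x)"
  shows "partial k (\<lambda>x. c * f x) x = c * partial k f x"
  using partial_mult[of "\<lambda>_. c" x f k] assms by simp

lemma partial_sum:
  assumes "\<And>i. i \<in> I \<Longrightarrow> f i differentiable (at x)"
  shows "partial k (\<lambda>x. \<Sum>i\<in>I. f i x) x = (\<Sum>i\<in>I. partial k (f i) x)"
proof -
  have "((\<lambda>x. \<Sum>i\<in>I. f i x) has_derivative (\<lambda>h. \<Sum>i\<in>I. frechet_derivative (f i) (at x) h)) (at x)"
    by (rule has_derivative_sum) (use assms frechet_derivative_works in blast)
  from partial_eqI[OF this] show ?thesis by (simp add: partial_def)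
qed

lemma partial_of_real_coord [simp]:
  "partial k (\<lambda>x::real^'n::finite. complex_of_real (x $ n)) x = (if k = n then 1 else 0)"
proof -
  have "bounded_linear (\<lambda>x::real^'n. complex_of_real (x $ n))"
    using bounded_linear_compose[OF bounded_linear_of_real bounded_linear_vec_nth] .
  from partial_eqI[OF bounded_linear_imp_has_derivative[OF this]] show ?thesis
    by (simp add: axis_def)
qed

lemma partial_cnj:
  assumes "f differentiable (at x)"
  shows "partial k (\<lambda>x. cnj (f x)) x = cnj (partial k f x)"
proof -
  have "((\<lambda>x. cnj (f x)) has_derivative (\<lambda>h. cnj (frechet_derivative f (at x) h))) (at x)"
    by (rule has_derivative_cnj) (use assms frechet_derivative_works in blast)
  from partial_eqI[OF this] show ?thesis by (simp add: partial_def)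
qed

section \<open>Schwartz functions\<close>

lemma schwartz_differentiable: "f \<in> schwartz \<Longrightarrow> f differentiable (at x)"
  unfolding schwartz_def by (drule CollectD, drule spec[of _ "[]"]) simp

lemma schwartz_continuous: "f \<in> schwartz \<Longrightarrow> continuous_on A f"
  by (meson schwartz_differentiable continuous_at_imp_continuous_on differentiable_imp_continuous_within)

lemma iter_partial_append: "iter_partial (ks @ ls) f = iter_partial ks (iter_partial ls f)"
  by (induction ks) auto

lemma schwartz_iter_partial: "f \<in> schwartz \<Longrightarrow> iter_partial ls f \<in> schwartz"
  unfolding schwartz_def by (auto simp: iter_partial_append[symmetric])

lemma schwartz_partial: "f \<in> schwartz \<Longrightarrow> partial k f \<in> schwartz"
  using schwartz_iter_partial[of f "[k]"] by simp

lemma schwartz_decay: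
  assumes "f \<in> schwartz"
  obtains C where "C > 0" "\<And>x. norm x ^ j * cmod (f x) \<le> C"
proof -
  have "bounded (range (\<lambda>x. of_real (norm x ^ j) * f x))"
    using assms unfolding schwartz_def by (drule_tac CollectD, drule_tac spec[of _ "[]"]) simp
  then obtain C where "C > 0" "\<forall>y\<in>range (\<lambda>x. of_real (norm x ^ j) * f x). norm y \<le> C"
    using bounded_pos by blast
  then have "norm x ^ j * cmod (f x) \<le> C" for x
    by (force simp: norm_mult norm_power)
  then show ?thesis using that \<open>C > 0\<close> by blast
qed

lemma iter_partial_add:
  assumes "f \<in> schwartz" "g \<in> schwartz"
  shows "iter_partial ks (\<lambda>x. f x + g x) = (\<lambda>x. iter_partial ks f x + iter_partial ks g x)"
proof (induction ks)
  case (Cons k ks)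
  then show ?case using assms
    by (auto intro!: ext partial_add schwartz_differentiable schwartz_iter_partial)
qed simp

lemma schwartz_add:
  assumes "f \<in> schwartz" "g \<in> schwartz"
  shows "(\<lambda>x. f x + g x) \<in> schwartz"
proof -
  have "bounded (range (\<lambda>x. of_real (norm x ^ j) * (iter_partial ks f x + iter_partial ks g x)))" for j ks
    unfolding distrib_left by (rule bounded_plus_comp) (use assms in \<open>auto simp: schwartz_def\<close>)
  moreover have "(\<lambda>x. iter_partial ks f x + iter_partial ks g x) differentiable at x" for ks x
    using assms by (intro differentiable_add) (auto simp: schwartz_def)
  ultimately show ?thesis
    unfolding schwartz_def by (simp add: iter_partial_add[OF assms])
qed

lemma iter_partial_cmult:
  assumes "f \<in> schwartz"
  shows "iter_partial ks (\<lambda>x. c * f x) = (\<lambda>x. c * iter_partial ks f x)"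
proof (induction ks)
  case (Cons k ks)
  then show ?case using assms
    by (auto intro!: ext partial_cmult schwartz_differentiable schwartz_iter_partial)
qed simp

lemma schwartz_cmult:
  assumes "f \<in> schwartz"
  shows "(\<lambda>x. c * f x) \<in> schwartz"
proof -
  have "bounded (range (\<lambda>x. of_real (norm x ^ j) * (c * iter_partial ks f x)))" for j ks
  proof -
    have "bounded (range (\<lambda>x. of_real (norm x ^ j) * iter_partial ks f x))"
      using assms by (auto simp: schwartz_def)
    then have "bounded ((\<lambda>z. c * z) ` range (\<lambda>x. of_real (norm x ^ j) * iter_partial ks f x))"
      by (rule bounded_linear_image[OF _ bounded_linear_mult_right])
    then show ?thesis by (simp add: image_image mult_ac)
  qed
  moreover have "(\<lambda>x. c * iter_partial ks f x) differentiable at x" for ks x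
    using assms by (intro differentiable_mult_complex) (auto simp: schwartz_def)
  ultimately show ?thesis
    unfolding schwartz_def by (simp add: iter_partial_cmult[OF assms])
qed

text \<open>Each derivative either hits the factor \<open>x\<^sub>n\<close> or passes it; collecting all terms of the first kind in one Schwartz function avoids the combinatorics of the Leibniz rule.\<close>
lemma iter_partial_mult_coord:
  fixes f :: "real^'n::finite \<Rightarrow> complex"
  assumes "f \<in> schwartz"
  shows "\<exists>g\<in>schwartz. iter_partial ks (mult_coord n f) = (\<lambda>x. of_real (x $ n) * iter_partial ks f x + g x)"
proof (induction ks)
  case Nil
  have "(\<lambda>x::real^'n. 0) \<in> schwartz" using schwartz_cmult[OF assms, of 0] by simp
  then show ?case by (intro bexI[of _ "\<lambda>x. 0"]) (auto simp: mult_coord_def)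
next
  case (Cons k ks)
  then obtain g where g: "g \<in> schwartz" and
    eq: "iter_partial ks (mult_coord n f) = (\<lambda>x. of_real (x $ n) * iter_partial ks f x + g x)" by blast
  have d: "iter_partial ks f differentiable at x" "g differentiable at x" for x
    using g assms by (auto intro: schwartz_differentiable schwartz_iter_partial)
  have "iter_partial (k # ks) (mult_coord n f) x =
     of_real (x $ n) * iter_partial (k # ks) f x + ((if k = n then 1 else 0) * iter_partial ks f x + partial k g x)" for x
    by (simp add: eq partial_add partial_mult differentiable_mult_complex d)
  moreover have "(\<lambda>x. (if k = n then 1 else 0) * iter_partial ks f x + partial k g x) \<in> schwartz"
    by (intro schwartz_add schwartz_cmult schwartz_partial schwartz_iter_partial g assms)
  ultimately show ?case by (intro bexI[rotated]) (assumption, rule ext)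
qed

lemma schwartz_mult_coord:
  fixes f :: "real^'n::finite \<Rightarrow> complex"
  assumes "f \<in> schwartz"
  shows "mult_coord n f \<in> schwartz"
proof -
  have *: "iter_partial ks (mult_coord n f) differentiable at x \<and>
     bounded (range (\<lambda>x. of_real (norm x ^ j) * iter_partial ks (mult_coord n f) x))" for ks j x
  proof -
    obtain g where g: "g \<in> schwartz" and
      eq: "iter_partial ks (mult_coord n f) = (\<lambda>x. of_real (x $ n) * iter_partial ks f x + g x)"
      using iter_partial_mult_coord[OF assms] by blast
    have h: "iter_partial ks f \<in> schwartz" using assms by (rule schwartz_iter_partial)
    have "iter_partial ks (mult_coord n f) differentiable at x"
      unfolding eq using g h by (intro differentiable_add differentiable_mult_complex)
        (auto intro: schwartz_differentiable)
    moreover have "bounded (range (\<lambda>x. of_real (norm x ^ j) * (of_real (x $ n) * iter_partial ks f x + g x)))"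
    proof -
      obtain A where A: "A > 0" "\<And>x. norm x ^ Suc j * cmod (iter_partial ks f x) \<le> A"
        using schwartz_decay[OF h, of "Suc j"] by blast
      obtain B where B: "B > 0" "\<And>x. norm x ^ j * cmod (g x) \<le> B"
        using schwartz_decay[OF g, of j] by blast
      have "cmod (of_real (norm x ^ j) * (of_real (x $ n) * iter_partial ks f x + g x)) \<le> A + B" for x
      proof -
        have "cmod (of_real (norm x ^ j) * (of_real (x $ n) * iter_partial ks f x + g x))
          \<le> norm x ^ j * (\<bar>x $ n\<bar> * cmod (iter_partial ks f x) + cmod (g x))"
          by (simp add: norm_mult norm_power mult_left_mono norm_triangle_le)
        also have "\<dots> \<le> norm x ^ j * (norm x * cmod (iter_partial ks f x) + cmod (g x))"
          by (intro mult_left_mono add_right_mono mult_right_mono component_le_norm_cart) auto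
        also have "\<dots> \<le> A + B" using add_mono[OF A(2) B(2), of x x] by (simp add: algebra_simps)
        finally show ?thesis .
      qed
      then show ?thesis unfolding bounded_iff by blast
    qed
    ultimately show ?thesis by (simp add: eq)
  qed
  then show ?thesis unfolding schwartz_def by blast
qed

lemma schwartz_diff:
  assumes "f \<in> schwartz" "g \<in> schwartz"
  shows "(\<lambda>x. f x - g x) \<in> schwartz"
  using schwartz_add[OF assms(1) schwartz_cmult[OF assms(2), of "-1"]] by simp

section \<open>Complex polynomials on \<open>\<real>\<^sup>N\<close>\<close>

text \<open>Complex-valued polynomial functions, generated by constants and coordinates. The induction rule of this definition is more convenient than that of \<^const>\<open>polynomial_function\<close>, which is stated through real linear functionals; the two notions agree by \<open>polynomial_function_iff_cpoly\<close>.\<close>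
inductive cpoly :: "(real^'n::finite \<Rightarrow> complex) \<Rightarrow> bool" where
  const: "cpoly (\<lambda>x. c)"
| coord: "cpoly (\<lambda>x. of_real (x $ k))"
| add: "cpoly p \<Longrightarrow> cpoly q \<Longrightarrow> cpoly (\<lambda>x. p x + q x)"
| mult: "cpoly p \<Longrightarrow> cpoly q \<Longrightarrow> cpoly (\<lambda>x. p x * q x)"

lemma cpoly_sum: "(\<And>i. i \<in> I \<Longrightarrow> cpoly (p i)) \<Longrightarrow> cpoly (\<lambda>x. \<Sum>i\<in>I. p i x)"
  by (induction I rule: infinite_finite_induct) (auto intro: cpoly.intros)

lemma cpoly_power: "cpoly p \<Longrightarrow> cpoly (\<lambda>x. p x ^ k)"
  by (induction k) (auto intro: cpoly.intros)

lemma cpoly_diff: "cpoly p \<Longrightarrow> cpoly q \<Longrightarrow> cpoly (\<lambda>x. p x - q x)"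
  using cpoly.add[of p "\<lambda>x. (-1) * q x"] cpoly.mult[OF cpoly.const[of "-1"], of q] by simp

lemma cpoly_inner: "cpoly (\<lambda>x. of_real (a \<bullet> x))"
proof -
  have "(\<lambda>x. complex_of_real (a \<bullet> x)) = (\<lambda>x. \<Sum>i\<in>UNIV. of_real (a $ i) * of_real (x $ i))"
    by (simp add: inner_vec_def)
  then show ?thesis by (auto intro!: cpoly_sum cpoly.intros)
qed

lemma cpoly_norm_sq: "cpoly (\<lambda>x::real^'n::finite. of_real ((norm x)\<^sup>2))"
proof -
  have "(\<lambda>x::real^'n. complex_of_real ((norm x)\<^sup>2)) = (\<lambda>x. \<Sum>i\<in>UNIV. of_real (x $ i) * of_real (x $ i))"
    by (simp add: power2_norm_eq_inner inner_vec_def del: of_real_power)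
  then show ?thesis by (auto intro!: cpoly_sum cpoly.intros simp del: of_real_power)
qed

lemma cpoly_affine:
  fixes p :: "real^'n::finite \<Rightarrow> complex"
  shows "cpoly p \<Longrightarrow> cpoly (\<lambda>x. p (a + t *\<^sub>R x))"
proof (induction rule: cpoly.induct)
  case (coord k)
  have "cpoly (\<lambda>x::real^'n. of_real (a $ k) + of_real t * of_real (x $ k))"
    by (intro cpoly.intros)
  then show ?case by simp
qed (auto intro: cpoly.intros)

lemma real_polynomial_imp_cpoly:
  fixes f :: "real^'n::finite \<Rightarrow> real"
  assumes "real_polynomial_function f"
  shows "cpoly (\<lambda>x. of_real (f x))"
  using assms
proof (induction rule: real_polynomial_function.induct)
  case (linear f)
  then interpret f: bounded_linear f .
  have "f x = (\<Sum>k\<in>UNIV. x $ k * f (axis k 1))" for x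
  proof -
    have "f x = f (\<Sum>k\<in>UNIV. x $ k *\<^sub>R axis k 1)"
      using basis_expansion[of x] by (simp add: scalar_mult_eq_scaleR)
    then show ?thesis by (simp add: f.sum f.scaleR)
  qed
  then have "(\<lambda>x. complex_of_real (f x)) = (\<lambda>x. \<Sum>k\<in>UNIV. of_real (x $ k) * of_real (f (axis k 1)))"
    by (metis (mono_tags, lifting) of_real_mult of_real_sum sum.cong)
  then show ?case by (auto intro!: cpoly_sum cpoly.intros)
qed (auto intro: cpoly.intros)

lemma polynomial_function_iff_cpoly:
  fixes p :: "real^'n::finite \<Rightarrow> complex"
  shows "polynomial_function p \<longleftrightarrow> cpoly p"
proof
  assume p: "polynomial_function p"
  then have "real_polynomial_function (Re \<circ> p)" "real_polynomial_function (Im \<circ> p)"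
    unfolding polynomial_function_def using bounded_linear_Re bounded_linear_Im by auto
  then have "cpoly (\<lambda>x. of_real (Re (p x)) + \<i> * of_real (Im (p x)))"
    by (intro cpoly.intros) (auto dest: real_polynomial_imp_cpoly)
  then show "cpoly p" by (simp add: complex_eq[symmetric])
next
  assume "cpoly p"
  then have "real_polynomial_function (\<lambda>x. Re (p x)) \<and> real_polynomial_function (\<lambda>x. Im (p x))"
    by (induction rule: cpoly.induct)
      (auto intro!: real_polynomial_function.intros(2-4) real_polynomial_function_diff
        real_polynomial_function.intros(1)[OF bounded_linear_vec_nth])
  then show "polynomial_function p"
    by (subst polynomial_function_iff_Basis_inner) (auto simp: Basis_complex_def)
qed

lemma cpoly_differentiable: "cpoly p \<Longrightarrow> p differentiable (at x)"
  by (induction rule: cpoly.induct) (auto intro: differentiable_add differentiable_mult_complex)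

lemma cpoly_partial:
  fixes p :: "real^'n::finite \<Rightarrow> complex"
  shows "cpoly p \<Longrightarrow> cpoly (partial k p)"
proof (induction rule: cpoly.induct)
  case (const c)
  have "partial k (\<lambda>x. c) = (\<lambda>x. 0)" by (rule ext) simp
  then show ?case by (simp add: cpoly.const)
next
  case (coord n)
  have "partial k (\<lambda>x::real^'n. complex_of_real (x $ n)) = (\<lambda>x. if k = n then 1 else 0)" by (rule ext) simp
  then show ?case by (simp add: cpoly.const)
next
  case (add p q)
  have "partial k (\<lambda>x. p x + q x) = (\<lambda>x. partial k p x + partial k q x)"
    by (rule ext) (intro partial_add cpoly_differentiable add)
  then show ?case using add by (simp add: cpoly.add)
next
  case (mult p q)
  have "partial k (\<lambda>x. p x * q x) = (\<lambda>x. partial k p x * q x + p x * partial k q x)"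
    by (rule ext) (intro partial_mult cpoly_differentiable mult)
  then show ?case using mult by (auto intro: cpoly.intros)
qed

lemma cpoly_continuous: "cpoly p \<Longrightarrow> continuous_on A p"
  by (induction rule: cpoly.induct) (auto intro!: continuous_intros)

lemma cpoly_bound: "cpoly p \<Longrightarrow> \<exists>C\<ge>0. \<exists>d. \<forall>x. cmod (p x) \<le> C * (1 + norm x) ^ d"
proof (induction rule: cpoly.induct)
  case (const c)
  show ?case by (intro exI[of _ "cmod c"] exI[of _ 0] conjI) auto
next
  case (coord k)
  show ?case by (intro exI[of _ 1] exI[of _ 1] conjI)
    (auto intro: order_trans[OF component_le_norm_cart])
next
  case (add p q)
  then obtain A a B b where *: "A \<ge> 0" "\<And>x. cmod (p x) \<le> A * (1 + norm x) ^ a"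
    "B \<ge> 0" "\<And>x. cmod (q x) \<le> B * (1 + norm x) ^ b" by metis
  have "cmod (p x + q x) \<le> (A + B) * (1 + norm x) ^ (a + b)" for x
  proof -
    have "A * (1 + norm x) ^ a \<le> A * (1 + norm x) ^ (a + b)" "B * (1 + norm x) ^ b \<le> B * (1 + norm x) ^ (a + b)"
      using * by (auto intro!: mult_left_mono power_increasing)
    then show ?thesis using *(2)[of x] *(4)[of x] norm_triangle_ineq[of "p x" "q x"] by (simp add: algebra_simps)
  qed
  then show ?case using * by (intro exI[of _ "A + B"] exI[of _ "a + b"] conjI) auto
next
  case (mult p q)
  then obtain A a B b where *: "A \<ge> 0" "\<And>x. cmod (p x) \<le> A * (1 + norm x) ^ a"
    "B \<ge> 0" "\<And>x. cmod (q x) \<le> B * (1 + norm x) ^ b" by metis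
  have "cmod (p x * q x) \<le> (A * B) * (1 + norm x) ^ (a + b)" for x
    using mult_mono[OF *(2)[of x] *(4)[of x]] * by (simp add: norm_mult power_add mult_ac)
  then show ?case using * by (intro exI[of _ "A * B"] exI[of _ "a + b"] conjI) auto
qed

lemma partial_commute_cpoly:
  fixes p :: "real^'n::finite \<Rightarrow> complex"
  shows "cpoly p \<Longrightarrow> partial j (partial k p) x = partial k (partial j p) x"
proof (induction arbitrary: x rule: cpoly.induct)
  case (const c)
  have "partial k (\<lambda>x. c) = (\<lambda>x. 0)" for k by (rule ext) simp
  then show ?case by simp
next
  case (coord n)
  have "partial k (\<lambda>x::real^'n. complex_of_real (x $ n)) = (\<lambda>x. if k = n then 1 else 0)" for k by (rule ext) simp
  then show ?case by simp
next
  case (add p q)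
  have *: "partial k (\<lambda>x. p x + q x) = (\<lambda>x. partial k p x + partial k q x)" for k
    by (rule ext) (intro partial_add cpoly_differentiable add)
  show ?case using add by (simp add: * partial_add cpoly_differentiable cpoly_partial)
next
  case (mult p q)
  have *: "partial k (\<lambda>x. p x * q x) = (\<lambda>x. partial k p x * q x + p x * partial k q x)" for k
    by (rule ext) (intro partial_mult cpoly_differentiable mult)
  show ?case using mult
    by (simp add: * partial_add partial_mult cpoly_differentiable cpoly_partial differentiable_mult_complex algebra_simps)
qed

lemma Laplacian_add:
  assumes "cpoly p" "cpoly q"
  shows "Laplacian (\<lambda>x. p x + q x) x = Laplacian p x + Laplacian q x"
proof -
  have "partial k (\<lambda>x. p x + q x) = (\<lambda>x. partial k p x + partial k q x)" for k
    by (rule ext) (intro partial_add cpoly_differentiable assms)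
  then show ?thesis unfolding Laplacian_def
    using assms by (simp add: partial_add cpoly_differentiable cpoly_partial sum.distrib)
qed

lemma Laplacian_mult:
  assumes "cpoly p" "cpoly q"
  shows "Laplacian (\<lambda>x. p x * q x) x =
    Laplacian p x * q x + 2 * (\<Sum>k\<in>UNIV. partial k p x * partial k q x) + p x * Laplacian q x"
proof -
  have "partial k (\<lambda>x. p x * q x) = (\<lambda>x. partial k p x * q x + p x * partial k q x)" for k
    by (rule ext) (intro partial_mult cpoly_differentiable assms)
  then show ?thesis unfolding Laplacian_def using assms
    by (simp add: partial_add partial_mult cpoly_differentiable cpoly_partial differentiable_mult_complex
      sum.distrib sum_distrib_left sum_distrib_right algebra_simps)
qed

lemma Laplacian_const [simp]: "Laplacian (\<lambda>x::real^'n::finite. c) x = 0"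
proof -
  have "partial k (\<lambda>x::real^'n. c) = (\<lambda>x. 0)" for k by (rule ext) simp
  then show ?thesis by (simp add: Laplacian_def)
qed

lemma Laplacian_partial:
  assumes "cpoly p"
  shows "Laplacian (partial n p) x = partial n (Laplacian p) x"
proof -
  have "partial k (partial n p) = partial n (partial k p)" for k
    by (rule ext) (rule partial_commute_cpoly[OF assms])
  then have "Laplacian (partial n p) x = (\<Sum>k\<in>UNIV. partial n (partial k (partial k p)) x)"
    unfolding Laplacian_def by (simp add: partial_commute_cpoly[OF cpoly_partial[OF assms]])
  also have "\<dots> = partial n (Laplacian p) x"
    unfolding Laplacian_def[abs_def]
    by (rule partial_sum[symmetric]) (intro cpoly_differentiable cpoly_partial assms)
  finally show ?thesis .
qed

definition homogeneous :: "nat \<Rightarrow> (real^'n::finite \<Rightarrow> complex) \<Rightarrow> bool" where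
  "homogeneous d p \<longleftrightarrow> (\<forall>c x. p (c *\<^sub>R x) = of_real (c ^ d) * p x)"

lemma harmonic_poly_iff:
  "p \<in> harmonic_poly m \<longleftrightarrow> cpoly p \<and> homogeneous m p \<and> (\<forall>x. Laplacian p x = 0)"
  unfolding harmonic_poly_def homogeneous_def polynomial_function_iff_cpoly by auto

lemma has_vector_derivative_along_line:
  fixes p :: "real^'n::finite \<Rightarrow> complex"
  assumes "\<And>y. p differentiable (at y)"
  shows "((\<lambda>t. p (a + t *\<^sub>R v)) has_vector_derivative (\<Sum>k\<in>UNIV. of_real (v $ k) * partial k p (a + t *\<^sub>R v))) (at t within S)"
proof -
  have "((\<lambda>t. a + t *\<^sub>R v) has_derivative (\<lambda>h. h *\<^sub>R v)) (at t within S)"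
    by (auto intro!: derivative_eq_intros)
  from diff_chain_within[OF this has_derivative_at_withinI[OF has_derivative_partial[OF assms]]]
  have "((\<lambda>t. p (a + t *\<^sub>R v)) has_derivative (\<lambda>h. \<Sum>k\<in>UNIV. of_real ((h *\<^sub>R v) $ k) * partial k p (a + t *\<^sub>R v))) (at t within S)"
    by (simp add: o_def)
  moreover have "(\<lambda>h. \<Sum>k\<in>UNIV. of_real ((h *\<^sub>R v) $ k) * partial k p (a + t *\<^sub>R v)) =
    (\<lambda>h. h *\<^sub>R (\<Sum>k\<in>UNIV. of_real (v $ k) * partial k p (a + t *\<^sub>R v)))"
    by (simp add: scaleR_sum_right) (simp add: scaleR_conv_of_real mult_ac)
  ultimately show ?thesis unfolding has_vector_derivative_def by simp
qed

lemma Euler_homogeneous: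
  assumes "cpoly p" "homogeneous d p"
  shows "(\<Sum>k\<in>UNIV. of_real (x $ k) * partial k p x) = of_nat d * p x"
proof -
  have 1: "((\<lambda>t. p (t *\<^sub>R x)) has_vector_derivative (\<Sum>k\<in>UNIV. of_real (x $ k) * partial k p x)) (at 1)"
    using has_vector_derivative_along_line[OF cpoly_differentiable[OF assms(1)], of 0 x 1] by simp
  have "((\<lambda>t::real. of_real (t ^ d) * p x) has_vector_derivative (of_real (real d * 1 ^ (d - 1)) * p x)) (at 1)"
    by (intro has_vector_derivative_mult_left has_vector_derivative_of_real)
      (auto intro!: derivative_eq_intros)
  then have 2: "((\<lambda>t. p (t *\<^sub>R x)) has_vector_derivative (of_nat d * p x)) (at 1)"
    using assms(2) by (simp add: homogeneous_def)
  show ?thesis using vector_derivative_unique_at[OF 1 2] .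
qed

lemma homogeneous_0_const: "homogeneous 0 p \<Longrightarrow> p x = p 0"
  unfolding homogeneous_def by (metis mult_1 of_real_1 power_0 scaleR_zero_left)

text \<open>For \<open>c \<noteq> 0\<close> this is the chain rule; at \<open>c = 0\<close> it follows by continuity, and for \<open>d = 0\<close> the function is constant, so that the truncated \<open>d - 1\<close> does no harm.\<close>
lemma homogeneous_partial:
  assumes "cpoly p" "homogeneous d p"
  shows "homogeneous (d - 1) (partial n p)"
proof (cases "d = 0")
  case True
  then have "p = (\<lambda>x. p 0)" using homogeneous_0_const assms(2) by blast
  then have "partial n p x = 0" for x by (metis partial_const)
  then show ?thesis unfolding homogeneous_def by simp
next
  case False
  have nz: "partial n p (c *\<^sub>R x) = of_real (c ^ (d - 1)) * partial n p x" if "c \<noteq> 0" for c x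
  proof -
    have "((\<lambda>x. p (c *\<^sub>R x)) has_derivative (\<lambda>h. \<Sum>k\<in>UNIV. of_real ((c *\<^sub>R h) $ k) * partial k p (c *\<^sub>R x))) (at x)"
      using diff_chain_at[OF bounded_linear_imp_has_derivative[OF bounded_linear_scaleR_right]
        has_derivative_partial[OF cpoly_differentiable[OF assms(1)]]] by (simp add: o_def)
    from partial_eqI[OF this, of n]
    have "partial n (\<lambda>x. p (c *\<^sub>R x)) x = of_real c * partial n p (c *\<^sub>R x)"
      by (simp add: axis_def if_distrib[of complex_of_real] if_distrib[of "\<lambda>t. _ * t * _"] cong: if_cong)
    moreover have "(\<lambda>x. p (c *\<^sub>R x)) = (\<lambda>x. of_real (c ^ d) * p x)"
      using assms(2) by (simp add: homogeneous_def)
    ultimately have "of_real c * partial n p (c *\<^sub>R x) = of_real (c ^ d) * partial n p x"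
      using partial_cmult[OF cpoly_differentiable[OF assms(1)], of n] by metis
    also have "c ^ d = c * c ^ (d - 1)" using False by (cases d) auto
    finally show ?thesis using that by simp
  qed
  have "partial n p (c *\<^sub>R x) = of_real (c ^ (d - 1)) * partial n p x" for c x
  proof (cases "c = 0")
    case True
    let ?L = "\<lambda>c::real. partial n p (c *\<^sub>R x)" and ?R = "\<lambda>c::real. of_real (c ^ (d - 1)) * partial n p x"
    have cont: "continuous_on UNIV (partial n p)"
      by (intro cpoly_continuous cpoly_partial assms)
    have "continuous_on UNIV ?L" by (intro continuous_on_compose2[OF cont]) (auto intro!: continuous_intros)
    then have L: "?L \<midarrow>0\<rightarrow> ?L 0" by (metis continuous_on_def UNIV_I)
    have "continuous_on UNIV ?R" by (intro continuous_intros)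
    then have R: "?R \<midarrow>0\<rightarrow> ?R 0" by (metis continuous_on_def UNIV_I)
    have "?R \<midarrow>0\<rightarrow> ?L 0"
      by (rule Lim_transform_eventually[OF L]) (auto simp: eventually_at nz intro!: exI[of _ 1])
    with R show ?thesis using True LIM_unique by blast
  qed (use nz in auto)
  then show ?thesis unfolding homogeneous_def by blast
qed

lemma harmonic_poly_partial:
  assumes "p \<in> harmonic_poly m"
  shows "partial n p \<in> harmonic_poly (m - 1)"
proof -
  have p: "cpoly p" "homogeneous m p" and L: "Laplacian p = (\<lambda>x. 0)"
    using assms unfolding harmonic_poly_iff by auto
  have "Laplacian (partial n p) x = 0" for x
    using Laplacian_partial[OF p(1), of n x] L by simp
  then show ?thesis unfolding harmonic_poly_iff using p homogeneous_partial cpoly_partial by blast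
qed

lemma harmonic_poly_cmult: "p \<in> harmonic_poly m \<Longrightarrow> (\<lambda>x. c * p x) \<in> harmonic_poly m"
  unfolding harmonic_poly_iff homogeneous_def
  using Laplacian_mult[OF cpoly.const, of p c]
  by (auto intro!: cpoly.intros simp: Laplacian_const)

lemma cpoly_cnj: "cpoly p \<Longrightarrow> cpoly (\<lambda>x. cnj (p x))"
  by (induction rule: cpoly.induct) (auto intro: cpoly.intros)

lemma harmonic_poly_cnj: 
  assumes "p \<in> harmonic_poly m"
  shows "(\<lambda>x. cnj (p x)) \<in> harmonic_poly m"
proof -
  have p: "cpoly p" using assms by (simp add: harmonic_poly_iff)
  have "partial k (\<lambda>x. cnj (p x)) = (\<lambda>x. cnj (partial k p x))" for k
    by (rule ext) (rule partial_cnj[OF cpoly_differentiable[OF p]])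
  then have "Laplacian (\<lambda>x. cnj (p x)) x = cnj (Laplacian p x)" for x
    unfolding Laplacian_def by (simp add: partial_cnj cpoly_differentiable cpoly_partial p)
  then show ?thesis using assms unfolding harmonic_poly_iff homogeneous_def by (auto intro: cpoly_cnj)
qed

lemma partial_norm_sq: "partial k (\<lambda>x. of_real ((norm x)\<^sup>2)) x = 2 * of_real (x $ k)"
proof -
  have "((\<lambda>x. complex_of_real ((norm x)\<^sup>2)) has_derivative (\<lambda>h. of_real (2 * (x \<bullet> h)))) (at x)"
    unfolding power2_norm_eq_inner
    by (auto intro!: derivative_eq_intros simp: inner_commute)
  from partial_eqI[OF this] show ?thesis by (simp add: inner_axis)
qed

lemma partial_norm_sq_fun: "partial k (\<lambda>x. of_real ((norm x)\<^sup>2)) = (\<lambda>x. 2 * of_real (x $ k))"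
  by (rule ext) (rule partial_norm_sq)

lemma Laplacian_norm_sq: "Laplacian (\<lambda>x::real^'n::finite. of_real ((norm x)\<^sup>2)) x = 2 * of_nat CARD('n)"
  by (simp add: Laplacian_def partial_norm_sq_fun partial_cmult del: of_real_power)

text \<open>The component \<open>q\<^sub>-\<close> in the decomposition \<open>x\<^sub>n p = q\<^sub>+ + |x|\<^sup>2 q\<^sub>-\<close> of the product of a coordinate with a harmonic polynomial of degree \<open>m\<close>. The denominator vanishes only for \<open>N = 2\<close>, \<open>m = 0\<close>; then \<open>p\<close> is constant and the value \<open>0 / 0 = 0\<close> is the right one.\<close>
definition lowering :: "'n \<Rightarrow> nat \<Rightarrow> (real^'n::finite \<Rightarrow> complex) \<Rightarrow> real^'n \<Rightarrow> complex" where
  "lowering n m p x = partial n p x / of_real (real CARD('n) + 2 * real m - 2)"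

lemma lowering_harmonic: "p \<in> harmonic_poly m \<Longrightarrow> lowering n m p \<in> harmonic_poly (m - 1)"
  unfolding lowering_def[abs_def] divide_inverse mult.commute[of _ "inverse _"]
  by (intro harmonic_poly_cmult harmonic_poly_partial)

lemma lowering_mult:
  fixes p :: "real^'n::finite \<Rightarrow> complex"
  assumes "p \<in> harmonic_poly m"
  shows "of_real (real CARD('n) + 2 * real m - 2) * lowering n m p x = partial n p x"
proof (cases "m = 0")
  case True
  then have "p = (\<lambda>x. p 0)" using homogeneous_0_const assms unfolding harmonic_poly_iff by blast
  then have "partial n p x = 0" by (metis partial_const)
  then show ?thesis by (simp add: lowering_def)
next
  case False
  have "CARD('n) \<noteq> 0" by simp
  then have "real CARD('n) + 2 * real m - 2 > 0" using False by linarith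
  then show ?thesis unfolding lowering_def by (simp del: of_real_diff of_real_add)
qed

text \<open>The Laplacian of \<open>x\<^sub>n p\<close> is \<open>2 \<partial>\<^sub>n p\<close>, and that of \<open>|x|\<^sup>2 q\<close> is \<open>(2 N + 4 (m - 1)) q\<close> for \<open>q\<close> harmonic of degree \<open>m - 1\<close>. The constant in \<open>lowering\<close> is chosen so that the two cancel.\<close>
lemma raising_harmonic:
  fixes p :: "real^'n::finite \<Rightarrow> complex"
  assumes p: "p \<in> harmonic_poly m"
  shows "(\<lambda>x. of_real (x $ n) * p x - of_real ((norm x)\<^sup>2) * lowering n m p x) \<in> harmonic_poly (Suc m)"
proof -
  define q where "q = lowering n m p"
  have q: "q \<in> harmonic_poly (m - 1)" unfolding q_def using lowering_harmonic[OF p] .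
  have P: "cpoly p" "homogeneous m p" "\<And>x. Laplacian p x = 0"
   and Q: "cpoly q" "homogeneous (m - 1) q" "\<And>x. Laplacian q x = 0"
    using p q by (auto simp: harmonic_poly_iff)
  have zero: "q x = 0" if "m = 0" for x
  proof -
    have "p = (\<lambda>x. p 0)" using homogeneous_0_const P(2) that by blast
    then have "partial n p x = 0" by (metis partial_const)
    then show ?thesis by (simp add: q_def lowering_def)
  qed
  have c1: "cpoly (\<lambda>x::real^'n. of_real (x $ n) * p x)" by (intro cpoly.intros P)
  have c2: "cpoly (\<lambda>x. of_real ((norm x)\<^sup>2) * q x)" by (intro cpoly.mult cpoly_norm_sq Q)
  have c3: "cpoly (\<lambda>x. (-1) * (of_real ((norm x)\<^sup>2) * q x))" by (intro cpoly.mult cpoly.const c2)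
  have Lc: "Laplacian (\<lambda>x::real^'n. complex_of_real (x $ n)) x = 0" for x
  proof -
    have "partial k (\<lambda>x::real^'n. complex_of_real (x $ n)) = (\<lambda>x. if k = n then 1 else 0)" for k by (rule ext) simp
    then show ?thesis by (simp add: Laplacian_def)
  qed
  have L1: "Laplacian (\<lambda>x. of_real (x $ n) * p x) x = 2 * partial n p x" for x
    unfolding Laplacian_mult[OF cpoly.coord P(1)] Lc P(3)
    by (simp add: if_distrib[of "\<lambda>t. t * _"] cong: if_cong)
  have L2: "Laplacian (\<lambda>x. of_real ((norm x)\<^sup>2) * q x) x = 2 * of_nat CARD('n) * q x + 4 * (of_nat (m - 1) * q x)" for x
    unfolding Laplacian_mult[OF cpoly_norm_sq Q(1)] Q(3) Laplacian_norm_sq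
      Euler_homogeneous[OF Q(1,2), symmetric] partial_norm_sq
    by (simp add: sum_distrib_left mult.assoc)
  have "Laplacian (\<lambda>x. of_real (x $ n) * p x - of_real ((norm x)\<^sup>2) * q x) x = 0" for x
  proof -
    have "Laplacian (\<lambda>x. of_real (x $ n) * p x - of_real ((norm x)\<^sup>2) * q x) x =
      2 * partial n p x - (2 * of_nat CARD('n) * q x + 4 * (of_nat (m - 1) * q x))"
      using Laplacian_add[OF c1 c3, of x] Laplacian_mult[OF cpoly.const c2, of "-1" x] L1 L2
      by simp
    also have "\<dots> = 0"
      unfolding lowering_mult[OF p, symmetric] q_def[symmetric]
      using zero[of x] by (cases m) (auto simp: algebra_simps)
    finally show ?thesis .
  qed
  moreover have "homogeneous (Suc m) (\<lambda>x. of_real (x $ n) * p x - of_real ((norm x)\<^sup>2) * q x)"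
    unfolding homogeneous_def
  proof (intro allI)
    fix c :: real and x :: "real^'n"
    have "(norm (c *\<^sub>R x))\<^sup>2 = c * c * (norm x)\<^sup>2" by (simp add: power_mult_distrib) (simp add: power2_eq_square)
    then show "of_real ((c *\<^sub>R x) $ n) * p (c *\<^sub>R x) - of_real ((norm (c *\<^sub>R x))\<^sup>2) * q (c *\<^sub>R x) =
       of_real (c ^ Suc m) * (of_real (x $ n) * p x - of_real ((norm x)\<^sup>2) * q x)"
      using P(2) Q(2) zero unfolding homogeneous_def
      by (cases m) (auto simp: algebra_simps simp del: norm_scaleR of_real_power)
  qed
  moreover have "cpoly (\<lambda>x. of_real (x $ n) * p x - of_real ((norm x)\<^sup>2) * q x)"
    by (rule cpoly_diff[OF c1 c2])
  ultimately show ?thesis unfolding harmonic_poly_iff q_def by blast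
qed

section \<open>The inner product on \<open>L\<^sup>2\<close>\<close>

lemma measurable_cnj [measurable]: "cnj \<in> borel_measurable borel"
  by (intro borel_measurable_continuous_onI continuous_intros)

lemma L2_I: "f \<in> borel_measurable M \<Longrightarrow> integrable M (\<lambda>x. (cmod (f x))\<^sup>2) \<Longrightarrow> f \<in> L2 M"
  by (simp add: L2_def)

lemma L2_measurable: "f \<in> L2 M \<Longrightarrow> f \<in> borel_measurable M"
  and L2_integrable: "f \<in> L2 M \<Longrightarrow> integrable M (\<lambda>x. (cmod (f x))\<^sup>2)"
  by (simp_all add: L2_def)

lemma L2_cong_AE:
  assumes "f \<in> L2 M" "g \<in> borel_measurable M" "AE x in M. f x = g x"
  shows "g \<in> L2 M"
proof (rule L2_I)
  show "integrable M (\<lambda>x. (cmod (g x))\<^sup>2)"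
    using L2_integrable[OF assms(1)] L2_measurable[OF assms(1)] assms(2,3)
    by (subst integrable_cong_AE[of _ _ "\<lambda>x. (cmod (f x))\<^sup>2"]) (auto elim: eventually_mono)
qed (rule assms)

lemma L2_cmult: "f \<in> L2 M \<Longrightarrow> (\<lambda>x. c * f x) \<in> L2 M"
  by (auto simp: L2_def norm_mult power_mult_distrib)

lemma L2_add:
  assumes "f \<in> L2 M" "g \<in> L2 M"
  shows "(\<lambda>x. f x + g x) \<in> L2 M"
proof (rule L2_I)
  note [measurable] = L2_measurable[OF assms(1)] L2_measurable[OF assms(2)]
  show "(\<lambda>x. f x + g x) \<in> borel_measurable M" by measurable
  have "integrable M (\<lambda>x. 2 * (cmod (f x))\<^sup>2 + 2 * (cmod (g x))\<^sup>2)"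
    using assms[THEN L2_integrable] by simp
  moreover have "(cmod (f x + g x))\<^sup>2 \<le> 2 * (cmod (f x))\<^sup>2 + 2 * (cmod (g x))\<^sup>2" for x
  proof -
    have "(cmod (f x + g x))\<^sup>2 \<le> (cmod (f x) + cmod (g x))\<^sup>2"
      by (intro power_mono norm_triangle_ineq) auto
    also have "\<dots> \<le> 2 * (cmod (f x))\<^sup>2 + 2 * (cmod (g x))\<^sup>2"
      using zero_le_power2[of "cmod (f x) - cmod (g x)"] by (simp add: power2_eq_square algebra_simps)
    finally show ?thesis .
  qed
  ultimately show "integrable M (\<lambda>x. (cmod (f x + g x))\<^sup>2)"
    by (elim Bochner_Integration.integrable_bound) auto
qed

lemma L2_diff: "f \<in> L2 M \<Longrightarrow> g \<in> L2 M \<Longrightarrow> (\<lambda>x. f x - g x) \<in> L2 M"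
  using L2_add[of f M "\<lambda>x. (-1) * g x"] L2_cmult[of g M "-1"] by simp

lemma integrable_L2_inner:
  assumes "f \<in> L2 M" "g \<in> L2 M"
  shows "integrable M (\<lambda>x. f x * cnj (g x))"
proof -
  note [measurable] = L2_measurable[OF assms(1)] L2_measurable[OF assms(2)]
  have "integrable M (\<lambda>x. (cmod (f x))\<^sup>2 + (cmod (g x))\<^sup>2)"
    using assms by (auto intro: L2_integrable)
  moreover have "cmod (f x * cnj (g x)) \<le> (cmod (f x))\<^sup>2 + (cmod (g x))\<^sup>2" for x
  proof -
    have "0 \<le> cmod (f x) * cmod (g x)" by simp
    then show ?thesis
      using sum_squares_bound[of "cmod (f x)" "cmod (g x)"] unfolding norm_mult complex_mod_cnj by linarith
  qed
  ultimately show ?thesis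
    by (elim Bochner_Integration.integrable_bound) auto
qed

lemma L2_norm_nonneg: "L2_norm M f \<ge> 0"
  by (simp add: L2_norm_def)

lemma L2_norm_sq: "(L2_norm M f)\<^sup>2 = (LINT x|M. (cmod (f x))\<^sup>2)"
  by (simp add: L2_norm_def)

lemma L2_Cauchy_Schwarz:
  assumes "f \<in> L2 M" "g \<in> L2 M"
  shows "cmod (L2_inner M f g) \<le> L2_norm M f * L2_norm M g"
proof -
  define I where "I = (LINT x|M. cmod (f x) * cmod (g x))"
  define A where "A = L2_norm M f"
  define B where "B = L2_norm M g"
  have int: "integrable M (\<lambda>x. cmod (f x) * cmod (g x))"
    using integrable_norm[OF integrable_L2_inner[OF assms]] by (simp add: norm_mult)
  have I0: "I \<ge> 0" unfolding I_def by (rule integral_nonneg_AE) simp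
  have quad: "0 \<le> s\<^sup>2 * A\<^sup>2 - 2 * s * I + B\<^sup>2" for s
  proof -
    have "0 \<le> (LINT x|M. (s * cmod (f x) - cmod (g x))\<^sup>2)" by (rule integral_nonneg_AE) simp
    also have "(\<lambda>x. (s * cmod (f x) - cmod (g x))\<^sup>2) =
      (\<lambda>x. s\<^sup>2 * (cmod (f x))\<^sup>2 - 2 * s * (cmod (f x) * cmod (g x)) + (cmod (g x))\<^sup>2)"
      by (auto simp: power2_eq_square algebra_simps)
    also have "(LINT x|M. s\<^sup>2 * (cmod (f x))\<^sup>2 - 2 * s * (cmod (f x) * cmod (g x)) + (cmod (g x))\<^sup>2) =
      s\<^sup>2 * A\<^sup>2 - 2 * s * I + B\<^sup>2"
      using L2_integrable[OF assms(1)] L2_integrable[OF assms(2)] int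
      by (simp add: A_def B_def L2_norm_sq I_def)
    finally show ?thesis .
  qed
  have "I\<^sup>2 \<le> A\<^sup>2 * B\<^sup>2"
  proof (cases "A = 0")
    case True
    have "I = 0"
    proof (rule ccontr)
      assume "I \<noteq> 0"
      with quad[of "(B\<^sup>2 + 1) / (2 * I)"] True show False by simp
    qed
    then show ?thesis by simp
  next
    case False
    have "0 \<le> A\<^sup>2 * ((I / A\<^sup>2)\<^sup>2 * A\<^sup>2 - 2 * (I / A\<^sup>2) * I + B\<^sup>2)"
      using quad[of "I / A\<^sup>2"] by simp
    also have "\<dots> = A\<^sup>2 * B\<^sup>2 - I\<^sup>2" using False by (simp add: field_simps power2_eq_square)
    finally show ?thesis by simp
  qed
  then have "I \<le> A * B"
    using abs_le_square_iff[of I "A * B"] I0 by (simp add: power_mult_distrib A_def B_def L2_norm_nonneg)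
  moreover have "cmod (L2_inner M f g) \<le> I"
    unfolding L2_inner_def I_def using integral_norm_bound[of M "\<lambda>x. f x * cnj (g x)"] by (simp add: norm_mult)
  ultimately show ?thesis unfolding A_def B_def by simp
qed

lemma L2_inner_cong_AE:
  assumes "f \<in> L2 M" "f' \<in> L2 M" "g \<in> L2 M" "g' \<in> L2 M" "AE x in M. f x = f' x" "AE x in M. g x = g' x"
  shows "L2_inner M f g = L2_inner M f' g'"
proof -
  note [measurable] = L2_measurable[OF assms(1)] L2_measurable[OF assms(2)]
    L2_measurable[OF assms(3)] L2_measurable[OF assms(4)]
  show ?thesis unfolding L2_inner_def
    by (rule integral_cong_AE) (use assms(5,6) in \<open>auto elim: eventually_elim2\<close>)
qed

lemma L2_inner_diff_left:
  assumes "f \<in> L2 M" "f' \<in> L2 M" "g \<in> L2 M"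
  shows "L2_inner M (\<lambda>x. f x - f' x) g = L2_inner M f g - L2_inner M f' g"
  unfolding L2_inner_def left_diff_distrib
  by (intro Bochner_Integration.integral_diff integrable_L2_inner assms)

lemma L2_inner_diff_right:
  assumes "f \<in> L2 M" "g' \<in> L2 M" "g \<in> L2 M"
  shows "L2_inner M f (\<lambda>x. g x - g' x) = L2_inner M f g - L2_inner M f g'"
  unfolding L2_inner_def complex_cnj_diff right_diff_distrib
  by (intro Bochner_Integration.integral_diff integrable_L2_inner assms)

lemma L2_inner_cmult_left: "L2_inner M (\<lambda>x. c * f x) g = c * L2_inner M f g"
  unfolding L2_inner_def mult.assoc by simp

lemma L2_inner_cmult_right: "L2_inner M f (\<lambda>x. c * g x) = cnj c * L2_inner M f g"
  unfolding L2_inner_def by (simp add: mult.left_commute)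

lemma L2_norm_zero_AE:
  assumes "f \<in> L2 M" "L2_norm M f = 0"
  shows "AE x in M. f x = 0"
proof -
  have "(LINT x|M. (cmod (f x))\<^sup>2) = 0" using assms(2) L2_norm_sq[of M f] by simp
  then have "AE x in M. (cmod (f x))\<^sup>2 = 0"
    using integral_nonneg_eq_0_iff_AE[OF L2_integrable[OF assms(1)]] by simp
  then show ?thesis by simp
qed

lemma L2_norm_triangle_sq:
  assumes "f \<in> L2 M" "g \<in> L2 M"
  shows "(L2_norm M (\<lambda>x. f x - g x))\<^sup>2 \<le> 2 * (L2_norm M f)\<^sup>2 + 2 * (L2_norm M g)\<^sup>2"
proof -
  have "(cmod (f x - g x))\<^sup>2 \<le> 2 * (cmod (f x))\<^sup>2 + 2 * (cmod (g x))\<^sup>2" for x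
  proof -
    have "(cmod (f x - g x))\<^sup>2 \<le> (cmod (f x) + cmod (g x))\<^sup>2"
      by (intro power_mono norm_triangle_ineq4) auto
    also have "\<dots> \<le> 2 * (cmod (f x))\<^sup>2 + 2 * (cmod (g x))\<^sup>2"
      using zero_le_power2[of "cmod (f x) - cmod (g x)"] by (simp add: power2_eq_square algebra_simps)
    finally show ?thesis .
  qed
  then have "(LINT x|M. (cmod (f x - g x))\<^sup>2) \<le> (LINT x|M. 2 * (cmod (f x))\<^sup>2 + 2 * (cmod (g x))\<^sup>2)"
    using assms[THEN L2_integrable] by (intro integral_mono L2_integrable[OF L2_diff] assms) auto
  then show ?thesis using assms by (simp add: L2_norm_sq L2_integrable)
qed

section \<open>Uniqueness of nilpotent one-parameter subgroups\<close>

lemma matrix_add_rdistrib: "((A + B) ** C) = (A ** C) + (B ** C :: real^'k^'m)" for A :: "real^'n^'m"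
  by (vector matrix_matrix_mult_def sum.distrib[symmetric] field_simps)

lemma bounded_bilinear_matrix_mult: "bounded_bilinear (\<lambda>(A::real^'n^'m) (B::real^'k^'n). A ** B)"
proof -
  have "bilinear (\<lambda>(A::real^'n^'m) (B::real^'k^'n). A ** B)"
    unfolding bilinear_def by (auto intro!: linearI simp: matrix_add_ldistrib matrix_add_rdistrib
      scalar_matrix_assoc[symmetric] matrix_scalar_ac)
  then show ?thesis by (simp add: bilinear_conv_bounded_bilinear)
qed

text \<open>The product of \<open>M t\<close> with \<open>1 - t X = exp(-t X)\<close> has derivative zero. As \<open>X\<^sup>2 = 0\<close>, the exponential series stops after the linear term, so the matrix exponential does not occur.\<close>
lemma one_parameter_group_nilpotent:
  fixes M :: "real \<Rightarrow> real^'n^'n"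
  assumes add: "\<And>s t. M (s + t) = M s ** M t" and M0: "M 0 = mat 1"
    and deriv: "(M has_vector_derivative X) (at 0)" and nil: "X ** X = 0"
  shows "M t = mat 1 + t *\<^sub>R X"
proof -
  interpret bb: bounded_bilinear "\<lambda>(A::real^'n^'n) (B::real^'n^'n). A ** B"
    by (rule bounded_bilinear_matrix_mult)
  have M': "(M has_vector_derivative (M t ** X)) (at t)" for t
  proof -
    have "((\<lambda>s. s - t) has_vector_derivative 1) (at t)"
      by (auto intro!: derivative_eq_intros)
    from vector_diff_chain_at[OF this, of M X] deriv
    have "((\<lambda>s. M (s - t)) has_vector_derivative X) (at t)" by (simp add: o_def)
    from bb.has_vector_derivative[OF has_vector_derivative_const this, of "M t"]
    have "((\<lambda>s. M t ** M (s - t)) has_vector_derivative M t ** X) (at t)" by (simp add: bb.zero_left)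
    moreover have "(\<lambda>s. M t ** M (s - t)) = M" by (rule ext) (simp add: add[symmetric])
    ultimately show ?thesis by simp
  qed
  define P where "P t = M t ** (mat 1 - t *\<^sub>R X)" for t
  have "(P has_vector_derivative 0) (at t)" for t
  proof -
    have "((\<lambda>t. mat 1 - t *\<^sub>R X) has_vector_derivative (- X)) (at t)"
      by (auto intro!: derivative_eq_intros)
    from bb.has_vector_derivative[OF M' this]
    have "(P has_vector_derivative M t ** (- X) + (M t ** X) ** (mat 1 - t *\<^sub>R X)) (at t)"
      unfolding P_def .
    moreover have "M t ** (- X) + (M t ** X) ** (mat 1 - t *\<^sub>R X) = 0"
      by (simp add: bb.minus_right bb.diff_right bb.scaleR_right matrix_mul_assoc[symmetric] nil bb.zero_right)
    ultimately show ?thesis by simp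
  qed
  then have "\<exists>c. \<forall>t\<in>UNIV. P t = c"
    by (intro has_derivative_zero_constant) (auto simp: has_vector_derivative_def)
  then have "P t = P 0" by auto
  then have "M t ** (mat 1 - t *\<^sub>R X) = mat 1" by (simp add: P_def M0)
  then have "M t ** (mat 1 - t *\<^sub>R X) ** (mat 1 + t *\<^sub>R X) = mat 1 + t *\<^sub>R X" by simp
  moreover have "(mat 1 - t *\<^sub>R X) ** (mat 1 + t *\<^sub>R X) = mat 1"
    by (simp add: bb.diff_left bb.add_right bb.scaleR_left bb.scaleR_right nil)
  ultimately show ?thesis by (simp add: matrix_mul_assoc[symmetric])
qed

lemma exp_curve_zero:
  assumes "group G" "is_exp_curve G \<pi> X \<gamma>"
  shows "\<gamma> 0 = \<one>\<^bsub>G\<^esub>"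
proof -
  interpret group G by fact
  have car: "\<gamma> 0 \<in> carrier G" and "\<gamma> (0 + 0) = \<gamma> 0 \<otimes>\<^bsub>G\<^esub> \<gamma> 0"
    using assms(2) unfolding is_exp_curve_def by blast+
  then have "\<gamma> 0 \<otimes>\<^bsub>G\<^esub> \<gamma> 0 = \<gamma> 0" by simp
  then show ?thesis using car by (simp add: l_cancel_one)
qed

lemma exp_curve_projection:
  assumes G: "is_universal_cover_SL2 G \<pi>" and \<gamma>: "is_exp_curve G \<pi> X \<gamma>" and nil: "X ** X = 0"
  shows "\<pi> (\<gamma> t) = mat 1 + t *\<^sub>R X"
proof (rule one_parameter_group_nilpotent[where M = "\<lambda>t. \<pi> (\<gamma> t)"])
  have car: "\<gamma> t \<in> carrier G" and add: "\<gamma> (s + t) = \<gamma> s \<otimes>\<^bsub>G\<^esub> \<gamma> t" for s t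
    using \<gamma> unfolding is_exp_curve_def by auto
  show add': "\<pi> (\<gamma> (s + t)) = \<pi> (\<gamma> s) ** \<pi> (\<gamma> t)" for s t
    using G car unfolding is_universal_cover_SL2_def add by blast
  show "((\<lambda>t. \<pi> (\<gamma> t)) has_vector_derivative X) (at 0)" using \<gamma> unfolding is_exp_curve_def by simp
  have "\<pi> (\<gamma> 0) \<in> SL2"
    using G car[of 0] unfolding is_universal_cover_SL2_def by (metis covering_space_imp_surjective imageI)
  then have "invertible (\<pi> (\<gamma> 0))" by (simp add: SL2_def invertible_det_nz)
  then obtain B where "B ** \<pi> (\<gamma> 0) = mat 1" unfolding invertible_def by blast
  moreover have "\<pi> (\<gamma> 0) = \<pi> (\<gamma> 0) ** \<pi> (\<gamma> 0)" using add'[of 0 0] by simp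
  ultimately show "\<pi> (\<gamma> 0) = mat 1" by (metis matrix_mul_assoc matrix_mul_lid)
qed (rule nil)

text \<open>Two such curves have the same image in \<open>SL(2, \<real>)\<close>. Both start at the identity, so for small \<open>t\<close> they stay in one sheet of the covering, where \<open>\<pi>\<close> is injective; the group law carries the equality from small \<open>t\<close> to all \<open>t\<close>.\<close>
lemma exp_curve_unique:
  assumes G: "is_universal_cover_SL2 G \<pi>" and nil: "X ** X = 0"
    and \<gamma>1: "is_exp_curve G \<pi> X \<gamma>1" and \<gamma>2: "is_exp_curve G \<pi> X \<gamma>2"
  shows "\<gamma>1 t = \<gamma>2 t"
proof -
  have grp: "group G" and cov: "covering_space (carrier G) \<pi> SL2"
    using G unfolding is_universal_cover_SL2_def by auto
  interpret group G by fact
  have car: "\<gamma>1 t \<in> carrier G" "\<gamma>2 t \<in> carrier G"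
    and add: "\<gamma>1 (s + t) = \<gamma>1 s \<otimes>\<^bsub>G\<^esub> \<gamma>1 t" "\<gamma>2 (s + t) = \<gamma>2 s \<otimes>\<^bsub>G\<^esub> \<gamma>2 t"
    and cont: "continuous_on UNIV \<gamma>1" "continuous_on UNIV \<gamma>2" for s t
    using \<gamma>1 \<gamma>2 unfolding is_exp_curve_def by auto
  have "\<pi> \<one>\<^bsub>G\<^esub> \<in> SL2" using cov covering_space_imp_surjective one_closed by blast
  \<comment> \<open>The sheet \<open>u\<close> over an evenly covered neighbourhood of \<open>\<pi> 1\<close> that contains the identity.\<close>
  then obtain T v where T: "\<pi> \<one>\<^bsub>G\<^esub> \<in> T" "\<Union>v = carrier G \<inter> \<pi> -` T"
    "\<And>u. u \<in> v \<Longrightarrow> openin (top_of_set (carrier G)) u" "\<And>u. u \<in> v \<Longrightarrow> \<exists>q. homeomorphism u T \<pi> q"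
    using cov unfolding covering_space_def by metis
  then obtain u where u: "u \<in> v" "\<one>\<^bsub>G\<^esub> \<in> u" using one_closed by (metis IntI UnionE vimageI)
  then obtain q where q: "homeomorphism u T \<pi> q" using T(4) by blast
  obtain W where W: "open W" "u = carrier G \<inter> W" using T(3)[OF u(1)] by (metis openin_open)
  have near: "\<forall>\<^sub>F t in at 0. \<gamma> t \<in> u" if "continuous_on UNIV \<gamma>" "\<And>t. \<gamma> t \<in> carrier G" "\<gamma> 0 = \<one>\<^bsub>G\<^esub>" for \<gamma> :: "real \<Rightarrow> 'a"
  proof -
    have "(\<gamma> \<longlongrightarrow> \<gamma> 0) (at 0)" using that(1) by (metis continuous_on_def UNIV_I)
    then have "\<forall>\<^sub>F t in at 0. \<gamma> t \<in> W"
      using W u that by (intro topological_tendstoD) auto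
    then show ?thesis using that W by (auto elim: eventually_mono)
  qed
  have "\<forall>\<^sub>F t in at 0. \<gamma>1 t \<in> u \<and> \<gamma>2 t \<in> u"
    using near[OF cont(1) car(1) exp_curve_zero[OF grp \<gamma>1]] near[OF cont(2) car(2) exp_curve_zero[OF grp \<gamma>2]]
    by (rule eventually_conj)
  then obtain d where d: "d > 0" "\<And>t. t \<noteq> 0 \<Longrightarrow> \<bar>t\<bar> < d \<Longrightarrow> \<gamma>1 t \<in> u \<and> \<gamma>2 t \<in> u"
    unfolding eventually_at by (auto simp: dist_norm)
  have small: "\<gamma>1 t = \<gamma>2 t" if "\<bar>t\<bar> < d" for t
  proof (cases "t = 0")
    case True
    then show ?thesis using exp_curve_zero[OF grp \<gamma>1] exp_curve_zero[OF grp \<gamma>2] by simp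
  next
    case False
    have "\<pi> (\<gamma>1 t) = \<pi> (\<gamma>2 t)"
      using exp_curve_projection[OF G \<gamma>1 nil] exp_curve_projection[OF G \<gamma>2 nil] by simp
    then show ?thesis using d(2)[OF False that] q unfolding homeomorphism_def by metis
  qed
  obtain k :: nat where k: "\<bar>t\<bar> / d < real k" using reals_Archimedean2 by blast
  have k0: "k > 0" using k d(1) by (cases k) (auto simp: divide_less_0_iff)
  define s where "s = t / real k"
  have s: "\<bar>s\<bar> < d" using k k0 d(1) by (simp add: s_def abs_divide field_simps)
  have "\<gamma>1 (real j * s) = \<gamma>2 (real j * s)" for j :: nat
  proof (induction j)
    case 0
    then show ?case using small[of 0] d by simp
  next
    case (Suc j)
    then show ?case using add[of "real j * s" s] small[OF s] by (simp add: algebra_simps)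
  qed
  from this[of k] show ?thesis using k0 by (simp add: s_def)
qed

section \<open>Skew-adjointness of the differential of a unitary representation\<close>

lemma unitary_rep_L2:
  assumes "is_unitary_rep G M \<Omega>" "is_exp_curve G \<pi> X \<gamma>" "f \<in> L2 M"
  shows "\<Omega> (\<gamma> t) f \<in> L2 M"
proof -
  have "\<gamma> t \<in> carrier G" using assms(2) unfolding is_exp_curve_def by simp
  moreover have "\<forall>g\<in>carrier G. \<forall>f\<in>L2 M. \<Omega> g f \<in> L2 M"
    using assms(1) unfolding is_unitary_rep_def by (rule conjunct1)
  ultimately show ?thesis using assms(3) by blast
qed

text \<open>The inverse of \<open>\<gamma> t\<close> is \<open>\<gamma> (- t)\<close>, and the adjoint of a unitary operator is its inverse.\<close>
lemma unitary_adjoint: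
  assumes grp: "group G" and U: "is_unitary_rep G M \<Omega>" and \<gamma>: "is_exp_curve G \<pi> X \<gamma>"
    and f: "f \<in> L2 M" and w: "w \<in> L2 M"
  shows "L2_inner M (\<Omega> (\<gamma> t) f) w = L2_inner M f (\<Omega> (\<gamma> (- t)) w)"
proof -
  have car: "\<gamma> t \<in> carrier G" for t using \<gamma> unfolding is_exp_curve_def by auto
  have one: "\<gamma> t \<otimes>\<^bsub>G\<^esub> \<gamma> (- t) = \<one>\<^bsub>G\<^esub>"
    using \<gamma> exp_curve_zero[OF grp \<gamma>] unfolding is_exp_curve_def by (metis (no_types) add.right_inverse)
  have inL2: "\<Omega> (\<gamma> t) f \<in> L2 M" if "f \<in> L2 M" for f t by (rule unitary_rep_L2[OF U \<gamma> that])
  have "AE x in M. \<Omega> \<one>\<^bsub>G\<^esub> w x = w x" using U w unfolding is_unitary_rep_def by blast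
  moreover have "AE x in M. \<Omega> (\<gamma> t \<otimes>\<^bsub>G\<^esub> \<gamma> (- t)) w x = \<Omega> (\<gamma> t) (\<Omega> (\<gamma> (- t)) w) x"
    using U w car unfolding is_unitary_rep_def by blast
  ultimately have "AE x in M. w x = \<Omega> (\<gamma> t) (\<Omega> (\<gamma> (- t)) w) x"
    unfolding one by eventually_elim simp
  then have "L2_inner M (\<Omega> (\<gamma> t) f) w = L2_inner M (\<Omega> (\<gamma> t) f) (\<Omega> (\<gamma> t) (\<Omega> (\<gamma> (- t)) w))"
    by (intro L2_inner_cong_AE inL2 f w) auto
  also have "\<dots> = L2_inner M f (\<Omega> (\<gamma> (- t)) w)"
    using U f inL2[OF w] car unfolding is_unitary_rep_def by blast
  finally show ?thesis .
qed

text \<open>The difference quotients of the orbit of \<open>f\<close> at \<open>t\<close> and of the orbit of \<open>w\<close> at \<open>- t\<close> have opposite inner products, by \<open>unitary_adjoint\<close>. Both quotients converge in norm, and the inner product is continuous. The two differentials may be witnessed by different curves, which coincide by uniqueness.\<close>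
lemma has_differential_skew_adjoint:
  assumes G: "is_universal_cover_SL2 G \<pi>" and U: "is_unitary_rep G M \<Omega>" and nil: "X ** X = 0"
    and f: "has_differential G \<pi> M \<Omega> X f h" and w: "has_differential G \<pi> M \<Omega> X w k"
  shows "L2_inner M h w = - L2_inner M f k"
proof -
  have grp: "group G" using G unfolding is_universal_cover_SL2_def by auto
  have L2: "f \<in> L2 M" "h \<in> L2 M" "w \<in> L2 M" "k \<in> L2 M" using f w unfolding has_differential_def by auto
  obtain \<gamma> where \<gamma>: "is_exp_curve G \<pi> X \<gamma>"
    and lf: "((\<lambda>t. L2_norm M (\<lambda>x. (\<Omega> (\<gamma> t) f x - f x) / of_real t - h x)) \<longlongrightarrow> 0) (at 0)"
    using f unfolding has_differential_def by auto
  obtain \<gamma>' where \<gamma>': "is_exp_curve G \<pi> X \<gamma>'"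
    and lw': "((\<lambda>t. L2_norm M (\<lambda>x. (\<Omega> (\<gamma>' t) w x - w x) / of_real t - k x)) \<longlongrightarrow> 0) (at 0)"
    using w unfolding has_differential_def by auto
  have "\<gamma>' = \<gamma>" using exp_curve_unique[OF G nil \<gamma>' \<gamma>] by blast
  then have lw: "((\<lambda>t. L2_norm M (\<lambda>x. (\<Omega> (\<gamma> t) w x - w x) / of_real t - k x)) \<longlongrightarrow> 0) (at 0)" using lw' by simp
  have lw2: "((\<lambda>t. L2_norm M (\<lambda>x. (\<Omega> (\<gamma> (- t)) w x - w x) / of_real (- t) - k x)) \<longlongrightarrow> 0) (at 0)"
  proof -
    have "filterlim uminus (at 0) (at (0::real))"
      using tendsto_minus[OF tendsto_ident_at[of "0::real" UNIV]] by (auto simp: filterlim_at eventually_at_filter)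
    from filterlim_compose[OF lw this] show ?thesis .
  qed
  have car: "\<gamma> t \<in> carrier G" for t using \<gamma> unfolding is_exp_curve_def by auto
  have inL2: "\<Omega> (\<gamma> t) f \<in> L2 M" if "f \<in> L2 M" for f t by (rule unitary_rep_L2[OF U \<gamma> that])
  \<comment> \<open>The errors of the two difference quotients, which tend to zero in norm.\<close>
  define u where "u t = (\<lambda>x. (\<Omega> (\<gamma> t) f x - f x) / of_real t - h x)" for t
  define v where "v t = (\<lambda>x. (\<Omega> (\<gamma> (- t)) w x - w x) / of_real (- t) - k x)" for t
  have quot: "(\<lambda>x. (\<Omega> (\<gamma> s) g x - g x) / of_real t) \<in> L2 M" if "g \<in> L2 M" for g s t
    unfolding divide_inverse mult.commute[of _ "inverse _"] by (intro L2_cmult L2_diff inL2 that)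
  have u: "u t \<in> L2 M" for t unfolding u_def by (intro L2_diff quot L2)
  have v: "v t \<in> L2 M" for t unfolding v_def by (intro L2_diff quot L2)
  have eq: "L2_inner M h w + L2_inner M f k = - L2_inner M (u t) w - L2_inner M f (v t)" if "t \<noteq> 0" for t
  proof -
    have "L2_inner M (u t) w = inverse (of_real t) * (L2_inner M (\<Omega> (\<gamma> t) f) w - L2_inner M f w) - L2_inner M h w"
      unfolding u_def divide_inverse mult.commute[of _ "inverse _"]
      by (simp add: L2_inner_diff_left L2_inner_cmult_left L2_cmult L2_diff inL2 L2)
    moreover have "L2_inner M f (v t) = - inverse (of_real t) * (L2_inner M f (\<Omega> (\<gamma> (- t)) w) - L2_inner M f w) - L2_inner M f k"
    proof -
      define c where "c = inverse (complex_of_real (- t))"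
      have "v t = (\<lambda>x. c * (\<Omega> (\<gamma> (- t)) w x - w x) - k x)"
        by (simp only: v_def c_def divide_inverse mult.commute[of _ "inverse _"])
      then have "L2_inner M f (v t) = cnj c * (L2_inner M f (\<Omega> (\<gamma> (- t)) w) - L2_inner M f w) - L2_inner M f k"
        by (simp only: L2_inner_diff_right L2_inner_cmult_right L2_cmult L2_diff inL2 L2)
      then show ?thesis by (simp add: c_def)
    qed
    ultimately show ?thesis using unitary_adjoint[OF grp U \<gamma> L2(1,3), of t] by simp
  qed
  have "((\<lambda>t. L2_norm M (u t) * L2_norm M w + L2_norm M f * L2_norm M (v t)) \<longlongrightarrow> 0 * L2_norm M w + L2_norm M f * 0) (at 0)"
    using lf lw2 unfolding u_def v_def by (intro tendsto_intros)
  then have lim: "((\<lambda>t. L2_norm M (u t) * L2_norm M w + L2_norm M f * L2_norm M (v t)) \<longlongrightarrow> 0) (at 0)" by simp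
  have "cmod (L2_inner M h w + L2_inner M f k) \<le> 0"
  proof (rule tendsto_lowerbound[OF lim])
    show "\<forall>\<^sub>F t in at 0. cmod (L2_inner M h w + L2_inner M f k) \<le> L2_norm M (u t) * L2_norm M w + L2_norm M f * L2_norm M (v t)"
      unfolding eventually_at_filter
    proof (intro always_eventually allI impI)
      fix t :: real assume "t \<noteq> 0"
      have "cmod (L2_inner M h w + L2_inner M f k) \<le> cmod (L2_inner M (u t) w) + cmod (L2_inner M f (v t))"
        unfolding eq[OF \<open>t \<noteq> 0\<close>] using norm_triangle_ineq4[of "- L2_inner M (u t) w" "L2_inner M f (v t)"] by simp
      then show "cmod (L2_inner M h w + L2_inner M f k) \<le> L2_norm M (u t) * L2_norm M w + L2_norm M f * L2_norm M (v t)"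
        using L2_Cauchy_Schwarz[OF u[of t] L2(3)] L2_Cauchy_Schwarz[OF L2(1) v[of t]] by simp
    qed
  qed simp
  then show ?thesis by (simp add: eq_neg_iff_add_eq_0)
qed

lemma has_differential_cong_AE:
  assumes "is_unitary_rep G M \<Omega>" and h: "has_differential G \<pi> M \<Omega> X f h"
    and h': "h' \<in> borel_measurable M" "AE x in M. h x = h' x"
  shows "has_differential G \<pi> M \<Omega> X f h'"
proof -
  have L2: "f \<in> L2 M" "h \<in> L2 M" using h unfolding has_differential_def by auto
  then have h'L2: "h' \<in> L2 M" using L2_cong_AE h' by blast
  obtain \<gamma> where \<gamma>: "is_exp_curve G \<pi> X \<gamma>"
    and lf: "((\<lambda>t. L2_norm M (\<lambda>x. (\<Omega> (\<gamma> t) f x - f x) / of_real t - h x)) \<longlongrightarrow> 0) (at 0)"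
    using h unfolding has_differential_def by auto
  have "L2_norm M (\<lambda>x. (\<Omega> (\<gamma> t) f x - f x) / of_real t - h x) = L2_norm M (\<lambda>x. (\<Omega> (\<gamma> t) f x - f x) / of_real t - h' x)" for t
  proof -
    have "\<Omega> (\<gamma> t) f \<in> L2 M" by (rule unitary_rep_L2[OF assms(1) \<gamma> L2(1)])
    note [measurable] = L2_measurable[OF this] L2_measurable[OF L2(1)] L2_measurable[OF L2(2)] h'(1)
    show ?thesis unfolding L2_norm_def
      by (intro arg_cong[of _ _ sqrt] integral_cong_AE) (use h'(2) in \<open>auto elim: eventually_mono\<close>)
  qed
  then show ?thesis using L2 h'L2 \<gamma> lf unfolding has_differential_def by auto
qed

lemma has_differential_unique:
  assumes G: "is_universal_cover_SL2 G \<pi>" and U: "is_unitary_rep G M \<Omega>" and nil: "X ** X = 0"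
    and f: "has_differential G \<pi> M \<Omega> X f h" and w: "has_differential G \<pi> M \<Omega> X f k"
  shows "AE x in M. h x = k x"
proof -
  have L2: "f \<in> L2 M" "h \<in> L2 M" "k \<in> L2 M" using f w unfolding has_differential_def by auto
  obtain \<gamma> where \<gamma>: "is_exp_curve G \<pi> X \<gamma>"
    and lf: "((\<lambda>t. L2_norm M (\<lambda>x. (\<Omega> (\<gamma> t) f x - f x) / of_real t - h x)) \<longlongrightarrow> 0) (at 0)"
    using f unfolding has_differential_def by auto
  obtain \<gamma>' where \<gamma>': "is_exp_curve G \<pi> X \<gamma>'"
    and lw': "((\<lambda>t. L2_norm M (\<lambda>x. (\<Omega> (\<gamma>' t) f x - f x) / of_real t - k x)) \<longlongrightarrow> 0) (at 0)"
    using w unfolding has_differential_def by auto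
  have "\<gamma>' = \<gamma>" using exp_curve_unique[OF G nil \<gamma>' \<gamma>] by blast
  then have lw: "((\<lambda>t. L2_norm M (\<lambda>x. (\<Omega> (\<gamma> t) f x - f x) / of_real t - k x)) \<longlongrightarrow> 0) (at 0)" using lw' by simp
  define u where "u t = (\<lambda>x. (\<Omega> (\<gamma> t) f x - f x) / of_real t - h x)" for t
  define v where "v t = (\<lambda>x. (\<Omega> (\<gamma> t) f x - f x) / of_real t - k x)" for t
  have inL2: "\<Omega> (\<gamma> t) f \<in> L2 M" for t by (rule unitary_rep_L2[OF U \<gamma> L2(1)])
  have quot: "(\<lambda>x. (\<Omega> (\<gamma> t) f x - f x) / of_real t) \<in> L2 M" for t
    unfolding divide_inverse mult.commute[of _ "inverse _"] by (intro L2_cmult L2_diff inL2 L2)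
  have uv: "u t \<in> L2 M" "v t \<in> L2 M" for t unfolding u_def v_def by (intro L2_diff quot L2)+
  have "(\<lambda>x. v t x - u t x) = (\<lambda>x. h x - k x)" for t by (simp add: u_def v_def)
  then have bound: "(L2_norm M (\<lambda>x. h x - k x))\<^sup>2 \<le> 2 * (L2_norm M (v t))\<^sup>2 + 2 * (L2_norm M (u t))\<^sup>2" for t
    using L2_norm_triangle_sq[OF uv(2,1)[of t]] by simp
  have "((\<lambda>t. 2 * (L2_norm M (v t))\<^sup>2 + 2 * (L2_norm M (u t))\<^sup>2) \<longlongrightarrow> 2 * 0\<^sup>2 + 2 * 0\<^sup>2) (at 0)"
    using lf lw unfolding u_def v_def by (intro tendsto_intros)
  then have "(L2_norm M (\<lambda>x. h x - k x))\<^sup>2 \<le> 2 * 0\<^sup>2 + 2 * 0\<^sup>2"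
    by (rule tendsto_lowerbound) (auto simp: bound)
  then have "L2_norm M (\<lambda>x. h x - k x) = 0" by simp
  from L2_norm_zero_AE[OF L2_diff[OF L2(2,3)] this] show ?thesis by simp
qed

section \<open>Polar coordinates for the cone measure\<close>

lemma lborel_translate: "distr lborel borel (\<lambda>x. a + x) = (lborel :: 'a::euclidean_space measure)"
  using lborel_affine[of 1 a] by (simp add: density_1)

lemma nn_integral_scale:
  fixes g :: "'a::euclidean_space \<Rightarrow> ennreal"
  assumes [measurable]: "g \<in> borel_measurable borel" and "c > 0"
  shows "(\<integral>\<^sup>+x. g x \<partial>lborel) = ennreal (c ^ DIM('a)) * (\<integral>\<^sup>+x. g (c *\<^sub>R x) \<partial>lborel)"
  using assms(2)
  by (subst lborel_affine[of c 0]) (simp_all add: nn_integral_density nn_integral_distr nn_integral_cmult)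

lemma measurable_sgn [measurable]: "(sgn :: real^'n::finite \<Rightarrow> _) \<in> borel_measurable borel"
proof -
  have "(\<lambda>x::real^'n. x /\<^sub>R norm x) \<in> borel_measurable borel" by measurable
  then show ?thesis by (simp add: sgn_div_norm[abs_def])
qed

lemma sets_sphere_measure [simp, measurable_cong]: "sets sphere_measure = sets borel"
  by (simp add: sphere_measure_def)

lemma space_sphere_measure [simp]: "space sphere_measure = UNIV"
  by (simp add: sphere_measure_def)

lemma emeasure_sphere_measure:
  assumes [measurable]: "B \<in> sets borel"
  shows "emeasure (sphere_measure :: (real^'n::finite) measure) B =
    ennreal (real CARD('n)) * emeasure lborel {x. norm x < 1 \<and> sgn x \<in> B}"
proof -
  have [measurable]: "ball 0 1 \<in> sets (borel :: (real^'n) measure)" by simp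
  have "emeasure (sphere_measure :: (real^'n) measure) B =
      (\<integral>\<^sup>+x. of_nat CARD('n) * indicator (ball 0 1) x * indicator (sgn -` B) x \<partial>lborel)"
    unfolding sphere_measure_def using measurable_sets_borel[OF measurable_sgn, of B]
    by (simp add: emeasure_distr emeasure_density)
  also have "\<dots> = (\<integral>\<^sup>+x. of_nat CARD('n) * indicator {x. norm x < 1 \<and> sgn x \<in> B} x \<partial>lborel)"
    by (intro nn_integral_cong) (auto split: split_indicator)
  also have "\<dots> = of_nat CARD('n) * emeasure lborel {x::real^'n. norm x < 1 \<and> sgn x \<in> B}"
    by (intro nn_integral_cmult_indicator) measurable
  finally show ?thesis by (simp add: ennreal_of_nat_eq_real_of_nat)
qed

lemma finite_sphere_measure: "finite_measure (sphere_measure :: (real^'n::finite) measure)"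
proof
  have "{x::real^'n. norm x < 1 \<and> sgn x \<in> UNIV} = ball 0 1" by auto
  then show "emeasure (sphere_measure :: (real^'n) measure) (space sphere_measure) \<noteq> \<infinity>"
    by (simp add: emeasure_sphere_measure emeasure_ball ennreal_mult_eq_top_iff)
qed

interpretation sphere: finite_measure "sphere_measure :: (real^'n::finite) measure"
  by (rule finite_sphere_measure)

lemma AE_sphere_measure_norm: "AE \<xi> in (sphere_measure :: (real^'n::finite) measure). norm \<xi> = 1"
proof -
  have [measurable]: "ball 0 1 \<in> sets (borel :: (real^'n) measure)" by simp
  have "AE x in lborel. x \<in> ball 0 1 \<longrightarrow> norm (sgn (x :: real^'n)) = 1"
    using AE_lborel_singleton[of 0] by eventually_elim (simp add: norm_sgn)
  then show ?thesis unfolding sphere_measure_def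
    by (subst AE_distr_iff) (auto simp: AE_density indicator_def elim: eventually_mono)
qed

definition radial_measure :: "nat \<Rightarrow> real measure" where
  "radial_measure N = density lborel (\<lambda>r. ennreal (r powr (real N - 1)) * indicator {0..} r)"

lemma sets_radial_measure [simp, measurable_cong]: "sets (radial_measure N) = sets borel"
  by (simp add: radial_measure_def)

lemma space_radial_measure [simp]: "space (radial_measure N) = UNIV"
  by (simp add: radial_measure_def)

lemma emeasure_radial_measure_lessThan:
  assumes "N > 0"
  shows "emeasure (radial_measure N) {..<a} = ennreal (if a > 0 then a ^ N / real N else 0)"
proof -
  have "emeasure (radial_measure N) {..<a} =
      (\<integral>\<^sup>+r. ennreal (r powr (real N - 1)) * indicator {0..} r * indicator {..<a} r \<partial>lborel)"
    unfolding radial_measure_def by (simp add: emeasure_density)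
  also have "\<dots> = (\<integral>\<^sup>+r. ennreal (r powr (real N - 1)) * indicator {0..max a 0} r \<partial>lborel)"
    by (rule nn_integral_cong_AE, use AE_lborel_singleton[of a] in eventually_elim)
      (auto split: split_indicator simp: max_def split: if_splits)
  also have "\<dots> = ennreal (max a 0 powr (real N - 1 + 1) / (real N - 1 + 1))"
    using assms by (intro nn_integral_has_integral_lebesgue' has_integral_powr_from_0) auto
  also have "\<dots> = ennreal (if a > 0 then a ^ N / real N else 0)"
    using assms by (auto simp: max_def powr_realpow)
  finally show ?thesis .
qed

lemma sigma_finite_radial_measure: "N > 0 \<Longrightarrow> sigma_finite_measure (radial_measure N)"
proof (rule sigma_finite_measure.intro)
  assume "N > 0"
  show "\<exists>A. countable A \<and> A \<subseteq> sets (radial_measure N) \<and> \<Union> A = space (radial_measure N) \<and>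
      (\<forall>a\<in>A. emeasure (radial_measure N) a \<noteq> \<infinity>)"
    by (rule exI[of _ "range (\<lambda>i::nat. {..<real i})"])
      (auto simp: emeasure_radial_measure_lessThan[OF \<open>N > 0\<close>] reals_Archimedean2 space_radial_measure)
qed

text \<open>Scaling by \<open>a\<close>.\<close>
lemma emeasure_cone:
  fixes B :: "(real^'n::finite) set"
  assumes [measurable]: "B \<in> sets borel" and "a > 0"
  shows "emeasure lborel {x. norm x < a \<and> sgn x \<in> B} = ennreal (a ^ CARD('n)) * emeasure lborel {x. norm x < 1 \<and> sgn x \<in> B}"
proof -
  have *: "{x. norm x < c \<and> sgn x \<in> B} \<in> sets borel" for c by measurable
  have "emeasure lborel {x. norm x < a \<and> sgn x \<in> B} = (\<integral>\<^sup>+x. indicator {x. norm x < a \<and> sgn x \<in> B} x \<partial>lborel)"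
    using * by (simp add: nn_integral_indicator)
  also have "\<dots> = ennreal (a ^ CARD('n)) * (\<integral>\<^sup>+x. indicator {x. norm x < a \<and> sgn x \<in> B} (a *\<^sub>R x) \<partial>lborel)"
    using * by (subst nn_integral_scale[OF _ \<open>a > 0\<close>]) (auto intro!: borel_measurable_indicator)
  also have "(\<lambda>x. indicator {x. norm x < a \<and> sgn x \<in> B} (a *\<^sub>R x) :: ennreal) = indicator {x. norm x < 1 \<and> sgn x \<in> B}"
    using \<open>a > 0\<close> by (auto simp: indicator_def sgn_scaleR fun_eq_iff)
  finally show ?thesis using * by (simp add: nn_integral_indicator)
qed

text \<open>On a rectangle \<open>{..<a} \<times> B\<close> both sides are the volume of a cone, computed by scaling from the unit cone that defines \<open>sphere_measure\<close>. Such rectangles determine the measures.\<close>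
lemma distr_norm_sgn:
  "distr lborel (borel \<Otimes>\<^sub>M borel) (\<lambda>x::real^'n::finite. (norm x, sgn x)) =
    radial_measure CARD('n) \<Otimes>\<^sub>M sphere_measure"
proof (rule pair_measure_eqI[symmetric])
  show "sigma_finite_measure (radial_measure CARD('n))" by (rule sigma_finite_radial_measure) simp
  show "sigma_finite_measure (sphere_measure :: (real^'n) measure)" by unfold_locales
  show "sets (radial_measure CARD('n) \<Otimes>\<^sub>M (sphere_measure :: (real^'n) measure)) =
     sets (distr lborel (borel \<Otimes>\<^sub>M borel) (\<lambda>x::real^'n. (norm x, sgn x)))"
    by (simp cong: sets_pair_measure_cong)
  fix A :: "real set" and B :: "(real^'n) set"
  assume "A \<in> sets (radial_measure CARD('n))" and B': "B \<in> sets sphere_measure"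
  then have A[measurable]: "A \<in> sets borel" and B[measurable]: "B \<in> sets borel" by simp_all
  define cB where "cB = emeasure lborel {x::real^'n. norm x < 1 \<and> sgn x \<in> B}"
  have cB: "cB < \<infinity>"
  proof -
    have "cB \<le> emeasure lborel (ball (0::real^'n) 1)"
      unfolding cB_def by (intro emeasure_mono) auto
    then show ?thesis using emeasure_lborel_ball_finite[of "0::real^'n" 1] by (simp add: le_less_trans)
  qed
  have N: "real CARD('n) > 0" by simp
  define M1 where "M1 = distr (density lborel (indicator (sgn -` B))) borel (norm :: real^'n \<Rightarrow> real)"
  define M2 where "M2 = density (radial_measure CARD('n)) (\<lambda>_. emeasure (sphere_measure :: (real^'n) measure) B)"
  have sB: "sgn -` B \<in> sets (borel :: (real^'n) measure)"
    using measurable_sets_borel[OF measurable_sgn B] by simp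
  have M1: "emeasure M1 X = emeasure lborel {x::real^'n. norm x \<in> X \<and> sgn x \<in> B}" if [measurable]: "X \<in> sets borel" for X
  proof -
    have "emeasure M1 X = (\<integral>\<^sup>+x. indicator (sgn -` B) x * indicator (norm -` X) x \<partial>(lborel :: (real^'n) measure))"
      unfolding M1_def using sB measurable_sets_borel[of norm borel X]
      by (subst emeasure_distr, simp, simp, subst emeasure_density) auto
    also have "\<dots> = (\<integral>\<^sup>+x. indicator {x::real^'n. norm x \<in> X \<and> sgn x \<in> B} x \<partial>lborel)"
      by (intro nn_integral_cong) (auto split: split_indicator)
    also have "\<dots> = emeasure lborel {x::real^'n. norm x \<in> X \<and> sgn x \<in> B}"
      by (intro nn_integral_indicator) measurable
    finally show ?thesis .
  qed
  have M2: "emeasure M2 X = emeasure (radial_measure CARD('n)) X * emeasure (sphere_measure :: (real^'n) measure) B"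
    if "X \<in> sets borel" for X
    unfolding M2_def mult.commute[of "emeasure (radial_measure _) X"]
    using that by (subst emeasure_density) (simp_all add: nn_integral_cmult_indicator)
  have "M1 = M2"
  proof (rule measure_eqI_generator_eq)
    let ?E = "range (\<lambda>a::real. {..<a})"
    have "{..<a} \<inter> {..<b} = {..<min a b}" for a b :: real by auto
    then show "Int_stable ?E" by (auto simp: Int_stable_def)
    show "?E \<subseteq> Pow UNIV" by auto
    have "sets borel = sigma_sets UNIV ?E"
      unfolding borel_eq_lessThan by (simp add: eucl_lessThan)
    then show "sets M1 = sigma_sets UNIV ?E" "sets M2 = sigma_sets UNIV ?E"
      by (simp_all add: M1_def M2_def)
    show "range (\<lambda>i::nat. {..<real i}) \<subseteq> ?E" "(\<Union>i. {..<real i}) = UNIV"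
      by (auto simp: reals_Archimedean2)
    have eq: "emeasure M1 {..<a} = emeasure M2 {..<a}" for a
    proof (cases "a > 0")
      case True
      have "emeasure M1 {..<a} = ennreal (a ^ CARD('n)) * cB"
        using emeasure_cone[OF B True] by (simp add: M1 cB_def)
      also have "\<dots> = ennreal (a ^ CARD('n) / real CARD('n)) * (ennreal (real CARD('n)) * cB)"
        unfolding mult.assoc[symmetric] using True N by (subst ennreal_mult[symmetric]) auto
      also have "\<dots> = emeasure M2 {..<a}"
        using True by (simp add: M2 emeasure_radial_measure_lessThan emeasure_sphere_measure[OF B] cB_def)
      finally show ?thesis .
    next
      case False
      then have "\<not> norm x < a" for x :: "real^'n" using norm_ge_zero[of x] by linarith
      then have E: "{x::real^'n. norm x \<in> {..<a} \<and> sgn x \<in> B} = {}" by blast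
      have "emeasure M1 {..<a} = 0" by (subst M1) (simp, subst E, simp)
      then show ?thesis using False M2[of "{..<a}"] by (simp add: emeasure_radial_measure_lessThan)
    qed
    show "emeasure M1 X = emeasure M2 X" if "X \<in> ?E" for X using that eq by auto
    show "emeasure M1 {..<real i} \<noteq> \<infinity>" for i
      unfolding eq using cB
      by (simp add: M2 emeasure_radial_measure_lessThan emeasure_sphere_measure[OF B] cB_def[symmetric] ennreal_mult_eq_top_iff)
  qed
  then have "emeasure lborel {x::real^'n. norm x \<in> A \<and> sgn x \<in> B} = emeasure (radial_measure CARD('n)) A * emeasure (sphere_measure :: (real^'n) measure) B"
    using M1[OF A] M2[OF A] by simp
  moreover have "emeasure (distr lborel (borel \<Otimes>\<^sub>M borel) (\<lambda>x::real^'n. (norm x, sgn x))) (A \<times> B) = emeasure lborel {x::real^'n. norm x \<in> A \<and> sgn x \<in> B}"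
    by (subst emeasure_distr) (auto simp: vimage_def)
  ultimately show "emeasure (radial_measure CARD('n)) A * emeasure (sphere_measure :: (real^'n) measure) B =
     emeasure (distr lborel (borel \<Otimes>\<^sub>M borel) (\<lambda>x::real^'n. (norm x, sgn x))) (A \<times> B)" by simp
qed

lemma norm_sgn_eq_self: "norm x *\<^sub>R sgn x = x" for x :: "'a::real_normed_vector"
  by (cases "x = 0") (simp_all add: sgn_div_norm)

lemma nn_integral_polar:
  fixes g :: "real^'n::finite \<Rightarrow> ennreal"
  assumes [measurable]: "g \<in> borel_measurable borel"
  shows "(\<integral>\<^sup>+x. g x \<partial>lborel) =
    (\<integral>\<^sup>+r. ennreal (r powr (real CARD('n) - 1)) * indicator {0..} r * (\<integral>\<^sup>+\<xi>. g (r *\<^sub>R \<xi>) \<partial>sphere_measure) \<partial>lborel)"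
proof -
  have "(\<integral>\<^sup>+x. g x \<partial>lborel) = (\<integral>\<^sup>+x. g (norm x *\<^sub>R sgn x) \<partial>lborel)"
    by (intro nn_integral_cong) (metis (no_types) norm_sgn_eq_self)
  also have "\<dots> = (\<integral>\<^sup>+(r, \<xi>). g (r *\<^sub>R \<xi>) \<partial>(distr lborel (borel \<Otimes>\<^sub>M borel) (\<lambda>x::real^'n. (norm x, sgn x))))"
    by (subst nn_integral_distr) auto
  also have "\<dots> = (\<integral>\<^sup>+r. (\<integral>\<^sup>+\<xi>. g (r *\<^sub>R \<xi>) \<partial>sphere_measure) \<partial>radial_measure CARD('n))"
    unfolding distr_norm_sgn by (subst sphere.nn_integral_fst[symmetric]) auto
  also have "\<dots> = (\<integral>\<^sup>+r. ennreal (r powr (real CARD('n) - 1)) * indicator {0..} r * (\<integral>\<^sup>+\<xi>. g (r *\<^sub>R \<xi>) \<partial>sphere_measure) \<partial>lborel)"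
    unfolding radial_measure_def by (subst nn_integral_density) auto
  finally show ?thesis .
qed

text \<open>In polar coordinates the radial integrals of \<open>r\<^sup>a\<^sup>+\<^sup>N\<^sup>-\<^sup>1\<close> over \<open>[0, 1]\<close> and of \<open>r\<^sup>-\<^sup>2\<close> over \<open>[1, \<infinity>)\<close> are finite.\<close>
lemma integrable_of_powr_bounds:
  fixes u :: "real^'n::finite \<Rightarrow> 'b::{banach, second_countable_topology}"
  assumes [measurable]: "u \<in> borel_measurable borel" and a: "a > - real CARD('n)"
    and near: "\<And>x. x \<noteq> 0 \<Longrightarrow> norm x \<le> 1 \<Longrightarrow> norm (u x) \<le> C * norm x powr a"
    and far: "\<And>x. norm x \<ge> 1 \<Longrightarrow> norm (u x) \<le> C * norm x powr (- real CARD('n) - 1)"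
  shows "integrable lborel u"
proof (rule integrableI_bounded)
  let ?N = "real CARD('n)"
  have C: "C \<ge> 0"
  proof -
    have "norm (axis undefined 1 :: real^'n) = 1" by simp
    from near[of "axis undefined 1"] this have "0 \<le> C"
      by (metis norm_ge_zero norm_zero mult.right_neutral order_refl order_trans powr_one_eq_one zero_neq_one)
    then show ?thesis .
  qed
  define h where "h r = C * (if r \<le> 1 then r powr a else r powr (- ?N - 1))" for r :: real
  have [measurable]: "h \<in> borel_measurable borel" unfolding h_def by measurable
  have "(\<integral>\<^sup>+x. ennreal (norm (u x)) \<partial>lborel) \<le> (\<integral>\<^sup>+x. ennreal (h (norm x)) \<partial>(lborel :: (real^'n) measure))"
    by (rule nn_integral_mono_AE, use AE_lborel_singleton[of 0] in eventually_elim)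
      (use near far in \<open>auto simp: h_def intro!: ennreal_leI\<close>)
  also have "\<dots> = (\<integral>\<^sup>+r. ennreal (r powr (?N - 1)) * indicator {0..} r * (\<integral>\<^sup>+\<xi>. ennreal (h (norm (r *\<^sub>R \<xi>))) \<partial>(sphere_measure :: (real^'n) measure)) \<partial>lborel)"
    by (rule nn_integral_polar) measurable
  also have "\<dots> = (\<integral>\<^sup>+r. ennreal (r powr (?N - 1)) * indicator {0..} r * (ennreal (h r) * emeasure (sphere_measure :: (real^'n) measure) UNIV) \<partial>lborel)"
  proof (rule nn_integral_cong)
    fix r :: real
    have "(\<integral>\<^sup>+\<xi>. ennreal (h (norm (r *\<^sub>R \<xi>))) \<partial>(sphere_measure :: (real^'n) measure)) = (\<integral>\<^sup>+\<xi>. ennreal (h r) \<partial>(sphere_measure :: (real^'n) measure))" if "r \<ge> 0"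
      by (rule nn_integral_cong_AE, use AE_sphere_measure_norm in eventually_elim) (use that in auto)
    then show "ennreal (r powr (?N - 1)) * indicator {0..} r * (\<integral>\<^sup>+\<xi>. ennreal (h (norm (r *\<^sub>R \<xi>))) \<partial>(sphere_measure :: (real^'n) measure)) =
      ennreal (r powr (?N - 1)) * indicator {0..} r * (ennreal (h r) * emeasure (sphere_measure :: (real^'n) measure) UNIV)"
      by (auto split: split_indicator)
  qed
  also have "\<dots> = (\<integral>\<^sup>+r. ennreal (r powr (?N - 1)) * indicator {0..} r * ennreal (h r) \<partial>lborel) * emeasure (sphere_measure :: (real^'n) measure) UNIV"
    unfolding mult.assoc[symmetric] by (subst nn_integral_multc) auto
  also have "\<dots> < \<infinity>"
  proof -
    have "(\<integral>\<^sup>+r. ennreal (r powr (?N - 1)) * indicator {0..} r * ennreal (h r) \<partial>lborel) \<le>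
      (\<integral>\<^sup>+r. ennreal C * (ennreal (r powr (a + ?N - 1)) * indicator {0..1} r) + ennreal C * (ennreal (r powr - 2) * indicator {1..} r) \<partial>lborel)"
    proof (rule nn_integral_mono)
      fix r :: real
      have "ennreal (r powr (?N - 1)) * ennreal (h r) = ennreal C * ennreal (r powr (a + ?N - 1))" if "0 \<le> r" "r \<le> 1"
        using that C by (simp add: h_def ennreal_mult'[symmetric] powr_add[symmetric] algebra_simps)
      moreover have "ennreal (r powr (?N - 1)) * ennreal (h r) = ennreal C * ennreal (r powr - 2)" if "r > 1"
        using that C by (simp add: h_def ennreal_mult'[symmetric] powr_add[symmetric] algebra_simps)
      ultimately show "ennreal (r powr (?N - 1)) * indicator {0..} r * ennreal (h r) \<le>
        ennreal C * (ennreal (r powr (a + ?N - 1)) * indicator {0..1} r) + ennreal C * (ennreal (r powr - 2) * indicator {1..} r)"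
        by (cases "r < 0"; cases "r \<le> 1") (auto split: split_indicator)
    qed
    also have "\<dots> = ennreal C * (\<integral>\<^sup>+r. ennreal (r powr (a + ?N - 1)) * indicator {0..1} r \<partial>lborel) + ennreal C * (\<integral>\<^sup>+r. ennreal (r powr - 2) * indicator {1..} r \<partial>lborel)"
      by (simp add: nn_integral_add nn_integral_cmult)
    also have "(\<integral>\<^sup>+r. ennreal (r powr (a + ?N - 1)) * indicator {0..1} r \<partial>lborel) = ennreal (1 powr (a + ?N - 1 + 1) / (a + ?N - 1 + 1))"
      using a by (intro nn_integral_has_integral_lebesgue' has_integral_powr_from_0) auto
    also have "(\<integral>\<^sup>+r. ennreal (r powr - 2) * indicator {1..} r \<partial>lborel) = ennreal (- (1 powr (- 2 + 1)) / (- 2 + 1))"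
      by (intro nn_integral_has_integral_lebesgue' has_integral_powr_to_inf) auto
    finally have "(\<integral>\<^sup>+r. ennreal (r powr (?N - 1)) * indicator {0..} r * ennreal (h r) \<partial>lborel) < \<infinity>"
      by (rule le_less_trans) (simp add: ennreal_mult_less_top)
    moreover have "emeasure (sphere_measure :: (real^'n) measure) UNIV < \<infinity>"
      using finite_measure.emeasure_finite[OF finite_sphere_measure, of "UNIV :: (real^'n) set"]
      by (metis infinity_ennreal_def top.not_eq_extremum)
    ultimately show ?thesis by (simp add: ennreal_mult_less_top)
  qed
  finally show "(\<integral>\<^sup>+x. ennreal (norm (u x)) \<partial>lborel) < \<infinity>" .
qed simp

section \<open>Integration by parts\<close>

lemma integrable_translate:
  fixes u :: "'a::euclidean_space \<Rightarrow> 'b::{banach, second_countable_topology}"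
  assumes "integrable lborel u"
  shows "integrable lborel (\<lambda>x. u (a + x))" "(LINT x|lborel. u (a + x)) = integral\<^sup>L lborel u"
proof -
  have [measurable]: "u \<in> borel_measurable borel" using borel_measurable_integrable[OF assms] by simp
  have "integrable (distr lborel borel (\<lambda>x. a + x)) u" using assms by (simp add: lborel_translate)
  then show "integrable lborel (\<lambda>x. u (a + x))" by (subst (asm) integrable_distr_eq) auto
  have "integral\<^sup>L (distr lborel borel (\<lambda>x. a + x)) u = (LINT x|lborel. u (a + x))"
    by (rule integral_distr) auto
  then show "(LINT x|lborel. u (a + x)) = integral\<^sup>L lborel u" by (simp add: lborel_translate)
qed

text \<open>By the fundamental theorem of calculus, \<open>u (e\<^sub>n + x) - u x\<close> is the integral of \<open>\<partial>\<^sub>n u\<close> over the segment from \<open>x\<close> to \<open>e\<^sub>n + x\<close>. Integrate over \<open>x\<close>: the left side gives zero by translation invariance, and by Fubini's theorem the right side gives the integral of \<open>\<partial>\<^sub>n u\<close>.\<close>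
lemma integral_partial_eq_0:
  fixes u :: "real^'n::finite \<Rightarrow> complex"
  assumes diff: "\<And>x. u differentiable (at x)" and cont: "continuous_on UNIV (partial n u)"
    and u: "integrable lborel u" and u': "integrable lborel (partial n u)"
  shows "integral\<^sup>L lborel (partial n u) = 0"
proof -
  let ?e = "axis n 1 :: real^'n"
  have [measurable]: "partial n u \<in> borel_measurable borel" using borel_measurable_integrable[OF u'] by simp
  \<comment> \<open>The double integral is taken over the unit interval in \<open>t\<close>.\<close>
  define g where "g t x = indicat_real {0..1} t *\<^sub>R partial n u (t *\<^sub>R ?e + x)" for t x
  have tr: "integrable lborel (\<lambda>x. partial n u (t *\<^sub>R ?e + x))" for t
    by (rule integrable_translate[OF u'])
  have "integrable (lborel \<Otimes>\<^sub>M lborel) (\<lambda>(t, x). g t x)"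
  proof (rule lborel_pair.Fubini_integrable)
    show "(\<lambda>(t, x). g t x) \<in> borel_measurable (lborel \<Otimes>\<^sub>M lborel)" unfolding g_def by measurable
    have "(\<lambda>t. LINT x|lborel. norm (g t x)) = (\<lambda>t. indicat_real {0..1} t * (LINT x|lborel. norm (partial n u x)))"
      using integrable_translate(2)[OF integrable_norm[OF u']] by (simp add: g_def abs_mult)
    then show "integrable lborel (\<lambda>t. LINT x|lborel. norm (case (t, x) of (t, x) \<Rightarrow> g t x))"
      by (simp add: integrable_mult_left)
    show "AE t in lborel. integrable lborel (\<lambda>x. case (t, x) of (t, x) \<Rightarrow> g t x)"
      by (auto simp: g_def intro!: integrable_scaleR_right tr)
  qed
  from lborel_pair.Fubini_integral[OF this]
  have "(LINT x|lborel. LINT t|lborel. g t x) = (LINT t|lborel. LINT x|lborel. g t x)" .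
  also have "\<dots> = (LINT t::real|lborel. indicat_real {0..1} t *\<^sub>R integral\<^sup>L lborel (partial n u))"
    unfolding g_def by (simp only: integral_scaleR_right integrable_translate(2)[OF u'])
  also have "\<dots> = integral\<^sup>L lborel (partial n u)"
    by (rule trans[OF integral_scaleR_left]) (simp_all add: integrable_indicator_iff)
  also have "(\<lambda>x. LINT t|lborel. g t x) = (\<lambda>x. u (?e + x) - u x)"
  proof
    fix x
    have line: "((\<lambda>t. u (t *\<^sub>R ?e + x)) has_vector_derivative partial n u (t *\<^sub>R ?e + x)) (at t within S)" for t S
    proof -
      have "((\<lambda>t. t *\<^sub>R ?e + x) has_derivative (\<lambda>h. h *\<^sub>R ?e)) (at t within S)"
        by (auto intro!: derivative_eq_intros)
      from diff_chain_within[OF this has_derivative_at_withinI[OF frechet_derivative_works[THEN iffD1, OF diff]]]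
      have "((\<lambda>t. u (t *\<^sub>R ?e + x)) has_derivative (\<lambda>h. frechet_derivative u (at (t *\<^sub>R ?e + x)) (h *\<^sub>R ?e))) (at t within S)"
        by (simp add: o_def)
      then show ?thesis unfolding has_vector_derivative_def partial_def
        by (simp add: linear_scale[OF linear_frechet_derivative[OF diff]])
    qed
    have "(LINT t|lborel. g t x) = u (1 *\<^sub>R ?e + x) - u (0 *\<^sub>R ?e + x)"
      unfolding g_def
      by (rule integral_FTC_atLeastAtMost) (auto intro!: line continuous_on_compose2[OF cont] continuous_intros)
    then show "(LINT t|lborel. g t x) = u (?e + x) - u x" by simp
  qed
  also have "(LINT x|lborel. u (?e + x) - u x) = 0"
    using integrable_translate[OF u, of ?e] u by (subst Bochner_Integration.integral_diff) auto
  finally show ?thesis by simp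
qed

section \<open>Rapidly decreasing functions\<close>

text \<open>Decay faster than any power, without a condition on derivatives. Products with merely bounded functions stay in this class.\<close>
definition rapid :: "('a::real_normed_vector \<Rightarrow> 'b::real_normed_vector) \<Rightarrow> bool" where
  "rapid g \<longleftrightarrow> (\<forall>j::nat. \<exists>C. \<forall>x. norm x ^ j * norm (g x) \<le> C)"

lemma rapidE:
  assumes "rapid g"
  obtains C where "C \<ge> 0" "\<And>x. norm x ^ j * norm (g x) \<le> C"
proof -
  obtain C where C: "\<And>x. norm x ^ j * norm (g x) \<le> C" using assms unfolding rapid_def by blast
  have "C \<ge> 0" using C[of 0] by (rule order_trans[rotated]) simp
  then show ?thesis using that C by blast
qed

lemma schwartz_rapid: "f \<in> schwartz \<Longrightarrow> rapid f"
  unfolding rapid_def by (metis schwartz_decay)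

lemma rapid_mult_poly_bound:
  fixes f g :: "'a::real_normed_vector \<Rightarrow> complex"
  assumes "rapid g" and h: "\<And>x. cmod (h x) \<le> C * (1 + norm x) ^ d * cmod (g x)"
  shows "rapid h"
  unfolding rapid_def
proof
  fix j
  obtain A where A: "\<And>x. norm x ^ j * norm (g x) \<le> A" using rapidE[OF assms(1)] by blast
  obtain B where B: "\<And>x. norm x ^ (j + d) * norm (g x) \<le> B" using rapidE[OF assms(1)] by blast
  have "norm x ^ j * norm (h x) \<le> \<bar>C\<bar> * 2 ^ d * (A + B)" for x
  proof -
    have "norm x ^ j * norm (h x) \<le> norm x ^ j * (\<bar>C\<bar> * (1 + norm x) ^ d * norm (g x))"
      by (intro mult_left_mono order_trans[OF h] mult_right_mono) auto
    also have "(1 + norm x) ^ d \<le> 2 ^ d * (1 + norm x ^ d)"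
    proof (cases "norm x \<le> 1")
      case True
      then have "(1 + norm x) ^ d \<le> 2 ^ d" by (intro power_mono) auto
      also have "\<dots> \<le> 2 ^ d * (1 + norm x ^ d)" by simp
      finally show ?thesis .
    next
      case False
      then have "(1 + norm x) ^ d \<le> (2 * norm x) ^ d" by (intro power_mono) auto
      also have "\<dots> \<le> 2 ^ d * (1 + norm x ^ d)" by (simp add: power_mult_distrib)
      finally show ?thesis .
    qed
    then have "norm x ^ j * (\<bar>C\<bar> * (1 + norm x) ^ d * norm (g x)) \<le> norm x ^ j * (\<bar>C\<bar> * (2 ^ d * (1 + norm x ^ d)) * norm (g x))"
      by (intro mult_left_mono mult_right_mono) auto
    also have "\<dots> = \<bar>C\<bar> * 2 ^ d * (norm x ^ j * norm (g x) + norm x ^ (j + d) * norm (g x))"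
      by (simp add: algebra_simps power_add)
    also have "\<dots> \<le> \<bar>C\<bar> * 2 ^ d * (A + B)" by (intro mult_left_mono add_mono A B) auto
    finally show ?thesis .
  qed
  then show "\<exists>C. \<forall>x. norm x ^ j * norm (h x) \<le> C" by blast
qed

lemma rapid_mult_bounded:
  fixes f g :: "'a::real_normed_vector \<Rightarrow> complex"
  assumes "rapid g" "\<And>x. cmod (f x) \<le> C"
  shows "rapid (\<lambda>x. f x * g x)"
  by (rule rapid_mult_poly_bound[OF assms(1), of _ C 0])
    (use assms(2) in \<open>auto simp: norm_mult intro!: mult_right_mono\<close>)

lemma integrable_powr_rapid:
  fixes g :: "real^'n::finite \<Rightarrow> complex"
  assumes g: "rapid g" and [measurable]: "g \<in> borel_measurable borel" and a: "a > - real CARD('n)"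
  shows "integrable lborel (\<lambda>x. of_real (norm x powr a) * g x)"
proof -
  obtain A where A: "A \<ge> 0" "\<And>x. cmod (g x) \<le> A" using rapidE[OF g, of 0] by auto
  obtain j :: nat where j: "real j \<ge> a + real CARD('n) + 1" using real_arch_simple by blast
  obtain B where B: "B \<ge> 0" "\<And>x. norm x ^ j * cmod (g x) \<le> B" using rapidE[OF g, of j] by blast
  show ?thesis
  proof (rule integrable_of_powr_bounds[OF _ a, where C = "max A B"])
    fix x :: "real^'n"
    show "norm (of_real (norm x powr a) * g x) \<le> max A B * norm x powr a"
      using A(2)[of x] by (simp add: norm_mult mult.commute mult_right_mono)
    show "norm (of_real (norm x powr a) * g x) \<le> max A B * norm x powr (- real CARD('n) - 1)" if x: "norm x \<ge> 1"
    proof -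
      have x0: "norm x > 0" using x by linarith
      have "norm x powr a = norm x powr (a - real j) * norm x ^ j"
        using x0 by (simp add: powr_realpow[symmetric] powr_add[symmetric])
      then have "norm (of_real (norm x powr a) * g x) = norm x powr (a - real j) * (norm x ^ j * cmod (g x))"
        by (simp add: norm_mult norm_power)
      also have "\<dots> \<le> norm x powr (a - real j) * max A B"
        using B(2)[of x] by (intro mult_left_mono) auto
      also have "\<dots> \<le> norm x powr (- real CARD('n) - 1) * max A B"
        using A x j by (intro mult_right_mono powr_mono) auto
      finally show ?thesis by (simp add: mult.commute)
    qed
  qed measurable
qed

lemma power_exp_bound: "(t::real) \<ge> 0 \<Longrightarrow> t ^ n * exp (- t) \<le> fact n"
proof -
  assume "t \<ge> 0"
  then have "t ^ n / fact n \<le> exp t"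
  proof -
    have "(\<Sum>k\<in>{n}. t ^ k /\<^sub>R fact k) \<le> (\<Sum>k. t ^ k /\<^sub>R fact k)"
      using \<open>t \<ge> 0\<close> by (intro sum_le_suminf summable_exp_generic) auto
    then show ?thesis by (simp add: exp_def divide_inverse mult.commute)
  qed
  then show ?thesis by (simp add: exp_minus field_simps)
qed

lemma rapid_gauss:
  assumes "c > 0"
  shows "rapid (\<lambda>x::'a::real_normed_vector. complex_of_real (exp (- c * (norm x)\<^sup>2)))"
  unfolding rapid_def
proof
  fix j
  have "norm x ^ j * norm (complex_of_real (exp (- c * (norm x)\<^sup>2))) \<le> 1 + fact j / c ^ j" for x :: 'a
  proof -
    have "norm x ^ j \<le> 1 + ((norm x)\<^sup>2) ^ j"
    proof (cases "norm x \<le> 1")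
      case True
      then have "norm x ^ j \<le> 1" by (simp add: power_le_one)
      then show ?thesis by (simp add: add_increasing2)
    next
      case False
      then have "norm x ^ j \<le> norm x ^ (2 * j)" by (intro power_increasing) auto
      then show ?thesis by (simp add: power_mult)
    qed
    then have "norm x ^ j * exp (- c * (norm x)\<^sup>2) \<le> (1 + ((norm x)\<^sup>2) ^ j) * exp (- c * (norm x)\<^sup>2)"
      by (intro mult_right_mono) auto
    also have "\<dots> = exp (- c * (norm x)\<^sup>2) + (c * (norm x)\<^sup>2) ^ j * exp (- (c * (norm x)\<^sup>2)) / c ^ j"
      using assms by (simp add: power_mult_distrib algebra_simps)
    also have "\<dots> \<le> 1 + fact j / c ^ j"
      using assms power_exp_bound[of "c * (norm x)\<^sup>2" j] by (intro add_mono divide_right_mono) auto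
    finally show ?thesis by simp
  qed
  then show "\<exists>C. \<forall>x::'a. norm x ^ j * norm (complex_of_real (exp (- c * (norm x)\<^sup>2))) \<le> C" by blast
qed

lemma rapid_gauss_cpoly:
  assumes "c > 0" "cpoly p"
  shows "rapid (\<lambda>x. complex_of_real (exp (- c * (norm x)\<^sup>2)) * p x)"
proof -
  obtain C d where "\<And>x. cmod (p x) \<le> C * (1 + norm x) ^ d" using cpoly_bound[OF assms(2)] by blast
  then show ?thesis
    by (intro rapid_mult_poly_bound[OF rapid_gauss[OF assms(1)], of _ C d])
      (auto simp: norm_mult mult.commute intro!: mult_right_mono)
qed

section \<open>Gaussian test functions and the commutator \<open>[H_b, x\<^sub>n]\<close>\<close>

text \<open>The radial factor of the test functions; as a function of \<open>|x|\<^sup>2\<close> it is the Gaussian times a power.\<close>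
definition gauss_pow :: "nat \<Rightarrow> real^'n::finite \<Rightarrow> complex" where
  "gauss_pow k x = of_real (exp (- ((norm x)\<^sup>2) / 2) * ((norm x)\<^sup>2) ^ k)"

definition test_fun :: "nat \<Rightarrow> (real^'n::finite \<Rightarrow> complex) \<Rightarrow> real^'n \<Rightarrow> complex" where
  "test_fun k p x = gauss_pow k x * p x"

lemma gauss_pow_eq: "gauss_pow k x = gauss_pow 0 x * of_real ((norm x)\<^sup>2) ^ k"
  by (simp add: gauss_pow_def)

lemma gauss_pow_Suc: "gauss_pow (Suc k) x = of_real ((norm x)\<^sup>2) * gauss_pow k x"
  by (simp add: gauss_pow_def)

lemma
  fixes x :: "real^'n::finite"
  shows differentiable_gauss: "gauss_pow 0 differentiable (at x)"
    and partial_gauss: "partial n (gauss_pow 0) x = - of_real (x $ n) * gauss_pow 0 x"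
proof -
  have 1: "((\<lambda>x::real^'n. x \<bullet> x) has_derivative (\<lambda>h. x \<bullet> h + h \<bullet> x)) (at x)"
    by (rule has_derivative_inner[OF has_derivative_ident has_derivative_ident])
  have "((\<lambda>u. exp (- u / 2)) has_field_derivative - exp (- (x \<bullet> x) / 2) / 2) (at (x \<bullet> x))"
    by (auto intro!: derivative_eq_intros)
  from has_derivative_of_real[OF DERIV_compose_FDERIV[OF this 1]]
  have "((\<lambda>x::real^'n. complex_of_real (exp (- (x \<bullet> x) / 2))) has_derivative
      (\<lambda>h. of_real ((x \<bullet> h + h \<bullet> x) * (- exp (- (x \<bullet> x) / 2) / 2)))) (at x)" .
  moreover have "(x \<bullet> h + h \<bullet> x) * (- exp (- (x \<bullet> x) / 2) / 2) = - (x \<bullet> h) * exp (- (x \<bullet> x) / 2)" for h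
    by (simp add: inner_commute[of h x])
  ultimately have "((\<lambda>x::real^'n. complex_of_real (exp (- (x \<bullet> x) / 2))) has_derivative
      (\<lambda>h. of_real (- (x \<bullet> h) * exp (- (x \<bullet> x) / 2)))) (at x)" by (simp only:)
  moreover have "gauss_pow 0 = (\<lambda>x::real^'n. complex_of_real (exp (- (x \<bullet> x) / 2)))"
    by (simp add: gauss_pow_def fun_eq_iff power2_norm_eq_inner)
  ultimately have D: "(gauss_pow 0 has_derivative (\<lambda>h. of_real (- (x \<bullet> h) * exp (- (x \<bullet> x) / 2)))) (at x)" by simp
  then show "gauss_pow 0 differentiable (at x)" unfolding differentiable_def by blast
  show "partial n (gauss_pow 0) x = - of_real (x $ n) * gauss_pow 0 x"
    unfolding partial_eqI[OF D] by (simp add: inner_axis gauss_pow_def power2_norm_eq_inner)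
qed

lemma partial_gauss_mult:
  assumes "cpoly q"
  shows "partial n (\<lambda>x. gauss_pow 0 x * q x) = (\<lambda>x. gauss_pow 0 x * (partial n q x - of_real (x $ n) * q x))"
  unfolding partial_mult[OF differentiable_gauss cpoly_differentiable[OF assms], abs_def] partial_gauss
  by (rule ext) (simp add: algebra_simps)

lemma cpoly_test_fun: "cpoly p \<Longrightarrow> cpoly (\<lambda>x. of_real ((norm x)\<^sup>2) ^ k * p x)"
  by (intro cpoly.mult cpoly_power cpoly_norm_sq)

lemma test_fun_eq: "test_fun k p = (\<lambda>x. gauss_pow 0 x * (of_real ((norm x)\<^sup>2) ^ k * p x))"
  by (rule ext) (simp only: test_fun_def gauss_pow_eq[of k] mult.assoc)

lemma differentiable_gauss_mult: "cpoly q \<Longrightarrow> (\<lambda>x. gauss_pow 0 x * q x) differentiable (at x)"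
  by (intro differentiable_mult_complex differentiable_gauss cpoly_differentiable)

lemma differentiable_gauss_pow: "gauss_pow k differentiable (at (x::real^'n::finite))"
proof -
  have eq: "gauss_pow k = (\<lambda>x::real^'n. gauss_pow 0 x * of_real ((norm x)\<^sup>2) ^ k)" by (rule ext) (rule gauss_pow_eq)
  show ?thesis by (subst eq) (intro differentiable_gauss_mult cpoly_power cpoly_norm_sq)
qed

lemma differentiable_test_fun: "cpoly p \<Longrightarrow> test_fun k p differentiable (at x)"
  unfolding test_fun_eq by (intro differentiable_gauss_mult cpoly_test_fun)

lemma differentiable_partial_test_fun:
  assumes "cpoly p" shows "partial n (test_fun k p) differentiable (at x)"
  unfolding test_fun_eq partial_gauss_mult[OF cpoly_test_fun[OF assms]]
  by (intro differentiable_gauss_mult cpoly_diff cpoly_partial cpoly_test_fun assms cpoly.intros)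

lemma gauss_eq: "gauss_pow 0 x = complex_of_real (exp (- (1 / 2) * (norm x)\<^sup>2))"
proof -
  have "- (1 / 2) * t = - t / 2" for t :: real by simp
  then show ?thesis unfolding gauss_pow_def by (simp only: power_0 mult_1_right)
qed

lemma rapid_gauss_mult:
  fixes q :: "real^'n::finite \<Rightarrow> complex"
  assumes "cpoly q"
  shows "rapid (\<lambda>x. gauss_pow 0 x * q x)"
  unfolding gauss_eq by (rule rapid_gauss_cpoly[OF _ assms]) simp

lemma continuous_gauss: "continuous_on A (gauss_pow 0)"
  by (intro continuous_at_imp_continuous_on ballI differentiable_imp_continuous_within differentiable_gauss)

lemma W_alg_zero: "(\<lambda>x. 0) \<in> W_alg b"
  unfolding W_alg_def by (intro CollectI exI[of _ "0::nat"]) auto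

lemma sum_lessThan_add: "(\<Sum>i<K + L. g i) = (\<Sum>i<K. g i) + (\<Sum>i<L. g (K + i))" for g :: "nat \<Rightarrow> complex"
  by (induction L) (auto simp: add.assoc)

lemma W_algI:
  fixes K :: nat
  assumes "\<And>i. i < K \<Longrightarrow> p i \<in> harmonic_poly (m i)"
  shows "(\<lambda>x. \<Sum>i<K. c i * Phi b (l i) (m i) (p i) x) \<in> W_alg b"
  unfolding W_alg_def mem_Collect_eq
  by (rule exI[of _ K], rule exI[of _ c], rule exI[of _ l], rule exI[of _ m], rule exI[of _ p]) (use assms in blast)

lemma W_algE:
  assumes "f \<in> W_alg b"
  obtains K :: nat and c l m p where "\<forall>i<K. p i \<in> harmonic_poly (m i)"
    "f = (\<lambda>x. \<Sum>i<K. c i * Phi b (l i) (m i) (p i) x)"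
  using assms unfolding W_alg_def mem_Collect_eq by (elim exE conjE) (rule that, assumption+)

lemma W_alg_add:
  assumes "f \<in> W_alg b" "g \<in> W_alg b"
  shows "(\<lambda>x. f x + g x) \<in> W_alg b"
proof -
  obtain K :: nat and c l m p where 1: "\<forall>i<K. p i \<in> harmonic_poly (m i)"
    "f = (\<lambda>x. \<Sum>i<K. c i * Phi b (l i) (m i) (p i) x)"
    by (rule W_algE[OF assms(1)]) (rule that, assumption+)
  obtain K' :: nat and c' l' m' p' where 2: "\<forall>i<K'. p' i \<in> harmonic_poly (m' i)"
    "g = (\<lambda>x. \<Sum>i<K'. c' i * Phi b (l' i) (m' i) (p' i) x)"
    by (rule W_algE[OF assms(2)]) (rule that, assumption+)
  let ?j = "\<lambda>u u' i. if i < K then u i else u' (i - K)"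
  have "(\<lambda>x. f x + g x) = (\<lambda>x. \<Sum>i<K + K'. ?j c c' i * Phi b (?j l l' i) (?j m m' i) (?j p p' i) x)"
    unfolding 1 2 sum_lessThan_add by auto
  moreover have "?j p p' i \<in> harmonic_poly (?j m m' i)" if "i < K + K'" for i using 1 2 that by auto
  ultimately show ?thesis by (simp only: W_algI[of "K + K'" "?j p p'" "?j m m'"])
qed

lemma W_alg_cmult:
  assumes "f \<in> W_alg b"
  shows "(\<lambda>x. a * f x) \<in> W_alg b"
proof -
  obtain K :: nat and c l m p where 1: "\<forall>i<K. p i \<in> harmonic_poly (m i)"
    "f = (\<lambda>x. \<Sum>i<K. c i * Phi b (l i) (m i) (p i) x)"
    by (rule W_algE[OF assms(1)]) (rule that, assumption+)
  then have "(\<lambda>x. a * f x) = (\<lambda>x. \<Sum>i<K. (a * c i) * Phi b (l i) (m i) (p i) x)"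
    by (simp add: sum_distrib_left mult.assoc)
  then show ?thesis using 1(1) by (simp only: W_algI)
qed

lemma W_alg_sum: "(\<And>i. i \<in> I \<Longrightarrow> f i \<in> W_alg b) \<Longrightarrow> (\<lambda>x. \<Sum>i\<in>I. f i x) \<in> W_alg b"
  by (induction I rule: infinite_finite_induct) (auto intro: W_alg_zero W_alg_add)

lemma Phi_W_alg: "p \<in> harmonic_poly m \<Longrightarrow> Phi b l m p \<in> W_alg b"
  using W_algI[of 1 "\<lambda>_. p" "\<lambda>_. m" "\<lambda>_. 1" b "\<lambda>_. l"] by simp

text \<open>The Laguerre polynomial of degree \<open>l\<close> is a combination of the monomials of degree at most \<open>l\<close> with leading coefficient \<open>(-1)\<^sup>l / l!\<close>. Hence the monomials can be recovered from the Laguerre polynomials by induction on the degree.\<close>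
lemma test_fun_W_alg:
  fixes p :: "real^'n::finite \<Rightarrow> complex"
  assumes b: "b > - real CARD('n) / 2" and p: "p \<in> harmonic_poly m"
  shows "test_fun k p \<in> W_alg b"
proof (induction k rule: less_induct)
  case (less l)
  define \<nu> where "\<nu> = b + lam CARD('n) m"
  \<comment> \<open>The coefficients of the Laguerre polynomial; the leading one is nonzero because the Gamma function has no zero.\<close>
  define a where "a k = (-1) ^ k * Gamma (\<nu> + real l + 1) / (Gamma (\<nu> + real k + 1) * fact (l - k) * fact k)" for k
  have "\<nu> + real l + 1 > 0" using b by (simp add: \<nu>_def lam_def field_simps)
  then have G: "Gamma (\<nu> + real l + 1) \<noteq> 0" by (metis Gamma_real_pos less_irrefl)
  have L: "Laguerre l \<nu> t = (\<Sum>k\<le>l. a k * t ^ k)" for t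
    unfolding Laguerre_def a_def by (intro sum.cong) auto
  have al: "a l = (-1) ^ l / fact l" using G by (simp add: a_def)
  have Phi: "Phi b l m p x = (\<Sum>k<l. of_real (a k) * test_fun k p x) + of_real (a l) * test_fun l p x" for x
  proof -
    have "Phi b l m p x = (\<Sum>k\<le>l. of_real (a k) * test_fun k p x)"
      unfolding Phi_def \<nu>_def[symmetric] L test_fun_def gauss_pow_def of_real_mult of_real_sum sum_distrib_left sum_distrib_right
      by (intro sum.cong refl) (simp only: mult_ac)
    then show ?thesis unfolding lessThan_Suc_atMost[symmetric] sum.lessThan_Suc .
  qed
  have eq: "test_fun l p x = of_real (inverse (a l)) * Phi b l m p x + (-1) * (of_real (inverse (a l)) * (\<Sum>k<l. of_real (a k) * test_fun k p x))" for x
    unfolding Phi by (simp add: al field_simps)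
  have "(\<lambda>x. of_real (inverse (a l)) * Phi b l m p x + (-1) * (of_real (inverse (a l)) * (\<Sum>k<l. of_real (a k) * test_fun k p x))) \<in> W_alg b"
    by (intro W_alg_add W_alg_cmult W_alg_sum Phi_W_alg[OF p] less) auto
  moreover have "test_fun l p = (\<lambda>x. of_real (inverse (a l)) * Phi b l m p x + (-1) * (of_real (inverse (a l)) * (\<Sum>k<l. of_real (a k) * test_fun k p x)))"
    by (rule ext) (rule eq)
  ultimately show ?case by (rule ssubst[rotated])
qed

lemma mult_coord_test_fun:
  "mult_coord n (test_fun k p) x = test_fun k (\<lambda>x. of_real (x $ n) * p x - of_real ((norm x)\<^sup>2) * lowering n m p x) x + test_fun (Suc k) (lowering n m p) x"
  by (simp add: mult_coord_def test_fun_def gauss_pow_Suc algebra_simps)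

lemma mult_coord_test_fun_W_alg:
  fixes p :: "real^'n::finite \<Rightarrow> complex"
  assumes b: "b > - real CARD('n) / 2" and p: "p \<in> harmonic_poly m"
  shows "mult_coord n (test_fun k p) \<in> W_alg b"
proof -
  have "mult_coord n (test_fun k p) = (\<lambda>x. test_fun k (\<lambda>x. of_real (x $ n) * p x - of_real ((norm x)\<^sup>2) * lowering n m p x) x + test_fun (Suc k) (lowering n m p) x)"
    by (rule ext) (rule mult_coord_test_fun)
  then show ?thesis
    using W_alg_add[OF test_fun_W_alg[OF b raising_harmonic[OF p]] test_fun_W_alg[OF b lowering_harmonic[OF p]]] by (simp only:)
qed

text \<open>The test function has the form \<open>F(|x|\<^sup>2) p(x)\<close> with \<open>F u = exp(-u/2) u\<^sup>k\<close>, to which the defining property of \<open>R\<close> applies.\<close>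
lemma radial_Euler_test_fun:
  fixes p :: "real^'n::finite \<Rightarrow> complex"
  assumes b: "b > - real CARD('n) / 2" and R: "is_radial_Euler b R" and p: "p \<in> harmonic_poly m"
  shows "R (test_fun k p) x = Euler (gauss_pow k) x * p x"
proof -
  define F where "F u = complex_of_real (exp (- u / 2) * u ^ k)" for u :: real
  have "((\<lambda>u. complex_of_real (exp (- u / 2) * u ^ k)) has_vector_derivative of_real (exp (- u / 2) * (real k * u ^ (k - 1)) + exp (- u / 2) * (- 1 / 2) * u ^ k)) (at u)" for u :: real
    by (intro has_vector_derivative_of_real) (auto intro!: derivative_eq_intros)
  then have "F differentiable (at u)" for u
    unfolding F_def has_vector_derivative_def differentiable_def by blast
  moreover have F: "(\<lambda>x::real^'n. F ((norm x)\<^sup>2)) = gauss_pow k" by (rule ext) (simp add: F_def gauss_pow_def)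
  have T: "(\<lambda>x::real^'n. F ((norm x)\<^sup>2) * p x) = test_fun k p" unfolding F[unfolded fun_eq_iff, rule_format] test_fun_def[abs_def] by (rule refl)
  ultimately have "(\<forall>u. F differentiable (at u))" "(\<lambda>x. F ((norm x)\<^sup>2) * p x) \<in> W_alg b"
    using test_fun_W_alg[OF b p, of k] unfolding T by blast+
  then have "R (\<lambda>x. F ((norm x)\<^sup>2) * p x) = (\<lambda>x. Euler (\<lambda>y. F ((norm y)\<^sup>2)) x * p x)"
    using R p unfolding is_radial_Euler_def by blast
  then have "R (test_fun k p) = (\<lambda>x. Euler (\<lambda>y. F ((norm y)\<^sup>2)) x * p x)" unfolding T .
  then show ?thesis by (simp add: F)
qed

text \<open>The Euler operator is a derivation, and \<open>|x|\<^sup>2\<close> is homogeneous of degree \<open>2\<close>.\<close>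
lemma Euler_gauss_pow_Suc: "Euler (gauss_pow (Suc k)) (x::real^'n::finite) = 2 * of_real ((norm x)\<^sup>2) * gauss_pow k x + of_real ((norm x)\<^sup>2) * Euler (gauss_pow k) x"
proof -
  have "gauss_pow (Suc k) = (\<lambda>x::real^'n. of_real ((norm x)\<^sup>2) * gauss_pow k x)" by (rule ext) (rule gauss_pow_Suc)
  note gpS = this
  have "partial j (gauss_pow (Suc k)) x = 2 * of_real (x $ j) * gauss_pow k x + of_real ((norm x)\<^sup>2) * partial j (gauss_pow k) x" for j
    unfolding gpS partial_mult[OF cpoly_differentiable[OF cpoly_norm_sq] differentiable_gauss_pow] partial_norm_sq ..
  then have "Euler (gauss_pow (Suc k)) x = (\<Sum>j\<in>UNIV. 2 * (of_real (x $ j) * of_real (x $ j)) * gauss_pow k x) + of_real ((norm x)\<^sup>2) * Euler (gauss_pow k) x"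
    unfolding Euler_def by (simp add: sum.distrib sum_distrib_left algebra_simps)
  also have "(\<Sum>j\<in>UNIV. 2 * (of_real (x $ j) * of_real (x $ j)) * gauss_pow k x) = 2 * (\<Sum>j\<in>UNIV. of_real (x $ j) * of_real (x $ j)) * gauss_pow k x"
    by (simp add: sum_distrib_left sum_distrib_right)
  also have "(\<Sum>j\<in>UNIV. of_real (x $ j) * of_real (x $ j)) = complex_of_real ((norm x)\<^sup>2)"
    unfolding power2_norm_eq_inner by (simp add: inner_vec_def)
  finally show ?thesis .
qed

text \<open>The operator \<open>R\<close> differentiates the radial factor only, hence it does not see the factor \<open>x\<^sub>n\<close> itself, but it does see the factor \<open>|x|\<^sup>2\<close> that splits off in \<open>x\<^sub>n p = q\<^sub>+ + |x|\<^sup>2 q\<^sub>-\<close>. Its Euler derivative \<open>2 |x|\<^sup>2\<close> is the source of the last term.\<close>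
lemma radial_Euler_mult_coord_test_fun:
  fixes p :: "real^'n::finite \<Rightarrow> complex"
  assumes b: "b > - real CARD('n) / 2" and R: "is_radial_Euler b R" and p: "p \<in> harmonic_poly m"
  shows "R (mult_coord n (test_fun k p)) x = of_real (x $ n) * R (test_fun k p) x + 2 * of_real ((norm x)\<^sup>2) * gauss_pow k x * lowering n m p x"
proof -
  define q1 where "q1 = (\<lambda>x. of_real (x $ n) * p x - of_real ((norm x)\<^sup>2) * lowering n m p x)"
  define q2 where "q2 = lowering n m p"
  have q: "q1 \<in> harmonic_poly (Suc m)" "q2 \<in> harmonic_poly (m - 1)"
    unfolding q1_def q2_def by (rule raising_harmonic[OF p], rule lowering_harmonic[OF p])
  have "mult_coord n (test_fun k p) = (\<lambda>x. 1 * test_fun k q1 x + 1 * test_fun (Suc k) q2 x)"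
    unfolding q1_def q2_def by (rule ext) (simp only: mult_1 mult_coord_test_fun[of n k p _ m])
  then have "R (mult_coord n (test_fun k p)) x = 1 * R (test_fun k q1) x + 1 * R (test_fun (Suc k) q2) x"
    using R[unfolded is_radial_Euler_def, THEN conjunct1, rule_format,
      OF test_fun_W_alg[OF b q(1), of k] test_fun_W_alg[OF b q(2), of "Suc k"], of 1 1] by (simp only:)
  also have "\<dots> = Euler (gauss_pow k) x * (q1 x + of_real ((norm x)\<^sup>2) * q2 x) + 2 * of_real ((norm x)\<^sup>2) * gauss_pow k x * q2 x"
    by (simp add: radial_Euler_test_fun[OF b R q(1)] radial_Euler_test_fun[OF b R q(2)] Euler_gauss_pow_Suc algebra_simps)
  also have "q1 x + of_real ((norm x)\<^sup>2) * q2 x = of_real (x $ n) * p x" by (simp add: q1_def q2_def)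
  finally show ?thesis by (simp add: radial_Euler_test_fun[OF b R p] q2_def)
qed

lemma Laplacian_mult_coord:
  assumes "\<And>x. w differentiable (at x)" "\<And>k x. partial k w differentiable (at x)"
  shows "Laplacian (mult_coord n w) x = of_real (x $ n) * Laplacian w x + 2 * partial n w x"
proof -
  have 1: "partial k (mult_coord n w) = (\<lambda>x. (if k = n then 1 else 0) * w x + of_real (x $ n) * partial k w x)" for k
    unfolding mult_coord_def[abs_def] by (rule ext) (simp add: partial_mult assms)
  have "partial k (partial k (mult_coord n w)) x = 2 * ((if k = n then 1 else 0) * partial k w x) + of_real (x $ n) * partial k (partial k w) x" for k
    unfolding 1 by (simp add: partial_add partial_mult partial_cmult differentiable_mult_complex assms)
  then show ?thesis unfolding Laplacian_def
    by (simp add: sum.distrib sum_distrib_left[symmetric] if_distrib[of "\<lambda>t. t * _"] cong: if_cong)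
qed

text \<open>The Laplacian contributes \<open>2 \<partial>\<^sub>n w\<close>, and in the contribution of \<open>R\<close> the factor \<open>|x|\<^sup>2\<close> cancels against \<open>2 b / |x|\<^sup>2\<close>.\<close>
lemma H_alg_commutator:
  fixes p :: "real^'n::finite \<Rightarrow> complex"
  assumes b: "b > - real CARD('n) / 2" and R: "is_radial_Euler b R" and p: "p \<in> harmonic_poly m" and x: "x \<noteq> 0"
  shows "H_alg b R (mult_coord n (test_fun k p)) x =
    of_real (x $ n) * H_alg b R (test_fun k p) x + 2 * (partial n (test_fun k p) x + 2 * of_real b * (gauss_pow k x * lowering n m p x))"
proof -
  have cp: "cpoly p" using p by (simp add: harmonic_poly_iff)
  define c where "c = complex_of_real (2 * b / (norm x)\<^sup>2)"
  have "c * of_real ((norm x)\<^sup>2) = of_real (2 * b / (norm x)\<^sup>2 * (norm x)\<^sup>2)"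
    unfolding c_def by (rule of_real_mult[symmetric])
  also have "2 * b / (norm x)\<^sup>2 * (norm x)\<^sup>2 = 2 * b" using x by simp
  finally have c: "c * (2 * of_real ((norm x)\<^sup>2) * gauss_pow k x * lowering n m p x) = 4 * of_real b * (gauss_pow k x * lowering n m p x)"
    by (simp add: mult_ac)
  have "H_alg b R (mult_coord n (test_fun k p)) x = of_real (x $ n) * Laplacian (test_fun k p) x + 2 * partial n (test_fun k p) x
    + c * (of_real (x $ n) * R (test_fun k p) x + 2 * of_real ((norm x)\<^sup>2) * gauss_pow k x * lowering n m p x)"
    unfolding H_alg_def c_def[symmetric] radial_Euler_mult_coord_test_fun[OF b R p]
    by (subst Laplacian_mult_coord) (simp_all add: differentiable_test_fun differentiable_partial_test_fun cp)
  then show ?thesis unfolding distrib_left c H_alg_def c_def[symmetric] by (simp add: mult_ac)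
qed

section \<open>The operator \<open>H_b\<close> on Schwartz functions\<close>

lemma sets_weighted [simp, measurable_cong]: "sets (weighted b) = sets borel"
  by (simp add: weighted_def)

lemma measurable_weighted [simp]: "borel_measurable (weighted b) = borel_measurable borel"
  by (rule measurable_cong_sets) simp_all

lemma AE_weighted: "(AE x in weighted b. P x) \<longleftrightarrow> (AE x in lborel. P (x :: real^'n::finite))"
proof -
  have "(AE x in weighted b. P x) \<longleftrightarrow> (AE x in lborel. 0 < ennreal (norm x powr (2 * b)) \<longrightarrow> P (x :: real^'n))"
    unfolding weighted_def by (rule AE_density) measurable
  also have "\<dots> \<longleftrightarrow> (AE x in lborel. P (x :: real^'n))"
  proof
    assume "AE x in lborel. 0 < ennreal (norm x powr (2 * b)) \<longrightarrow> P (x :: real^'n)"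
    then show "AE x in lborel. P (x :: real^'n)"
      using AE_lborel_singleton[of "0 :: real^'n"] by eventually_elim simp
  qed auto
  finally show ?thesis .
qed

text \<open>Nonempty open sets are not null sets.\<close>
lemma continuous_AE_zero:
  fixes f :: "real^'n::finite \<Rightarrow> complex"
  assumes "continuous_on UNIV f" "AE x in lborel. f x = 0"
  shows "f x = 0"
proof (rule ccontr)
  assume "f x \<noteq> 0"
  let ?S = "{x. f x \<noteq> 0}"
  have "open ?S" using assms(1) by (intro open_Collect_neq continuous_on_const)
  moreover have "?S \<noteq> {}" using \<open>f x \<noteq> 0\<close> by blast
  moreover have "?S \<in> null_sets lborel"
  proof (rule AE_iff_null_sets[THEN iffD2])
    show "?S \<in> sets lborel" using \<open>open ?S\<close> by simp
    show "AE x in lborel. x \<notin> ?S" using assms(2) by simp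
  qed
  then have "negligible ?S"
    by (simp add: negligible_iff_null_sets null_sets_completionI)
  ultimately show False using open_not_negligible by blast
qed

lemma integral_weighted:
  fixes g :: "real^'n::finite \<Rightarrow> complex"
  assumes [measurable]: "g \<in> borel_measurable borel"
  shows "integral\<^sup>L (weighted b) g = (LINT x|lborel. of_real (norm x powr (2 * b)) * g x)"
    and "integrable (weighted b) g \<longleftrightarrow> integrable lborel (\<lambda>x. of_real (norm x powr (2 * b)) * g x)"
  unfolding weighted_def
  by (simp_all add: integral_density integrable_density scaleR_conv_of_real)

lemma rapid_L2:
  fixes g :: "real^'n::finite \<Rightarrow> complex"
  assumes b: "b > - real CARD('n) / 2" and g: "rapid g" and [measurable]: "g \<in> borel_measurable borel"
  shows "g \<in> L2 (weighted b)"
proof (rule L2_I)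
  obtain A where A: "\<And>x. cmod (g x) \<le> A" using rapidE[OF g, of 0] by auto
  have "rapid (\<lambda>x. of_real (cmod (g x)) * g x)"
    using A by (intro rapid_mult_bounded[OF g, of _ A]) simp
  moreover have "norm (of_real (cmod (g x)) * g x) = norm (complex_of_real ((cmod (g x))\<^sup>2))" for x
    by (simp add: norm_mult power2_eq_square)
  ultimately have "rapid (\<lambda>x. complex_of_real ((cmod (g x))\<^sup>2))"
    unfolding rapid_def by simp
  then have "integrable lborel (\<lambda>x. of_real (norm x powr (2 * b)) * complex_of_real ((cmod (g x))\<^sup>2))"
    using b by (intro integrable_powr_rapid) auto
  then have "integrable (weighted b) (\<lambda>x. complex_of_real ((cmod (g x))\<^sup>2))"
    by (subst integral_weighted(2)) auto
  from integrable_Re[OF this] show "integrable (weighted b) (\<lambda>x. (cmod (g x))\<^sup>2)" by simp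
qed simp

lemma schwartz_measurable: "f \<in> schwartz \<Longrightarrow> f \<in> borel_measurable borel"
  by (intro borel_measurable_continuous_onI schwartz_continuous)

lemma schwartz_L2:
  fixes f :: "real^'n::finite \<Rightarrow> complex"
  assumes "b > - real CARD('n) / 2" "f \<in> schwartz"
  shows "f \<in> L2 (weighted b)"
  by (intro rapid_L2 assms schwartz_rapid schwartz_measurable)

abbreviation lower_nilpotent :: "real^2^2" where
  "lower_nilpotent \<equiv> mat22 0 0 1 0"

lemma lower_nilpotent_square: "lower_nilpotent ** lower_nilpotent = 0"
  by (simp add: vec_eq_iff matrix_matrix_mult_def mat22_def forall_2 sum_2)

lemma lower_nilpotent_sl2: "lower_nilpotent \<in> sl2"
  by (simp add: sl2_def trace_def mat22_def sum_2)

context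
  fixes b :: real and G :: "('g::topological_space) monoid" and \<pi> :: "'g \<Rightarrow> real^2^2"
    and R :: "(real^'n::finite \<Rightarrow> complex) \<Rightarrow> real^'n \<Rightarrow> complex"
    and \<Omega> :: "'g \<Rightarrow> (real^'n \<Rightarrow> complex) \<Rightarrow> real^'n \<Rightarrow> complex"
  assumes b: "b > - real CARD('n) / 2"
    and G: "is_universal_cover_SL2 G \<pi>"
    and R: "is_radial_Euler b R"
    and Omega: "is_Omega G \<pi> b R \<Omega>"
    and smooth: "smooth_vectors_are_schwartz G \<pi> b \<Omega>"
begin

lemma unitary: "is_unitary_rep G (weighted b) \<Omega>"
  using Omega unfolding is_Omega_def by blast

text \<open>The space of smooth vectors is invariant under the differentials, so the differential of \<open>f\<close> is again a Schwartz function up to a null set; it is unique by \<open>has_differential_unique\<close> and continuity. Thus the definite description in \<open>H_op\<close> denotes.\<close>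
lemma H_op_spec:
  assumes f: "f \<in> schwartz"
  shows "H_op G \<pi> b \<Omega> f \<in> schwartz"
    and "has_differential G \<pi> (weighted b) \<Omega> lower_nilpotent f (\<lambda>x. \<i> / 2 * H_op G \<pi> b \<Omega> f x)"
proof -
  let ?P = "\<lambda>g. g \<in> schwartz \<and> has_differential G \<pi> (weighted b) \<Omega> lower_nilpotent f (\<lambda>x. \<i> / 2 * g x)"
  have "f \<in> smooth_vectors G \<pi> (weighted b) \<Omega>"
    using smooth schwartz_L2[OF b f] f unfolding smooth_vectors_are_schwartz_def by auto
  then obtain V where V: "f \<in> V" "V \<subseteq> L2 (weighted b)"
    "\<forall>f\<in>V. \<forall>X\<in>sl2. \<exists>h\<in>V. has_differential G \<pi> (weighted b) \<Omega> X f h"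
    unfolding smooth_vectors_def by blast
  then obtain h where h: "h \<in> V" "has_differential G \<pi> (weighted b) \<Omega> lower_nilpotent f h"
    using lower_nilpotent_sl2 by blast
  have "h \<in> smooth_vectors G \<pi> (weighted b) \<Omega>" using V h(1) unfolding smooth_vectors_def by blast
  then obtain g0 where g0: "g0 \<in> schwartz" "AE x in weighted b. h x = g0 x"
    using smooth unfolding smooth_vectors_are_schwartz_def by auto
  have "has_differential G \<pi> (weighted b) \<Omega> lower_nilpotent f g0"
    by (rule has_differential_cong_AE[OF unitary h(2)]) (use g0 schwartz_measurable in auto)
  moreover have "(\<lambda>x. \<i> / 2 * ((- 2 * \<i>) * g0 x)) = g0" by (rule ext) simp
  ultimately have "?P (\<lambda>x. (- 2 * \<i>) * g0 x)"
    using schwartz_cmult[OF g0(1), of "- 2 * \<i>"] by (simp only: simp_thms)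
  moreover have "g = g'" if "?P g" "?P g'" for g g'
  proof
    fix x
    have "AE x in weighted b. \<i> / 2 * g x = \<i> / 2 * g' x"
      using has_differential_unique[OF G unitary lower_nilpotent_square] that by blast
    then have "AE x in lborel. g x - g' x = 0" by (simp add: AE_weighted)
    moreover have "continuous_on UNIV (\<lambda>x. g x - g' x)"
      using that by (intro continuous_intros schwartz_continuous) auto
    ultimately show "g x = g' x" using continuous_AE_zero[of "\<lambda>x. g x - g' x" x] by simp
  qed
  ultimately have "\<exists>!g. ?P g" by blast
  from theI'[OF this] show "H_op G \<pi> b \<Omega> f \<in> schwartz"
    and "has_differential G \<pi> (weighted b) \<Omega> lower_nilpotent f (\<lambda>x. \<i> / 2 * H_op G \<pi> b \<Omega> f x)"
    unfolding H_op_def by blast+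
qed

text \<open>Skew-adjointness of \<open>(i/2) H_b\<close>; the factor \<open>i/2\<close> is itself skew, hence \<open>H_b\<close> is symmetric.\<close>
lemma H_op_adjoint:
  assumes f: "f \<in> schwartz" and w: "w \<in> W_alg b"
  shows "L2_inner (weighted b) (H_op G \<pi> b \<Omega> f) w = L2_inner (weighted b) f (H_alg b R w)"
proof -
  have "has_differential G \<pi> (weighted b) \<Omega> lower_nilpotent w (\<lambda>x. \<i> / 2 * H_alg b R w x)"
    using Omega w unfolding is_Omega_def by blast
  from has_differential_skew_adjoint[OF G unitary lower_nilpotent_square H_op_spec(2)[OF f] this]
  have "\<i> / 2 * L2_inner (weighted b) (H_op G \<pi> b \<Omega> f) w = \<i> / 2 * L2_inner (weighted b) f (H_alg b R w)"
    unfolding L2_inner_cmult_left L2_inner_cmult_right by simp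
  then show ?thesis by simp
qed

lemma D_op_eq: "D_op G \<pi> b \<Omega> n f = (\<lambda>x. (1 / 2) * (H_op G \<pi> b \<Omega> (mult_coord n f) x - mult_coord n (H_op G \<pi> b \<Omega> f) x))"
  by (rule ext) (simp add: D_op_def half_H_minus_def mult_coord_def field_simps)

lemma D_op_schwartz:
  assumes f: "f \<in> schwartz"
  shows "D_op G \<pi> b \<Omega> n f \<in> schwartz"
  unfolding D_op_eq by (intro schwartz_cmult schwartz_diff schwartz_mult_coord H_op_spec f)

lemma L2_H_alg:
  assumes "w \<in> W_alg b"
  shows "H_alg b R w \<in> L2 (weighted b)" "w \<in> L2 (weighted b)"
proof -
  have d: "has_differential G \<pi> (weighted b) \<Omega> lower_nilpotent w (\<lambda>x. \<i> / 2 * H_alg b R w x)"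
    using Omega assms unfolding is_Omega_def by blast
  then have "(\<lambda>x. \<i> / 2 * H_alg b R w x) \<in> L2 (weighted b)"
    unfolding has_differential_def by blast
  from L2_cmult[OF this, of "- 2 * \<i>"] show "H_alg b R w \<in> L2 (weighted b)" by (simp add: mult.assoc[symmetric])
  show "w \<in> L2 (weighted b)" using d unfolding has_differential_def by blast
qed

text \<open>Both \<open>H_b\<close> and the multiplication by \<open>x\<^sub>n\<close> are symmetric, so their commutator is skew-symmetric. On the right it acts on a function of \<open>W_alg b\<close>, where \<open>H_alg_commutator\<close> evaluates it. The term \<open>|x|\<^sup>2\<close> in \<open>half_H_minus\<close> commutes with \<open>x\<^sub>n\<close> and drops out.\<close>
lemma D_op_pairing:
  assumes f: "f \<in> schwartz" and p: "p \<in> harmonic_poly m"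
  shows "L2_inner (weighted b) (D_op G \<pi> b \<Omega> n f) (test_fun k p) =
    - L2_inner (weighted b) f (\<lambda>x. partial n (test_fun k p) x + 2 * of_real b * (gauss_pow k x * lowering n m p x))"
proof -
  let ?w = "test_fun k p" and ?H = "H_op G \<pi> b \<Omega>" and ?M = "weighted b :: (real^'n) measure"
  have w: "?w \<in> W_alg b" "mult_coord n ?w \<in> W_alg b"
    by (rule test_fun_W_alg[OF b p], rule mult_coord_test_fun_W_alg[OF b p])
  have S: "mult_coord n f \<in> schwartz" "?H f \<in> schwartz" "?H (mult_coord n f) \<in> schwartz"
    "mult_coord n (?H f) \<in> schwartz"
    by (intro schwartz_mult_coord f H_op_spec)+
  note L = S[THEN schwartz_L2[OF b]] schwartz_L2[OF b f] L2_H_alg[OF w(1)] L2_H_alg[OF w(2)]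
  have "L2_inner ?M (D_op G \<pi> b \<Omega> n f) ?w = 1 / 2 * (L2_inner ?M (?H (mult_coord n f)) ?w - L2_inner ?M (mult_coord n (?H f)) ?w)"
    unfolding D_op_eq L2_inner_cmult_left by (simp add: L2_inner_diff_left L)
  also have "L2_inner ?M (mult_coord n (?H f)) ?w = L2_inner ?M (?H f) (mult_coord n ?w)"
    unfolding L2_inner_def by (simp add: mult_coord_def mult_ac)
  also have "L2_inner ?M (?H (mult_coord n f)) ?w - L2_inner ?M (?H f) (mult_coord n ?w) =
     L2_inner ?M (mult_coord n f) (H_alg b R ?w) - L2_inner ?M f (H_alg b R (mult_coord n ?w))"
    by (simp only: H_op_adjoint[OF S(1) w(1)] H_op_adjoint[OF f w(2)])
  also have "\<dots> = (LINT x|?M. mult_coord n f x * cnj (H_alg b R ?w x) - f x * cnj (H_alg b R (mult_coord n ?w) x))"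
    unfolding L2_inner_def by (intro Bochner_Integration.integral_diff[symmetric] integrable_L2_inner L)
  also have "\<dots> = (LINT x|?M. - 2 * (f x * cnj (partial n ?w x + 2 * of_real b * (gauss_pow k x * lowering n m p x))))"
  proof (rule integral_cong_AE)
    note [measurable] = L[THEN L2_measurable]
    show "(\<lambda>x. mult_coord n f x * cnj (H_alg b R ?w x) - f x * cnj (H_alg b R (mult_coord n ?w) x)) \<in> borel_measurable ?M"
      by measurable
    have "cpoly p" using p by (simp add: harmonic_poly_iff)
    then have c: "continuous_on UNIV (partial n ?w)" "continuous_on UNIV (gauss_pow k)" "continuous_on UNIV (lowering n m p)"
      using lowering_harmonic[OF p, of n] unfolding harmonic_poly_iff
      by (auto intro!: continuous_at_imp_continuous_on differentiable_imp_continuous_within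
          differentiable_partial_test_fun differentiable_gauss_pow) (erule cpoly_differentiable)
    note [measurable] = c[THEN borel_measurable_continuous_onI]
    have [measurable]: "f \<in> borel_measurable borel" by (rule schwartz_measurable[OF f])
    show "(\<lambda>x. - 2 * (f x * cnj (partial n ?w x + 2 * of_real b * (gauss_pow k x * lowering n m p x)))) \<in> borel_measurable ?M"
      by measurable
    show "AE x in ?M. mult_coord n f x * cnj (H_alg b R ?w x) - f x * cnj (H_alg b R (mult_coord n ?w) x) =
       - 2 * (f x * cnj (partial n ?w x + 2 * of_real b * (gauss_pow k x * lowering n m p x)))"
      unfolding AE_weighted using AE_lborel_singleton[of "0::real^'n"]
      by eventually_elim (simp add: H_alg_commutator[OF b R p] mult_coord_def algebra_simps)
  qed
  also have "\<dots> = - 2 * L2_inner ?M f (\<lambda>x. partial n ?w x + 2 * of_real b * (gauss_pow k x * lowering n m p x))"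
    unfolding L2_inner_def by simp
  finally show ?thesis by simp
qed

end

section \<open>Gaussian moments of harmonic polynomials\<close>

lemma integrable_rapid:
  fixes g :: "real^'n::finite \<Rightarrow> complex"
  assumes "rapid g" and [measurable]: "g \<in> borel_measurable borel"
  shows "integrable lborel g"
proof -
  have "integrable lborel (\<lambda>x. of_real (norm x powr 0) * g x)"
    by (rule integrable_powr_rapid[OF assms]) simp
  moreover have "AE x in lborel. of_real (norm x powr 0) * g x = g x"
    using AE_lborel_singleton[of "0::real^'n"] by eventually_elim simp
  ultimately show ?thesis by (subst (asm) integrable_cong_AE) auto
qed

lemma cpoly_measurable: "cpoly q \<Longrightarrow> q \<in> borel_measurable borel"
  by (intro borel_measurable_continuous_onI cpoly_continuous)

lemma gauss_measurable: "gauss_pow 0 \<in> borel_measurable borel"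
  by (intro borel_measurable_continuous_onI continuous_gauss)

lemma integrable_gauss_mult: "cpoly q \<Longrightarrow> integrable lborel (\<lambda>x. gauss_pow 0 x * q x)"
  using gauss_measurable cpoly_measurable by (intro integrable_rapid rapid_gauss_mult borel_measurable_times) auto

definition gauss_int :: "(real^'n::finite \<Rightarrow> complex) \<Rightarrow> complex" where
  "gauss_int q = (LINT x|lborel. gauss_pow 0 x * q x)"

lemma gauss_int_add: "cpoly p \<Longrightarrow> cpoly q \<Longrightarrow> gauss_int (\<lambda>x. p x + q x) = gauss_int p + gauss_int q"
  unfolding gauss_int_def distrib_left by (intro Bochner_Integration.integral_add integrable_gauss_mult)

lemma gauss_int_sum: "(\<And>i. i \<in> I \<Longrightarrow> cpoly (q i)) \<Longrightarrow> gauss_int (\<lambda>x. \<Sum>i\<in>I. q i x) = (\<Sum>i\<in>I. gauss_int (q i))"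
  unfolding gauss_int_def sum_distrib_left by (intro Bochner_Integration.integral_sum integrable_gauss_mult)

lemma gauss_int_cmult: "gauss_int (\<lambda>x. c * q x) = c * gauss_int q"
  unfolding gauss_int_def mult.left_commute[of _ c] by (rule integral_mult_right_zero)

lemma gauss_int_by_parts:
  fixes q :: "real^'n::finite \<Rightarrow> complex"
  assumes "cpoly q"
  shows "gauss_int (\<lambda>x. of_real (x $ n) * q x) = gauss_int (partial n q)"
proof -
  have c: "cpoly (\<lambda>x::real^'n. of_real (x $ n) * q x)" "cpoly (partial n q)"
    using assms by (auto intro: cpoly.intros cpoly_partial)
  have "integral\<^sup>L lborel (partial n (\<lambda>x. gauss_pow 0 x * q x)) = 0"
  proof (rule integral_partial_eq_0)
    show "(\<lambda>x. gauss_pow 0 x * q x) differentiable (at x)" for x by (rule differentiable_gauss_mult[OF assms])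
    show "integrable lborel (\<lambda>x. gauss_pow 0 x * q x)" by (rule integrable_gauss_mult[OF assms])
    show "integrable lborel (partial n (\<lambda>x. gauss_pow 0 x * q x))"
      unfolding partial_gauss_mult[OF assms] by (intro integrable_gauss_mult cpoly_diff c)
    show "continuous_on UNIV (partial n (\<lambda>x. gauss_pow 0 x * q x))"
      unfolding partial_gauss_mult[OF assms] by (intro continuous_on_mult continuous_gauss cpoly_continuous cpoly_diff c)
  qed
  then show ?thesis
    unfolding partial_gauss_mult[OF assms] gauss_int_def right_diff_distrib
    by (subst (asm) Bochner_Integration.integral_diff) (auto intro: integrable_gauss_mult c)
qed

text \<open>Gaussian integration by parts in each variable.\<close>
lemma gauss_int_divergence:
  fixes h :: "'n::finite \<Rightarrow> real^'n \<Rightarrow> complex"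
  assumes h: "\<And>i. cpoly (h i)"
  shows "gauss_int (\<lambda>x. \<Sum>i\<in>UNIV. of_real (x $ i) * h i x) = (\<Sum>i\<in>UNIV. gauss_int (partial i (h i)))"
proof -
  have "gauss_int (\<lambda>x. \<Sum>i\<in>UNIV. of_real (x $ i) * h i x) = (\<Sum>i\<in>UNIV. gauss_int (\<lambda>x. of_real (x $ i) * h i x))"
    by (rule gauss_int_sum) (intro cpoly.mult cpoly.coord h)
  then show ?thesis by (simp only: gauss_int_by_parts[OF h])
qed

lemma partial_cpoly_inner_power:
  "partial i (\<lambda>x. of_real (y \<bullet> x) ^ j) = (\<lambda>x::real^'n::finite. of_nat j * of_real (y $ i) * of_real (y \<bullet> x) ^ (j - 1))"
proof (induction j)
  case 0
  then show ?case by (simp add: fun_eq_iff)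
next
  case (Suc j)
  have 1: "partial i (\<lambda>x::real^'n. complex_of_real (y \<bullet> x)) x = of_real (y $ i)" for x
  proof -
    have "bounded_linear (\<lambda>x. complex_of_real (y \<bullet> x))"
      using bounded_linear_compose[OF bounded_linear_of_real bounded_linear_inner_right] .
    from partial_eqI[OF bounded_linear_imp_has_derivative[OF this]] show ?thesis by (simp add: inner_axis)
  qed
  have "partial i (\<lambda>x::real^'n. complex_of_real (y \<bullet> x) ^ Suc j) x =
     of_real (y $ i) * of_real (y \<bullet> x) ^ j + of_real (y \<bullet> x) * partial i (\<lambda>x. of_real (y \<bullet> x) ^ j) x" for x
    unfolding power_Suc
    by (subst partial_mult[OF cpoly_differentiable[OF cpoly_inner[of y]] cpoly_differentiable[OF cpoly_power[OF cpoly_inner[of y]]]])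
      (simp only: 1)
  then show ?case unfolding Suc
    by (cases j) (auto simp: fun_eq_iff algebra_simps)
qed

text \<open>Integrate by parts after writing \<open>k q\<close> as the Euler derivative of \<open>q\<close>. The terms in which both derivatives hit \<open>q\<close> add up to its Laplacian and vanish; the others lower both \<open>j\<close> and \<open>k\<close> by one. So only the full pairing \<open>j = k\<close> survives, as for the apolar inner product.\<close>
lemma gauss_int_inner_power_harmonic:
  fixes q :: "real^'n::finite \<Rightarrow> complex"
  assumes "q \<in> harmonic_poly k" "j \<le> k"
  shows "gauss_int (\<lambda>x. of_real (y \<bullet> x) ^ j * q x) =
    (if j = k then of_nat (fact k) * q y * gauss_int (\<lambda>_::real^'n. 1) else 0)"
  using assms
proof (induction j arbitrary: k q)
  case (0 k q)
  show ?case
  proof (cases "k = 0")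
    case True
    then have "homogeneous 0 q" using 0(1) by (auto simp: harmonic_poly_iff)
    then have qy: "q x = q y" for x using homogeneous_0_const[of q x] homogeneous_0_const[of q y] by (simp only:)
    have eq: "(\<lambda>x. of_real (y \<bullet> x) ^ 0 * q x) = (\<lambda>x. q y * 1)"
      by (rule ext) (simp only: power_0 mult_1 mult_1_right, rule qy)
    have gi: "gauss_int (\<lambda>x. of_real (y \<bullet> x) ^ 0 * q x) = q y * gauss_int (\<lambda>_::real^'n. 1)"
      unfolding eq by (rule gauss_int_cmult)
    show ?thesis unfolding gi True by simp
  next
    case False
    have q: "cpoly q" "homogeneous k q" "\<And>x. Laplacian q x = 0" using 0(1) unfolding harmonic_poly_iff by blast+
    have "of_nat k * gauss_int q = gauss_int (\<lambda>x. of_nat k * q x)" by (rule gauss_int_cmult[symmetric])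
    also have "(\<lambda>x. of_nat k * q x) = (\<lambda>x. \<Sum>i\<in>UNIV. of_real (x $ i) * partial i q x)"
      by (rule ext) (rule Euler_homogeneous[OF q(1,2), symmetric])
    also have "gauss_int \<dots> = (\<Sum>i\<in>UNIV. gauss_int (partial i (partial i q)))"
      by (rule gauss_int_divergence[OF cpoly_partial[OF q(1)]])
    also have "\<dots> = gauss_int (Laplacian q)"
      unfolding Laplacian_def[abs_def] by (rule gauss_int_sum[symmetric]) (intro cpoly_partial q)
    also have "\<dots> = 0" using q(3) by (simp add: gauss_int_def)
    finally show ?thesis using False by simp
  qed
next
  case (Suc j k q)
  then obtain k' where k: "k = Suc k'" by (cases k) auto
  have q: "cpoly q" "homogeneous k q" "\<And>x. Laplacian q x = 0" using Suc.prems(1) unfolding harmonic_poly_iff by blast+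
  let ?l = "\<lambda>x. complex_of_real (y \<bullet> x)"
  have cl: "cpoly (\<lambda>x. ?l x ^ j)" for j by (intro cpoly_power cpoly_inner)
  have c: "cpoly (\<lambda>x. ?l x ^ Suc j * partial i q x)" for i by (intro cpoly.mult cl cpoly_partial q)
  have IH: "gauss_int (\<lambda>x. ?l x ^ j * partial i q x) = (if j = k' then of_nat (fact k') * partial i q y * gauss_int (\<lambda>_::real^'n. 1) else 0)" for i
    using Suc.IH[OF harmonic_poly_partial[OF Suc.prems(1), of i]] Suc.prems k by simp
  have "of_nat k * gauss_int (\<lambda>x. ?l x ^ Suc j * q x) = gauss_int (\<lambda>x. of_nat k * (?l x ^ Suc j * q x))"
    by (rule gauss_int_cmult[symmetric])
  also have "(\<lambda>x. of_nat k * (?l x ^ Suc j * q x)) = (\<lambda>x. \<Sum>i\<in>UNIV. of_real (x $ i) * (?l x ^ Suc j * partial i q x))"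
  proof
    fix x
    have "of_nat k * (?l x ^ Suc j * q x) = ?l x ^ Suc j * (of_nat k * q x)" by (simp only: mult_ac)
    also have "\<dots> = (\<Sum>i\<in>UNIV. of_real (x $ i) * (?l x ^ Suc j * partial i q x))"
      unfolding Euler_homogeneous[OF q(1,2), symmetric] sum_distrib_left by (intro sum.cong refl) (simp only: mult_ac)
    finally show "of_nat k * (?l x ^ Suc j * q x) = (\<Sum>i\<in>UNIV. of_real (x $ i) * (?l x ^ Suc j * partial i q x))" .
  qed
  also have "gauss_int \<dots> = (\<Sum>i\<in>UNIV. gauss_int (partial i (\<lambda>x. ?l x ^ Suc j * partial i q x)))"
    by (rule gauss_int_divergence[OF c])
  also have "\<dots> = (\<Sum>i\<in>UNIV. of_nat (Suc j) * of_real (y $ i) * gauss_int (\<lambda>x. ?l x ^ j * partial i q x) +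
      gauss_int (\<lambda>x. ?l x ^ Suc j * partial i (partial i q) x))"
  proof (rule sum.cong[OF refl])
    fix i
    have "partial i (\<lambda>x. ?l x ^ Suc j * partial i q x) =
      (\<lambda>x. (of_nat (Suc j) * of_real (y $ i)) * (?l x ^ j * partial i q x) + ?l x ^ Suc j * partial i (partial i q) x)"
      by (rule ext, subst partial_mult[OF cpoly_differentiable[OF cl] cpoly_differentiable[OF cpoly_partial[OF q(1)]]])
        (simp only: partial_cpoly_inner_power diff_Suc_1 mult.assoc)
    then show "gauss_int (partial i (\<lambda>x. ?l x ^ Suc j * partial i q x)) =
      of_nat (Suc j) * of_real (y $ i) * gauss_int (\<lambda>x. ?l x ^ j * partial i q x) + gauss_int (\<lambda>x. ?l x ^ Suc j * partial i (partial i q) x)"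
      by (simp only: gauss_int_cmult gauss_int_add[OF cpoly.mult[OF cpoly.const cpoly.mult[OF cl cpoly_partial[OF q(1)]]]
        cpoly.mult[OF cl cpoly_partial[OF cpoly_partial[OF q(1)]]]])
  qed
  also have "\<dots> = (\<Sum>i\<in>UNIV. of_nat (Suc j) * of_real (y $ i) * gauss_int (\<lambda>x. ?l x ^ j * partial i q x)) + gauss_int (\<lambda>x. ?l x ^ Suc j * Laplacian q x)"
    unfolding sum.distrib Laplacian_def[abs_def] sum_distrib_left[of "_ ^ _"]
    by (subst gauss_int_sum) (rule cpoly.mult[OF cl cpoly_partial[OF cpoly_partial[OF q(1)]]], rule refl)
  also have "gauss_int (\<lambda>x. ?l x ^ Suc j * Laplacian q x) = 0" using q(3) by (simp add: gauss_int_def)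
  also have "(\<Sum>i\<in>UNIV. of_nat (Suc j) * of_real (y $ i) * gauss_int (\<lambda>x. ?l x ^ j * partial i q x)) + 0 =
     (if Suc j = k then of_nat (Suc j) * of_nat (fact k') * gauss_int (\<lambda>_::real^'n. 1) * (\<Sum>i\<in>UNIV. of_real (y $ i) * partial i q y) else 0)"
  proof (cases "Suc j = k")
    case True
    then have "j = k'" using k by simp
    then have IH': "gauss_int (\<lambda>x. ?l x ^ j * partial i q x) = of_nat (fact k') * partial i q y * gauss_int (\<lambda>_::real^'n. 1)" for i
      unfolding IH by (rule if_P)
    show ?thesis unfolding IH' if_P[OF True] add_0_right sum_distrib_left
      by (intro sum.cong refl) (simp only: mult_ac)
  next
    case False
    then have "j \<noteq> k'" using k by simp
    then have IH': "gauss_int (\<lambda>x. ?l x ^ j * partial i q x) = 0" for i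
      unfolding IH by (rule if_not_P)
    show ?thesis unfolding IH' if_not_P[OF False] by simp
  qed
  also have "\<dots> = of_nat k * (if Suc j = k then of_nat (fact k) * q y * gauss_int (\<lambda>_::real^'n. 1) else 0)"
  proof (cases "Suc j = k")
    case True
    have fk: "of_nat (fact k) = (of_nat k * of_nat (fact k') :: complex)" unfolding k fact_Suc by (simp only: of_nat_id of_nat_mult)
    show ?thesis unfolding Euler_homogeneous[OF q(1,2)] if_P[OF True] unfolding True unfolding fk
      by (simp only: mult_ac)
  next
    case False
    show ?thesis unfolding if_not_P[OF False] by simp
  qed
  finally have "of_nat k * gauss_int (\<lambda>x. ?l x ^ Suc j * q x) = of_nat k * (if Suc j = k then of_nat (fact k) * q y * gauss_int (\<lambda>_::real^'n. 1) else 0)" .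
  moreover have "of_nat k \<noteq> (0::complex)" using k by (simp del: of_nat_Suc)
  ultimately show ?case by (rule mult_left_cancel[THEN iffD1, rotated])
qed

text \<open>One further integration by parts removes the factor \<open>x\<^sub>n\<close>. The term in which the derivative hits the power of the linear form vanishes by degree.\<close>
lemma gauss_int_coord_inner_power_harmonic:
  fixes q :: "real^'n::finite \<Rightarrow> complex"
  assumes q: "q \<in> harmonic_poly (Suc j)"
  shows "gauss_int (\<lambda>x. of_real (x $ n) * (of_real (y \<bullet> x) ^ j * q x)) =
    of_nat (fact j) * partial n q y * gauss_int (\<lambda>_::real^'n. 1)"
proof -
  have cq: "cpoly q" using q by (simp add: harmonic_poly_iff)
  have cl: "cpoly (\<lambda>x. complex_of_real (y \<bullet> x) ^ j)" for j by (intro cpoly_power cpoly_inner)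
  have "partial n (\<lambda>x. of_real (y \<bullet> x) ^ j * q x) =
     (\<lambda>x. of_nat j * of_real (y $ n) * (of_real (y \<bullet> x) ^ (j - 1) * q x) + of_real (y \<bullet> x) ^ j * partial n q x)"
    by (rule ext, subst partial_mult)
      (auto intro: cpoly_differentiable cl cq simp: partial_cpoly_inner_power)
  then have "gauss_int (\<lambda>x. of_real (x $ n) * (of_real (y \<bullet> x) ^ j * q x)) =
     of_nat j * of_real (y $ n) * gauss_int (\<lambda>x. of_real (y \<bullet> x) ^ (j - 1) * q x) + gauss_int (\<lambda>x. of_real (y \<bullet> x) ^ j * partial n q x)"
    using gauss_int_by_parts[OF cpoly.mult[OF cl cq], of n j]
      gauss_int_add[OF cpoly.mult[OF cpoly.const cpoly.mult[OF cl cq]] cpoly.mult[OF cl cpoly_partial[OF cq]],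
        of "of_nat j * of_real (y $ n)" "j - 1" j n]
    by (simp only: gauss_int_cmult)
  also have "gauss_int (\<lambda>x. of_real (y \<bullet> x) ^ (j - 1) * q x) = 0"
    using gauss_int_inner_power_harmonic[OF q, of "j - 1"] by simp
  also have "gauss_int (\<lambda>x. of_real (y \<bullet> x) ^ j * partial n q x) = of_nat (fact j) * partial n q y * gauss_int (\<lambda>_::real^'n. 1)"
    using gauss_int_inner_power_harmonic[OF harmonic_poly_partial[OF q, of n], of j] by simp
  finally show ?thesis by simp
qed

section \<open>From Gaussian to spherical integrals\<close>

lemma integral_polar:
  fixes g :: "real^'n::finite \<Rightarrow> complex"
  assumes [measurable]: "g \<in> borel_measurable borel" and g: "integrable lborel g"
  shows "(LINT x|lborel. g x) = (LINT r|radial_measure CARD('n). LINT \<xi>|sphere_measure. g (r *\<^sub>R \<xi>))"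
proof -
  interpret R: sigma_finite_measure "radial_measure CARD('n)" by (rule sigma_finite_radial_measure) simp
  interpret P: pair_sigma_finite "radial_measure CARD('n)" "sphere_measure :: (real^'n) measure"
    by unfold_locales
  have eq: "g x = (\<lambda>(r, \<xi>). g (r *\<^sub>R \<xi>)) (norm x, sgn x)" for x by (simp add: norm_sgn_eq_self)
  have "integrable lborel (\<lambda>x. (\<lambda>(r, \<xi>). g (r *\<^sub>R \<xi>)) (norm x, sgn x))" using g by (simp add: norm_sgn_eq_self)
  then have int: "integrable (radial_measure CARD('n) \<Otimes>\<^sub>M (sphere_measure :: (real^'n) measure)) (\<lambda>(r, \<xi>). g (r *\<^sub>R \<xi>))"
    unfolding distr_norm_sgn[symmetric] by (subst integrable_distr_eq) auto
  have "(LINT x|lborel. g x) = (LINT x|lborel. (\<lambda>(r, \<xi>). g (r *\<^sub>R \<xi>)) (norm x, sgn x))" by (simp add: norm_sgn_eq_self)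
  also have "\<dots> = integral\<^sup>L (radial_measure CARD('n) \<Otimes>\<^sub>M (sphere_measure :: (real^'n) measure)) (\<lambda>(r, \<xi>). g (r *\<^sub>R \<xi>))"
    unfolding distr_norm_sgn[symmetric] by (rule integral_distr[symmetric]) auto
  also have "\<dots> = (LINT r|radial_measure CARD('n). LINT \<xi>|sphere_measure. g (r *\<^sub>R \<xi>))"
    using P.integral_fst'[OF int] by simp
  finally show ?thesis .
qed

text \<open>The dependence of a Gaussian moment on the radius; this factor cancels between two homogeneous polynomials of the same degree.\<close>
definition radial_moment :: "nat \<Rightarrow> nat \<Rightarrow> complex" where
  "radial_moment N d = (LINT r|radial_measure N. of_real (exp (- (1 / 2) * r\<^sup>2) * r ^ d))"

lemma gauss_int_eq_sphere:
  fixes h :: "real^'n::finite \<Rightarrow> complex"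
  assumes h: "cpoly h" "homogeneous d h"
  shows "gauss_int h = radial_moment CARD('n) d * (LINT \<xi>|sphere_measure. h \<xi>)"
proof -
  note [measurable] = cpoly_measurable[OF h(1)] gauss_measurable
  have "gauss_int h = (LINT r|radial_measure CARD('n). LINT \<xi>|sphere_measure. gauss_pow 0 (r *\<^sub>R \<xi>) * h (r *\<^sub>R (\<xi>::real^'n)))"
    unfolding gauss_int_def by (rule integral_polar) (auto intro: integrable_gauss_mult h)
  also have "\<dots> = (LINT r|radial_measure CARD('n). of_real (exp (- (1 / 2) * r\<^sup>2) * r ^ d) * (LINT \<xi>|sphere_measure. h \<xi>))"
  proof (rule Bochner_Integration.integral_cong[OF refl])
    fix r :: real
    have "(LINT \<xi>|sphere_measure. gauss_pow 0 (r *\<^sub>R \<xi>) * h (r *\<^sub>R \<xi>)) = (LINT \<xi>|sphere_measure. of_real (exp (- (1 / 2) * r\<^sup>2) * r ^ d) * h \<xi>)"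
    proof (rule integral_cong_AE)
      show "AE \<xi> in sphere_measure. gauss_pow 0 (r *\<^sub>R \<xi>) * h (r *\<^sub>R \<xi>) = of_real (exp (- (1 / 2) * r\<^sup>2) * r ^ d) * h \<xi>"
        using AE_sphere_measure_norm
      proof eventually_elim
        case (elim \<xi>)
        then have "(norm (r *\<^sub>R \<xi>))\<^sup>2 = r\<^sup>2" by simp
        moreover have "h (r *\<^sub>R \<xi>) = of_real (r ^ d) * h \<xi>" using h(2) unfolding homogeneous_def by blast
        ultimately show ?case by (simp only: gauss_eq of_real_mult mult.assoc)
      qed
    qed measurable
    also have "\<dots> = of_real (exp (- (1 / 2) * r\<^sup>2) * r ^ d) * (LINT \<xi>|sphere_measure. h \<xi>)" by (rule integral_mult_right_zero)
    finally show "(LINT \<xi>|sphere_measure. gauss_pow 0 (r *\<^sub>R \<xi>) * h (r *\<^sub>R \<xi>)) = of_real (exp (- (1 / 2) * r\<^sup>2) * r ^ d) * (LINT \<xi>|sphere_measure. h \<xi>)" .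
  qed
  also have "\<dots> = radial_moment CARD('n) d * (LINT \<xi>|sphere_measure. h \<xi>)"
    unfolding radial_moment_def by (rule integral_mult_left_zero)
  finally show ?thesis .
qed

lemma gauss_int_one_nonzero: "gauss_int (\<lambda>_::real^'n::finite. 1) \<noteq> 0"
proof
  assume "gauss_int (\<lambda>_::real^'n. 1) = 0"
  then have "complex_of_real (LINT x|lborel. exp (- (1 / 2) * (norm (x::real^'n))\<^sup>2)) = 0"
    unfolding gauss_int_def gauss_eq mult_1_right by (subst integral_complex_of_real[symmetric])
  then have 0: "(LINT x|lborel. exp (- (1 / 2) * (norm (x::real^'n))\<^sup>2)) = 0" by simp
  have "integrable lborel (\<lambda>x::real^'n. complex_of_real (exp (- (1 / 2) * (norm x)\<^sup>2)))"
    using integrable_gauss_mult[OF cpoly.const[of 1]] unfolding gauss_eq mult_1_right .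
  from integrable_Re[OF this] have "integrable lborel (\<lambda>x::real^'n. exp (- (1 / 2) * (norm x)\<^sup>2))" by (simp only: Re_complex_of_real)
  then have "AE x in lborel. exp (- (1 / 2) * (norm (x::real^'n))\<^sup>2) = 0"
    using 0 by (subst (asm) integral_nonneg_eq_0_iff_AE) auto
  then have "ae_filter (lborel :: (real^'n) measure) = bot" by (simp add: trivial_limit_def)
  then show False by (simp add: ae_filter_eq_bot_iff)
qed

text \<open>The divergence of \<open>|x|\<^sup>2\<^sup>k x\<close> is \<open>(N + 2 k) |x|\<^sup>2\<^sup>k\<close>, by Euler's formula.\<close>
lemma gauss_int_norm_sq:
  "gauss_int (\<lambda>x::real^'n::finite. of_real ((norm x)\<^sup>2) ^ Suc k) = of_nat (CARD('n) + 2 * k) * gauss_int (\<lambda>x::real^'n. of_real ((norm x)\<^sup>2) ^ k)"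
proof -
  let ?s = "\<lambda>x::real^'n. complex_of_real ((norm x)\<^sup>2)"
  have cs: "cpoly (\<lambda>x. ?s x ^ j)" for j by (intro cpoly_power cpoly_norm_sq)
  have nsq: "?s x = (\<Sum>i\<in>UNIV. of_real (x $ i) * of_real (x $ i))" for x
    unfolding power2_norm_eq_inner by (simp add: inner_vec_def)
  have homs: "homogeneous (2 * k) (\<lambda>x. ?s x ^ k)"
    unfolding homogeneous_def by (simp add: power_mult_distrib power_mult)
  have "gauss_int (\<lambda>x. ?s x ^ Suc k) = gauss_int (\<lambda>x. \<Sum>i\<in>UNIV. of_real (x $ i) * (of_real (x $ i) * ?s x ^ k))"
    unfolding power_Suc by (subst nsq) (simp only: sum_distrib_right mult.assoc)
  also have "\<dots> = (\<Sum>i\<in>UNIV. gauss_int (partial i (\<lambda>x. of_real (x $ i) * ?s x ^ k)))"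
    by (rule gauss_int_divergence[OF cpoly.mult[OF cpoly.coord cs]])
  also have "\<dots> = (\<Sum>i\<in>UNIV. gauss_int (\<lambda>x. ?s x ^ k + of_real (x $ i) * partial i (\<lambda>x. ?s x ^ k) x))"
  proof (rule sum.cong[OF refl])
    fix i
    have "partial i (\<lambda>x. of_real (x $ i) * ?s x ^ k) = (\<lambda>x. ?s x ^ k + of_real (x $ i) * partial i (\<lambda>x. ?s x ^ k) x)"
      by (rule ext, subst partial_mult) (auto intro: cpoly_differentiable cs simp del: of_real_power)
    then show "gauss_int (partial i (\<lambda>x. of_real (x $ i) * ?s x ^ k)) = gauss_int (\<lambda>x. ?s x ^ k + of_real (x $ i) * partial i (\<lambda>x. ?s x ^ k) x)"
      by (simp only:)
  qed
  also have "\<dots> = gauss_int (\<lambda>x. \<Sum>i\<in>UNIV. (?s x ^ k + of_real (x $ i) * partial i (\<lambda>x. ?s x ^ k) x))"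
    by (subst gauss_int_sum) (auto intro!: cpoly.add cpoly.mult cpoly.coord cpoly_partial cs simp del: of_real_power)
  also have "(\<lambda>x. \<Sum>i\<in>UNIV. (?s x ^ k + of_real (x $ i) * partial i (\<lambda>x. ?s x ^ k) x)) = (\<lambda>x. of_nat (CARD('n) + 2 * k) * ?s x ^ k)"
    by (rule ext) (simp only: sum.distrib Euler_homogeneous[OF cs homs] sum_constant of_nat_add distrib_right)
  finally show ?thesis by (simp only: gauss_int_cmult)
qed

lemma integrable_sphere_bounded:
  fixes g :: "real^'n::finite \<Rightarrow> complex"
  assumes [measurable]: "g \<in> borel_measurable borel" and "\<And>\<xi>. norm \<xi> = 1 \<Longrightarrow> cmod (g \<xi>) \<le> C"
  shows "integrable sphere_measure g"
proof (rule finite_measure.integrable_const_bound[OF finite_sphere_measure, of _ C])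
  show "AE \<xi> in sphere_measure. cmod (g \<xi>) \<le> C"
    using AE_sphere_measure_norm by eventually_elim (rule assms(2))
qed measurable

lemma integrable_sphere_cpoly:
  assumes "cpoly q" shows "integrable sphere_measure q"
proof -
  obtain C d where C: "\<And>x. cmod (q x) \<le> C * (1 + norm x) ^ d" using cpoly_bound[OF assms] by blast
  show ?thesis
  proof (rule integrable_sphere_bounded[OF cpoly_measurable[OF assms], of "C * 2 ^ d"])
    show "cmod (q \<xi>) \<le> C * 2 ^ d" if "norm \<xi> = 1" for \<xi> using C[of \<xi>] that by simp
  qed
qed

text \<open>In polar coordinates \<open>h\<close> and \<open>|x|\<^sup>2\<^sup>k\<close> have the same radial moment, and the integral of \<open>|x|\<^sup>2\<^sup>k\<close> is known from \<open>gauss_int_norm_sq\<close>.\<close>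
lemma gauss_int_sphere_moment:
  fixes h :: "real^'n::finite \<Rightarrow> complex"
  assumes h: "cpoly h" "homogeneous (2 * k) h"
  shows "gauss_int h * of_real (sphere_vol TYPE('n)) = gauss_int (\<lambda>_::real^'n. 1) * (\<Prod>i<k. of_nat (CARD('n) + 2 * i)) * (LINT \<xi>|sphere_measure. h \<xi>)"
proof -
  let ?s = "\<lambda>x::real^'n. complex_of_real ((norm x)\<^sup>2)"
  have prod: "gauss_int (\<lambda>x. ?s x ^ k) = (\<Prod>i<k. of_nat (CARD('n) + 2 * i)) * gauss_int (\<lambda>_::real^'n. 1)"
  proof (induction k)
    case 0
    then show ?case by simp
  next
    case (Suc k)
    show ?case unfolding gauss_int_norm_sq Suc prod.lessThan_Suc by (simp only: mult_ac)
  qed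
  have cs: "cpoly (\<lambda>x. ?s x ^ k)" by (intro cpoly_power cpoly_norm_sq)
  have homs: "homogeneous (2 * k) (\<lambda>x. ?s x ^ k)"
    unfolding homogeneous_def by (simp add: power_mult_distrib power_mult)
  have "(LINT \<xi>|sphere_measure. ?s \<xi> ^ k) = (LINT \<xi>|(sphere_measure :: (real^'n) measure). 1)"
  proof (rule integral_cong_AE)
    show "(\<lambda>\<xi>. ?s \<xi> ^ k) \<in> borel_measurable sphere_measure" using cpoly_measurable[OF cs] by measurable
    show "AE \<xi> in sphere_measure. ?s \<xi> ^ k = 1" using AE_sphere_measure_norm by eventually_elim simp
  qed simp
  also have "\<dots> = of_real (sphere_vol TYPE('n))" by (simp add: sphere_vol_def scaleR_conv_of_real)
  finally have "gauss_int (\<lambda>x. ?s x ^ k) = radial_moment CARD('n) (2 * k) * of_real (sphere_vol TYPE('n))"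
    using gauss_int_eq_sphere[OF cs homs] by simp
  then show ?thesis using gauss_int_eq_sphere[OF h] prod by simp
qed

section \<open>Taylor expansion into harmonic components\<close>

lemma homogeneous_mult: "homogeneous i p \<Longrightarrow> homogeneous j q \<Longrightarrow> homogeneous (i + j) (\<lambda>x. p x * q x)"
  unfolding homogeneous_def by (simp add: power_add)

lemma homogeneous_sum: "(\<And>i. i \<in> I \<Longrightarrow> homogeneous d (p i)) \<Longrightarrow> homogeneous d (\<lambda>x. \<Sum>i\<in>I. p i x)"
  unfolding homogeneous_def by (simp add: sum_distrib_left)

lemma cpoly_homogeneous_decomposition:
  fixes q :: "real^'n::finite \<Rightarrow> complex"
  assumes "cpoly q"
  shows "\<exists>P d. (\<forall>k. cpoly (P k) \<and> homogeneous k (P k)) \<and> (\<forall>k>d. \<forall>x. P k x = 0) \<and> (\<forall>x. q x = (\<Sum>k\<le>d. P k x))"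
  using assms
proof (induction rule: cpoly.induct)
  case (const c)
  show ?case
    by (rule exI[of _ "\<lambda>k x. if k = 0 then c else 0"], rule exI[of _ 0])
      (auto simp: homogeneous_def intro: cpoly.const)
next
  case (coord i)
  have "cpoly (\<lambda>x::real^'n. if k = 1 then complex_of_real (x $ i) else 0)" for k :: nat
    by (cases "k = 1") (auto intro: cpoly.const cpoly.coord)
  then show ?case
    by (intro exI[of _ "\<lambda>k x. if k = 1 then of_real (x $ i) else 0"] exI[of _ 1]) (auto simp: homogeneous_def)
next
  case (add p q)
  then obtain P d Q e where P: "\<And>k. cpoly (P k)" "\<And>k. homogeneous k (P k)" "\<And>k x. k > d \<Longrightarrow> P k x = 0" "\<And>x. p x = (\<Sum>k\<le>d. P k x)"
    and Q: "\<And>k. cpoly (Q k)" "\<And>k. homogeneous k (Q k)" "\<And>k x. k > e \<Longrightarrow> Q k x = 0" "\<And>x. q x = (\<Sum>k\<le>e. Q k x)"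
    by metis
  have "p x = (\<Sum>k\<le>d + e. P k x)" "q x = (\<Sum>k\<le>d + e. Q k x)" for x
    unfolding P(4) Q(4) by (rule sum.mono_neutral_left; auto simp: P(3) Q(3))+
  then have "p x + q x = (\<Sum>k\<le>d + e. P k x + Q k x)" for x by (simp add: sum.distrib)
  moreover have "homogeneous k (\<lambda>x. P k x + Q k x)" for k using P(2)[of k] Q(2)[of k] by (simp add: homogeneous_def distrib_left)
  ultimately show ?case using P Q
    by (intro exI[of _ "\<lambda>k x. P k x + Q k x"] exI[of _ "d + e"]) (auto intro: cpoly.add)
next
  case (mult p q)
  then obtain P d Q e where P: "\<And>k. cpoly (P k)" "\<And>k. homogeneous k (P k)" "\<And>k x. k > d \<Longrightarrow> P k x = 0" "\<And>x. p x = (\<Sum>k\<le>d. P k x)"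
    and Q: "\<And>k. cpoly (Q k)" "\<And>k. homogeneous k (Q k)" "\<And>k x. k > e \<Longrightarrow> Q k x = 0" "\<And>x. q x = (\<Sum>k\<le>e. Q k x)"
    by metis
  have "p x * q x = (\<Sum>k\<le>d + e. \<Sum>i\<le>k. P i x * Q (k - i) x)" for x
    unfolding P(4) Q(4) using polynomial_product[of d "\<lambda>i. P i x" e "\<lambda>i. Q i x" 1] P(3) Q(3) by simp
  moreover have "homogeneous k (\<lambda>x. \<Sum>i\<le>k. P i x * Q (k - i) x)" for k
  proof (rule homogeneous_sum)
    fix i assume "i \<in> {..k}"
    then show "homogeneous k (\<lambda>x. P i x * Q (k - i) x)" using homogeneous_mult[OF P(2)[of i] Q(2)[of "k - i"]] by simp
  qed
  moreover have "(\<Sum>i\<le>k. P i x * Q (k - i) x) = 0" if "k > d + e" for k x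
  proof (rule sum.neutral, rule ballI)
    fix i assume "i \<in> {..k}"
    then have "i > d \<or> k - i > e" using that by auto
    then show "P i x * Q (k - i) x = 0" using P(3) Q(3) by auto
  qed
  ultimately show ?case using P Q
    by (intro exI[of _ "\<lambda>k x. \<Sum>i\<le>k. P i x * Q (k - i) x"] exI[of _ "d + e"]) (auto intro!: cpoly_sum cpoly.mult)
qed

lemma real_polynomial_coeffs_zero:
  fixes c :: "nat \<Rightarrow> complex"
  assumes "\<And>t::real. (\<Sum>k\<le>d. of_real (t ^ k) * c k) = 0" "k \<le> d"
  shows "c k = 0"
proof -
  have "(\<Sum>k\<le>d. Re (c k) * t ^ k) = 0" "(\<Sum>k\<le>d. Im (c k) * t ^ k) = 0" for t :: real
    using arg_cong[OF assms(1)[of t], of Re] arg_cong[OF assms(1)[of t], of Im]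
    by (simp_all add: mult.commute del: of_real_power)
  then have "Re (c k) = 0" "Im (c k) = 0"
    using polyfun_eq_0[of "\<lambda>k. Re (c k)" d] polyfun_eq_0[of "\<lambda>k. Im (c k)" d] assms(2) by auto
  then show ?thesis by (simp add: complex_eq_iff)
qed

text \<open>The Laplacian lowers degrees by exactly two, so it acts on each homogeneous component separately. The components are isolated by evaluating at \<open>t x\<close> and comparing coefficients in \<open>t\<close>.\<close>
lemma harmonic_components:
  fixes q :: "real^'n::finite \<Rightarrow> complex"
  assumes "cpoly q" and L: "\<And>x. Laplacian q x = 0"
    and P: "\<And>k. cpoly (P k)" "\<And>k. homogeneous k (P k)" and q: "\<And>x. q x = (\<Sum>k\<le>d. P k x)" and "k \<le> d"
  shows "P k \<in> harmonic_poly k"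
proof -
  have part: "partial i q = (\<lambda>x. \<Sum>k\<le>d. partial i (P k) x)" for i
    unfolding q[abs_def] by (rule ext, rule partial_sum) (intro cpoly_differentiable P)
  have L': "(\<Sum>k\<le>d. Laplacian (P k) x) = 0" for x
  proof -
    have "Laplacian q x = (\<Sum>i\<in>UNIV. \<Sum>k\<le>d. partial i (partial i (P k)) x)"
      unfolding Laplacian_def part by (rule sum.cong[OF refl], rule partial_sum) (intro cpoly_differentiable cpoly_partial P)
    then show ?thesis unfolding Laplacian_def L[unfolded Laplacian_def] by (subst sum.swap) simp
  qed
  have hom: "Laplacian (P k) (t *\<^sub>R x) * of_real (t\<^sup>2) = of_real (t ^ k) * Laplacian (P k) x" for k t x
  proof -
    have pp: "homogeneous (k - 1 - 1) (partial i (partial i (P k)))" for i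
      by (intro homogeneous_partial cpoly_partial P)
    have z: "partial i (partial i (P k)) x = 0" if "k \<le> 1" for i x
    proof -
      have "homogeneous 0 (partial i (P k))" using homogeneous_partial[OF P(1,2), of k i] that by simp
      then have "partial i (P k) = (\<lambda>x. partial i (P k) 0)" using homogeneous_0_const by blast
      then show ?thesis by (metis partial_const)
    qed
    show ?thesis
    proof (cases "k \<le> 1")
      case True
      then show ?thesis by (simp add: Laplacian_def z)
    next
      case False
      define j where "j = k - 2"
      have j: "k = Suc (Suc j)" using False by (simp add: j_def)
      show ?thesis using pp unfolding homogeneous_def Laplacian_def j
        by (simp add: sum_distrib_left sum_distrib_right power2_eq_square mult_ac)
    qed
  qed
  have "(\<Sum>k\<le>d. of_real (t ^ k) * Laplacian (P k) x) = 0" for t x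
    unfolding hom[symmetric] sum_distrib_right[symmetric] L' by simp
  from real_polynomial_coeffs_zero[OF this \<open>k \<le> d\<close>] show ?thesis
    unfolding harmonic_poly_iff using P by blast
qed

section \<open>The spherical average of a reflected harmonic polynomial\<close>

text \<open>Induction on \<open>M\<close> with shift of \<open>a\<close> by \<open>2\<close>: apart from its first term \<open>1 / a\<close>, the sum for \<open>(M + 1, a)\<close> is a multiple of the sum for \<open>(M, a + 2)\<close>. It is a beta integral in disguise.\<close>
lemma alternating_sum_identity:
  fixes a :: real
  assumes "a > 0"
  shows "(\<Sum>j\<le>M. (-2) ^ j * fact j * real (M choose j) / (\<Prod>i\<le>j. a + 2 * real i)) = 1 / (a + 2 * real M)"
  using assms
proof (induction M arbitrary: a)
  case 0
  then show ?case by simp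
next
  case (Suc M)
  have step: "(-2) ^ Suc j * fact (Suc j) * real (Suc M choose Suc j) / (\<Prod>i\<le>Suc j. a + 2 * real i) =
     (- 2 * real (Suc M) / a) * ((-2) ^ j * fact j * real (M choose j) / (\<Prod>i\<le>j. (a + 2) + 2 * real i))" for j
  proof -
    have "(\<Prod>i\<le>Suc j. a + 2 * real i) = a * (\<Prod>i\<le>j. (a + 2) + 2 * real i)"
      unfolding prod.atMost_Suc_shift by (simp add: algebra_simps)
    moreover have B: "fact (Suc j) * real (Suc M choose Suc j) = real (Suc M) * (fact j * real (M choose j))"
    proof -
      have "Suc j * (Suc M choose Suc j) = Suc M * (M choose j)" unfolding Suc_times_binomial_eq by (rule mult.commute)
      then have "real (Suc j) * real (Suc M choose Suc j) = real (Suc M) * real (M choose j)"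
        by (metis of_nat_mult)
      then have "fact j * (real (Suc j) * real (Suc M choose Suc j)) = fact j * (real (Suc M) * real (M choose j))" by (simp only:)
      then show ?thesis unfolding fact_Suc by (simp only: mult_ac)
    qed
    moreover have "(-2) ^ Suc j * fact (Suc j) * real (Suc M choose Suc j) = (-2) ^ Suc j * (real (Suc M) * (fact j * real (M choose j)))"
      unfolding B[symmetric] by (rule mult.assoc)
    ultimately show ?thesis by (simp only: power_Suc times_divide_times_eq mult_ac)
  qed
  have "(\<Sum>j\<le>Suc M. (-2) ^ j * fact j * real (Suc M choose j) / (\<Prod>i\<le>j. a + 2 * real i)) =
     1 / a + (\<Sum>j\<le>M. (-2) ^ Suc j * fact (Suc j) * real (Suc M choose Suc j) / (\<Prod>i\<le>Suc j. a + 2 * real i))"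
    unfolding sum.atMost_Suc_shift by simp
  also have "\<dots> = 1 / a + (- 2 * real (Suc M) / a) * (1 / (a + 2 + 2 * real M))"
    unfolding step sum_distrib_left[symmetric] using Suc.IH[of "a + 2"] Suc.prems by simp
  also have "\<dots> = 1 / (a + 2 * real (Suc M))"
    using Suc.prems by (simp add: divide_simps)
  finally show ?case .
qed

lemma partial_translate:
  assumes "\<And>y. p differentiable (at y)"
  shows "partial k (\<lambda>\<xi>. p (x + \<xi>)) \<xi> = partial k p (x + \<xi>)"
proof -
  have "((\<lambda>\<xi>. x + \<xi>) has_derivative (\<lambda>h. h)) (at \<xi>)" by (auto intro!: derivative_eq_intros)
  from diff_chain_at[OF this frechet_derivative_works[THEN iffD1, OF assms]]
  have "((\<lambda>\<xi>. p (x + \<xi>)) has_derivative (\<lambda>h. frechet_derivative p (at (x + \<xi>)) h)) (at \<xi>)" by (simp add: o_def)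
  from partial_eqI[OF this] show ?thesis by (simp add: partial_def)
qed

lemma AE_sphere_inner_nonzero:
  fixes x :: "real^'n::finite"
  assumes "x \<noteq> 0"
  shows "AE \<xi> in sphere_measure. x \<bullet> \<xi> \<noteq> 0"
proof -
  have [measurable]: "ball 0 1 \<in> sets (borel :: (real^'n) measure)" by simp
  have "{y. x \<bullet> y = 0} \<in> null_sets lborel"
  proof -
    have "negligible {y. x \<bullet> y = 0}" using assms by (intro negligible_hyperplane) simp
    moreover have "{y. x \<bullet> y = 0} \<in> sets borel" by (intro borel_closed closed_hyperplane)
    ultimately show ?thesis by (simp add: negligible_iff_null_sets null_sets_completion_iff)
  qed
  then have "AE y in lborel. x \<bullet> y \<noteq> 0" using AE_not_in by fastforce
  then have "AE y in lborel. y \<in> ball 0 1 \<longrightarrow> x \<bullet> sgn y \<noteq> 0"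
    by eventually_elim (auto simp: sgn_div_norm)
  then show ?thesis unfolding sphere_measure_def
    by (subst AE_distr_iff) (auto simp: AE_density indicator_def elim: eventually_mono)
qed

lemma sphere_vol_pos: "sphere_vol TYPE('n::finite) > 0"
  unfolding sphere_vol_eq by (simp add: unit_ball_vol_pos)

text \<open>The Gaussian moment, transferred to the sphere by homogeneity of degree \<open>2 (k + 1)\<close>.\<close>
lemma sphere_moment_harmonic:
  fixes q :: "real^'n::finite \<Rightarrow> complex"
  assumes q: "q \<in> harmonic_poly (Suc k)"
  shows "(LINT \<xi>|sphere_measure. of_real (\<xi> $ n) * (of_real (x \<bullet> \<xi>) ^ k * q \<xi>)) =
    of_real (sphere_vol TYPE('n) * fact k / (\<Prod>i\<le>k. real CARD('n) + 2 * real i)) * partial n q x"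
proof -
  let ?h = "\<lambda>\<xi>. of_real (\<xi> $ n) * (of_real (x \<bullet> \<xi>) ^ k * q \<xi>)"
  let ?Z = "gauss_int (\<lambda>_::real^'n. 1)"
  define A where "A = (\<Prod>i\<le>k. real CARD('n) + 2 * real i)"
  have "A > 0" unfolding A_def by (intro prod_pos) (simp add: add_pos_nonneg)
  have Q: "cpoly q" "homogeneous (Suc k) q" using q by (auto simp: harmonic_poly_iff)
  have "cpoly ?h" by (intro cpoly.mult cpoly.coord cpoly_power cpoly_inner Q)
  moreover have "homogeneous (2 * Suc k) ?h"
    using Q(2) unfolding homogeneous_def by (simp add: power_mult_distrib power_mult power2_eq_square mult_ac)
  ultimately have "gauss_int ?h * of_real (sphere_vol TYPE('n)) = ?Z * (\<Prod>i<Suc k. of_nat (CARD('n) + 2 * i)) * (LINT \<xi>|sphere_measure. ?h \<xi>)"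
    by (rule gauss_int_sphere_moment)
  also have "(\<Prod>i<Suc k. of_nat (CARD('n) + 2 * i)) = complex_of_real A"
    unfolding lessThan_Suc_atMost A_def by simp
  finally have "?Z * (of_nat (fact k) * partial n q x * of_real (sphere_vol TYPE('n))) = ?Z * (of_real A * (LINT \<xi>|sphere_measure. ?h \<xi>))"
    unfolding gauss_int_coord_inner_power_harmonic[OF q] by (simp only: mult_ac)
  then have "of_nat (fact k) * partial n q x * of_real (sphere_vol TYPE('n)) = of_real A * (LINT \<xi>|sphere_measure. ?h \<xi>)"
    by (rule mult_left_cancel[THEN iffD1, OF gauss_int_one_nonzero])
  then show ?thesis unfolding A_def[symmetric] using \<open>A > 0\<close> by (simp add: field_simps)
qed

text \<open>Expand \<open>p (x + \<eta>) = \<Sum>\<^sub>k P\<^sub>k(\<eta>)\<close> into homogeneous components; they are harmonic since \<open>p\<close> is. With \<open>c = \<langle>x, \<xi>\<rangle>\<close> the reflected point is \<open>x - 2 c \<xi>\<close>, so that the quotient is the polynomial \<open>Q(\<xi>) = \<Sum>\<^sub>k 2 (-2)\<^sup>k c\<^sup>k P\<^sub>k\<^sub>+\<^sub>1(\<xi>)\<close>. By \<open>sphere_moment_harmonic\<close> each term integrates to a multiple of \<open>\<partial>\<^sub>n P\<^sub>k\<^sub>+\<^sub>1(x)\<close>, which homogeneity of \<open>\<partial>\<^sub>n p\<close> identifies as a binomial coefficient times \<open>\<partial>\<^sub>n p(x)\<close>. The remaining numerical sum is \<open>alternating_sum_identity\<close>.\<close>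
lemma spherical_reflection_average:
  fixes p :: "real^'n::finite \<Rightarrow> complex"
  assumes p: "p \<in> harmonic_poly m"
  shows "\<exists>Q. cpoly Q \<and> (\<forall>\<xi>. \<xi> \<bullet> x \<noteq> 0 \<longrightarrow> (p x - p (reflection \<xi> x)) / of_real (\<xi> \<bullet> x) = Q \<xi>) \<and>
    (LINT \<xi>|sphere_measure. of_real (\<xi> $ n) * Q \<xi>) = of_real (2 * sphere_vol TYPE('n)) * lowering n m p x"
proof (cases "m = 0")
  case True
  then have "homogeneous 0 p" using p by (simp add: harmonic_poly_iff)
  then have const: "p = (\<lambda>x. p 0)" using homogeneous_0_const by blast
  then have "partial n p x = 0" by (metis partial_const)
  then have "lowering n m p x = 0" by (simp add: lowering_def)
  moreover have "p x - p (reflection \<xi> x) = 0" for \<xi> using const by (metis diff_self)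
  ultimately show ?thesis by (intro exI[of _ "\<lambda>_. 0"]) (simp add: cpoly.const)
next
  case False
  define M where "M = m - 1"
  have m: "m = Suc M" using False by (simp add: M_def)
  have pc: "cpoly p" "homogeneous m p" "\<And>x. Laplacian p x = 0" using p unfolding harmonic_poly_iff by blast+
  define q where "q \<xi> = p (x + \<xi>)" for \<xi>
  have qc: "cpoly q" using cpoly_affine[OF pc(1), of x 1] unfolding q_def by (simp only: scaleR_one)
  have pq: "partial i q \<xi> = partial i p (x + \<xi>)" for i \<xi>
    unfolding q_def by (rule partial_translate) (rule cpoly_differentiable[OF pc(1)])
  have pq2: "partial i (partial i q) \<xi> = partial i (partial i p) (x + \<xi>)" for i \<xi>
    unfolding pq[abs_def] by (rule partial_translate) (intro cpoly_differentiable cpoly_partial pc)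
  have qL: "Laplacian q \<xi> = 0" for \<xi> using pc(3)[of "x + \<xi>"] unfolding Laplacian_def pq2 .
  obtain P d where P: "\<And>k. cpoly (P k)" "\<And>k. homogeneous k (P k)" "\<And>k x. k > d \<Longrightarrow> P k x = 0" "\<And>x. q x = (\<Sum>k\<le>d. P k x)"
    using cpoly_homogeneous_decomposition[OF qc] by metis
  \<comment> \<open>All sums are extended to a common range, which contains both the degrees in \<open>\<eta>\<close> and the exponents up to \<open>M\<close>.\<close>
  define D where "D = d + M"
  have qP: "q \<xi> = (\<Sum>k\<le>Suc D. P k \<xi>)" for \<xi>
    unfolding P(4) by (rule sum.mono_neutral_left) (auto simp: P(3) D_def)
  have Pharm: "P k \<in> harmonic_poly k" if "k \<le> Suc D" for k
    by (rule harmonic_components[OF qc qL P(1,2) qP that])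
  have P0: "P 0 \<xi> = p x" for \<xi>
  proof -
    have "P (Suc k) 0 = 0" for k using P(2)[of "Suc k"] unfolding homogeneous_def by (metis mult_eq_0_iff of_real_0 power_0_Suc scaleR_zero_left)
    then have "q 0 = P 0 0" unfolding qP sum.atMost_shift by simp
    then have "P 0 0 = p x" by (simp add: q_def)
    then show ?thesis using homogeneous_0_const[OF P(2)[of 0]] by (rule trans[rotated])
  qed
  define Q where "Q \<xi> = (\<Sum>k\<le>D. of_real (2 * (-2) ^ k) * (of_real (x \<bullet> \<xi>) ^ k * P (Suc k) \<xi>))" for \<xi>
  have cQ: "cpoly Q" unfolding Q_def[abs_def] by (intro cpoly_sum cpoly.mult cpoly.const cpoly_power cpoly_inner P)
  have quot: "(p x - p (reflection \<xi> x)) / of_real (\<xi> \<bullet> x) = Q \<xi>" if "\<xi> \<bullet> x \<noteq> 0" for \<xi>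
  proof -
    define c where "c = x \<bullet> \<xi>"
    have c0: "c \<noteq> 0" using that by (simp add: c_def inner_commute)
    have "p (reflection \<xi> x) = q ((- 2 * c) *\<^sub>R \<xi>)" by (simp add: q_def reflection_def c_def)
    also have "\<dots> = (\<Sum>k\<le>Suc D. of_real ((- 2 * c) ^ k) * P k \<xi>)"
      unfolding qP using P(2) unfolding homogeneous_def by (intro sum.cong refl) blast
    also have "\<dots> = p x + (\<Sum>k\<le>D. of_real ((- 2 * c) ^ Suc k) * P (Suc k) \<xi>)"
      unfolding sum.atMost_Suc_shift P0 by simp
    also have "(\<Sum>k\<le>D. of_real ((- 2 * c) ^ Suc k) * P (Suc k) \<xi>) = - of_real c * Q \<xi>"
    proof -
      have "(- 2 * c) ^ Suc k = - c * (2 * (-2) ^ k * c ^ k)" for k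
        unfolding power_Suc power_mult_distrib by simp
      then show ?thesis unfolding Q_def sum_distrib_left c_def[symmetric]
        by (simp only: of_real_mult of_real_minus of_real_power mult.assoc)
    qed
    finally have "p x - p (reflection \<xi> x) = of_real c * Q \<xi>" by simp
    then show ?thesis using c0 by (simp add: c_def inner_commute)
  qed
  \<comment> \<open>Along the ray \<open>\<eta> = t x\<close> the function \<open>\<partial>\<^sub>n p (x + \<eta>)\<close> equals \<open>(1 + t)\<^sup>M \<partial>\<^sub>n p (x)\<close>; compare coefficients of \<open>t\<^sup>k\<close>.\<close>
  have coeff: "partial n (P (Suc k)) x = of_nat (M choose k) * partial n p x" if "k \<le> D" for k
  proof -
    have "(\<Sum>k\<le>D. of_real (t ^ k) * (partial n (P (Suc k)) x - of_nat (M choose k) * partial n p x)) = 0" for t :: real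
    proof -
      have "partial n q (t *\<^sub>R x) = (\<Sum>k\<le>Suc D. partial n (P k) (t *\<^sub>R x))"
        unfolding qP[abs_def] by (rule partial_sum) (intro cpoly_differentiable P)
      also have "\<dots> = (\<Sum>k\<le>D. partial n (P (Suc k)) (t *\<^sub>R x))"
      proof -
        have "P 0 = (\<lambda>\<xi>. p x)" by (rule ext) (rule P0)
        then have "partial n (P 0) (t *\<^sub>R x) = 0" by (simp only: partial_const)
        then show ?thesis unfolding sum.atMost_Suc_shift by simp
      qed
      also have "\<dots> = (\<Sum>k\<le>D. of_real (t ^ k) * partial n (P (Suc k)) x)"
      proof (rule sum.cong[OF refl])
        fix k
        show "partial n (P (Suc k)) (t *\<^sub>R x) = of_real (t ^ k) * partial n (P (Suc k)) x"
          using homogeneous_partial[OF P(1,2), of "Suc k" n] unfolding homogeneous_def diff_Suc_1 by blast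
      qed
      finally have 1: "partial n q (t *\<^sub>R x) = (\<Sum>k\<le>D. of_real (t ^ k) * partial n (P (Suc k)) x)" .
      have "partial n q (t *\<^sub>R x) = partial n p ((1 + t) *\<^sub>R x)"
        unfolding pq by (simp add: scaleR_add_left)
      also have "\<dots> = of_real ((1 + t) ^ M) * partial n p x"
        using homogeneous_partial[OF pc(1,2), of n] unfolding homogeneous_def m diff_Suc_1 by blast
      also have "(1 + t) ^ M = (\<Sum>k\<le>M. real (M choose k) * t ^ k)"
        using binomial_ring[of t 1 M] by (simp add: add.commute)
      also have "\<dots> = (\<Sum>k\<le>D. real (M choose k) * t ^ k)"
        by (rule sum.mono_neutral_left) (auto simp: D_def)
      finally have 2: "partial n q (t *\<^sub>R x) = (\<Sum>k\<le>D. of_real (t ^ k) * (of_nat (M choose k) * partial n p x))"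
        unfolding of_real_sum sum_distrib_right by (simp only: of_real_mult of_real_of_nat_eq mult_ac)
      show ?thesis unfolding right_diff_distrib sum_subtractf 1[symmetric] 2[symmetric] by simp
    qed
    from real_polynomial_coeffs_zero[OF this that] show ?thesis by simp
  qed
  have "(LINT \<xi>|sphere_measure. of_real (\<xi> $ n) * Q \<xi>) =
     (LINT \<xi>|sphere_measure. (\<Sum>k\<le>D. of_real (2 * (-2) ^ k) * (of_real (\<xi> $ n) * (of_real (x \<bullet> \<xi>) ^ k * P (Suc k) \<xi>))))"
    unfolding Q_def sum_distrib_left by (intro Bochner_Integration.integral_cong refl sum.cong) (simp only: mult_ac)
  also have "\<dots> = (\<Sum>k\<le>D. (LINT \<xi>|sphere_measure. of_real (2 * (-2) ^ k) * (of_real (\<xi> $ n) * (of_real (x \<bullet> \<xi>) ^ k * P (Suc k) \<xi>))))"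
    by (intro Bochner_Integration.integral_sum integrable_sphere_cpoly cpoly.mult cpoly.const cpoly.coord cpoly_power cpoly_inner P)
  also have "\<dots> = (\<Sum>k\<le>D. of_real ((-2) ^ k * fact k * real (M choose k) / (\<Prod>i\<le>k. real CARD('n) + 2 * real i)) * (of_real (2 * sphere_vol TYPE('n)) * partial n p x))"
  proof (rule sum.cong[OF refl])
    fix k assume k: "k \<in> {..D}"
    have h: "P (Suc k) \<in> harmonic_poly (Suc k)" using Pharm[of "Suc k"] k by simp
    show "(LINT \<xi>|sphere_measure. of_real (2 * (-2) ^ k) * (of_real (\<xi> $ n) * (of_real (x \<bullet> \<xi>) ^ k * P (Suc k) \<xi>))) =
      of_real ((-2) ^ k * fact k * real (M choose k) / (\<Prod>i\<le>k. real CARD('n) + 2 * real i)) * (of_real (2 * sphere_vol TYPE('n)) * partial n p x)"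
      unfolding integral_mult_right_zero sphere_moment_harmonic[OF h] using coeff[of k] k by (simp add: mult_ac)
  qed
  also have "\<dots> = of_real (\<Sum>k\<le>D. (-2) ^ k * fact k * real (M choose k) / (\<Prod>i\<le>k. real CARD('n) + 2 * real i)) * (of_real (2 * sphere_vol TYPE('n)) * partial n p x)"
    unfolding sum_distrib_right[symmetric] of_real_sum ..
  also have "(\<Sum>k\<le>D. (-2) ^ k * fact k * real (M choose k) / (\<Prod>i\<le>k. real CARD('n) + 2 * real i)) =
     (\<Sum>k\<le>M. (-2) ^ k * fact k * real (M choose k) / (\<Prod>i\<le>k. real CARD('n) + 2 * real i))"
    by (rule sum.mono_neutral_right) (auto simp: D_def)
  also have "\<dots> = 1 / (real CARD('n) + 2 * real M)" by (rule alternating_sum_identity) simp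
  also have "of_real (1 / (real CARD('n) + 2 * real M)) * (of_real (2 * sphere_vol TYPE('n)) * partial n p x) = of_real (2 * sphere_vol TYPE('n)) * lowering n m p x"
    unfolding lowering_def m by (simp add: algebra_simps)
  finally show ?thesis using cQ quot by blast
qed

section \<open>Density of the test functions\<close>

text \<open>The span of the products \<open>|x|\<^sup>2\<^sup>j p\<close> with \<open>p\<close> harmonic; by \<open>harmonic_span_cpoly\<close> it consists of all polynomials.\<close>
inductive harmonic_span :: "(real^'n::finite \<Rightarrow> complex) \<Rightarrow> bool" where
  base: "p \<in> harmonic_poly m \<Longrightarrow> harmonic_span (\<lambda>x. of_real ((norm x)\<^sup>2) ^ j * p x)"
| add: "harmonic_span P \<Longrightarrow> harmonic_span Q \<Longrightarrow> harmonic_span (\<lambda>x. P x + Q x)"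

lemma harmonic_span_cmult: "harmonic_span Q \<Longrightarrow> harmonic_span (\<lambda>x. c * Q x)"
proof (induction rule: harmonic_span.induct)
  case (base p m j)
  have "harmonic_span (\<lambda>x. of_real ((norm x)\<^sup>2) ^ j * (c * p x))"
    by (rule harmonic_span.base[OF harmonic_poly_cmult[OF base]])
  then show ?case by (simp only: mult.left_commute[of _ c])
next
  case (add P Q)
  then show ?case using harmonic_span.add[OF add.IH] by (simp only: distrib_left)
qed

text \<open>This is again the decomposition \<open>x\<^sub>n p = q\<^sub>+ + |x|\<^sup>2 q\<^sub>-\<close>.\<close>
lemma harmonic_span_coord: "harmonic_span Q \<Longrightarrow> harmonic_span (\<lambda>x. of_real (x $ n) * Q x)"
proof (induction rule: harmonic_span.induct)
  case (base p m j)
  have "(\<lambda>x. of_real (x $ n) * (of_real ((norm x)\<^sup>2) ^ j * p x)) =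
    (\<lambda>x. of_real ((norm x)\<^sup>2) ^ j * (of_real (x $ n) * p x - of_real ((norm x)\<^sup>2) * lowering n m p x) +
         of_real ((norm x)\<^sup>2) ^ Suc j * lowering n m p x)"
    unfolding power_Suc by (rule ext) (simp only: right_diff_distrib mult.assoc mult.left_commute diff_add_cancel)
  then show ?case
    using harmonic_span.add[OF harmonic_span.base[OF raising_harmonic[OF base, of n], of j] harmonic_span.base[OF lowering_harmonic[OF base, of n], of "Suc j"]]
    by (simp only:)
next
  case (add P Q)
  then show ?case using harmonic_span.add[OF add.IH] by (simp only: distrib_left)
qed

lemma harmonic_span_mult: "cpoly P \<Longrightarrow> harmonic_span Q \<Longrightarrow> harmonic_span (\<lambda>x. P x * Q x)"
proof (induction arbitrary: Q rule: cpoly.induct)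
  case (const c)
  then show ?case by (rule harmonic_span_cmult)
next
  case (coord k)
  then show ?case by (rule harmonic_span_coord)
next
  case (add p q)
  from harmonic_span.add[OF add.IH(1)[OF add.prems] add.IH(2)[OF add.prems]] show ?case by (simp only: distrib_right)
next
  case (mult p q)
  from mult.IH(1)[OF mult.IH(2)[OF mult.prems]] show ?case by (simp only: mult.assoc)
qed

lemma harmonic_span_cpoly:
  assumes "cpoly P"
  shows "harmonic_span P"
proof -
  have "(\<lambda>_. 1) \<in> (harmonic_poly 0 :: (real^'a \<Rightarrow> complex) set)"
    unfolding harmonic_poly_iff by (auto simp: homogeneous_def intro: cpoly.const)
  from harmonic_span.base[OF this, of 0] have "harmonic_span (\<lambda>_::real^'a. 1)" by simp
  from harmonic_span_mult[OF assms this] show ?thesis by simp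
qed

lemma integral_affine:
  fixes g :: "'a::euclidean_space \<Rightarrow> complex"
  assumes [measurable]: "g \<in> borel_measurable borel" and "c > 0"
  shows "(LINT x|lborel. g x) = of_real (c ^ DIM('a)) * (LINT z|lborel. g (y + c *\<^sub>R z))"
proof -
  have "(LINT x|lborel. g x) = (LINT x|density (distr lborel borel (\<lambda>x. y + c *\<^sub>R x)) (\<lambda>_. ennreal (c ^ DIM('a))). g x)"
    using lborel_affine[of c y] \<open>c > 0\<close> by simp
  also have "\<dots> = (LINT x|distr lborel borel (\<lambda>x. y + c *\<^sub>R x). c ^ DIM('a) *\<^sub>R g x)"
    using \<open>c > 0\<close> by (intro integral_density) auto
  also have "\<dots> = (LINT z|lborel. c ^ DIM('a) *\<^sub>R g (y + c *\<^sub>R z))"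
    by (rule integral_distr) measurable
  also have "\<dots> = of_real (c ^ DIM('a)) * (LINT z|lborel. g (y + c *\<^sub>R z))"
    unfolding scaleR_conv_of_real by (rule integral_mult_right_zero)
  finally show ?thesis .
qed

text \<open>Normalised Gaussians centred at \<open>y\<close> with variance tending to zero form an approximate identity.\<close>
lemma gauss_orthogonal_imp_zero:
  fixes v :: "real^'n::finite \<Rightarrow> complex"
  assumes v: "continuous_on UNIV v" "\<And>x. cmod (v x) \<le> B"
    and int0: "\<And>i::nat. (LINT x|lborel. v x * of_real (exp (- (real i / 2) * (norm (x - y))\<^sup>2))) = 0"
  shows "v y = 0"
proof -
  have [measurable]: "v \<in> borel_measurable borel" using v(1) by (rule borel_measurable_continuous_onI)
  note [measurable] = gauss_measurable
  \<comment> \<open>The substitution \<open>x = y + c z\<close> turns the Gaussian of parameter \<open>i + 1\<close> into the standard one.\<close>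
  define c where "c i = 1 / sqrt (real (Suc i))" for i
  have c: "c i > 0" "(c i)\<^sup>2 * real (Suc i) = 1" for i by (auto simp: c_def power_divide)
  have zero: "(LINT z|lborel. gauss_pow 0 z * v (y + c i *\<^sub>R z)) = 0" for i
  proof -
    have "0 = of_real (c i ^ DIM(real^'n)) * (LINT z|lborel. v (y + c i *\<^sub>R z) * of_real (exp (- (real (Suc i) / 2) * (norm (y + c i *\<^sub>R z - y))\<^sup>2)))"
      using integral_affine[of "\<lambda>x. v x * of_real (exp (- (real (Suc i) / 2) * (norm (x - y))\<^sup>2))" "c i" y] int0[of "Suc i"] c(1)[of i] by simp
    then have "(LINT z|lborel. v (y + c i *\<^sub>R z) * of_real (exp (- (real (Suc i) / 2) * (norm (y + c i *\<^sub>R z - y))\<^sup>2))) = 0"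
      using c(1)[of i] by simp
    moreover have "of_real (exp (- (real (Suc i) / 2) * (norm (y + c i *\<^sub>R z - y))\<^sup>2)) = gauss_pow 0 z" for z
    proof -
      have "(real (Suc i) / 2) * (norm (y + c i *\<^sub>R z - y))\<^sup>2 = ((c i)\<^sup>2 * real (Suc i)) * (norm z)\<^sup>2 / 2"
        by (simp add: power_mult_distrib)
      also have "\<dots> = (norm z)\<^sup>2 / 2" unfolding c(2) by simp
      finally have "- (real (Suc i) / 2) * (norm (y + c i *\<^sub>R z - y))\<^sup>2 = - (1 / 2) * (norm z)\<^sup>2" by linarith
      then show ?thesis unfolding gauss_eq by (simp only:)
    qed
    ultimately show ?thesis by (simp only: mult.commute)
  qed
  have "(\<lambda>i. LINT z|lborel. gauss_pow 0 z * v (y + c i *\<^sub>R z)) \<longlonglongrightarrow> (LINT z::real^'n|lborel. gauss_pow 0 z * v y)"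
  proof (rule integral_dominated_convergence[where w = "\<lambda>z::real^'n. B * cmod (gauss_pow 0 z)"])
    show "integrable lborel (\<lambda>z::real^'n. B * cmod (gauss_pow 0 z))"
      using integrable_gauss_mult[OF cpoly.const[of 1]] by (intro integrable_mult_right integrable_norm) simp
    show "AE z in lborel. cmod (gauss_pow 0 z * v (y + c i *\<^sub>R z)) \<le> B * cmod (gauss_pow 0 z)" for i
      unfolding norm_mult mult.commute[of B] by (intro AE_I2 mult_left_mono v) auto
    have "c \<longlonglongrightarrow> 0" unfolding c_def by real_asymp
    then have "(\<lambda>i. y + c i *\<^sub>R z) \<longlonglongrightarrow> y + 0 *\<^sub>R z" for z by (intro tendsto_intros)
    then have "(\<lambda>i. v (y + c i *\<^sub>R z)) \<longlonglongrightarrow> v y" for z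
      using continuous_on_tendsto_compose[OF v(1), of "\<lambda>i. y + c i *\<^sub>R z" y sequentially] by simp
    then show "AE z in lborel. (\<lambda>i. gauss_pow 0 z * v (y + c i *\<^sub>R z)) \<longlonglongrightarrow> gauss_pow 0 z * v y"
      by (intro AE_I2 tendsto_intros)
  qed measurable
  then have "(LINT z::real^'n|lborel. gauss_pow 0 z * v y) = 0" unfolding zero LIMSEQ_const_iff by (rule sym)
  then have "gauss_int (\<lambda>_::real^'n. v y * 1) = 0" by (simp add: gauss_int_def)
  then have "v y * gauss_int (\<lambda>_::real^'n. 1) = 0" by (simp only: gauss_int_cmult)
  then show ?thesis using gauss_int_one_nonzero by (metis mult_eq_0_iff)
qed

text \<open>Formally one expands the Gaussian centred at \<open>y\<close> into its power series, every term of which is a polynomial. Dominated convergence needs \<open>v\<close> to absorb the exponential of the absolute values of the exponent, and a function bounded by \<open>exp(-|x|\<^sup>2/2)\<close> can do so only for a small exponent. Therefore the Gaussian is built up in \<open>j\<close> steps, each of which multiplies by \<open>exp(-|x - y|\<^sup>2/8)\<close>.\<close>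
lemma polynomial_orthogonal_imp_gauss_orthogonal:
  fixes v :: "real^'n::finite \<Rightarrow> complex"
  assumes [measurable]: "v \<in> borel_measurable borel"
    and bound: "\<And>P. cpoly P \<Longrightarrow> integrable lborel (\<lambda>x. v x * (of_real (exp ((norm x)\<^sup>2 / 4)) * P x))"
    and orth: "\<And>P. cpoly P \<Longrightarrow> (LINT x|lborel. v x * P x) = 0"
    and P: "cpoly P"
  shows "(LINT x|lborel. v x * (of_real (exp (- real j * ((norm (x - y))\<^sup>2 / 8))) * P x)) = 0"
  using P
proof (induction j arbitrary: P)
  case 0
  then show ?case using orth by simp
next
  case (Suc j)
  note [measurable] = cpoly_measurable[OF Suc.prems]
  define q where "q x = (norm (x - y))\<^sup>2 / 8" for x :: "real^'n"
  have q0: "q x \<ge> 0" for x by (simp add: q_def)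
  have cq: "cpoly (\<lambda>x. complex_of_real (q x))"
  proof -
    have "complex_of_real (q x) = of_real (1 / 8) * (of_real ((norm x)\<^sup>2) - of_real (2 * (y \<bullet> x)) + of_real ((norm y)\<^sup>2))" for x
      unfolding of_real_mult[symmetric] of_real_diff[symmetric] of_real_add[symmetric] q_def
      by (intro arg_cong[of _ _ complex_of_real]) (simp add: power2_norm_eq_inner inner_diff_left inner_diff_right inner_commute[of x y] field_simps)
    moreover have "cpoly (\<lambda>x. of_real (1 / 8) * (of_real ((norm x)\<^sup>2) - of_real (2 * (y \<bullet> x)) + of_real ((norm y)\<^sup>2)))"
      unfolding of_real_mult[of 2] by (intro cpoly.mult cpoly.const cpoly.add cpoly_diff cpoly_norm_sq cpoly_inner)
    ultimately show ?thesis by (simp only:)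
  qed
  have qb: "q x \<le> (norm x)\<^sup>2 / 4 + (norm y)\<^sup>2 / 4" for x
  proof -
    have "(norm (x - y))\<^sup>2 \<le> (norm x + norm y)\<^sup>2" by (intro power_mono norm_triangle_ineq4) auto
    also have "\<dots> \<le> 2 * (norm x)\<^sup>2 + 2 * (norm y)\<^sup>2"
      using zero_le_power2[of "norm x - norm y"] by (simp add: power2_eq_square algebra_simps)
    finally show ?thesis by (simp add: q_def)
  qed
  have [measurable]: "q \<in> borel_measurable borel" unfolding q_def by measurable
  let ?E = "\<lambda>x. complex_of_real (exp (- real j * q x))"
  let ?S = "\<lambda>k x. \<Sum>i<k. complex_of_real ((- q x) ^ i /\<^sub>R fact i)"
  have term0: "(LINT x|lborel. v x * (?E x * (?S k x * P x))) = 0" for k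
  proof -
    have "complex_of_real (\<Sum>i<k. (- q x) ^ i /\<^sub>R fact i) = (\<Sum>i<k. of_real (inverse (fact i) * (-1) ^ i) * of_real (q x) ^ i)" for x
      unfolding of_real_sum by (intro sum.cong refl) (simp add: power_minus[of "q x"])
    moreover have "cpoly (\<lambda>x. \<Sum>i<k. of_real (inverse (fact i) * (-1) ^ i) * of_real (q x) ^ i)"
      by (intro cpoly_sum cpoly.mult cpoly.const cpoly_power cq)
    ultimately have "cpoly (?S k)" unfolding of_real_sum by (simp only:)
    from Suc.IH[OF cpoly.mult[OF this Suc.prems]] show ?thesis by (simp only: q_def)
  qed
  have "(\<lambda>k. LINT x|lborel. v x * (?E x * (?S k x * P x))) \<longlonglongrightarrow> (LINT x|lborel. v x * (?E x * (of_real (exp (- q x)) * P x)))"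
  proof (rule integral_dominated_convergence[where w = "\<lambda>x. cmod (of_real (exp ((norm y)\<^sup>2 / 4)) * (v x * (of_real (exp ((norm x)\<^sup>2 / 4)) * P x)))"])
    show "integrable lborel (\<lambda>x. cmod (of_real (exp ((norm y)\<^sup>2 / 4)) * (v x * (of_real (exp ((norm x)\<^sup>2 / 4)) * P x))))"
      by (intro integrable_norm integrable_mult_right bound Suc.prems)
    show "AE x in lborel. (\<lambda>k. v x * (?E x * (?S k x * P x))) \<longlonglongrightarrow> v x * (?E x * (of_real (exp (- q x)) * P x))"
    proof (intro AE_I2 tendsto_intros)
      fix x
      have "(\<lambda>k. \<Sum>i<k. (- q x) ^ i /\<^sub>R fact i) \<longlonglongrightarrow> exp (- q x)"
        using exp_converges[of "- q x"] by (simp only: sums_def)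
      from tendsto_of_real[OF this, where 'a = complex] show "(\<lambda>k. ?S k x) \<longlonglongrightarrow> of_real (exp (- q x))" by (simp only: of_real_sum)
    qed
    show "AE x in lborel. norm (v x * (?E x * (?S k x * P x))) \<le> cmod (of_real (exp ((norm y)\<^sup>2 / 4)) * (v x * (of_real (exp ((norm x)\<^sup>2 / 4)) * P x)))" for k
    proof (rule AE_I2)
      fix x
      have "cmod (?S k x) \<le> (\<Sum>i<k. cmod (of_real ((- q x) ^ i /\<^sub>R fact i)))" by (rule norm_sum)
      also have "\<dots> = (\<Sum>i<k. q x ^ i /\<^sub>R fact i)"
        using q0[of x] by (intro sum.cong refl) (simp only: norm_of_real, simp add: abs_mult power_abs)
      also have "\<dots> \<le> (\<Sum>i. q x ^ i /\<^sub>R fact i)" using q0[of x] by (intro sum_le_suminf summable_exp_generic) auto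
      also have "\<dots> = exp (q x)" by (simp add: exp_def)
      also have "\<dots> \<le> exp ((norm x)\<^sup>2 / 4 + (norm y)\<^sup>2 / 4)" using qb by simp
      finally have S: "cmod (?S k x) \<le> exp ((norm x)\<^sup>2 / 4) * exp ((norm y)\<^sup>2 / 4)" by (simp only: exp_add)
      have E: "cmod (?E x) \<le> 1" using q0[of x] by (simp add: mult_nonneg_nonneg)
      have "norm (v x * (?E x * (?S k x * P x))) = cmod (v x) * (cmod (?E x) * cmod (?S k x)) * cmod (P x)" by (simp only: norm_mult mult.assoc)
      also have "\<dots> \<le> cmod (v x) * (1 * (exp ((norm x)\<^sup>2 / 4) * exp ((norm y)\<^sup>2 / 4))) * cmod (P x)"
        by (intro mult_left_mono mult_right_mono mult_mono E S) auto
      also have "\<dots> = cmod (of_real (exp ((norm y)\<^sup>2 / 4)) * (v x * (of_real (exp ((norm x)\<^sup>2 / 4)) * P x)))"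
        by (simp add: norm_mult mult_ac)
      finally show "norm (v x * (?E x * (?S k x * P x))) \<le> cmod (of_real (exp ((norm y)\<^sup>2 / 4)) * (v x * (of_real (exp ((norm x)\<^sup>2 / 4)) * P x)))" .
    qed
  qed measurable
  then have "(LINT x|lborel. v x * (?E x * (of_real (exp (- q x)) * P x))) = 0"
    unfolding term0 LIMSEQ_const_iff by (rule sym)
  moreover have "?E x * (of_real (exp (- q x)) * P x) = of_real (exp (- real (Suc j) * ((norm (x - y))\<^sup>2 / 8))) * P x" for x
  proof -
    have "exp (- real j * q x) * exp (- q x) = exp (- real (Suc j) * q x)"
      unfolding exp_add[symmetric] by (simp add: algebra_simps)
    then show ?thesis unfolding q_def mult.assoc[symmetric] of_real_mult[symmetric] by (simp only:)
  qed
  ultimately show ?case by (simp only:)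
qed

lemma powr_add_even:
  fixes r :: real
  assumes "r > 0"
  shows "r powr (a + 2 * real K) = r powr a * (r\<^sup>2) ^ K"
proof -
  have "r powr real (2 * K) = r ^ (2 * K)" by (rule powr_realpow[OF assms])
  then have "r powr (2 * real K) = (r\<^sup>2) ^ K" by (simp add: power_mult)
  then show ?thesis by (simp only: powr_add)
qed

text \<open>The function \<open>v = |x|\<^sup>2\<^sup>b h |x|\<^sup>2\<^sup>K exp(-|x|\<^sup>2/2)\<close> is orthogonal to all products \<open>|x|\<^sup>2\<^sup>j p\<close>, hence to all polynomials, hence to all Gaussians, so it vanishes. The exponent \<open>2 b + 2 K\<close> is positive in order that \<open>v\<close> be bounded and continuous also at the origin.\<close>
lemma test_functions_dense:
  fixes h :: "real^'n::finite \<Rightarrow> complex"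
  assumes b: "b > - real CARD('n) / 2" and K: "2 * b + 2 * real K > 0" "K > 0"
    and h: "continuous_on UNIV h" "\<And>x. cmod (h x) \<le> C"
    and orth: "\<And>j m p. p \<in> harmonic_poly m \<Longrightarrow> (LINT x|lborel. of_real (norm x powr (2 * b)) * (h x * test_fun (K + j) p x)) = 0"
  shows "h x = 0"
proof -
  have hm[measurable]: "h \<in> borel_measurable borel" using h(1) by (rule borel_measurable_continuous_onI)
  define v where "v x = of_real (norm x powr (2 * b)) * (h x * gauss_pow K x)" for x
  have gpK: "gauss_pow K = (\<lambda>x::real^'n. gauss_pow 0 x * of_real ((norm x)\<^sup>2) ^ K)" by (rule ext) (rule gauss_pow_eq)
  have cK: "cpoly (\<lambda>x::real^'n. of_real ((norm x)\<^sup>2) ^ K)" by (intro cpoly_power cpoly_norm_sq)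
  have gpm[measurable]: "gauss_pow K \<in> borel_measurable (borel :: (real^'n) measure)"
    using gauss_measurable cpoly_measurable[OF cK] unfolding gpK by (intro borel_measurable_times)
  have vm[measurable]: "v \<in> borel_measurable borel" unfolding v_def by measurable
  have C0: "C \<ge> 0" using h(2)[of 0] by (rule order_trans[OF norm_ge_zero])
  have bound: "integrable lborel (\<lambda>x. v x * (of_real (exp ((norm x)\<^sup>2 / 4)) * P x))" if P: "cpoly P" for P
  proof -
    note [measurable] = cpoly_measurable[OF P]
    have "rapid (\<lambda>x. h x * (of_real (exp (- (1 / 4) * (norm x)\<^sup>2)) * (of_real ((norm x)\<^sup>2) ^ K * P x)))"
      by (rule rapid_mult_bounded[OF _ h(2)]) (intro rapid_gauss_cpoly cpoly.mult cK P, simp)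
    then have "integrable lborel (\<lambda>x. of_real (norm x powr (2 * b)) * (h x * (of_real (exp (- (1 / 4) * (norm x)\<^sup>2)) * (of_real ((norm x)\<^sup>2) ^ K * P x))))"
      using b cpoly_measurable[OF cK] by (intro integrable_powr_rapid) auto
    moreover have "of_real (norm x powr (2 * b)) * (h x * (of_real (exp (- (1 / 4) * (norm x)\<^sup>2)) * (of_real ((norm x)\<^sup>2) ^ K * P x))) =
       v x * (of_real (exp ((norm x)\<^sup>2 / 4)) * P x)" for x
    proof -
      have "- (1 / 4) * (norm x)\<^sup>2 = - (1 / 2) * (norm x)\<^sup>2 + (norm x)\<^sup>2 / 4" by linarith
      then have "exp (- (1 / 4) * (norm x)\<^sup>2) = exp (- (1 / 2) * (norm x)\<^sup>2) * exp ((norm x)\<^sup>2 / 4)"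
        by (simp only: exp_add)
      then show ?thesis unfolding v_def gpK gauss_eq by (simp only: of_real_mult mult_ac)
    qed
    ultimately show ?thesis by (simp only:)
  qed
  have int: "integrable lborel (\<lambda>x. v x * P x)" if P: "cpoly P" for P
  proof (rule Bochner_Integration.integrable_bound[OF bound[OF P]])
    show "(\<lambda>x. v x * P x) \<in> borel_measurable lborel" using cpoly_measurable[OF P] by measurable
    have "cmod (P x) \<le> exp ((norm x)\<^sup>2 / 4) * cmod (P x)" for x
      using mult_right_mono[of 1 "exp ((norm x)\<^sup>2 / 4)" "cmod (P x)"] by simp
    then show "AE x in lborel. norm (v x * P x) \<le> norm (v x * (of_real (exp ((norm x)\<^sup>2 / 4)) * P x))"
      by (intro AE_I2) (simp add: norm_mult mult_left_mono)
  qed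
  have span0: "cpoly P \<and> (LINT x|lborel. v x * P x) = 0" if "harmonic_span P" for P
    using that
  proof (induction rule: harmonic_span.induct)
    case (base p m j)
    have "v x * (of_real ((norm x)\<^sup>2) ^ j * p x) = of_real (norm x powr (2 * b)) * (h x * test_fun (K + j) p x)" for x
      unfolding v_def test_fun_def gauss_pow_eq[of K] gauss_pow_eq[of "K + j"] power_add by (simp only: mult_ac)
    then have "(LINT x|lborel. v x * (of_real ((norm x)\<^sup>2) ^ j * p x)) = 0" using orth[OF base, of j] by (simp only:)
    moreover have "cpoly p" using base by (simp add: harmonic_poly_iff)
    ultimately show ?case by (intro conjI cpoly.mult cpoly_power cpoly_norm_sq)
  next
    case (add P Q)
    then have "(LINT x|lborel. v x * (P x + Q x)) = (LINT x|lborel. v x * P x) + (LINT x|lborel. v x * Q x)"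
      unfolding distrib_left by (intro Bochner_Integration.integral_add int) auto
    then show ?case using add by (auto intro: cpoly.add)
  qed
  have orth': "(LINT x|lborel. v x * P x) = 0" if "cpoly P" for P using span0[OF harmonic_span_cpoly[OF that]] ..
  have vcont: "continuous_on UNIV v"
  proof -
    have "v x = of_real (norm x powr (2 * b + 2 * real K)) * (h x * gauss_pow 0 x)" for x
    proof (cases "x = 0")
      case True
      then show ?thesis using K by (simp add: v_def gauss_pow_def)
    next
      case False
      then have "norm x powr (2 * b + 2 * real K) = norm x powr (2 * b) * ((norm x)\<^sup>2) ^ K"
        by (intro powr_add_even) simp
      then show ?thesis unfolding v_def gpK by (simp only: of_real_mult of_real_power mult_ac)
    qed
    then have "v = (\<lambda>x. of_real (norm x powr (2 * b + 2 * real K)) * (h x * gauss_pow 0 x))" by (rule ext)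
    moreover have "continuous_on UNIV (\<lambda>x. of_real (norm x powr (2 * b + 2 * real K)) * (h x * gauss_pow 0 x))"
      using K by (intro continuous_intros h continuous_gauss continuous_on_powr') auto
    ultimately show ?thesis by (simp only:)
  qed
  have vbound: "\<exists>B. \<forall>x. cmod (v x) \<le> B"
  proof -
    obtain j :: nat where j: "real j \<ge> 2 * b + 2 * real K" using real_arch_simple by blast
    obtain B where B: "\<And>x::real^'n. norm x ^ j * norm (complex_of_real (exp (- (1/2) * (norm x)\<^sup>2))) \<le> B"
      using rapidE[OF rapid_gauss[of "1/2"], of j] by (metis half_gt_zero zero_less_one)
    have "cmod (v x) \<le> C * (1 + B)" for x
    proof (cases "x = 0")
      case True
      have "0 \<le> B" using B[of 0] by (rule order_trans[rotated]) simp
      then show ?thesis using True C0 K by (simp add: v_def gauss_pow_def)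
    next
      case False
      have "norm x powr (2 * b) * ((norm x)\<^sup>2) ^ K = norm x powr (2 * b + 2 * real K)"
        using False by (intro powr_add_even[symmetric]) simp
      also have "\<dots> \<le> 1 + norm x ^ j"
      proof (cases "norm x \<le> 1")
        case True
        then have "norm x powr (2 * b + 2 * real K) \<le> 1 powr (2 * b + 2 * real K)" using K by (intro powr_mono2) auto
        then show ?thesis by (simp add: add_increasing2)
      next
        case False
        then have "norm x powr (2 * b + 2 * real K) \<le> norm x powr (real j)" using j by (intro powr_mono) auto
        also have "\<dots> = norm x ^ j" using False by (intro powr_realpow) (auto intro: less_trans[OF zero_less_one])
        finally show ?thesis by simp
      qed
      finally have 1: "norm x powr (2 * b) * ((norm x)\<^sup>2) ^ K \<le> 1 + norm x ^ j" .
      have "cmod (v x) = cmod (h x) * ((norm x powr (2 * b) * ((norm x)\<^sup>2) ^ K) * exp (- (1/2) * (norm x)\<^sup>2))"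
        unfolding v_def gpK gauss_eq norm_mult norm_of_real norm_power by (simp add: mult_ac)
      also have "\<dots> \<le> C * ((1 + norm x ^ j) * exp (- (1/2) * (norm x)\<^sup>2))"
        using C0 by (intro mult_mono h 1) auto
      also have "\<dots> \<le> C * (1 + B)"
        using C0 B[of x] by (intro mult_left_mono) (auto simp: distrib_right intro!: add_mono)
      finally show ?thesis .
    qed
    then show ?thesis by blast
  qed
  then obtain B where B: "\<And>x. cmod (v x) \<le> B" by blast
  have v0: "v y = 0" for y
  proof (rule gauss_orthogonal_imp_zero[OF vcont B])
    fix i :: nat
    have "(LINT x|lborel. v x * (of_real (exp (- real (4 * i) * ((norm (x - y))\<^sup>2 / 8))) * 1)) = 0"
      by (rule polynomial_orthogonal_imp_gauss_orthogonal[OF vm bound orth' cpoly.const])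
    moreover have "- real (4 * i) * ((norm (x - y))\<^sup>2 / 8) = - (real i / 2) * (norm (x - y))\<^sup>2" for x by simp
    ultimately show "(LINT x|lborel. v x * of_real (exp (- (real i / 2) * (norm (x - y))\<^sup>2))) = 0"
      by (simp only: mult_1_right)
  qed
  have "h x = 0" if "x \<noteq> 0" for x
    using v0[of x] that by (simp add: v_def gauss_pow_def)
  then have "AE x in lborel. h x = 0"
    using AE_lborel_singleton[of "0::real^'n"] by (auto elim!: eventually_mono)
  from continuous_AE_zero[OF h(1) this] show ?thesis .
qed

section \<open>Reflections\<close>

lemma linear_reflection: "linear (reflection \<xi>)"
  unfolding reflection_def by (intro linearI) (simp_all add: algebra_simps inner_add_left)

lemma reflection_inner:
  assumes "norm \<xi> = 1"
  shows "reflection \<xi> x \<bullet> reflection \<xi> y = x \<bullet> y"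
proof -
  have "\<xi> \<bullet> \<xi> = 1" using assms by (simp add: dot_square_norm)
  then show ?thesis unfolding reflection_def by (simp add: inner_simps inner_commute algebra_simps)
qed

lemma orthogonal_reflection: "norm \<xi> = 1 \<Longrightarrow> orthogonal_transformation (reflection \<xi>)"
  unfolding orthogonal_transformation_def using linear_reflection reflection_inner by blast

lemma norm_reflection: "norm \<xi> = 1 \<Longrightarrow> norm (reflection \<xi> x) = norm x"
  using reflection_inner[of \<xi> x x] by (simp add: norm_eq_sqrt_inner)

lemma reflection_reflection: "norm \<xi> = 1 \<Longrightarrow> reflection \<xi> (reflection \<xi> x) = x"
proof -
  assume "norm \<xi> = 1"
  then have "\<xi> \<bullet> \<xi> = 1" by (simp add: dot_square_norm)
  then show ?thesis unfolding reflection_def by (simp add: inner_diff_left algebra_simps)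
qed

lemma inner_reflection: "norm \<xi> = 1 \<Longrightarrow> reflection \<xi> x \<bullet> \<xi> = - (x \<bullet> \<xi>)"
  unfolding reflection_def by (simp add: inner_diff_left dot_square_norm)

lemma continuous_reflection: "continuous_on A (reflection \<xi>)"
  unfolding reflection_def by (intro continuous_intros)

lemma reflection_scaleR: "reflection \<xi> (r *\<^sub>R x) = r *\<^sub>R reflection \<xi> x"
  by (rule linear_scale[OF linear_reflection])

section \<open>Relabelling coordinates by a well-ordered index type\<close>

text \<open>The change of variables formula and the images of Lebesgue measure under orthogonal maps involve determinants, for which the coordinates are indexed by a well-ordered type. This copy of \<open>'n\<close> inherits the order of the natural numbers; renaming coordinates transports the results back to \<open>'n\<close>.\<close>
typedef ('n::finite) ordered_index = "{..<CARD('n)}"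
  by (rule exI[of _ 0]) simp

instantiation ordered_index :: (finite) wellorder
begin

definition less_eq_ordered_index :: "'a ordered_index \<Rightarrow> 'a ordered_index \<Rightarrow> bool" where
  "x \<le> y \<longleftrightarrow> Rep_ordered_index x \<le> Rep_ordered_index y"

definition less_ordered_index :: "'a ordered_index \<Rightarrow> 'a ordered_index \<Rightarrow> bool" where
  "x < y \<longleftrightarrow> Rep_ordered_index x < Rep_ordered_index y"

instance
proof
  fix P :: "'a ordered_index \<Rightarrow> bool" and a :: "'a ordered_index"
  assume step: "\<And>x. (\<And>y. y < x \<Longrightarrow> P y) \<Longrightarrow> P x"
  show "P a"
    by (induction "Rep_ordered_index a" arbitrary: a rule: less_induct)
      (rule step, simp add: less_ordered_index_def)
qed (auto simp: less_eq_ordered_index_def less_ordered_index_def Rep_ordered_index_inject)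

end

instance ordered_index :: (finite) finite
proof
  have "(UNIV :: 'a ordered_index set) = Abs_ordered_index ` {..<CARD('a)}"
    using type_definition.Abs_image[OF type_definition_ordered_index] by blast
  then show "finite (UNIV :: 'a ordered_index set)" by (metis finite_imageI finite_lessThan)
qed

lemma card_ordered_index: "CARD('n::finite ordered_index) = CARD('n)"
  using type_definition.card[OF type_definition_ordered_index] by simp

definition relabel :: "('n \<Rightarrow> 'm) \<Rightarrow> real^'m::finite \<Rightarrow> real^'n::finite" where
  "relabel h v = (\<chi> i. v $ h i)"

lemma relabel_inner: "bij h \<Longrightarrow> relabel h v \<bullet> relabel h w = v \<bullet> w"
  unfolding relabel_def inner_vec_def by (simp add: sum.reindex_bij_betw[of h UNIV UNIV "\<lambda>j. v $ j * w $ j"])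

lemma relabel_norm: "bij h \<Longrightarrow> norm (relabel h v) = norm v"
  by (simp add: norm_eq_sqrt_inner relabel_inner)

lemma relabel_scaleR: "relabel h (a *\<^sub>R v) = a *\<^sub>R relabel h v"
  and relabel_diff: "relabel h (v - w) = relabel h v - relabel h w"
  by (simp_all add: relabel_def vec_eq_iff)

lemma relabel_sgn: "bij h \<Longrightarrow> relabel h (sgn v) = sgn (relabel h v)"
  by (simp add: sgn_div_norm relabel_scaleR relabel_norm)

lemma relabel_reflection: "bij h \<Longrightarrow> relabel h (reflection \<xi> v) = reflection (relabel h \<xi>) (relabel h v)"
  by (simp add: reflection_def relabel_scaleR relabel_diff relabel_inner)

lemma relabel_inverse:
  assumes "bij h" shows "relabel h (relabel (inv_into UNIV h) v) = v" "relabel (inv_into UNIV h) (relabel h w) = w"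
  using assms by (simp_all add: relabel_def vec_eq_iff bij_is_inj bij_is_surj surj_f_inv_f)

lemma continuous_relabel: "continuous_on A (relabel h)"
  unfolding relabel_def by (intro continuous_intros)

lemma measurable_relabel [measurable]: "relabel h \<in> borel_measurable borel"
  by (intro borel_measurable_continuous_onI continuous_relabel)

lemma prod_Basis_vec: "(\<Prod>b\<in>(Basis :: (real^'n::finite) set). w \<bullet> b) = (\<Prod>i\<in>UNIV. w $ i)"
proof -
  have B: "Basis = range (\<lambda>i. axis i (1::real) :: real^'n)" by (auto simp: Basis_vec_def)
  have inj: "inj (\<lambda>i. axis i (1::real) :: real^'n)" by (auto simp: inj_on_def axis_eq_axis)
  show ?thesis unfolding B by (subst prod.reindex[OF inj]) (simp add: inner_axis o_def)
qed

lemma lborel_relabel: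
  fixes h :: "'n::finite \<Rightarrow> 'm::finite"
  assumes h: "bij h"
  shows "distr lborel borel (relabel h) = (lborel :: (real^'n) measure)"
proof (rule lborel_eqI[symmetric])
  fix l u :: "real^'n" assume lu: "\<And>b. b \<in> Basis \<Longrightarrow> l \<bullet> b \<le> u \<bullet> b"
  have le: "l $ i \<le> u $ i" for i using lu[of "axis i 1"] by (simp add: axis_in_Basis_iff inner_axis)
  have ih: "bij (inv_into UNIV h)" using h by (rule bij_imp_bij_inv)
  have "relabel h -` box l u = box (relabel (inv_into UNIV h) l) (relabel (inv_into UNIV h) u)"
  proof (rule Set.set_eqI)
    fix v :: "real^'m"
    have "(\<forall>i. l $ i < v $ h i \<and> v $ h i < u $ i) \<longleftrightarrow> (\<forall>j. l $ inv_into UNIV h j < v $ j \<and> v $ j < u $ inv_into UNIV h j)"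
      using h by (metis bij_inv_eq_iff)
    then show "v \<in> relabel h -` box l u \<longleftrightarrow> v \<in> box (relabel (inv_into UNIV h) l) (relabel (inv_into UNIV h) u)"
      by (simp add: relabel_def mem_box_cart)
  qed
  then have "emeasure (distr lborel borel (relabel h)) (box l u) = emeasure lborel (box (relabel (inv_into UNIV h) l) (relabel (inv_into UNIV h) u))"
    by (subst emeasure_distr) auto
  also have "\<dots> = ennreal (\<Prod>b\<in>Basis. (relabel (inv_into UNIV h) u - relabel (inv_into UNIV h) l) \<bullet> b)"
    by (rule emeasure_lborel_box) (auto simp: Basis_vec_def inner_axis relabel_def le)
  also have "(\<Prod>b\<in>Basis. (relabel (inv_into UNIV h) u - relabel (inv_into UNIV h) l) \<bullet> b) = (\<Prod>j\<in>UNIV. (u - l) $ inv_into UNIV h j)"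
    unfolding prod_Basis_vec by (simp add: relabel_def)
  also have "\<dots> = (\<Prod>i\<in>UNIV. (u - l) $ i)"
    by (rule prod.reindex_bij_betw[OF ih])
  also have "\<dots> = (\<Prod>b\<in>Basis. (u - l) \<bullet> b)" by (simp only: prod_Basis_vec)
  finally show "emeasure (distr lborel borel (relabel h)) (box l u) = ennreal (\<Prod>b\<in>Basis. (u - l) \<bullet> b)" .
qed simp

lemma ex_relabel: "\<exists>h :: 'n::finite \<Rightarrow> 'n ordered_index. bij h"
  using finite_same_card_bij[of "UNIV :: 'n set" "UNIV :: 'n ordered_index set"] by (simp add: card_ordered_index)

section \<open>Invariance of Lebesgue measure under reflections\<close>

lemma lborel_reflection_wellorder:
  fixes \<xi> :: "real^'m::{finite,wellorder}"
  assumes \<xi>: "norm \<xi> = 1"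
  shows "distr lborel borel (reflection \<xi>) = lborel"
proof (rule lborel_eqI[symmetric])
  fix l u :: "real^'m::_" assume le: "\<And>b. b \<in> Basis \<Longrightarrow> l \<bullet> b \<le> u \<bullet> b"
  have [measurable]: "reflection \<xi> \<in> borel_measurable borel"
    by (intro borel_measurable_continuous_onI continuous_reflection)
  have img: "reflection \<xi> -` box l u = reflection \<xi> ` box l u"
  proof (intro equalityI subsetI)
    fix x assume "x \<in> reflection \<xi> -` box l u"
    then have "reflection \<xi> x \<in> box l u" by simp
    then have "reflection \<xi> (reflection \<xi> x) \<in> reflection \<xi> ` box l u" by (rule imageI)
    then show "x \<in> reflection \<xi> ` box l u" by (simp only: reflection_reflection[OF \<xi>])
  next
    fix x assume "x \<in> reflection \<xi> ` box l u"
    then obtain y where "y \<in> box l u" "x = reflection \<xi> y" by blast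
    then show "x \<in> reflection \<xi> -` box l u" by (simp only: vimage_eq reflection_reflection[OF \<xi>])
  qed
  have "box l u \<in> lmeasurable" by (simp add: lmeasurable_box)
  note m = measurable_orthogonal_image[OF orthogonal_reflection[OF \<xi>] this]
    measure_orthogonal_image[OF orthogonal_reflection[OF \<xi>] this]
  have meas: "reflection \<xi> -` box l u \<in> sets borel" using measurable_sets_borel[of "reflection \<xi>" borel "box l u"] by simp
  have "emeasure (distr lborel borel (reflection \<xi>)) (box l u) = emeasure lborel (reflection \<xi> -` box l u)"
    by (subst emeasure_distr) auto
  also have "\<dots> = emeasure lebesgue (reflection \<xi> -` box l u)"
    using meas unfolding emeasure_completion[OF sets_completionI_sets[OF meas[folded sets_lborel]]] by simp
  also have "\<dots> = ennreal (measure lebesgue (reflection \<xi> ` box l u))"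
    unfolding img by (rule emeasure_eq_measure2[OF m(1)])
  also have "\<dots> = ennreal (measure lborel (box l u))" unfolding m(2) by simp
  also have "\<dots> = ennreal (\<Prod>b\<in>Basis. (u - l) \<bullet> b)" using le by simp
  finally show "emeasure (distr lborel borel (reflection \<xi>)) (box l u) = ennreal (\<Prod>b\<in>Basis. (u - l) \<bullet> b)" .
qed simp

lemma lborel_reflection:
  fixes \<xi> :: "real^'n::finite"
  assumes \<xi>: "norm \<xi> = 1"
  shows "distr lborel borel (reflection \<xi>) = lborel"
proof -
  obtain h :: "'n \<Rightarrow> 'n ordered_index" where h: "bij h" using ex_relabel by blast
  define \<zeta> where "\<zeta> = relabel (inv_into UNIV h) \<xi>"
  have z: "relabel h \<zeta> = \<xi>" unfolding \<zeta>_def by (rule relabel_inverse[OF h])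
  have z1: "norm \<zeta> = 1" using relabel_norm[OF h, of \<zeta>] z \<xi> by simp
  have m1[measurable]: "reflection \<xi> \<in> borel_measurable borel" and m2[measurable]: "reflection \<zeta> \<in> borel_measurable borel"
    by (intro borel_measurable_continuous_onI continuous_reflection)+
  have "distr lborel borel (reflection \<xi>) = distr (distr lborel borel (relabel h)) borel (reflection \<xi>)"
    by (simp only: lborel_relabel[OF h])
  also have "\<dots> = distr lborel borel (reflection \<xi> \<circ> relabel h)" by (intro distr_distr) auto
  also have "reflection \<xi> \<circ> relabel h = relabel h \<circ> reflection \<zeta>"
    by (simp add: fun_eq_iff relabel_reflection[OF h] z)
  also have "distr lborel borel (relabel h \<circ> reflection \<zeta>) = distr (distr lborel borel (reflection \<zeta>)) borel (relabel h)"
    by (intro distr_distr[symmetric]) auto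
  also have "\<dots> = lborel" by (simp only: lborel_reflection_wellorder[OF z1] lborel_relabel[OF h])
  finally show ?thesis .
qed

section \<open>A Jacobian determinant\<close>

text \<open>Add the multiples of \<open>v\<close> to the rows of the identity matrix one at a time. By multilinearity each step adds the determinant of a matrix with one row \<open>v\<close>, in which row operations remove the multiples of \<open>v\<close> from all other rows.\<close>
lemma det_rank_one_update:
  fixes u v :: "real^'n::finite"
  shows "det (matrix (\<lambda>h. h + (v \<bullet> h) *\<^sub>R u)) = 1 + u \<bullet> v"
proof -
  define B where "B S k = ((\<chi> i. if i = k then v else if i \<in> S then axis i 1 + u $ i *s v else axis i 1) :: real^'n^'n)" for S k
  have B0: "det (B {} k) = v $ k" for k
  proof -
    have r: "row i (mat 1 :: real^'n^'n) = axis i 1" for i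
      by (simp add: row_def mat_def axis_def vec_eq_iff)
    have "det (\<chi> i. if i = k then (\<Sum>i\<in>UNIV. v $ i *s row i (mat 1 :: real^'n^'n)) else row i (mat 1)) = v $ k * det (mat 1 :: real^'n^'n)"
      by (rule cramer_lemma_transpose)
    moreover have "B {} k = (\<chi> i. if i = k then v else axis i 1)" by (simp add: B_def cong: if_cong)
    ultimately show ?thesis unfolding r basis_expansion by simp
  qed
  have B: "det (B S k) = v $ k" if "finite S" "k \<notin> S" for S k
    using that
  proof (induction S)
    case empty
    then show ?case by (simp add: B0)
  next
    case (insert s S)
    then have sk: "s \<noteq> k" "k \<notin> S" by auto
    have "B (insert s S) k = (\<chi> i. if i = s then row s (B S k) + u $ s *s row k (B S k) else row i (B S k))"
      using insert(2) sk by (auto simp: B_def row_def vec_eq_iff)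
    then have "det (B (insert s S) k) = det (B S k)" using det_row_operation[OF sk(1)] by simp
    then show ?case using insert.IH[OF sk(2)] by simp
  qed
  define A where "A S = ((\<chi> i. if i \<in> S then axis i 1 + u $ i *s v else axis i 1) :: real^'n^'n)" for S
  have A: "det (A S) = 1 + (\<Sum>i\<in>S. u $ i * v $ i)" if "finite S" for S
    using that
  proof (induction S)
    case empty
    have "A {} = mat 1" by (simp add: A_def mat_def axis_def vec_eq_iff)
    then show ?case by simp
  next
    case (insert k S)
    let ?c = "\<lambda>i. if i \<in> S then axis i 1 + u $ i *s v else axis i 1"
    have "A (insert k S) = (\<chi> i. if i = k then axis i 1 + u $ i *s v else ?c i)"
      by (auto simp: A_def vec_eq_iff)
    then have "det (A (insert k S)) = det ((\<chi> i. if i = k then axis i 1 else ?c i) :: real^'n^'n) + det ((\<chi> i. if i = k then u $ i *s v else ?c i) :: real^'n^'n)"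
      by (simp only: det_row_add)
    also have "((\<chi> i. if i = k then axis i 1 else ?c i) :: real^'n^'n) = A S"
      using insert(2) by (auto simp: A_def vec_eq_iff)
    also have "((\<chi> i. if i = k then u $ i *s v else ?c i) :: real^'n^'n) = (\<chi> i. if i = k then u $ k *s v else ?c i)"
      by (auto simp: vec_eq_iff)
    also have "det (\<dots>) = u $ k * det ((\<chi> i. if i = k then v else ?c i) :: real^'n^'n)"
      by (rule det_row_mul)
    also have "((\<chi> i. if i = k then v else ?c i) :: real^'n^'n) = B S k" by (simp add: B_def)
    finally show ?case using insert B[OF insert(1,2)] by (simp add: algebra_simps)
  qed
  have "matrix (\<lambda>h. h + (v \<bullet> h) *\<^sub>R u) = A UNIV"
  proof -
    have "axis j (1::real) $ i = axis i 1 $ j" for i j :: 'n by (auto simp: axis_def)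
    then have "axis j 1 $ i + v $ j * u $ i = axis i 1 $ j + u $ i * v $ j" for i j
      by (simp only: mult.commute)
    then show ?thesis unfolding A_def matrix_def vec_eq_iff by (simp add: inner_axis)
  qed
  then show ?thesis using A[of UNIV] by (simp add: inner_vec_def)
qed

text \<open>The linear map is the derivative at \<open>x\<close> of \<open>|x|\<^sup>2 e - 2 \<langle>e, x\<rangle> x\<close>. It is \<open>-2 \<langle>e, x\<rangle>\<close> times a perturbation of the identity of rank two, which factors into two perturbations of rank one.\<close>
lemma det_quadratic_reflection_map:
  fixes e x :: "real^'n::finite"
  assumes e: "norm e = 1" and c: "e \<bullet> x \<noteq> 0"
  shows "det (matrix (\<lambda>h. (2 * (x \<bullet> h)) *\<^sub>R e - (2 * (e \<bullet> h)) *\<^sub>R x - (2 * (e \<bullet> x)) *\<^sub>R h)) =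
    (- 2 * (e \<bullet> x)) ^ CARD('n) * ((norm x)\<^sup>2 / (e \<bullet> x)\<^sup>2)"
proof -
  define c where "c = e \<bullet> x"
  have c0: "c \<noteq> 0" using assms by (simp add: c_def)
  have ee: "e \<bullet> e = 1" using e by (simp add: dot_square_norm)
  \<comment> \<open>The vectors \<open>u\<close> and \<open>w\<close> solve \<open>L2 (L1 h) = h - (\<langle>x, h\<rangle> / c) e + (\<langle>e, h\<rangle> / c) x\<close>.\<close>
  define u where "u = (- 1 / c) *\<^sub>R e + (1 / (2 * c\<^sup>2)) *\<^sub>R x"
  define w where "w = (1 / c) *\<^sub>R x"
  define L1 where "L1 h = h + (x \<bullet> h) *\<^sub>R u" for h
  define L2 where "L2 h = h + (e \<bullet> h) *\<^sub>R w" for h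
  have lin: "linear L1" "linear L2" unfolding L1_def L2_def
    by (intro linearI; simp add: algebra_simps inner_simps)+
  have eu: "e \<bullet> u = - 1 / (2 * c)"
    using c0 by (simp add: u_def inner_simps ee c_def[symmetric] field_simps power2_eq_square)
  have eq: "(\<lambda>h. (2 * (x \<bullet> h)) *\<^sub>R e - (2 * (e \<bullet> h)) *\<^sub>R x - (2 * (e \<bullet> x)) *\<^sub>R h) = (*\<^sub>R) (- 2 * c) \<circ> (L2 \<circ> L1)"
  proof
    fix h
    have "L2 (L1 h) = h - ((x \<bullet> h) / c) *\<^sub>R e + ((e \<bullet> h) / c) *\<^sub>R x"
    proof -
      have "L2 (L1 h) = h + (x \<bullet> h) *\<^sub>R u + (e \<bullet> h + (x \<bullet> h) * (- 1 / (2 * c))) *\<^sub>R w"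
        by (simp add: L1_def L2_def inner_simps eu)
      also have "\<dots> = h - ((x \<bullet> h) / c) *\<^sub>R e + ((x \<bullet> h) / (2 * c\<^sup>2) + (e \<bullet> h + (x \<bullet> h) * (- 1 / (2 * c))) / c) *\<^sub>R x"
      proof -
        have "h + s *\<^sub>R u + t *\<^sub>R w = h - (s / c) *\<^sub>R e + (s / (2 * c\<^sup>2) + t / c) *\<^sub>R x" for s t
          unfolding u_def w_def by (simp add: algebra_simps)
        then show ?thesis .
      qed
      also have "(x \<bullet> h) / (2 * c\<^sup>2) + (e \<bullet> h + (x \<bullet> h) * (- 1 / (2 * c))) / c = (e \<bullet> h) / c"
        using c0 by (simp add: field_simps power2_eq_square)
      finally show ?thesis .
    qed
    then have "(- 2 * c) *\<^sub>R L2 (L1 h) = (- 2 * c) *\<^sub>R (h - ((x \<bullet> h) / c) *\<^sub>R e + ((e \<bullet> h) / c) *\<^sub>R x)"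
      by (simp only:)
    also have "\<dots> = (2 * (x \<bullet> h)) *\<^sub>R e - (2 * (e \<bullet> h)) *\<^sub>R x - (2 * c) *\<^sub>R h"
      unfolding scaleR_diff_right scaleR_add_right scaleR_scaleR using c0 by simp
    finally show "(2 * (x \<bullet> h)) *\<^sub>R e - (2 * (e \<bullet> h)) *\<^sub>R x - (2 * (e \<bullet> x)) *\<^sub>R h = ((*\<^sub>R) (- 2 * c) \<circ> (L2 \<circ> L1)) h"
      by (simp add: c_def)
  qed
  have "det (matrix ((*\<^sub>R) (- 2 * c) \<circ> (L2 \<circ> L1))) = (- 2 * c) ^ CARD('n) * (det (matrix L2) * det (matrix L1))"
    unfolding matrix_compose[OF linear_compose[OF lin] linear_scale_self] matrix_compose[OF lin] det_mul
    by (simp only: det_matrix_scaleR)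
  also have "det (matrix L2) = 2"
    unfolding L2_def det_rank_one_update using c0 by (simp add: w_def inner_commute c_def)
  also have "det (matrix L1) = (norm x)\<^sup>2 / (2 * c\<^sup>2)"
    unfolding L1_def det_rank_one_update using c0
    by (simp add: u_def inner_simps c_def[symmetric] power2_norm_eq_inner)
  finally have F: "det (matrix ((*\<^sub>R) (- 2 * c) \<circ> (L2 \<circ> L1))) = (- 2 * c) ^ CARD('n) * (2 * ((norm x)\<^sup>2 / (2 * c\<^sup>2)))" .
  show ?thesis unfolding eq unfolding c_def[symmetric] F by simp
qed

section \<open>The law of a random reflection of a fixed point\<close>

lemma measurable_reflection_arg [measurable]: "(\<lambda>\<xi>. reflection \<xi> x) \<in> borel_measurable borel"
  unfolding reflection_def by (intro borel_measurable_continuous_onI continuous_intros)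

text \<open>The polynomial map on the left applies the reflection in the direction of \<open>x\<close> to \<open>e\<close> and squares the radius. Being quadratic, it is smooth and easy to differentiate, unlike \<open>reflection (sgn x) e\<close> alone.\<close>
lemma quadratic_reflection_map_eq:
  fixes e x :: "real^'n::finite"
  shows "(norm x)\<^sup>2 *\<^sub>R e - (2 * (e \<bullet> x)) *\<^sub>R x = (norm x)\<^sup>2 *\<^sub>R reflection (sgn x) e"
proof -
  have "r\<^sup>2 *\<^sub>R e - (2 * (e \<bullet> (r *\<^sub>R s))) *\<^sub>R (r *\<^sub>R s) = r\<^sup>2 *\<^sub>R reflection s e" for r and s :: "real^'n"
    by (simp add: reflection_def scaleR_diff_right power2_eq_square mult_ac)
  from this[of "norm x" "sgn x"] show ?thesis by (simp only: norm_sgn_eq_self)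
qed

text \<open>Change of variables for \<open>\<Psi> x = |x|\<^sup>2 e - 2 \<langle>e, x\<rangle> x\<close>. Since \<open>\<sigma>\<^sub>\<xi> = \<sigma>\<^sub>-\<^sub>\<xi>\<close>, the map is injective only on a half ball \<open>\<langle>e, x\<rangle> > 0\<close>, which it maps onto the unit ball without the ray through \<open>e\<close>. As \<open>|\<Psi> x| = |x|\<^sup>2\<close> and \<open>|e - sgn (\<Psi> x)| = 2 \<langle>e, x\<rangle> / |x|\<close>, the Jacobian determinant can be expressed by \<open>\<Psi> x\<close>; its inverse is the density on the right.\<close>
lemma emeasure_half_ball_reflection_wellorder:
  fixes e :: "real^'m::{finite,wellorder}"
  assumes e: "norm e = 1" and A[measurable]: "A \<in> sets borel"
  shows "emeasure lborel {x. norm x < 1 \<and> e \<bullet> x > 0 \<and> reflection (sgn x) e \<in> A} =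
    (\<integral>\<^sup>+y. indicator {y. y \<noteq> 0 \<and> norm y < 1 \<and> sgn y \<noteq> e} y *
      ennreal (indicator A (sgn y) * (norm (e - sgn y) powr (2 - real CARD('m)) * norm y powr (- real CARD('m) / 2) / 4)) \<partial>lborel)"
proof -
  let ?N = "real CARD('m)"
  define U where "U = {x. norm x < 1 \<and> e \<bullet> x > 0}"
  define T where "T = {x. norm x < 1 \<and> e \<bullet> x > 0 \<and> reflection (sgn x) e \<in> A}"
  define \<Psi> where "\<Psi> x = (norm x)\<^sup>2 *\<^sub>R e - (2 * (e \<bullet> x)) *\<^sub>R x" for x
  define \<Psi>' where "\<Psi>' x = (\<lambda>h. (2 * (x \<bullet> h)) *\<^sub>R e - (2 * (e \<bullet> h)) *\<^sub>R x - (2 * (e \<bullet> x)) *\<^sub>R h)" for x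
  define g where "g y = indicator A (sgn y) * (norm (e - sgn y) powr (2 - ?N) * norm y powr (- ?N / 2) / 4)" for y :: "real^'m::_"
  have TU: "T \<subseteq> U" by (auto simp: T_def U_def)
  have [measurable]: "U \<in> sets borel" "T \<in> sets borel" unfolding U_def T_def by measurable
  have Tb: "emeasure lborel T < \<infinity>"
  proof -
    have "emeasure lborel T \<le> emeasure lborel (ball (0::real^'m::_) 1)" by (intro emeasure_mono) (auto simp: T_def)
    then show ?thesis using emeasure_lborel_ball_finite[of "0::real^'m::_" 1] by (simp add: le_less_trans)
  qed
  have U0: "x \<noteq> 0" "e \<bullet> x > 0" "norm x < 1" if "x \<in> U" for x using that by (auto simp: U_def)
  have Psi: "\<Psi> x = (norm x)\<^sup>2 *\<^sub>R reflection (sgn x) e" if "x \<noteq> 0" for x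
    unfolding \<Psi>_def by (rule quadratic_reflection_map_eq)
  have nr: "norm (reflection (sgn x) e) = 1" if "x \<noteq> 0" for x
    using that e by (simp add: norm_reflection norm_sgn)
  have nPsi: "norm (\<Psi> x) = (norm x)\<^sup>2" "sgn (\<Psi> x) = reflection (sgn x) e" if "x \<noteq> 0" for x
    using that nr[OF that] by (simp_all add: Psi sgn_div_norm)
  have der: "(\<Psi> has_derivative \<Psi>' x) (at x within U)" for x
  proof -
    have "((\<lambda>x. (x \<bullet> x) *\<^sub>R e - (2 * (e \<bullet> x)) *\<^sub>R x) has_derivative
      (\<lambda>h. (x \<bullet> h + h \<bullet> x) *\<^sub>R e - ((2 * (e \<bullet> x)) *\<^sub>R h + (2 * (e \<bullet> h)) *\<^sub>R x))) (at x within U)"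
      by (auto intro!: derivative_eq_intros)
    then show ?thesis unfolding \<Psi>_def \<Psi>'_def power2_norm_eq_inner
      by (simp add: inner_commute algebra_simps)
  qed
  have inj: "inj_on \<Psi> U"
  proof (rule inj_onI)
    fix x y assume x: "x \<in> U" and y: "y \<in> U" and eq: "\<Psi> x = \<Psi> y"
    have "(norm x)\<^sup>2 = (norm y)\<^sup>2" using nPsi(1)[OF U0(1)[OF x]] nPsi(1)[OF U0(1)[OF y]] eq by simp
    then have "2 *\<^sub>R ((e \<bullet> x) *\<^sub>R x) = 2 *\<^sub>R ((e \<bullet> y) *\<^sub>R y)" using eq unfolding \<Psi>_def by simp
    then have eq2: "(e \<bullet> x) *\<^sub>R x = (e \<bullet> y) *\<^sub>R y" by (rule scaleR_left_imp_eq[rotated]) simp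
    then have "e \<bullet> ((e \<bullet> x) *\<^sub>R x) = e \<bullet> ((e \<bullet> y) *\<^sub>R y)" by (simp only:)
    then have "(e \<bullet> x)\<^sup>2 = (e \<bullet> y)\<^sup>2" by (simp add: power2_eq_square)
    then have "e \<bullet> x = e \<bullet> y" using U0[OF x] U0[OF y] by (simp add: power2_eq_iff_nonneg)
    then show "x = y" using eq2 U0(2)[OF y] by simp
  qed
  have image: "\<Psi> ` U = {y. y \<noteq> 0 \<and> norm y < 1 \<and> sgn y \<noteq> e}"
  proof (intro Set.set_eqI iffI)
    fix y assume "y \<in> \<Psi> ` U"
    then obtain x where x: "x \<in> U" "y = \<Psi> x" by blast
    note u = U0[OF x(1)]
    have "reflection (sgn x) e \<noteq> e"
      using u by (simp add: reflection_def sgn_div_norm)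
    moreover have "(norm x)\<^sup>2 < 1" using u by (simp add: abs_square_less_1)
    moreover have "y \<noteq> 0" using nPsi(1)[OF u(1)] u(1) x(2) by auto
    ultimately show "y \<in> {y. y \<noteq> 0 \<and> norm y < 1 \<and> sgn y \<noteq> e}" using nPsi[OF u(1)] x(2) by simp
  next
    fix y assume "y \<in> {y. y \<noteq> 0 \<and> norm y < 1 \<and> sgn y \<noteq> e}"
    then have y: "y \<noteq> 0" "norm y < 1" "sgn y \<noteq> e" by auto
    define \<eta> where "\<eta> = sgn y"
    have n1: "\<eta> \<bullet> \<eta> = 1" "e \<bullet> e = 1" using y(1) e by (simp_all add: \<eta>_def dot_square_norm norm_sgn)
    \<comment> \<open>The hyperplane that exchanges \<open>e\<close> and \<open>\<eta>\<close> is orthogonal to \<open>e - \<eta>\<close>; this gives the preimage.\<close>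
    define d where "d = e - \<eta>"
    have d0: "d \<noteq> 0" using y(3) by (auto simp: d_def \<eta>_def)
    have dd: "d \<bullet> d = 2 * (e \<bullet> d)" by (simp add: d_def inner_simps n1 inner_commute)
    have ed: "e \<bullet> d > 0" using dd d0 by (metis inner_gt_zero_iff zero_less_mult_pos zero_less_numeral)
    define x where "x = sqrt (norm y) *\<^sub>R sgn d"
    have nx: "norm x = sqrt (norm y)" using d0 by (simp add: x_def norm_sgn)
    have "sgn (sgn d) = sgn d" using d0 by (simp add: sgn_div_norm[of "sgn d"] norm_sgn)
    then have sx: "sgn x = sgn d" using y(1) by (simp add: x_def sgn_scaleR)
    have ex: "e \<bullet> x > 0" using ed d0 y(1) by (simp add: x_def sgn_div_norm)
    have x0: "x \<noteq> 0" using ex by auto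
    have "reflection (sgn d) e = e - (2 * (e \<bullet> d) / (d \<bullet> d)) *\<^sub>R d"
      by (simp add: reflection_def sgn_div_norm dot_square_norm power2_eq_square divide_inverse mult_ac)
    also have "\<dots> = \<eta>" using d0 unfolding dd[symmetric] by (simp add: d_def)
    finally have "\<Psi> x = norm y *\<^sub>R \<eta>" unfolding Psi[OF x0] sx nx by simp
    then have "\<Psi> x = y" unfolding \<eta>_def by (simp only: norm_sgn_eq_self)
    moreover have "x \<in> U" using ex nx y(2) by (simp add: U_def)
    ultimately show "y \<in> \<Psi> ` U" by blast
  qed
  have key: "\<bar>det (matrix (\<Psi>' x))\<bar> * g (\<Psi> x) = indicator T x" if x: "x \<in> U" for x
  proof -
    note u = U0[OF x]
    define c where "c = e \<bullet> x"
    have c: "c > 0" using u(2) by (simp add: c_def)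
    have nx: "norm x > 0" using u(1) by simp
    have D: "\<bar>det (matrix (\<Psi>' x))\<bar> = (2 * c) ^ CARD('m) * ((norm x)\<^sup>2 / c\<^sup>2)"
      unfolding \<Psi>'_def using det_quadratic_reflection_map[OF e, of x] c
      by (simp add: c_def[symmetric] abs_mult power_abs)
    have E: "norm (e - sgn (\<Psi> x)) = 2 * c / norm x"
      using c nx unfolding nPsi(2)[OF u(1)] by (simp add: reflection_def sgn_div_norm c_def[symmetric] divide_inverse)
    have F: "(2 * c / norm x) powr (2 - ?N) * ((norm x)\<^sup>2) powr (- ?N / 2) / 4 * ((2 * c) ^ CARD('m) * ((norm x)\<^sup>2 / c\<^sup>2)) = 1"
    proof -
      have 1: "(2 * c / norm x) powr (2 - ?N) = ((2 * c) ^ 2 / (2 * c) ^ CARD('m)) / ((norm x)\<^sup>2 / norm x ^ CARD('m))"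
        using c nx by (simp add: powr_divide powr_diff powr_realpow)
      have 2: "((norm x)\<^sup>2) powr (- ?N / 2) = 1 / norm x ^ CARD('m)"
      proof -
        have "((norm x)\<^sup>2) powr (- ?N / 2) = (norm x powr real 2) powr (- ?N / 2)"
          using powr_realpow[OF nx, of 2] by (simp only:)
        also have "\<dots> = norm x powr (- ?N)" unfolding powr_powr by simp
        also have "\<dots> = 1 / norm x ^ CARD('m)" using nx by (simp add: powr_minus powr_realpow divide_inverse)
        finally show ?thesis .
      qed
      show ?thesis unfolding 1 2 using c nx by (simp add: field_simps power2_eq_square)
    qed
    have gP: "g (\<Psi> x) = indicator A (reflection (sgn x) e) * ((2 * c / norm x) powr (2 - ?N) * ((norm x)\<^sup>2) powr (- ?N / 2) / 4)"
      unfolding g_def E unfolding nPsi[OF u(1)] by (rule refl)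
    have rot: "r * (a * s) = a * (s * r)" for a r s :: real by (simp only: mult_ac)
    have "\<bar>det (matrix (\<Psi>' x))\<bar> * g (\<Psi> x) = indicator A (reflection (sgn x) e)"
      unfolding D gP by (rule trans[OF rot], unfold F, rule mult_1_right)
    then show ?thesis using x by (auto simp: T_def U_def indicator_def)
  qed
  \<comment> \<open>The change of variables formula concerns vector-valued functions; \<open>real^1\<close> stands for the reals.\<close>
  define f where "f y = g y *\<^sub>R (1 :: real^1)" for y
  have fU: "\<bar>det (matrix (\<Psi>' x))\<bar> *\<^sub>R f (\<Psi> x) = indicat_real T x *\<^sub>R 1" if "x \<in> U" for x
    using key[OF that] by (simp add: f_def)
  have Tint: "integrable lebesgue (\<lambda>x. indicat_real T x *\<^sub>R (1 :: real^1))"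
    using Tb by (intro integrable_scaleR_left integrable_real_indicator) (auto simp: less_top)
  have ind: "indicat_real U x *\<^sub>R (indicat_real T x *\<^sub>R (1 :: real^1)) = indicat_real T x *\<^sub>R 1" for x
    using TU by (auto simp: indicator_def)
  have abs1: "(\<lambda>x. indicat_real T x *\<^sub>R (1 :: real^1)) absolutely_integrable_on U"
    unfolding set_integrable_def ind by (rule Tint)
  have "integral U (\<lambda>x. indicat_real T x *\<^sub>R (1 :: real^1)) = (LINT x:U|lebesgue. indicat_real T x *\<^sub>R (1 :: real^1))"
    by (rule set_lebesgue_integral_eq_integral(2)[OF abs1, symmetric])
  also have "\<dots> = measure lebesgue T *\<^sub>R 1"
    unfolding set_lebesgue_integral_def ind using Tb
    by (subst integral_scaleR_left) (auto simp: integrable_indicator_iff less_top)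
  finally have int1: "integral U (\<lambda>x. indicat_real T x *\<^sub>R (1 :: real^1)) = measure lborel T *\<^sub>R 1" by simp
  have "(\<lambda>x. \<bar>det (matrix (\<Psi>' x))\<bar> *\<^sub>R f (\<Psi> x)) absolutely_integrable_on U \<and>
      integral U (\<lambda>x. \<bar>det (matrix (\<Psi>' x))\<bar> *\<^sub>R f (\<Psi> x)) = measure lborel T *\<^sub>R 1"
    using abs1 int1 fU by (simp cong: integral_cong set_integrable_cong)
  then have "f absolutely_integrable_on (\<Psi> ` U) \<and> integral (\<Psi> ` U) f = measure lborel T *\<^sub>R 1"
    by (subst (asm) has_absolute_integral_change_of_variables[OF _ der inj]) auto
  then have "(f has_integral (measure lborel T *\<^sub>R 1)) (\<Psi> ` U)"
    using set_lebesgue_integral_eq_integral(1) by (metis integrable_integral)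
  from has_integral_linear[OF this bounded_linear_vec_nth[of 1]]
  have "(g has_integral measure lborel T) (\<Psi> ` U)" by (simp add: f_def o_def)
  then have "(\<integral>\<^sup>+y. ennreal (indicator (\<Psi> ` U) y * g y) \<partial>lborel) = ennreal (measure lborel T)"
    by (rule nn_integral_has_integral_lebesgue[rotated]) (simp add: g_def)
  also have "ennreal (measure lborel T) = emeasure lborel T"
    using Tb by (intro emeasure_eq_ennreal_measure[symmetric]) simp
  finally have "emeasure lborel T = (\<integral>\<^sup>+y. indicator (\<Psi> ` U) y * ennreal (g y) \<partial>lborel)"
    by (simp add: ennreal_mult' ennreal_indicator[symmetric])
  then show ?thesis unfolding image T_def g_def .
qed

lemma emeasure_half_ball_reflection:
  fixes e :: "real^'n::finite"
  assumes e: "norm e = 1" and A[measurable]: "A \<in> sets borel"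
  shows "emeasure lborel {x. norm x < 1 \<and> e \<bullet> x > 0 \<and> reflection (sgn x) e \<in> A} =
    (\<integral>\<^sup>+y. indicator {y. y \<noteq> 0 \<and> norm y < 1 \<and> sgn y \<noteq> e} y *
      ennreal (indicator A (sgn y) * (norm (e - sgn y) powr (2 - real CARD('n)) * norm y powr (- real CARD('n) / 2) / 4)) \<partial>lborel)"
proof -
  obtain h :: "'n \<Rightarrow> 'n ordered_index" where h: "bij h" using ex_relabel by blast
  define e' where "e' = relabel (inv_into UNIV h) e"
  have ee: "relabel h e' = e" unfolding e'_def by (rule relabel_inverse[OF h])
  have e1: "norm e' = 1" using relabel_norm[OF h, of e'] ee e by simp
  define A' where "A' = relabel h -` A"
  have A'[measurable]: "A' \<in> sets borel" unfolding A'_def using measurable_sets_borel[OF measurable_relabel A, of h] by simp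
  have inner: "e \<bullet> relabel h x = e' \<bullet> x" for x using relabel_inner[OF h, of e' x] by (simp only: ee)
  have refl: "reflection (sgn (relabel h x)) e \<in> A \<longleftrightarrow> reflection (sgn x) e' \<in> A'" for x
    using relabel_reflection[OF h, of "sgn x" e'] by (simp add: A'_def relabel_sgn[OF h] ee)
  have zero: "relabel h x = 0 \<longleftrightarrow> x = 0" for x using relabel_norm[OF h, of x] by (metis norm_eq_zero)
  have sgne: "sgn (relabel h x) = e \<longleftrightarrow> sgn x = e'" for x
    unfolding relabel_sgn[OF h, symmetric] ee[symmetric] using relabel_inverse(2)[OF h] by metis
  have dist: "norm (e - sgn (relabel h x)) = norm (e' - sgn x)" for x
    unfolding relabel_sgn[OF h, symmetric] ee[symmetric] relabel_diff[symmetric] by (rule relabel_norm[OF h])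
  have "emeasure lborel {x. norm x < 1 \<and> e \<bullet> x > 0 \<and> reflection (sgn x) e \<in> A} =
      emeasure (distr lborel borel (relabel h)) {x. norm x < 1 \<and> e \<bullet> x > 0 \<and> reflection (sgn x) e \<in> A}"
    by (simp only: lborel_relabel[OF h])
  also have "\<dots> = emeasure lborel (relabel h -` {x. norm x < 1 \<and> e \<bullet> x > 0 \<and> reflection (sgn x) e \<in> A})"
    by (subst emeasure_distr) auto
  also have "relabel h -` {x. norm x < 1 \<and> e \<bullet> x > 0 \<and> reflection (sgn x) e \<in> A} =
      {x. norm x < 1 \<and> e' \<bullet> x > 0 \<and> reflection (sgn x) e' \<in> A'}"
    by (simp only: vimage_Collect_eq relabel_norm[OF h] inner refl)
  also have "emeasure lborel \<dots> = (\<integral>\<^sup>+y. indicator {y. y \<noteq> 0 \<and> norm y < 1 \<and> sgn y \<noteq> e'} y *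
      ennreal (indicator A' (sgn y) * (norm (e' - sgn y) powr (2 - real CARD('n)) * norm y powr (- real CARD('n) / 2) / 4)) \<partial>lborel)"
    using emeasure_half_ball_reflection_wellorder[OF e1 A'] by (simp only: card_ordered_index)
  also have "\<dots> = (\<integral>\<^sup>+x. indicator {y. y \<noteq> 0 \<and> norm y < 1 \<and> sgn y \<noteq> e} (relabel h x) *
      ennreal (indicator A (sgn (relabel h x)) * (norm (e - sgn (relabel h x)) powr (2 - real CARD('n)) * norm (relabel h x) powr (- real CARD('n) / 2) / 4)) \<partial>lborel)"
  proof (rule nn_integral_cong)
    fix x
    have "indicator A' (sgn x) = indicat_real A (sgn (relabel h x))"
      by (simp add: indicator_def A'_def relabel_sgn[OF h])
    moreover have "indicator {y. y \<noteq> 0 \<and> norm y < 1 \<and> sgn y \<noteq> e'} x = (indicator {y. y \<noteq> 0 \<and> norm y < 1 \<and> sgn y \<noteq> e} (relabel h x) :: ennreal)"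
      by (simp only: indicator_def mem_Collect_eq zero relabel_norm[OF h] sgne)
    ultimately show "indicator {y. y \<noteq> 0 \<and> norm y < 1 \<and> sgn y \<noteq> e'} x *
      ennreal (indicator A' (sgn x) * (norm (e' - sgn x) powr (2 - real CARD('n)) * norm x powr (- real CARD('n) / 2) / 4)) =
      indicator {y. y \<noteq> 0 \<and> norm y < 1 \<and> sgn y \<noteq> e} (relabel h x) *
      ennreal (indicator A (sgn (relabel h x)) * (norm (e - sgn (relabel h x)) powr (2 - real CARD('n)) * norm (relabel h x) powr (- real CARD('n) / 2) / 4))"
      by (simp only: dist relabel_norm[OF h])
  qed
  also have "\<dots> = (\<integral>\<^sup>+y. indicator {y. y \<noteq> 0 \<and> norm y < 1 \<and> sgn y \<noteq> e} y *
      ennreal (indicator A (sgn y) * (norm (e - sgn y) powr (2 - real CARD('n)) * norm y powr (- real CARD('n) / 2) / 4)) \<partial>distr lborel borel (relabel h))"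
    by (subst nn_integral_distr) auto
  finally show ?thesis by (simp only: lborel_relabel[OF h])
qed

text \<open>The mass of \<open>A\<close> under the image measure is the volume of a cone over the set of \<open>\<xi>\<close> with \<open>\<sigma>\<^sub>\<xi> e \<in> A\<close>, that is, of two opposite half cones of equal volume. The half cone is evaluated by \<open>emeasure_half_ball_reflection\<close> and polar coordinates. For \<open>N = 1\<close> and \<open>\<xi> = \<plusminus>1\<close> the image is concentrated at \<open>-e\<close>; there \<open>|e - \<eta>| = 2\<close> gives the mass \<open>2\<close> of both points, and the value \<open>0 powr 1 = 0\<close> the mass zero of \<open>e\<close>.\<close>
lemma distr_reflection_sphere:
  fixes e :: "real^'n::finite"
  assumes e: "norm e = 1"
  shows "distr sphere_measure borel (\<lambda>\<xi>. reflection \<xi> e) =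
    density sphere_measure (\<lambda>\<eta>. ennreal (norm (e - \<eta>) powr (2 - real CARD('n))))"
proof (rule measure_eqI)
  fix A assume "A \<in> sets (distr sphere_measure borel (\<lambda>\<xi>. reflection \<xi> e))"
  then have A[measurable]: "A \<in> sets borel" by simp
  let ?N = "real CARD('n)"
  define J where "J = (\<integral>\<^sup>+\<eta>. ennreal (norm (e - \<eta>) powr (2 - ?N)) * indicator A \<eta> \<partial>(sphere_measure :: (real^'n) measure))"
  define T where "T = {x. norm x < 1 \<and> e \<bullet> x > 0 \<and> reflection (sgn x) e \<in> A}"
  define T' where "T' = {x. norm x < 1 \<and> e \<bullet> x < 0 \<and> reflection (sgn x) e \<in> A}"
  have [measurable]: "T \<in> sets borel" "T' \<in> sets borel" unfolding T_def T'_def by measurable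
  have "emeasure lborel T = (\<integral>\<^sup>+y. indicator {y. y \<noteq> 0 \<and> norm y < 1 \<and> sgn y \<noteq> e} y *
      ennreal (indicator A (sgn y) * (norm (e - sgn y) powr (2 - ?N) * norm y powr (- ?N / 2) / 4)) \<partial>lborel)"
    unfolding T_def by (rule emeasure_half_ball_reflection[OF e A])
  also have "\<dots> = (\<integral>\<^sup>+r. ennreal (r powr (?N - 1)) * indicator {0..} r * (\<integral>\<^sup>+\<xi>. indicator {y. y \<noteq> 0 \<and> norm y < 1 \<and> sgn y \<noteq> e} (r *\<^sub>R \<xi>) *
      ennreal (indicator A (sgn (r *\<^sub>R \<xi>)) * (norm (e - sgn (r *\<^sub>R \<xi>)) powr (2 - ?N) * norm (r *\<^sub>R \<xi>) powr (- ?N / 2) / 4)) \<partial>(sphere_measure :: (real^'n) measure)) \<partial>lborel)"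
    by (rule nn_integral_polar) measurable
  also have "\<dots> = (\<integral>\<^sup>+r. ennreal (r powr (?N / 2 - 1) / 4) * indicator {0..1} r * J \<partial>lborel)"
  proof (rule nn_integral_cong_AE)
    have inner: "(\<integral>\<^sup>+\<xi>. indicator {y. y \<noteq> 0 \<and> norm y < 1 \<and> sgn y \<noteq> e} (r *\<^sub>R \<xi>) *
      ennreal (indicator A (sgn (r *\<^sub>R \<xi>)) * (norm (e - sgn (r *\<^sub>R \<xi>)) powr (2 - ?N) * norm (r *\<^sub>R \<xi>) powr (- ?N / 2) / 4)) \<partial>(sphere_measure :: (real^'n) measure)) =
      indicator {..<1} r * ennreal (r powr (- ?N / 2) / 4) * J" if r: "r > 0" for r
    proof -
      have "(\<integral>\<^sup>+\<xi>. indicator {y. y \<noteq> 0 \<and> norm y < 1 \<and> sgn y \<noteq> e} (r *\<^sub>R \<xi>) *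
        ennreal (indicator A (sgn (r *\<^sub>R \<xi>)) * (norm (e - sgn (r *\<^sub>R \<xi>)) powr (2 - ?N) * norm (r *\<^sub>R \<xi>) powr (- ?N / 2) / 4)) \<partial>(sphere_measure :: (real^'n) measure)) =
        (\<integral>\<^sup>+\<xi>. (indicator {..<1} r * ennreal (r powr (- ?N / 2) / 4)) * (ennreal (norm (e - \<xi>) powr (2 - ?N)) * indicator A \<xi>) \<partial>(sphere_measure :: (real^'n) measure))"
      proof (rule nn_integral_cong_AE, use AE_sphere_measure_norm in eventually_elim)
        case (elim \<xi>)
        have s: "sgn (r *\<^sub>R \<xi>) = \<xi>" "norm (r *\<^sub>R \<xi>) = r" "r *\<^sub>R \<xi> \<noteq> 0"
          using r elim by (auto simp: sgn_scaleR sgn_div_norm)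
        show ?case unfolding s(1,2) indicator_def mem_Collect_eq using s(3)
          by (auto simp: ennreal_mult'[symmetric] mult_ac)
      qed
      also have "\<dots> = (indicator {..<1} r * ennreal (r powr (- ?N / 2) / 4)) * J"
        unfolding J_def by (rule nn_integral_cmult) measurable
      finally show ?thesis .
    qed
    show "AE r in lborel. ennreal (r powr (?N - 1)) * indicator {0..} r * (\<integral>\<^sup>+\<xi>. indicator {y. y \<noteq> 0 \<and> norm y < 1 \<and> sgn y \<noteq> e} (r *\<^sub>R \<xi>) *
      ennreal (indicator A (sgn (r *\<^sub>R \<xi>)) * (norm (e - sgn (r *\<^sub>R \<xi>)) powr (2 - ?N) * norm (r *\<^sub>R \<xi>) powr (- ?N / 2) / 4)) \<partial>(sphere_measure :: (real^'n) measure)) =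
      ennreal (r powr (?N / 2 - 1) / 4) * indicator {0..1} r * J"
      using AE_lborel_singleton[of "0::real"] AE_lborel_singleton[of "1::real"]
    proof eventually_elim
      case (elim r)
      show ?case
      proof (cases "r > 0")
        case True
        have "ennreal (r powr (?N - 1)) * ennreal (r powr (- ?N / 2) / 4) = ennreal (r powr (?N - 1 + - ?N / 2) / 4)"
          unfolding powr_add by (subst ennreal_mult'[symmetric]) auto
        also have "?N - 1 + - ?N / 2 = ?N / 2 - 1" by simp
        finally have "ennreal (r powr (?N - 1)) * ennreal (r powr (- ?N / 2) / 4) = ennreal (r powr (?N / 2 - 1) / 4)" .
        then show ?thesis unfolding inner[OF True] using True elim
          by (auto simp: indicator_def mult.assoc[symmetric])
      next
        case False
        then show ?thesis using elim by (simp add: indicator_def)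
      qed
    qed
  qed
  also have "\<dots> = (\<integral>\<^sup>+r. ennreal (r powr (?N / 2 - 1) / 4) * indicator {0..1} r \<partial>lborel) * J"
    by (rule nn_integral_multc) measurable
  also have "(\<integral>\<^sup>+r. ennreal (r powr (?N / 2 - 1) / 4) * indicator {0..1} r \<partial>lborel) = ennreal (1 powr (?N / 2 - 1 + 1) / (?N / 2 - 1 + 1) / 4)"
    by (intro nn_integral_has_integral_lebesgue' has_integral_divide has_integral_powr_from_0) (auto simp: divide_simps)
  finally have T: "emeasure lborel T = ennreal (1 / (2 * ?N)) * J" by simp
  have "emeasure lborel T' = emeasure (distr lborel borel (\<lambda>x. 0 + (-1) *\<^sub>R x)) T'"
    using lborel_affine[of "-1" "0::real^'n"] by (simp add: density_1)
  also have "\<dots> = emeasure lborel ((\<lambda>x. 0 + (-1) *\<^sub>R x) -` T')" by (subst emeasure_distr) auto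
  also have "(\<lambda>x. 0 + (-1) *\<^sub>R x) -` T' = T"
    unfolding T_def T'_def by (auto simp: reflection_def sgn_minus)
  finally have T': "emeasure lborel T' = emeasure lborel T" .
  have null: "{y. e \<bullet> y = 0} \<in> null_sets lborel"
  proof -
    have "negligible {y. e \<bullet> y = 0}" using e by (intro negligible_hyperplane) auto
    moreover have "{y. e \<bullet> y = 0} \<in> sets borel" by (intro borel_closed closed_hyperplane)
    ultimately show ?thesis by (simp add: negligible_iff_null_sets null_sets_completion_iff)
  qed
  have "emeasure (distr sphere_measure borel (\<lambda>\<xi>. reflection \<xi> e)) A = emeasure sphere_measure ((\<lambda>\<xi>. reflection \<xi> e) -` A)"
    by (subst emeasure_distr) auto
  also have "\<dots> = ennreal ?N * emeasure lborel {x. norm x < 1 \<and> sgn x \<in> (\<lambda>\<xi>. reflection \<xi> e) -` A}"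
    by (rule emeasure_sphere_measure) (use measurable_sets_borel[OF measurable_reflection_arg A, of e] in simp)
  also have "emeasure lborel {x. norm x < 1 \<and> sgn x \<in> (\<lambda>\<xi>. reflection \<xi> e) -` A} = emeasure lborel (T \<union> T')"
  proof (rule emeasure_eq_AE)
    show "AE x in lborel. (x \<in> {x. norm x < 1 \<and> sgn x \<in> (\<lambda>\<xi>. reflection \<xi> e) -` A}) = (x \<in> T \<union> T')"
      using AE_not_in[OF null] by eventually_elim (auto simp: T_def T'_def)
    have "{x. norm x < 1 \<and> sgn x \<in> (\<lambda>\<xi>. reflection \<xi> e) -` A} = {x. norm x < 1 \<and> reflection (sgn x) e \<in> A}" by auto
    also have "\<dots> \<in> sets borel" by measurable
    finally show "{x. norm x < 1 \<and> sgn x \<in> (\<lambda>\<xi>. reflection \<xi> e) -` A} \<in> sets lborel" by simp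
  qed simp
  also have "\<dots> = emeasure lborel T + emeasure lborel T'"
    by (rule plus_emeasure[symmetric]) (auto simp: T_def T'_def)
  also have "\<dots> = ennreal (1 / ?N) * J"
    unfolding T' T distrib_right[symmetric] by (simp flip: ennreal_plus)
  also have "ennreal ?N * (ennreal (1 / ?N) * J) = J"
    unfolding mult.assoc[symmetric] by (simp flip: ennreal_mult')
  also have "J = emeasure (density sphere_measure (\<lambda>\<eta>. ennreal (norm (e - \<eta>) powr (2 - ?N)))) A"
    unfolding J_def by (rule emeasure_density[symmetric]) auto
  finally show "emeasure (distr sphere_measure borel (\<lambda>\<xi>. reflection \<xi> e)) A = emeasure (density sphere_measure (\<lambda>\<eta>. ennreal (norm (e - \<eta>) powr (2 - ?N)))) A" .
qed simp

section \<open>The reflection quotient\<close>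

text \<open>The segment from \<open>x\<close> to its mirror image stays in the ball of radius \<open>|x|\<close>.\<close>
lemma norm_reflection_path:
  assumes "norm \<xi> = 1" "0 \<le> s" "s \<le> 1"
  shows "norm (x - (2 * s * (x \<bullet> \<xi>)) *\<^sub>R \<xi>) \<le> norm x"
proof -
  have "\<xi> \<bullet> \<xi> = 1" using assms(1) by (simp add: dot_square_norm)
  then have "(norm (x - (2 * s * (x \<bullet> \<xi>)) *\<^sub>R \<xi>))\<^sup>2 = (norm x)\<^sup>2 - 4 * (s * (1 - s)) * (x \<bullet> \<xi>)\<^sup>2"
    unfolding power2_norm_eq_inner by (simp add: inner_simps inner_commute[of \<xi> x] power2_eq_square algebra_simps)
  moreover have "0 \<le> s * (1 - s)" using assms by simp
  ultimately have "(norm (x - (2 * s * (x \<bullet> \<xi>)) *\<^sub>R \<xi>))\<^sup>2 \<le> (norm x)\<^sup>2" by simp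
  then show ?thesis by (rule power2_le_imp_le) simp
qed

lemma continuous_reflection_quotient:
  fixes f :: "real^'n::finite \<Rightarrow> complex"
  assumes "\<And>k. continuous_on UNIV (partial k f)"
  shows "continuous_on UNIV (\<lambda>(x, \<xi>). reflection_quotient f x \<xi>)"
proof -
  have "continuous_on (UNIV \<times> cbox 0 1) (\<lambda>(z, s). \<Sum>k\<in>UNIV. complex_of_real (snd z $ k) * partial k f (fst z - (2 * s * (fst z \<bullet> snd z)) *\<^sub>R snd z))"
    unfolding split_def
    by (intro continuous_on_sum continuous_on_mult continuous_intros continuous_on_compose2[OF assms]) auto
  from integral_continuous_on_param[OF this]
  have "continuous_on UNIV (\<lambda>z. integral (cbox 0 1) (\<lambda>s. \<Sum>k\<in>UNIV. complex_of_real (snd z $ k) * partial k f (fst z - (2 * s * (fst z \<bullet> snd z)) *\<^sub>R snd z)))" .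
  then have "continuous_on UNIV (\<lambda>z. 2 * integral {0..1} (\<lambda>s. \<Sum>k\<in>UNIV. complex_of_real (snd z $ k) * partial k f (fst z - (2 * s * (fst z \<bullet> snd z)) *\<^sub>R snd z)))"
    by (intro continuous_intros) simp
  then show ?thesis unfolding reflection_quotient_def split_def .
qed

lemma reflection_quotient_bound:
  fixes f :: "real^'n::finite \<Rightarrow> complex"
  assumes cont: "\<And>k. continuous_on UNIV (partial k f)" and \<xi>: "norm \<xi> = 1"
    and C: "\<And>k z. norm z \<le> norm x \<Longrightarrow> cmod (partial k f z) \<le> C"
  shows "cmod (reflection_quotient f x \<xi>) \<le> 2 * (real CARD('n) * C)"
proof -
  let ?g = "\<lambda>s. \<Sum>k\<in>UNIV. complex_of_real (\<xi> $ k) * partial k f (x - (2 * s * (x \<bullet> \<xi>)) *\<^sub>R \<xi>)"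
  have "cmod (integral {0..1} ?g) \<le> real CARD('n) * C * (1 - 0)"
  proof (rule integral_bound)
    show "continuous_on {0..1} ?g"
      by (intro continuous_on_sum continuous_on_mult continuous_intros continuous_on_compose2[OF cont]) auto
    fix s :: real assume s: "s \<in> {0..1}"
    have "cmod (?g s) \<le> (\<Sum>k\<in>(UNIV :: 'n set). C)"
    proof (rule sum_norm_le)
      fix k
      have "\<bar>\<xi> $ k\<bar> \<le> 1" using component_le_norm_cart[of \<xi> k] \<xi> by simp
      moreover have "cmod (partial k f (x - (2 * s * (x \<bullet> \<xi>)) *\<^sub>R \<xi>)) \<le> C"
        using s by (intro C norm_reflection_path \<xi>) auto
      ultimately have "\<bar>\<xi> $ k\<bar> * cmod (partial k f (x - (2 * s * (x \<bullet> \<xi>)) *\<^sub>R \<xi>)) \<le> 1 * C"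
        by (intro mult_mono) auto
      then show "cmod (complex_of_real (\<xi> $ k) * partial k f (x - (2 * s * (x \<bullet> \<xi>)) *\<^sub>R \<xi>)) \<le> C"
        by (simp add: norm_mult)
    qed
    then show "cmod (?g s) \<le> real CARD('n) * C" by simp
  qed simp
  then show ?thesis unfolding reflection_quotient_def by (simp add: norm_mult)
qed

text \<open>The integral of the theorem, without its prefactor.\<close>
definition refl_int :: "'n \<Rightarrow> (real^'n::finite \<Rightarrow> complex) \<Rightarrow> real^'n \<Rightarrow> complex" where
  "refl_int n f x = (LINT \<xi>|sphere_measure. of_real (\<xi> $ n) * reflection_quotient f x \<xi>)"

lemma measurable_reflection_quotient:
  assumes "\<And>k. continuous_on UNIV (partial k f)"
  shows "(\<lambda>(x, \<xi>). reflection_quotient f x \<xi>) \<in> borel_measurable (borel \<Otimes>\<^sub>M borel)"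
    and "(\<lambda>\<xi>. reflection_quotient f x \<xi>) \<in> borel_measurable borel"
proof -
  show "(\<lambda>(x, \<xi>). reflection_quotient f x \<xi>) \<in> borel_measurable (borel \<Otimes>\<^sub>M borel)"
    unfolding borel_prod by (intro borel_measurable_continuous_onI continuous_reflection_quotient assms)
  have "continuous_on UNIV (\<lambda>\<xi>. (\<lambda>(x, \<xi>). reflection_quotient f x \<xi>) (x, \<xi>))"
    by (intro continuous_on_compose2[OF continuous_reflection_quotient[OF assms]] continuous_intros) auto
  then show "(\<lambda>\<xi>. reflection_quotient f x \<xi>) \<in> borel_measurable borel"
    by (intro borel_measurable_continuous_onI) simp
qed

lemma schwartz_partial_bound:
  fixes f :: "real^'n::finite \<Rightarrow> complex"
  assumes "f \<in> schwartz"
  shows "\<exists>C\<ge>0. \<forall>k z. cmod (partial k f z) \<le> C"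
proof -
  have "\<exists>C. \<forall>z. cmod (partial k f z) \<le> C" for k
    using rapidE[OF schwartz_rapid[OF schwartz_partial[OF assms]], of 0 k] by (metis mult_1 power_0)
  then obtain C where C: "\<And>k z. cmod (partial k f z) \<le> C k" by metis
  have "cmod (partial k f z) \<le> (\<Sum>k\<in>UNIV. \<bar>C k\<bar>)" for k z
  proof -
    have "cmod (partial k f z) \<le> \<bar>C k\<bar>" using C[of k z] by simp
    also have "\<dots> \<le> (\<Sum>k\<in>UNIV. \<bar>C k\<bar>)" by (rule member_le_sum) auto
    finally show ?thesis .
  qed
  then show ?thesis by (intro exI[of _ "\<Sum>k\<in>UNIV. \<bar>C k\<bar>"]) (auto intro: sum_nonneg)
qed

lemma schwartz_refl_quotient_bound:
  fixes f :: "real^'n::finite \<Rightarrow> complex"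
  assumes "f \<in> schwartz"
  shows "\<exists>C\<ge>0. \<forall>x \<xi>. norm \<xi> = 1 \<longrightarrow> cmod (of_real (\<xi> $ n) * reflection_quotient f x \<xi>) \<le> C"
proof -
  obtain C where C: "C \<ge> 0" "\<And>k z. cmod (partial k f z) \<le> C" using schwartz_partial_bound[OF assms] by blast
  have "cmod (of_real (\<xi> $ n) * reflection_quotient f x \<xi>) \<le> 1 * (2 * (real CARD('n) * C))" if "norm \<xi> = 1" for x \<xi>
    unfolding norm_mult
    using component_le_norm_cart[of \<xi> n] that C(1)
    by (intro mult_mono reflection_quotient_bound that C(2) schwartz_continuous schwartz_partial assms) auto
  then show ?thesis using C(1) by (intro exI[of _ "1 * (2 * (real CARD('n) * C))"]) auto
qed

lemma measurable_coord [measurable]: "(\<lambda>x::real^'n::finite. x $ n) \<in> borel_measurable borel"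
  by (intro borel_measurable_continuous_onI continuous_intros)

lemma integrable_refl_quotient:
  fixes f :: "real^'n::finite \<Rightarrow> complex"
  assumes "f \<in> schwartz"
  shows "integrable sphere_measure (\<lambda>\<xi>. of_real (\<xi> $ n) * reflection_quotient f x \<xi>)"
proof -
  note [measurable] = measurable_reflection_quotient(2)[OF schwartz_continuous[OF schwartz_partial[OF assms]]]
  obtain C where "\<And>x \<xi>. norm \<xi> = 1 \<Longrightarrow> cmod (of_real (\<xi> $ n) * reflection_quotient f x \<xi>) \<le> C"
    using schwartz_refl_quotient_bound[OF assms, of n] by blast
  then show ?thesis by (intro integrable_sphere_bounded) measurable
qed

lemma refl_int_bounded_continuous:
  fixes f :: "real^'n::finite \<Rightarrow> complex"
  assumes f: "f \<in> schwartz"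
  shows "continuous_on UNIV (refl_int n f)" "\<exists>C. \<forall>x. cmod (refl_int n f x) \<le> C"
proof -
  note cont = schwartz_continuous[OF schwartz_partial[OF f]]
  note [measurable] = measurable_reflection_quotient(2)[OF cont]
  obtain C where C: "C \<ge> 0" "\<And>x \<xi>. norm \<xi> = 1 \<Longrightarrow> cmod (of_real (\<xi> $ n) * reflection_quotient f x \<xi>) \<le> C"
    using schwartz_refl_quotient_bound[OF f, of n] by blast
  show "continuous_on UNIV (refl_int n f)"
    unfolding continuous_on_sequentially
  proof (intro allI ballI impI)
    fix X :: "nat \<Rightarrow> real^'n" and a assume X: "(\<forall>n. X n \<in> UNIV) \<and> X \<longlonglongrightarrow> a"
    show "(refl_int n f \<circ> X) \<longlonglongrightarrow> refl_int n f a"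
      unfolding refl_int_def o_def
    proof (rule integral_dominated_convergence[where w = "\<lambda>_. C"])
      show "integrable sphere_measure (\<lambda>_::real^'n. C)" by (rule finite_measure.integrable_const[OF finite_sphere_measure])
      show "AE \<xi> in sphere_measure. cmod (of_real (\<xi> $ n) * reflection_quotient f (X i) \<xi>) \<le> C" for i
        using AE_sphere_measure_norm by eventually_elim (rule C)
      have "(\<lambda>i. reflection_quotient f (X i) \<xi>) \<longlonglongrightarrow> reflection_quotient f a \<xi>" for \<xi>
      proof -
        have "(\<lambda>i. (X i, \<xi>)) \<longlonglongrightarrow> (a, \<xi>)" using X by (intro tendsto_intros) simp
        from continuous_on_tendsto_compose[OF continuous_reflection_quotient[OF cont] this] show ?thesis by simp
      qed
      then show "AE \<xi> in sphere_measure. (\<lambda>i. of_real (\<xi> $ n) * reflection_quotient f (X i) \<xi>) \<longlonglongrightarrow> of_real (\<xi> $ n) * reflection_quotient f a \<xi>"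
        by (intro AE_I2 tendsto_intros)
    qed measurable
  qed
  have "cmod (refl_int n f x) \<le> C * measure (sphere_measure :: (real^'n) measure) UNIV" for x
  proof -
    have "cmod (refl_int n f x) \<le> (LINT \<xi>|sphere_measure. cmod (of_real (\<xi> $ n) * reflection_quotient f x \<xi>))"
      unfolding refl_int_def by (rule integral_norm_bound)
    also have "\<dots> \<le> (LINT \<xi>|(sphere_measure :: (real^'n) measure). C)"
    proof (rule integral_mono_AE)
      show "AE \<xi> in sphere_measure. cmod (of_real (\<xi> $ n) * reflection_quotient f x \<xi>) \<le> C"
        using AE_sphere_measure_norm by eventually_elim (rule C)
    qed (intro integrable_norm integrable_refl_quotient f, rule finite_measure.integrable_const[OF finite_sphere_measure])
    finally show ?thesis by (simp add: mult.commute)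
  qed
  then show "\<exists>C. \<forall>x. cmod (refl_int n f x) \<le> C" by blast
qed

text \<open>The polynomial quotient of \<open>spherical_reflection_average\<close> agrees with the smooth extension off the null set \<open>\<langle>\<xi>, x\<rangle> = 0\<close>.\<close>
lemma refl_int_harmonic:
  fixes p :: "real^'n::finite \<Rightarrow> complex"
  assumes p: "p \<in> harmonic_poly m" and x: "x \<noteq> 0"
  shows "refl_int n p x = of_real (2 * sphere_vol TYPE('n)) * lowering n m p x"
proof -
  have cp: "cpoly p" using p by (simp add: harmonic_poly_iff)
  note [measurable] = measurable_reflection_quotient(2)[OF cpoly_continuous[OF cpoly_partial[OF cp]]]
  obtain Q where Q: "cpoly Q" "\<And>\<xi>. \<xi> \<bullet> x \<noteq> 0 \<Longrightarrow> (p x - p (reflection \<xi> x)) / of_real (\<xi> \<bullet> x) = Q \<xi>"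
    "(LINT \<xi>|sphere_measure. of_real (\<xi> $ n) * Q \<xi>) = of_real (2 * sphere_vol TYPE('n)) * lowering n m p x"
    using spherical_reflection_average[OF p, of x n] by blast
  note [measurable] = cpoly_measurable[OF Q(1)]
  have "refl_int n p x = (LINT \<xi>|sphere_measure. of_real (\<xi> $ n) * Q \<xi>)"
    unfolding refl_int_def
  proof (rule integral_cong_AE)
    show "AE \<xi> in sphere_measure. of_real (\<xi> $ n) * reflection_quotient p x \<xi> = of_real (\<xi> $ n) * Q \<xi>"
      using AE_sphere_inner_nonzero[OF x]
    proof eventually_elim
      case (elim \<xi>)
      then have "\<xi> \<bullet> x \<noteq> 0" by (simp add: inner_commute)
      then show ?case using reflection_quotient_eq[OF cpoly_differentiable[OF cp]] Q(2) by simp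
    qed
  qed measurable
  then show ?thesis using Q(3) by simp
qed

section \<open>Reflection invariance of the sphere measure\<close>

text \<open>Inherited from Lebesgue measure, because reflections preserve the unit ball and commute with \<open>sgn\<close>.\<close>
lemma distr_sphere_reflection:
  fixes e :: "real^'n::finite"
  assumes e: "norm e = 1"
  shows "distr sphere_measure borel (reflection e) = sphere_measure"
proof (rule measure_eqI)
  have rm[measurable]: "reflection e \<in> borel_measurable borel"
    by (intro borel_measurable_continuous_onI continuous_reflection)
  fix A assume "A \<in> sets (distr sphere_measure borel (reflection e))"
  then have A[measurable]: "A \<in> sets borel" by simp
  have A': "reflection e -` A \<in> sets borel" using measurable_sets_borel[OF rm A] by simp
  have "emeasure (distr sphere_measure borel (reflection e)) A = emeasure sphere_measure (reflection e -` A)"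
    by (subst emeasure_distr) auto
  also have "\<dots> = ennreal (real CARD('n)) * emeasure lborel {x. norm x < 1 \<and> sgn x \<in> reflection e -` A}"
    by (rule emeasure_sphere_measure[OF A'])
  also have "{x. norm x < 1 \<and> sgn x \<in> reflection e -` A} = reflection e -` {x. norm x < 1 \<and> sgn x \<in> A}"
    by (auto simp: norm_reflection[OF e] sgn_div_norm reflection_scaleR)
  also have "emeasure lborel (reflection e -` {x. norm x < 1 \<and> sgn x \<in> A}) = emeasure (distr lborel borel (reflection e)) {x. norm x < 1 \<and> sgn x \<in> A}"
    by (subst emeasure_distr) auto
  also have "\<dots> = emeasure lborel {x. norm x < 1 \<and> sgn x \<in> A}" by (simp only: lborel_reflection[OF e])
  also have "ennreal (real CARD('n)) * \<dots> = emeasure sphere_measure A" by (rule emeasure_sphere_measure[OF A, symmetric])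
  finally show "emeasure (distr sphere_measure borel (reflection e)) A = emeasure sphere_measure A" .
qed simp

lemma integral_sphere_reflection:
  fixes g :: "real^'n::finite \<Rightarrow> complex"
  assumes e: "norm e = 1" and [measurable]: "g \<in> borel_measurable borel"
  shows "(LINT \<xi>|sphere_measure. g (reflection e \<xi>)) = (LINT \<xi>|sphere_measure. g \<xi>)"
proof -
  have [measurable]: "reflection e \<in> borel_measurable borel"
    by (intro borel_measurable_continuous_onI continuous_reflection)
  have "(LINT \<xi>|distr sphere_measure borel (reflection e). g \<xi>) = (LINT \<xi>|sphere_measure. g (reflection e \<xi>))"
    by (rule integral_distr) auto
  then show ?thesis by (simp only: distr_sphere_reflection[OF e])
qed

lemma integral_lborel_reflection:
  fixes g :: "real^'n::finite \<Rightarrow> complex"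
  assumes e: "norm e = 1" and [measurable]: "g \<in> borel_measurable borel"
  shows "(LINT x|lborel. g (reflection e x)) = (LINT x|lborel. g x)"
    "integrable lborel g \<Longrightarrow> integrable lborel (\<lambda>x. g (reflection e x))"
proof -
  have [measurable]: "reflection e \<in> borel_measurable borel"
    by (intro borel_measurable_continuous_onI continuous_reflection)
  have "(LINT x|distr lborel borel (reflection e). g x) = (LINT x|lborel. g (reflection e x))"
    by (rule integral_distr) auto
  then show "(LINT x|lborel. g (reflection e x)) = (LINT x|lborel. g x)" by (simp only: lborel_reflection[OF e])
  assume "integrable lborel g"
  then have "integrable (distr lborel borel (reflection e)) g" by (simp only: lborel_reflection[OF e])
  then show "integrable lborel (\<lambda>x. g (reflection e x))" by (subst (asm) integrable_distr_eq) auto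
qed

section \<open>Regularising the singular kernel\<close>

text \<open>The kernel \<open>\<xi>\<^sub>n / \<langle>\<xi>, x\<rangle>\<close> with \<open>1 / c\<close> replaced by \<open>c / (c\<^sup>2 + d\<^sup>2 |x|\<^sup>2)\<close>. It is bounded for fixed \<open>x \<noteq> 0\<close>, still odd under \<open>x \<mapsto> \<sigma>\<^sub>\<xi> x\<close>, and the factor \<open>|x|\<close> makes it homogeneous of degree \<open>-1\<close> in \<open>x\<close>.\<close>
definition reg_kernel :: "'n \<Rightarrow> real \<Rightarrow> real^'n::finite \<Rightarrow> real^'n \<Rightarrow> real" where
  "reg_kernel n d x \<xi> = \<xi> $ n * ((\<xi> \<bullet> x) / ((\<xi> \<bullet> x)\<^sup>2 + (d * norm x)\<^sup>2))"

lemma measurable_reg_kernel [measurable]: "(\<lambda>(x, \<xi>). reg_kernel n d x \<xi>) \<in> borel_measurable (borel \<Otimes>\<^sub>M borel)"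
  unfolding reg_kernel_def by measurable

lemma ratio_le_one:
  fixes a b :: real
  assumes "0 \<le> a" "0 \<le> b"
  shows "a / (a + b) \<le> 1" "0 \<le> a / (a + b)"
proof -
  show "a / (a + b) \<le> 1"
  proof (cases "a + b = 0")
    case False
    then have "a + b > 0" using assms by linarith
    then show ?thesis using assms by (simp add: pos_divide_le_eq)
  qed simp
qed (use assms in simp)

lemma reg_kernel_bound_inverse_inner:
  assumes "norm \<xi> = 1"
  shows "\<bar>reg_kernel n d x \<xi>\<bar> * \<bar>\<xi> \<bullet> x\<bar> \<le> 1"
proof -
  have "\<bar>\<xi> $ n\<bar> \<le> 1" using component_le_norm_cart[of \<xi> n] assms by simp
  moreover have "(\<xi> \<bullet> x)\<^sup>2 / ((\<xi> \<bullet> x)\<^sup>2 + (d * norm x)\<^sup>2) \<le> 1" by (rule ratio_le_one) auto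
  ultimately have "\<bar>\<xi> $ n\<bar> * ((\<xi> \<bullet> x)\<^sup>2 / ((\<xi> \<bullet> x)\<^sup>2 + (d * norm x)\<^sup>2)) \<le> 1 * 1" by (intro mult_mono) auto
  moreover have "\<bar>reg_kernel n d x \<xi>\<bar> * \<bar>\<xi> \<bullet> x\<bar> = \<bar>\<xi> $ n\<bar> * ((\<xi> \<bullet> x)\<^sup>2 / ((\<xi> \<bullet> x)\<^sup>2 + (d * norm x)\<^sup>2))"
    unfolding reg_kernel_def by (simp add: abs_mult power2_eq_square)
  ultimately show ?thesis by simp
qed

lemma reg_kernel_bound_norm:
  assumes "norm \<xi> = 1" "d > 0" "x \<noteq> 0"
  shows "\<bar>reg_kernel n d x \<xi>\<bar> \<le> (1 / d) * norm x powr (- 1)"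
proof -
  have n0: "norm x > 0" using assms by simp
  have "\<bar>\<xi> $ n\<bar> \<le> 1" using component_le_norm_cart[of \<xi> n] assms by simp
  moreover have "\<bar>\<xi> \<bullet> x\<bar> / ((\<xi> \<bullet> x)\<^sup>2 + (d * norm x)\<^sup>2) \<le> 1 / (d * norm x)"
  proof -
    have "2 * \<bar>\<xi> \<bullet> x\<bar> * (d * norm x) \<le> \<bar>\<xi> \<bullet> x\<bar>\<^sup>2 + (d * norm x)\<^sup>2" by (rule sum_squares_bound)
    moreover have "0 \<le> \<bar>\<xi> \<bullet> x\<bar> * (d * norm x)" using assms by simp
    ultimately have "\<bar>\<xi> \<bullet> x\<bar> * (d * norm x) \<le> (\<xi> \<bullet> x)\<^sup>2 + (d * norm x)\<^sup>2" by simp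
    moreover have "(\<xi> \<bullet> x)\<^sup>2 + (d * norm x)\<^sup>2 > 0" using assms n0 by (intro add_nonneg_pos) auto
    ultimately show ?thesis using assms n0 by (simp add: divide_le_eq pos_le_divide_eq field_simps)
  qed
  ultimately have "\<bar>\<xi> $ n\<bar> * (\<bar>\<xi> \<bullet> x\<bar> / ((\<xi> \<bullet> x)\<^sup>2 + (d * norm x)\<^sup>2)) \<le> 1 * (1 / (d * norm x))"
    by (intro mult_mono) auto
  moreover have "\<bar>reg_kernel n d x \<xi>\<bar> = \<bar>\<xi> $ n\<bar> * (\<bar>\<xi> \<bullet> x\<bar> / ((\<xi> \<bullet> x)\<^sup>2 + (d * norm x)\<^sup>2))"
    unfolding reg_kernel_def by (simp add: abs_mult)
  ultimately show ?thesis using n0 by (simp add: powr_minus divide_inverse)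
qed

lemma reg_kernel_reflection:
  assumes "norm \<xi> = 1"
  shows "reg_kernel n d (reflection \<xi> x) \<xi> = - reg_kernel n d x \<xi>"
proof -
  have "\<xi> \<bullet> reflection \<xi> x = - (\<xi> \<bullet> x)"
    unfolding inner_commute[of \<xi> "reflection \<xi> x"] inner_reflection[OF assms] by (simp only: inner_commute)
  then show ?thesis unfolding reg_kernel_def by (simp add: norm_reflection[OF assms])
qed

lemma reg_kernel_mult_tendsto:
  fixes f :: "real^'n::finite \<Rightarrow> complex"
  assumes "\<And>y. f differentiable (at y)" "\<xi> \<bullet> x \<noteq> 0"
  shows "(\<lambda>i. of_real (reg_kernel n (1 / real (Suc i)) x \<xi>) * (f x - f (reflection \<xi> x))) \<longlonglongrightarrow> of_real (\<xi> $ n) * reflection_quotient f x \<xi>"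
proof -
  define c where "c = \<xi> \<bullet> x"
  have c: "c \<noteq> 0" using assms by (simp add: c_def)
  have "(\<lambda>i. \<xi> $ n * (c / (c\<^sup>2 + ((1 / real (Suc i)) * norm x)\<^sup>2))) \<longlonglongrightarrow> \<xi> $ n * (c / (c\<^sup>2 + (0 * norm x)\<^sup>2))"
    using c by (intro tendsto_intros LIMSEQ_Suc[OF lim_1_over_n]) auto
  then have "(\<lambda>i. reg_kernel n (1 / real (Suc i)) x \<xi>) \<longlonglongrightarrow> \<xi> $ n * (1 / c)"
    using c by (simp add: reg_kernel_def c_def[symmetric] power2_eq_square)
  then have "(\<lambda>i. of_real (reg_kernel n (1 / real (Suc i)) x \<xi>) * (f x - f (reflection \<xi> x))) \<longlonglongrightarrow> of_real (\<xi> $ n * (1 / c)) * (f x - f (reflection \<xi> x))"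
    by (intro tendsto_intros)
  then show ?thesis using reflection_quotient_eq[OF assms] by (simp add: c_def)
qed

lemma reg_kernel_mult_bound:
  fixes f :: "real^'n::finite \<Rightarrow> complex"
  assumes f: "\<And>y. f differentiable (at y)" "\<And>k. continuous_on UNIV (partial k f)" and \<xi>: "norm \<xi> = 1"
    and C: "\<And>k z. norm z \<le> norm x \<Longrightarrow> cmod (partial k f z) \<le> C"
  shows "cmod (of_real (reg_kernel n d x \<xi>) * (f x - f (reflection \<xi> x))) \<le> 2 * (real CARD('n) * C)"
proof (cases "\<xi> \<bullet> x = 0")
  case True
  have "0 \<le> C" using C[of x] by (rule order_trans[OF norm_ge_zero]) simp
  then show ?thesis using True by (simp add: reg_kernel_def)
next
  case False
  then have "f x - f (reflection \<xi> x) = of_real (\<xi> \<bullet> x) * reflection_quotient f x \<xi>"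
    using reflection_quotient_eq[OF f(1) False] by simp
  then have "cmod (of_real (reg_kernel n d x \<xi>) * (f x - f (reflection \<xi> x))) = (\<bar>reg_kernel n d x \<xi>\<bar> * \<bar>\<xi> \<bullet> x\<bar>) * cmod (reflection_quotient f x \<xi>)"
    by (simp only: norm_mult norm_of_real mult.assoc)
  also have "\<dots> \<le> 1 * (2 * (real CARD('n) * C))"
    by (intro mult_mono reg_kernel_bound_inverse_inner reflection_quotient_bound f \<xi> C) auto
  finally show ?thesis by simp
qed

lemma integrable_reg_kernel:
  fixes x :: "real^'n::finite"
  assumes "d > 0"
  shows "integrable sphere_measure (\<lambda>\<xi>. complex_of_real (reg_kernel n d x \<xi>))"
proof (cases "x = 0")
  case True
  then show ?thesis by (simp add: reg_kernel_def)
next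
  case False
  show ?thesis
  proof (rule integrable_sphere_bounded)
    show "(\<lambda>\<xi>. complex_of_real (reg_kernel n d x \<xi>)) \<in> borel_measurable borel" unfolding reg_kernel_def by measurable
    show "cmod (complex_of_real (reg_kernel n d x \<xi>)) \<le> (1 / d) * norm x powr (- 1)" if "norm \<xi> = 1" for \<xi>
      using reg_kernel_bound_norm[OF that assms False] by simp
  qed
qed

text \<open>The kernel depends on \<open>\<xi>\<close> through \<open>\<xi>\<^sub>n\<close> and \<open>\<langle>\<xi>, x\<rangle>\<close>, so by symmetry its integral is the \<open>n\<close>-th coordinate of a multiple of \<open>x\<close>. This is seen by reflecting \<open>\<xi>\<close> along \<open>x\<close>, which changes the sign of \<open>\<langle>\<xi>, x\<rangle>\<close> and leaves the component orthogonal to \<open>x\<close> fixed.\<close>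
lemma integral_reg_kernel:
  fixes x :: "real^'n::finite"
  assumes x: "x \<noteq> 0" and d: "d > 0"
  shows "(LINT \<xi>|sphere_measure. complex_of_real (reg_kernel n d x \<xi>)) =
    of_real (x $ n / (norm x)\<^sup>2) * (LINT \<xi>|sphere_measure. complex_of_real ((\<xi> \<bullet> x)\<^sup>2 / ((\<xi> \<bullet> x)\<^sup>2 + (d * norm x)\<^sup>2)))"
proof -
  define e where "e = sgn x"
  have e: "norm e = 1" using x by (simp add: e_def norm_sgn)
  let ?q = "\<lambda>\<xi>. complex_of_real ((\<xi> \<bullet> x)\<^sup>2 / ((\<xi> \<bullet> x)\<^sup>2 + (d * norm x)\<^sup>2))"
  have refl: "complex_of_real (reg_kernel n d x (reflection e \<xi>)) = of_real (2 * (x $ n / (norm x)\<^sup>2)) * ?q \<xi> - of_real (reg_kernel n d x \<xi>)" for \<xi>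
  proof -
    have "reflection e \<xi> \<bullet> x = - (\<xi> \<bullet> x)"
    proof -
      have ip: "y \<bullet> x = norm x * (y \<bullet> e)" for y
        unfolding e_def by (simp only: inner_scaleR_right[symmetric] norm_sgn_eq_self)
      show ?thesis unfolding ip inner_reflection[OF e] by simp
    qed
    have "reflection e \<xi> $ n = \<xi> $ n - 2 * ((\<xi> \<bullet> x) * (x $ n / (norm x)\<^sup>2))"
      by (simp add: reflection_def e_def sgn_div_norm power2_eq_square divide_inverse)
    have "reg_kernel n d x (reflection e \<xi>) = 2 * (x $ n / (norm x)\<^sup>2) * ((\<xi> \<bullet> x)\<^sup>2 / ((\<xi> \<bullet> x)\<^sup>2 + (d * norm x)\<^sup>2)) - reg_kernel n d x \<xi>"
    proof -
      have "(u - 2 * (c * a)) * (- c / ((- c)\<^sup>2 + D)) = 2 * a * (c\<^sup>2 / (c\<^sup>2 + D)) - u * (c / (c\<^sup>2 + D))" for u c a D :: real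
        by (simp add: divide_inverse algebra_simps) (simp add: power2_eq_square)
      then show ?thesis unfolding reg_kernel_def \<open>reflection e \<xi> \<bullet> x = - (\<xi> \<bullet> x)\<close> \<open>reflection e \<xi> $ n = _\<close> .
    qed
    then show ?thesis by (simp only: of_real_mult of_real_diff)
  qed
  have [measurable]: "(\<lambda>\<xi>. complex_of_real (reg_kernel n d x \<xi>)) \<in> borel_measurable borel" unfolding reg_kernel_def by measurable
  have qi: "integrable sphere_measure ?q"
  proof (rule integrable_sphere_bounded[where C = 1])
    show "cmod (?q \<xi>) \<le> 1" for \<xi>
      using ratio_le_one[of "(\<xi> \<bullet> x)\<^sup>2" "(d * norm x)\<^sup>2"] by (simp only: norm_of_real abs_of_nonneg zero_le_power2)
  qed measurable
  have "(LINT \<xi>|sphere_measure. complex_of_real (reg_kernel n d x \<xi>)) = (LINT \<xi>|sphere_measure. complex_of_real (reg_kernel n d x (reflection e \<xi>)))"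
    by (rule integral_sphere_reflection[OF e, symmetric]) measurable
  also have "\<dots> = of_real (2 * (x $ n / (norm x)\<^sup>2)) * (LINT \<xi>|sphere_measure. ?q \<xi>) - (LINT \<xi>|sphere_measure. complex_of_real (reg_kernel n d x \<xi>))"
    unfolding refl using qi integrable_reg_kernel[OF d, of n x]
    by (subst Bochner_Integration.integral_diff) (auto simp only: integral_mult_right_zero intro!: integrable_mult_right)
  finally have *: "(LINT \<xi>|sphere_measure. complex_of_real (reg_kernel n d x \<xi>)) =
    of_real (2 * (x $ n / (norm x)\<^sup>2)) * (LINT \<xi>|sphere_measure. ?q \<xi>) - (LINT \<xi>|sphere_measure. complex_of_real (reg_kernel n d x \<xi>))" .
  have gen: "z = of_real a * q" if "z = of_real (2 * a) * q - z" for z q :: complex and a :: real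
  proof -
    have "2 * z = z + z" by simp
    also have "z + z = of_real (2 * a) * q" by (subst (1) that) simp
    finally have "2 * z = 2 * (of_real a * q)" by (simp add: mult.assoc)
    then show ?thesis using mult_left_cancel[of "2::complex"] by simp
  qed
  show ?thesis by (rule gen[OF *])
qed

section \<open>Duality for the reflection integral\<close>

interpretation lborel_sphere: pair_sigma_finite "lborel :: (real^'n::finite) measure" "sphere_measure :: (real^'n) measure" ..

lemma measurable_lborel_sphere:
  "g \<in> borel_measurable (borel \<Otimes>\<^sub>M borel) \<Longrightarrow> g \<in> borel_measurable (lborel \<Otimes>\<^sub>M sphere_measure)"
  by (subst measurable_cong_sets[OF sets_pair_measure_cong[OF sets_lborel sets_sphere_measure] refl])

lemma cmod_sphere_integral_le:
  fixes g :: "real^'n::finite \<Rightarrow> complex"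
  assumes [measurable]: "g \<in> borel_measurable borel" and C: "\<And>\<xi>. norm \<xi> = 1 \<Longrightarrow> cmod (g \<xi>) \<le> C"
  shows "cmod (LINT \<xi>|sphere_measure. g \<xi>) \<le> C * sphere_vol TYPE('n)"
proof -
  have "cmod (LINT \<xi>|sphere_measure. g \<xi>) \<le> (LINT \<xi>|sphere_measure. cmod (g \<xi>))" by (rule integral_norm_bound)
  also have "\<dots> \<le> (LINT \<xi>|(sphere_measure :: (real^'n) measure). C)"
  proof (rule integral_mono_AE)
    show "AE \<xi> in sphere_measure. cmod (g \<xi>) \<le> C" using AE_sphere_measure_norm by eventually_elim (rule C)
  qed (intro integrable_norm integrable_sphere_bounded[OF assms], assumption, rule finite_measure.integrable_const[OF finite_sphere_measure])
  finally show ?thesis by (simp add: mult.commute sphere_vol_def)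
qed

text \<open>The sphere has finite measure, so a bound that depends on \<open>x\<close> only suffices.\<close>
lemma integrable_lborel_sphere_bounded:
  fixes F :: "(real^'n::finite) \<times> (real^'n) \<Rightarrow> complex"
  assumes [measurable]: "F \<in> borel_measurable (borel \<Otimes>\<^sub>M borel)"
    and g: "integrable lborel g"
    and le: "\<And>x \<xi>. norm \<xi> = 1 \<Longrightarrow> x \<noteq> 0 \<Longrightarrow> cmod (F (x, \<xi>)) \<le> g x"
  shows "integrable (lborel \<Otimes>\<^sub>M sphere_measure) F"
proof (rule lborel_sphere.Fubini_integrable)
  show F: "F \<in> borel_measurable (lborel \<Otimes>\<^sub>M sphere_measure)" by (rule measurable_lborel_sphere[OF assms(1)])
  show "AE x in lborel. integrable sphere_measure (\<lambda>\<xi>. F (x, \<xi>))"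
    using AE_lborel_singleton[of "0::real^'n"]
  proof eventually_elim
    case (elim x)
    show ?case by (rule integrable_sphere_bounded[of _ "g x"]) (use le elim in auto)
  qed
  show "integrable lborel (\<lambda>x. LINT \<xi>|sphere_measure. norm (F (x, \<xi>)))"
  proof (rule Bochner_Integration.integrable_bound)
    show "integrable lborel (\<lambda>x. complex_of_real (g x) * of_real (sphere_vol TYPE('n)))" using g by (intro integrable_mult_left integrable_of_real)
    show "(\<lambda>x. LINT \<xi>|sphere_measure. norm (F (x, \<xi>))) \<in> borel_measurable lborel"
      using F by (intro sphere.borel_measurable_lebesgue_integral) (simp add: split_def)
    show "AE x in lborel. norm (LINT \<xi>|sphere_measure. norm (F (x, \<xi>))) \<le> norm (complex_of_real (g x) * of_real (sphere_vol TYPE('n)))"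
      using AE_lborel_singleton[of "0::real^'n"]
    proof eventually_elim
      case (elim x)
      have "cmod (LINT \<xi>|sphere_measure. complex_of_real (norm (F (x, \<xi>)))) \<le> g x * sphere_vol TYPE('n)"
        by (rule cmod_sphere_integral_le) (use le elim in auto)
      also have "\<dots> \<le> norm (complex_of_real (g x) * of_real (sphere_vol TYPE('n)))"
        by (simp add: norm_mult mult_right_mono sphere_vol_pos less_imp_le)
      finally show ?case by (simp only: integral_complex_of_real norm_of_real real_norm_def)
    qed
  qed
qed

text \<open>The reflection integral with regularised kernel; here the two terms can be integrated separately.\<close>
definition reg_int :: "'n \<Rightarrow> real \<Rightarrow> (real^'n::finite \<Rightarrow> complex) \<Rightarrow> real^'n \<Rightarrow> complex" where
  "reg_int n d f x = (LINT \<xi>|sphere_measure. of_real (reg_kernel n d x \<xi>) * (f x - f (reflection \<xi> x)))"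

lemma reg_kernel_mult_measurable:
  fixes f :: "real^'n::finite \<Rightarrow> complex"
  assumes [measurable]: "f \<in> borel_measurable borel"
  shows "(\<lambda>(x, \<xi>). of_real (reg_kernel n d x \<xi>) * (f x - f (reflection \<xi> x))) \<in> borel_measurable (borel \<Otimes>\<^sub>M borel)"
    and "(\<lambda>\<xi>. of_real (reg_kernel n d x \<xi>) * (f x - f (reflection \<xi> x))) \<in> borel_measurable borel"
proof -
  have [measurable]: "(\<lambda>\<xi>. reflection \<xi> x) \<in> borel_measurable borel" by (rule measurable_reflection_arg)
  show "(\<lambda>\<xi>. of_real (reg_kernel n d x \<xi>) * (f x - f (reflection \<xi> x))) \<in> borel_measurable borel" by measurable
  have [measurable]: "(\<lambda>(x, \<xi>). reflection \<xi> x) \<in> (borel \<Otimes>\<^sub>M borel) \<rightarrow>\<^sub>M (borel :: (real^'n) measure)"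
    unfolding borel_prod by (intro borel_measurable_continuous_onI) (auto simp: split_def reflection_def intro!: continuous_intros)
  have [measurable]: "(\<lambda>z. reg_kernel n d (fst z) (snd z)) \<in> borel_measurable (borel \<Otimes>\<^sub>M borel)"
    using measurable_reg_kernel[of n d] by (simp only: split_def)
  have [measurable]: "(\<lambda>z. reflection (snd z) (fst z)) \<in> (borel \<Otimes>\<^sub>M borel) \<rightarrow>\<^sub>M (borel :: (real^'n) measure)"
    using \<open>(\<lambda>(x, \<xi>). reflection \<xi> x) \<in> _\<close> by (simp only: split_def)
  show "(\<lambda>(x, \<xi>). of_real (reg_kernel n d x \<xi>) * (f x - f (reflection \<xi> x))) \<in> borel_measurable (borel \<Otimes>\<^sub>M borel)"
    unfolding split_def by measurable
qed

lemma differentiable_borel_measurable: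
  fixes f :: "real^'n::finite \<Rightarrow> complex"
  shows "(\<And>y. f differentiable (at y)) \<Longrightarrow> f \<in> borel_measurable borel"
  by (intro borel_measurable_continuous_onI continuous_at_imp_continuous_on ballI differentiable_imp_continuous_within)

context
  fixes f :: "real^'n::finite \<Rightarrow> complex" and x :: "real^'n" and C :: real
  assumes f: "\<And>y. f differentiable (at y)" "\<And>k. continuous_on UNIV (partial k f)"
    and C: "\<And>k z. norm z \<le> norm x \<Longrightarrow> cmod (partial k f z) \<le> C"
begin

lemma cmod_reg_int_le: "cmod (reg_int n d f x) \<le> 2 * (real CARD('n) * C) * sphere_vol TYPE('n)"
  unfolding reg_int_def
  by (rule cmod_sphere_integral_le reg_kernel_mult_measurable(2) reg_kernel_mult_bound f differentiable_borel_measurable C | assumption)+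

lemma reg_int_tendsto:
  assumes "x \<noteq> 0"
  shows "(\<lambda>i. reg_int n (1 / real (Suc i)) f x) \<longlonglongrightarrow> refl_int n f x"
  unfolding reg_int_def refl_int_def
proof (rule integral_dominated_convergence[where w = "\<lambda>_. 2 * (real CARD('n) * C)"])
  note [measurable] = measurable_reflection_quotient(2)[OF f(2)]
  show "(\<lambda>\<xi>. of_real (\<xi> $ n) * reflection_quotient f x \<xi>) \<in> borel_measurable sphere_measure" by measurable
  show "(\<lambda>\<xi>. of_real (reg_kernel n (1 / real (Suc i)) x \<xi>) * (f x - f (reflection \<xi> x))) \<in> borel_measurable sphere_measure" for i
    using reg_kernel_mult_measurable(2)[OF differentiable_borel_measurable[OF f(1)]] by (subst measurable_cong_sets[OF sets_sphere_measure refl])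
  show "integrable sphere_measure (\<lambda>_::real^'n. 2 * (real CARD('n) * C))"
    by (rule finite_measure.integrable_const[OF finite_sphere_measure])
  show "AE \<xi> in sphere_measure. (\<lambda>i. of_real (reg_kernel n (1 / real (Suc i)) x \<xi>) * (f x - f (reflection \<xi> x))) \<longlonglongrightarrow> of_real (\<xi> $ n) * reflection_quotient f x \<xi>"
    using AE_sphere_inner_nonzero[OF assms]
    by eventually_elim (rule reg_kernel_mult_tendsto[OF f(1)], simp add: inner_commute)
  show "AE \<xi> in sphere_measure. cmod (of_real (reg_kernel n (1 / real (Suc i)) x \<xi>) * (f x - f (reflection \<xi> x))) \<le> 2 * (real CARD('n) * C)" for i
    using AE_sphere_measure_norm by eventually_elim (rule reg_kernel_mult_bound[OF f _ C])
qed

end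

lemma integral_ratio_tendsto:
  fixes x :: "real^'n::finite"
  assumes x: "x \<noteq> 0"
  shows "(\<lambda>i. LINT \<xi>|sphere_measure. complex_of_real ((\<xi> \<bullet> x)\<^sup>2 / ((\<xi> \<bullet> x)\<^sup>2 + (1 / real (Suc i) * norm x)\<^sup>2))) \<longlonglongrightarrow> of_real (sphere_vol TYPE('n))"
proof -
  have "(\<lambda>i. LINT \<xi>|sphere_measure. complex_of_real ((\<xi> \<bullet> x)\<^sup>2 / ((\<xi> \<bullet> x)\<^sup>2 + (1 / real (Suc i) * norm x)\<^sup>2))) \<longlonglongrightarrow> (LINT \<xi>|(sphere_measure :: (real^'n) measure). 1)"
  proof (rule integral_dominated_convergence[where w = "\<lambda>_. 1"])
    show "AE \<xi> in sphere_measure. (\<lambda>i. complex_of_real ((\<xi> \<bullet> x)\<^sup>2 / ((\<xi> \<bullet> x)\<^sup>2 + (1 / real (Suc i) * norm x)\<^sup>2))) \<longlonglongrightarrow> 1"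
      using AE_sphere_inner_nonzero[OF x]
    proof eventually_elim
      case (elim \<xi>)
      have "(\<lambda>i. (\<xi> \<bullet> x)\<^sup>2 / ((\<xi> \<bullet> x)\<^sup>2 + (1 / real (Suc i) * norm x)\<^sup>2)) \<longlonglongrightarrow> (\<xi> \<bullet> x)\<^sup>2 / ((\<xi> \<bullet> x)\<^sup>2 + (0 * norm x)\<^sup>2)"
        using elim LIMSEQ_inverse_real_of_nat by (intro tendsto_intros) (auto simp: inner_commute inverse_eq_divide)
      then have "(\<lambda>i. (\<xi> \<bullet> x)\<^sup>2 / ((\<xi> \<bullet> x)\<^sup>2 + (1 / real (Suc i) * norm x)\<^sup>2)) \<longlonglongrightarrow> 1"
        using elim by (simp add: inner_commute)
      from tendsto_of_real[OF this, where 'a = complex] show ?case by (simp only: of_real_1)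
    qed
    show "AE \<xi> in sphere_measure. cmod (complex_of_real ((\<xi> \<bullet> x)\<^sup>2 / ((\<xi> \<bullet> x)\<^sup>2 + (1 / real (Suc i) * norm x)\<^sup>2))) \<le> 1" for i
      using ratio_le_one[OF zero_le_power2 zero_le_power2] by (intro AE_I2) (simp only: norm_of_real abs_of_nonneg)
    show "integrable sphere_measure (\<lambda>_::real^'n. 1::real)"
      by (rule finite_measure.integrable_const[OF finite_sphere_measure])
  qed measurable
  then show ?thesis by (simp add: sphere_vol_def scaleR_conv_of_real)
qed

text \<open>The principal value of the integral of \<open>\<xi>\<^sub>n / \<langle>\<xi>, x\<rangle>\<close> over the sphere.\<close>
lemma integral_reg_kernel_tendsto:
  fixes x :: "real^'n::finite"
  assumes x: "x \<noteq> 0"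
  shows "(\<lambda>i. LINT \<xi>|sphere_measure. complex_of_real (reg_kernel n (1 / real (Suc i)) x \<xi>)) \<longlonglongrightarrow> of_real (sphere_vol TYPE('n) * (x $ n / (norm x)\<^sup>2))"
proof -
  have "(\<lambda>i. of_real (x $ n / (norm x)\<^sup>2) * (LINT \<xi>|sphere_measure. complex_of_real ((\<xi> \<bullet> x)\<^sup>2 / ((\<xi> \<bullet> x)\<^sup>2 + (1 / real (Suc i) * norm x)\<^sup>2))))
      \<longlonglongrightarrow> of_real (x $ n / (norm x)\<^sup>2) * of_real (sphere_vol TYPE('n))"
    by (intro tendsto_intros integral_ratio_tendsto x)
  moreover have "1 / real (Suc i) > 0" for i by simp
  ultimately show ?thesis by (simp only: integral_reg_kernel[OF x] of_real_mult mult.commute)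
qed

lemma cmod_integral_reg_kernel_le:
  fixes x :: "real^'n::finite"
  assumes x: "x \<noteq> 0" and d: "d > 0"
  shows "cmod (LINT \<xi>|sphere_measure. complex_of_real (reg_kernel n d x \<xi>)) \<le> sphere_vol TYPE('n) * norm x powr (-1)"
proof -
  have "cmod (LINT \<xi>|sphere_measure. complex_of_real ((\<xi> \<bullet> x)\<^sup>2 / ((\<xi> \<bullet> x)\<^sup>2 + (d * norm x)\<^sup>2))) \<le> 1 * sphere_vol TYPE('n)"
  proof (rule cmod_sphere_integral_le)
    show "cmod (complex_of_real ((\<xi> \<bullet> x)\<^sup>2 / ((\<xi> \<bullet> x)\<^sup>2 + (d * norm x)\<^sup>2))) \<le> 1" for \<xi>
      using ratio_le_one[OF zero_le_power2 zero_le_power2] by (simp only: norm_of_real abs_of_nonneg)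
  qed measurable
  moreover have "\<bar>x $ n / (norm x)\<^sup>2\<bar> \<le> norm x powr (-1)"
  proof -
    have "\<bar>x $ n\<bar> / (norm x)\<^sup>2 \<le> norm x / (norm x)\<^sup>2" by (intro divide_right_mono component_le_norm_cart) simp
    also have "\<dots> = norm x powr (-1)" using x by (simp add: powr_minus power2_eq_square divide_inverse)
    finally show ?thesis by simp
  qed
  ultimately have "\<bar>x $ n / (norm x)\<^sup>2\<bar> * cmod (LINT \<xi>|sphere_measure. complex_of_real ((\<xi> \<bullet> x)\<^sup>2 / ((\<xi> \<bullet> x)\<^sup>2 + (d * norm x)\<^sup>2))) \<le> norm x powr (-1) * (1 * sphere_vol TYPE('n))"
    by (intro mult_mono) auto
  then show ?thesis unfolding integral_reg_kernel[OF x d] norm_mult norm_of_real by (simp only: mult.commute mult_1)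
qed

text \<open>Exchange the integrals and substitute \<open>\<sigma>\<^sub>\<xi> x\<close> for \<open>x\<close> in the term with \<open>f (\<sigma>\<^sub>\<xi> x)\<close>. With \<open>\<kappa>\<close> for the kernel, which is odd, and \<open>W = rad P\<close>, this turns the integrand into \<open>\<kappa> f (W + W \<circ> \<sigma>\<^sub>\<xi>) = f (2 \<kappa> W - rad \<kappa> (P - P \<circ> \<sigma>\<^sub>\<xi>))\<close>. The function \<open>B\<close> bounds the derivatives of \<open>P\<close> on the ball of radius \<open>|x|\<close>, so that the last difference is controlled although the kernel is not bounded uniformly in \<open>d\<close>.\<close>
lemma integral_reg_int_duality:
  fixes f P :: "real^'n::finite \<Rightarrow> complex" and rad :: "real^'n \<Rightarrow> complex"
  assumes f [measurable]: "f \<in> borel_measurable borel" and Cf: "\<And>x. cmod (f x) \<le> Cf"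
    and P: "\<And>y. P differentiable (at y)" "\<And>k. continuous_on UNIV (partial k P)"
    and B: "\<And>k x z. norm z \<le> norm x \<Longrightarrow> cmod (partial k P z) \<le> B x"
    and rad [measurable]: "rad \<in> borel_measurable borel"
    and inv: "\<And>\<xi> x. norm \<xi> = 1 \<Longrightarrow> rad (reflection \<xi> x) = rad x"
    and W1: "integrable lborel (\<lambda>x. of_real (norm x powr (-1)) * (rad x * P x))"
    and W2: "integrable lborel (\<lambda>x. rad x * of_real (B x))"
    and d: "d > 0"
  shows "(LINT x|lborel. reg_int n d f x * (rad x * P x)) =
    (LINT x|lborel. f x * (of_real 2 * (LINT \<xi>|sphere_measure. of_real (reg_kernel n d x \<xi>)) * (rad x * P x) - rad x * reg_int n d P x))"
proof -
  note [measurable] = differentiable_borel_measurable[OF P(1)]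
  have [measurable]: "(\<lambda>z. reflection (snd z) (fst z)) \<in> (borel \<Otimes>\<^sub>M borel) \<rightarrow>\<^sub>M (borel :: (real^'n) measure)"
    unfolding borel_prod by (intro borel_measurable_continuous_onI) (auto simp: split_def reflection_def intro!: continuous_intros)
  have [measurable]: "(\<lambda>z. reg_kernel n d (fst z) (snd z)) \<in> borel_measurable (borel \<Otimes>\<^sub>M borel)"
    using measurable_reg_kernel[of n d] by (simp only: split_def)
  have [measurable]: "(\<lambda>x. reg_kernel n d x \<xi>) \<in> borel_measurable borel" for \<xi> unfolding reg_kernel_def by measurable
  have Cf0: "Cf \<ge> 0" using Cf[of 0] norm_ge_zero[of "f 0"] by (rule order_trans[rotated])
  let ?\<kappa> = "\<lambda>x \<xi>. complex_of_real (reg_kernel n d x \<xi>)"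
  let ?W = "\<lambda>x. rad x * P x"
  let ?g = "\<lambda>x. 2 * Cf * (1 / d) * cmod (of_real (norm x powr (-1)) * ?W x)"
  let ?h = "\<lambda>x. 2 * real CARD('n) * Cf * cmod (rad x * of_real (B x))"
  have g: "integrable lborel ?g" by (intro integrable_mult_right integrable_norm W1)
  have h: "integrable lborel ?h" by (intro integrable_mult_right integrable_norm W2)
  have g_le: "cmod (?\<kappa> x \<xi> * u * ?W x) \<le> ?g x" if "norm \<xi> = 1" "x \<noteq> 0" "cmod u \<le> 2 * Cf" for x \<xi> :: "real^'n" and u
  proof -
    have "cmod (?\<kappa> x \<xi> * u * ?W x) = \<bar>reg_kernel n d x \<xi>\<bar> * cmod u * cmod (?W x)" by (simp only: norm_mult norm_of_real)
    also have "\<dots> \<le> ((1 / d) * norm x powr (-1)) * (2 * Cf) * cmod (?W x)"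
      using d by (intro mult_right_mono mult_mono reg_kernel_bound_norm that) auto
    also have "\<dots> = ?g x"
    proof -
      have "cmod (of_real (norm x powr (-1)) * ?W x) = norm x powr (-1) * cmod (?W x)"
        by (simp only: norm_mult[of "of_real (norm x powr (-1))"] norm_of_real abs_of_nonneg[OF powr_ge_zero])
      then show ?thesis by (simp only: mult_ac)
    qed
    finally show ?thesis .
  qed
  have u_le: "cmod (f x - f y) \<le> 2 * Cf" for x y
    using norm_triangle_ineq4[of "f x" "f y"] Cf[of x] Cf[of y] by linarith
  \<comment> \<open>The integrand before and after the substitution.\<close>
  let ?F = "\<lambda>x \<xi>. ?\<kappa> x \<xi> * (f x - f (reflection \<xi> x)) * ?W x"
  let ?F' = "\<lambda>x \<xi>. f x * (of_real 2 * ?\<kappa> x \<xi> * ?W x - rad x * (?\<kappa> x \<xi> * (P x - P (reflection \<xi> x))))"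
  have iF: "integrable (lborel \<Otimes>\<^sub>M sphere_measure) (\<lambda>(x, \<xi>). ?F x \<xi>)"
  proof (rule integrable_lborel_sphere_bounded[OF _ g])
    show "(\<lambda>(x, \<xi>). ?F x \<xi>) \<in> borel_measurable (borel \<Otimes>\<^sub>M borel)" unfolding split_def by measurable
    show "cmod (case (x, \<xi>) of (x, \<xi>) \<Rightarrow> ?F x \<xi>) \<le> ?g x" if "norm \<xi> = 1" "x \<noteq> 0" for x \<xi> :: "real^'n"
      using g_le[OF that u_le] by (simp only: prod.case)
  qed
  have iF': "integrable (lborel \<Otimes>\<^sub>M sphere_measure) (\<lambda>(x, \<xi>). ?F' x \<xi>)"
  proof (rule integrable_lborel_sphere_bounded)
    show "integrable lborel (\<lambda>x. ?g x + ?h x)" using g h by (rule Bochner_Integration.integrable_add)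
    show "(\<lambda>(x, \<xi>). ?F' x \<xi>) \<in> borel_measurable (borel \<Otimes>\<^sub>M borel)" unfolding split_def by measurable
    fix x \<xi> :: "real^'n" assume \<xi>: "norm \<xi> = 1" and x: "x \<noteq> 0"
    have "cmod (f x * (of_real 2 * ?\<kappa> x \<xi> * ?W x)) = cmod (?\<kappa> x \<xi> * (of_real 2 * f x) * ?W x)" by (simp only: norm_mult mult_ac)
    also have "\<dots> \<le> ?g x" using Cf[of x] by (intro g_le \<xi> x) (simp add: norm_mult)
    finally have 1: "cmod (f x * (of_real 2 * ?\<kappa> x \<xi> * ?W x)) \<le> ?g x" .
    have "cmod (f x * (rad x * (?\<kappa> x \<xi> * (P x - P (reflection \<xi> x))))) \<le> Cf * (cmod (rad x) * (2 * (real CARD('n) * B x)))"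
      unfolding norm_mult[of "f x"] norm_mult[of "rad x"]
      by (intro mult_mono Cf reg_kernel_mult_bound[OF P \<xi> B] order_refl mult_nonneg_nonneg norm_ge_zero Cf0)
    also have "\<dots> \<le> Cf * (cmod (rad x) * (2 * (real CARD('n) * \<bar>B x\<bar>)))" using Cf0 by (intro mult_left_mono) auto
    also have "\<dots> = ?h x" by (simp only: norm_mult norm_of_real mult_ac)
    finally have 2: "cmod (f x * (rad x * (?\<kappa> x \<xi> * (P x - P (reflection \<xi> x))))) \<le> ?h x" .
    show "cmod (case (x, \<xi>) of (x, \<xi>) \<Rightarrow> ?F' x \<xi>) \<le> ?g x + ?h x"
      unfolding prod.case right_diff_distrib[of "f x"]
      by (rule order_trans[OF norm_triangle_ineq4 add_mono[OF 1 2]])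
  qed
  have inner: "(LINT x|lborel. ?F x \<xi>) = (LINT x|lborel. ?F' x \<xi>)" if \<xi>: "norm \<xi> = 1" for \<xi> :: "real^'n"
  proof -
    have [measurable]: "reflection \<xi> \<in> borel_measurable borel"
      by (intro borel_measurable_continuous_onI continuous_reflection)
    have int: "integrable lborel (\<lambda>x. ?\<kappa> x \<xi> * u x * ?W x)"
      if [measurable]: "u \<in> borel_measurable borel" and u: "\<And>x. cmod (u x) \<le> Cf" for u :: "real^'n \<Rightarrow> complex"
    proof (rule Bochner_Integration.integrable_bound[OF g])
      show "AE x in lborel. cmod (?\<kappa> x \<xi> * u x * ?W x) \<le> norm (?g x)"
        using AE_lborel_singleton[of "0::real^'n"]
      proof eventually_elim
        case (elim x)
        have "cmod (u x) \<le> 2 * Cf" using u[of x] Cf0 by linarith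
        from g_le[OF \<xi> elim this] show ?case by (rule order_trans) (simp only: real_norm_def abs_ge_self)
      qed
    qed measurable
    have i1: "integrable lborel (\<lambda>x. ?\<kappa> x \<xi> * f x * ?W x)" by (rule int[OF f Cf])
    have i2: "integrable lborel (\<lambda>x. ?\<kappa> x \<xi> * f (reflection \<xi> x) * ?W x)" by (rule int) (measurable, rule Cf)
    have swap: "?\<kappa> (reflection \<xi> x) \<xi> * f (reflection \<xi> (reflection \<xi> x)) * ?W (reflection \<xi> x) = - (?\<kappa> x \<xi> * f x * (rad x * P (reflection \<xi> x)))" for x
      by (simp only: reg_kernel_reflection[OF \<xi>] reflection_reflection[OF \<xi>] inv[OF \<xi>] of_real_minus mult_minus_left)
    have i3: "integrable lborel (\<lambda>x. ?\<kappa> x \<xi> * f x * (rad x * P (reflection \<xi> x)))"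
    proof -
      have "(\<lambda>x. ?\<kappa> x \<xi> * f (reflection \<xi> x) * ?W x) \<in> borel_measurable borel" by measurable
      from Bochner_Integration.integrable_minus[OF integral_lborel_reflection(2)[OF \<xi> this i2]]
      show ?thesis unfolding swap minus_minus .
    qed
    have "(LINT x|lborel. ?\<kappa> x \<xi> * f (reflection \<xi> x) * ?W x) = - (LINT x|lborel. ?\<kappa> x \<xi> * f x * (rad x * P (reflection \<xi> x)))"
      using integral_lborel_reflection(1)[OF \<xi>, of "\<lambda>x. ?\<kappa> x \<xi> * f (reflection \<xi> x) * ?W x"] unfolding swap by simp
    moreover have "(LINT x|lborel. ?F x \<xi>) = (LINT x|lborel. ?\<kappa> x \<xi> * f x * ?W x) - (LINT x|lborel. ?\<kappa> x \<xi> * f (reflection \<xi> x) * ?W x)"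
      unfolding right_diff_distrib left_diff_distrib by (rule Bochner_Integration.integral_diff[OF i1 i2])
    ultimately have "(LINT x|lborel. ?F x \<xi>) = (LINT x|lborel. ?\<kappa> x \<xi> * f x * ?W x) + (LINT x|lborel. ?\<kappa> x \<xi> * f x * (rad x * P (reflection \<xi> x)))"
      by simp
    also have "\<dots> = (LINT x|lborel. ?\<kappa> x \<xi> * f x * ?W x + ?\<kappa> x \<xi> * f x * (rad x * P (reflection \<xi> x)))"
      by (rule Bochner_Integration.integral_add[OF i1 i3, symmetric])
    also have "\<dots> = (LINT x|lborel. ?F' x \<xi>)"
      by (rule Bochner_Integration.integral_cong[OF refl]) (simp add: algebra_simps)
    finally show ?thesis .
  qed
  have "(LINT x|lborel. reg_int n d f x * ?W x) = (LINT x|lborel. (LINT \<xi>|sphere_measure. ?F x \<xi>))"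
    unfolding reg_int_def by (simp only: integral_mult_left_zero)
  also have "\<dots> = (LINT \<xi>|sphere_measure. (LINT x|lborel. ?F x \<xi>))"
    by (rule lborel_sphere.Fubini_integral[OF iF, symmetric])
  also have "\<dots> = (LINT \<xi>|sphere_measure. (LINT x|lborel. ?F' x \<xi>))"
  proof (rule integral_cong_AE)
    show "(\<lambda>\<xi>. LINT x|lborel. ?F x \<xi>) \<in> borel_measurable sphere_measure" "(\<lambda>\<xi>. LINT x|lborel. ?F' x \<xi>) \<in> borel_measurable sphere_measure"
      by (rule borel_measurable_integrable, rule lborel_sphere.integrable_snd, rule iF iF')+
    show "AE \<xi> in sphere_measure. (LINT x|lborel. ?F x \<xi>) = (LINT x|lborel. ?F' x \<xi>)"
      using AE_sphere_measure_norm by eventually_elim (rule inner)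
  qed
  also have "\<dots> = (LINT x|lborel. (LINT \<xi>|sphere_measure. ?F' x \<xi>))"
    by (rule lborel_sphere.Fubini_integral[OF iF'])
  also have "\<dots> = (LINT x|lborel. f x * (of_real 2 * (LINT \<xi>|sphere_measure. ?\<kappa> x \<xi>) * ?W x - rad x * reg_int n d P x))"
  proof (rule Bochner_Integration.integral_cong[OF refl])
    fix x :: "real^'n"
    have a: "integrable sphere_measure (\<lambda>\<xi>. of_real 2 * ?\<kappa> x \<xi> * ?W x)" by (intro integrable_mult_left integrable_mult_right integrable_reg_kernel d)
    have b: "integrable sphere_measure (\<lambda>\<xi>. rad x * (?\<kappa> x \<xi> * (P x - P (reflection \<xi> x))))"
      by (intro integrable_mult_right integrable_sphere_bounded[OF reg_kernel_mult_measurable(2)[OF differentiable_borel_measurable[OF P(1)]] reg_kernel_mult_bound[OF P _ B]]) auto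
    show "(LINT \<xi>|sphere_measure. ?F' x \<xi>) = f x * (of_real 2 * (LINT \<xi>|sphere_measure. ?\<kappa> x \<xi>) * ?W x - rad x * reg_int n d P x)"
      unfolding reg_int_def integral_mult_right_zero Bochner_Integration.integral_diff[OF a b] integral_mult_left_zero ..
  qed
  finally show ?thesis .
qed

lemma borel_measurable_sphere_integral:
  fixes F :: "real^'n::finite \<Rightarrow> real^'n \<Rightarrow> complex"
  assumes "(\<lambda>(x, \<xi>). F x \<xi>) \<in> borel_measurable (borel \<Otimes>\<^sub>M borel)"
  shows "(\<lambda>x. LINT \<xi>|sphere_measure. F x \<xi>) \<in> borel_measurable borel"
  using sphere.borel_measurable_lebesgue_integral[OF measurable_lborel_sphere[OF assms]] by simp

lemma refl_int_borel_measurable: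
  fixes f :: "real^'n::finite \<Rightarrow> complex"
  assumes "\<And>k. continuous_on UNIV (partial k f)"
  shows "refl_int n f \<in> borel_measurable borel"
  unfolding refl_int_def
proof (rule borel_measurable_sphere_integral)
  have [measurable]: "(\<lambda>z. reflection_quotient f (fst z) (snd z)) \<in> borel_measurable (borel \<Otimes>\<^sub>M borel)"
    using measurable_reflection_quotient(1)[OF assms] by (simp only: split_def)
  show "(\<lambda>(x, \<xi>). of_real (\<xi> $ n) * reflection_quotient f x \<xi>) \<in> borel_measurable (borel \<Otimes>\<^sub>M borel)"
    unfolding split_def by measurable
qed

lemma reg_int_borel_measurable:
  fixes f :: "real^'n::finite \<Rightarrow> complex"
  shows "f \<in> borel_measurable borel \<Longrightarrow> reg_int n d f \<in> borel_measurable borel"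
  unfolding reg_int_def[abs_def] by (intro borel_measurable_sphere_integral reg_kernel_mult_measurable)

text \<open>Let the regularisation tend to zero in \<open>integral_reg_int_duality\<close>. In both integrals the differences compensate the singularity of the kernel, and the mean of the kernel itself converges by \<open>integral_reg_kernel_tendsto\<close>; all bounds are uniform in \<open>d\<close>.\<close>
lemma integral_refl_int_duality:
  fixes f P :: "real^'n::finite \<Rightarrow> complex" and rad :: "real^'n \<Rightarrow> complex"
  assumes f: "f \<in> schwartz"
    and P: "\<And>y. P differentiable (at y)" "\<And>k. continuous_on UNIV (partial k P)"
    and B: "\<And>k x z. norm z \<le> norm x \<Longrightarrow> cmod (partial k P z) \<le> B x"
    and rad [measurable]: "rad \<in> borel_measurable borel"
    and inv: "\<And>\<xi> x. norm \<xi> = 1 \<Longrightarrow> rad (reflection \<xi> x) = rad x"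
    and W0: "integrable lborel (\<lambda>x. rad x * P x)"
    and W1: "integrable lborel (\<lambda>x. of_real (norm x powr (-1)) * (rad x * P x))"
    and W2: "integrable lborel (\<lambda>x. rad x * of_real (B x))"
  shows "(LINT x|lborel. refl_int n f x * (rad x * P x)) =
    (LINT x|lborel. f x * (of_real 2 * of_real (sphere_vol TYPE('n) * (x $ n / (norm x)\<^sup>2)) * (rad x * P x) - rad x * refl_int n P x))"
proof -
  note fd = schwartz_differentiable[OF f] and fc = schwartz_continuous[OF schwartz_partial[OF f]]
  note [measurable] = differentiable_borel_measurable[OF P(1)] schwartz_measurable[OF f]
    refl_int_borel_measurable[OF fc] refl_int_borel_measurable[OF P(2)]
    reg_int_borel_measurable[OF schwartz_measurable[OF f]] reg_int_borel_measurable[OF differentiable_borel_measurable[OF P(1)]]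
  obtain C where C: "C \<ge> 0" "\<And>k z. cmod (partial k f z) \<le> C" using schwartz_partial_bound[OF f] by blast
  obtain Cf where Cf: "Cf > 0" "\<And>x. norm x ^ 0 * cmod (f x) \<le> Cf" by (rule schwartz_decay[OF f, of 0]) blast
  then have Cf': "cmod (f x) \<le> Cf" for x by simp
  let ?v = "sphere_vol TYPE('n)" and ?d = "\<lambda>i. 1 / real (Suc i)"
  let ?m = "\<lambda>i x. LINT \<xi>|sphere_measure. complex_of_real (reg_kernel n (?d i) x \<xi>)"
  have [measurable]: "?m i \<in> borel_measurable borel" for i
  proof (rule borel_measurable_sphere_integral)
    show "(\<lambda>(x, \<xi>). complex_of_real (reg_kernel n (?d i) x \<xi>)) \<in> borel_measurable (borel \<Otimes>\<^sub>M borel)"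
      using measurable_reg_kernel[of n "?d i"] by (simp add: split_def)
  qed
  let ?L = "\<lambda>i. LINT x|lborel. reg_int n (?d i) f x * (rad x * P x)"
  let ?R = "\<lambda>i. LINT x|lborel. f x * (of_real 2 * ?m i x * (rad x * P x) - rad x * reg_int n (?d i) P x)"
  have eq: "?L i = ?R i" for i
    by (rule integral_reg_int_duality[OF schwartz_measurable[OF f] Cf' P B rad inv W1 W2]) simp_all
  have L: "?L \<longlonglongrightarrow> (LINT x|lborel. refl_int n f x * (rad x * P x))"
  proof (rule integral_dominated_convergence[where w = "\<lambda>x. 2 * (real CARD('n) * C) * ?v * cmod (rad x * P x)"])
    show "integrable lborel (\<lambda>x. 2 * (real CARD('n) * C) * ?v * cmod (rad x * P x))"
      by (intro integrable_mult_right integrable_norm W0)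
    show "AE x in lborel. (\<lambda>i. reg_int n (?d i) f x * (rad x * P x)) \<longlonglongrightarrow> refl_int n f x * (rad x * P x)"
      using AE_lborel_singleton[of "0::real^'n"]
      by eventually_elim (intro tendsto_intros reg_int_tendsto[OF fd fc C(2)])
    show "AE x in lborel. cmod (reg_int n (?d i) f x * (rad x * P x)) \<le> 2 * (real CARD('n) * C) * ?v * cmod (rad x * P x)" for i
      unfolding norm_mult[of "reg_int n (?d i) f _"]
      by (intro AE_I2 mult_right_mono cmod_reg_int_le fd fc C(2) norm_ge_zero)
  qed measurable
  have R: "?R \<longlonglongrightarrow> (LINT x|lborel. f x * (of_real 2 * of_real (?v * (x $ n / (norm x)\<^sup>2)) * (rad x * P x) - rad x * refl_int n P x))"
  proof (rule integral_dominated_convergence[where w = "\<lambda>x. Cf * (2 * ?v * cmod (of_real (norm x powr (-1)) * (rad x * P x)) + 2 * real CARD('n) * ?v * cmod (rad x * of_real (B x)))"])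
    show "integrable lborel (\<lambda>x. Cf * (2 * ?v * cmod (of_real (norm x powr (-1)) * (rad x * P x)) + 2 * real CARD('n) * ?v * cmod (rad x * of_real (B x))))"
      by (intro integrable_mult_right Bochner_Integration.integrable_add integrable_norm W1 W2)
    show "AE x in lborel. (\<lambda>i. f x * (of_real 2 * ?m i x * (rad x * P x) - rad x * reg_int n (?d i) P x)) \<longlonglongrightarrow>
        f x * (of_real 2 * of_real (?v * (x $ n / (norm x)\<^sup>2)) * (rad x * P x) - rad x * refl_int n P x)"
      using AE_lborel_singleton[of "0::real^'n"]
      by eventually_elim (intro tendsto_intros reg_int_tendsto[OF P B] integral_reg_kernel_tendsto)
    show "AE x in lborel. cmod (f x * (of_real 2 * ?m i x * (rad x * P x) - rad x * reg_int n (?d i) P x)) \<le>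
        Cf * (2 * ?v * cmod (of_real (norm x powr (-1)) * (rad x * P x)) + 2 * real CARD('n) * ?v * cmod (rad x * of_real (B x)))" for i
      using AE_lborel_singleton[of "0::real^'n"]
    proof eventually_elim
      case (elim x)
      have "cmod (of_real 2 * ?m i x * (rad x * P x)) = 2 * cmod (?m i x) * cmod (rad x * P x)" by (simp only: norm_mult norm_of_real abs_numeral)
      also have "\<dots> \<le> 2 * (?v * norm x powr (-1)) * cmod (rad x * P x)"
        by (intro mult_right_mono mult_left_mono cmod_integral_reg_kernel_le elim) auto
      also have "\<dots> = 2 * ?v * cmod (of_real (norm x powr (-1)) * (rad x * P x))"
        by (simp only: norm_mult[of "of_real (norm x powr (-1))"] norm_of_real abs_of_nonneg[OF powr_ge_zero] mult.assoc)
      finally have 1: "cmod (of_real 2 * ?m i x * (rad x * P x)) \<le> 2 * ?v * cmod (of_real (norm x powr (-1)) * (rad x * P x))" .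
      have "cmod (rad x * reg_int n (?d i) P x) \<le> cmod (rad x) * (2 * (real CARD('n) * B x) * ?v)"
        unfolding norm_mult by (intro mult_left_mono cmod_reg_int_le P B norm_ge_zero)
      also have "\<dots> \<le> cmod (rad x) * (2 * (real CARD('n) * \<bar>B x\<bar>) * ?v)"
        using sphere_vol_pos by (intro mult_left_mono mult_right_mono) (auto intro: less_imp_le)
      also have "\<dots> = 2 * real CARD('n) * ?v * cmod (rad x * of_real (B x))" by (simp only: norm_mult norm_of_real mult_ac)
      finally have 2: "cmod (rad x * reg_int n (?d i) P x) \<le> 2 * real CARD('n) * ?v * cmod (rad x * of_real (B x))" .
      show ?case unfolding norm_mult[of "f x"]
        by (intro mult_mono Cf' order_trans[OF norm_triangle_ineq4 add_mono[OF 1 2]]) (use Cf in auto)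
    qed
  qed measurable
  show ?thesis using L R unfolding eq by (rule LIMSEQ_unique)
qed

section \<open>Integration by parts with a radial weight\<close>

text \<open>At the origin both the function and its derivative vanish, since \<open>s > 1\<close>; the formula remains correct there because of the factor \<open>x \<bullet> h = 0\<close>.\<close>
lemma has_derivative_norm_powr:
  fixes x :: "real^'n::finite"
  assumes s: "s > 1"
  shows "((\<lambda>x. norm x powr s) has_derivative (\<lambda>h. s * norm x powr (s - 2) * (x \<bullet> h))) (at x)"
proof (cases "x = 0")
  case True
  have "((\<lambda>h. norm h powr (s - 1)) \<longlongrightarrow> 0 powr (s - 1)) (at (0::real^'n))"
    using s by (intro tendsto_powr' tendsto_const) (auto intro!: tendsto_eq_intros)
  moreover have "norm h powr s / norm h = norm h powr (s - 1)" for h :: "real^'n"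
    by (cases "h = 0") (simp_all add: powr_diff)
  ultimately show ?thesis unfolding True has_derivative_at by simp
next
  case False
  have "((\<lambda>r. r powr s) has_real_derivative s * norm x powr (s - 1)) (at (norm x))"
    using False by (auto intro!: has_real_derivative_powr)
  from DERIV_compose_FDERIV[OF this has_derivative_norm[OF False]]
  have "((\<lambda>x. norm x powr s) has_derivative (\<lambda>h. (h \<bullet> sgn x) * (s * norm x powr (s - 1)))) (at x)" .
  moreover have "(h \<bullet> sgn x) * (s * norm x powr (s - 1)) = s * norm x powr (s - 2) * (x \<bullet> h)" for h
    using False powr_add[of "norm x" "s - 2" 1] by (simp add: sgn_div_norm inner_commute field_simps)
  ultimately show ?thesis by (simp only:)
qed

lemma integrable_bounded_powr_gauss:
  fixes h :: "real^'n::finite \<Rightarrow> complex"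
  assumes [measurable]: "h \<in> borel_measurable borel" and C: "\<And>x. cmod (h x) \<le> C" and q: "cpoly q" and a: "a > - real CARD('n)"
  shows "integrable lborel (\<lambda>x. h x * (of_real (norm x powr a) * (gauss_pow 0 x * q x)))"
proof -
  note [measurable] = gauss_measurable cpoly_measurable[OF q]
  have "integrable lborel (\<lambda>x. of_real (norm x powr a) * (h x * (gauss_pow 0 x * q x)))"
    by (intro integrable_powr_rapid rapid_mult_bounded[OF rapid_gauss_mult[OF q] C] a) measurable
  then show ?thesis by (simp only: mult.left_commute)
qed

text \<open>For \<open>s > 2\<close> the product of \<open>|x|\<^sup>s\<close> with a differentiable function is differentiable everywhere and its derivative is continuous, so the origin contributes no boundary term.\<close>
lemma integral_weighted_by_parts:
  fixes f q :: "real^'n::finite \<Rightarrow> complex"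
  assumes f: "f \<in> schwartz" and q: "cpoly q" and s: "s > 2"
  shows "(LINT x|lborel. partial n f x * (of_real (norm x powr s) * (gauss_pow 0 x * q x))) =
    - (LINT x|lborel. f x * (of_real (norm x powr s) * partial n (\<lambda>x. gauss_pow 0 x * q x) x
        + of_real s * (of_real (norm x powr (s - 2)) * (gauss_pow 0 x * (of_real (x $ n) * q x)))))"
proof -
  obtain C where C: "C > 0" "\<And>x. norm x ^ 0 * cmod (f x) \<le> C" by (rule schwartz_decay[OF f, of 0]) blast
  then have C': "cmod (f x) \<le> C" for x by simp
  obtain C1 where C1: "C1 > 0" "\<And>x. norm x ^ 0 * cmod (partial n f x) \<le> C1" by (rule schwartz_decay[OF schwartz_partial[OF f], of 0 n]) blast
  then have C1': "cmod (partial n f x) \<le> C1" for x by simp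
  note fm = schwartz_measurable[OF f] and f1m = schwartz_measurable[OF schwartz_partial[OF f]]
  let ?V = "\<lambda>x. gauss_pow 0 x * q x"
  let ?q1 = "\<lambda>x. partial n q x - of_real (x $ n) * q x" and ?q2 = "\<lambda>x. of_real (x $ n) * q x"
  let ?\<rho> = "\<lambda>x::real^'n. complex_of_real (norm x powr s)"
  have c: "cpoly ?q1" "cpoly ?q2" by (intro cpoly_diff cpoly_partial cpoly.intros q)+
  have V: "partial n ?V = (\<lambda>x. gauss_pow 0 x * ?q1 x)" by (rule partial_gauss_mult[OF q])
  have \<rho>D: "(?\<rho> has_derivative (\<lambda>h. of_real (s * norm x powr (s - 2) * (x \<bullet> h)))) (at x)" for x
    using s by (intro has_derivative_of_real has_derivative_norm_powr) simp
  have \<rho>: "?\<rho> differentiable (at x)" "partial n ?\<rho> x = of_real (s * norm x powr (s - 2) * x $ n)" for x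
    using \<rho>D[of x] by (auto simp: differentiable_def partial_eqI[OF \<rho>D] inner_axis)
  have i0: "integrable lborel (\<lambda>x. f x * (?\<rho> x * ?V x))"
    using s by (intro integrable_bounded_powr_gauss[OF fm C'] q) auto
  have i1: "integrable lborel (\<lambda>x. partial n f x * (?\<rho> x * ?V x))"
    using s by (intro integrable_bounded_powr_gauss[OF f1m C1'] q) auto
  have i2: "integrable lborel (\<lambda>x. f x * (?\<rho> x * (gauss_pow 0 x * ?q1 x)))"
    using s by (intro integrable_bounded_powr_gauss[OF fm C'] c) auto
  have i3: "integrable lborel (\<lambda>x. f x * (of_real (norm x powr (s - 2)) * (gauss_pow 0 x * ?q2 x)))"
    using s by (intro integrable_bounded_powr_gauss[OF fm C'] c) auto
  let ?g = "\<lambda>x. f x * (?\<rho> x * (gauss_pow 0 x * ?q1 x) + of_real s * (of_real (norm x powr (s - 2)) * (gauss_pow 0 x * ?q2 x)))"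
  have ig: "integrable lborel ?g"
    unfolding distrib_left mult.left_commute[of "f _" "of_real s"]
    by (intro Bochner_Integration.integrable_add integrable_mult_right i2 i3)
  have \<rho>V: "(\<lambda>x. ?\<rho> x * ?V x) differentiable (at x)" for x
    by (intro differentiable_mult_complex \<rho> differentiable_gauss_mult q)
  have part: "partial n (\<lambda>x. f x * (?\<rho> x * ?V x)) = (\<lambda>x. partial n f x * (?\<rho> x * ?V x) + ?g x)"
  proof
    fix x
    have "partial n (\<lambda>x. f x * (?\<rho> x * ?V x)) x = partial n f x * (?\<rho> x * ?V x) + f x * (partial n ?\<rho> x * ?V x + ?\<rho> x * partial n ?V x)"
      by (simp only: partial_mult[OF schwartz_differentiable[OF f] \<rho>V] partial_mult[OF \<rho>(1) differentiable_gauss_mult[OF q]])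
    also have "partial n ?\<rho> x * ?V x + ?\<rho> x * partial n ?V x = ?\<rho> x * (gauss_pow 0 x * ?q1 x) + of_real s * (of_real (norm x powr (s - 2)) * (gauss_pow 0 x * ?q2 x))"
      unfolding \<rho>(2) V of_real_mult by (simp only: add.commute mult_ac)
    finally show "partial n (\<lambda>x. f x * (?\<rho> x * ?V x)) x = partial n f x * (?\<rho> x * ?V x) + ?g x" .
  qed
  have powr_cont: "continuous_on UNIV (\<lambda>x::real^'n. complex_of_real (norm x powr a))" if "a > 0" for a
    by (intro continuous_on_of_real continuous_on_powr' continuous_on_norm_id continuous_on_const) (use that in auto)
  have conts: "continuous_on UNIV f" "continuous_on UNIV (partial n f)" "continuous_on UNIV (gauss_pow 0 :: real^'n \<Rightarrow> complex)"
    "continuous_on UNIV q" "continuous_on UNIV ?q1" "continuous_on UNIV ?q2"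
    by (rule schwartz_continuous[OF f] schwartz_continuous[OF schwartz_partial[OF f]] continuous_gauss cpoly_continuous[OF q] cpoly_continuous[OF c(1)] cpoly_continuous[OF c(2)])+
  have "integral\<^sup>L lborel (partial n (\<lambda>x. f x * (?\<rho> x * ?V x))) = 0"
  proof (rule integral_partial_eq_0)
    show "(\<lambda>x. f x * (?\<rho> x * ?V x)) differentiable (at x)" for x
      by (intro differentiable_mult_complex schwartz_differentiable f \<rho> differentiable_gauss_mult q)
    show "continuous_on UNIV (partial n (\<lambda>x. f x * (?\<rho> x * ?V x)))"
      unfolding part
      by (intro continuous_on_add continuous_on_mult continuous_on_const powr_cont conts) (use s in simp_all)
    show "integrable lborel (partial n (\<lambda>x. f x * (?\<rho> x * ?V x)))"
      unfolding part by (rule Bochner_Integration.integrable_add[OF i1 ig])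
  qed (rule i0)
  then have "(LINT x|lborel. partial n f x * (?\<rho> x * ?V x)) + (LINT x|lborel. ?g x) = 0"
    unfolding part Bochner_Integration.integral_add[OF i1 ig] .
  then show ?thesis unfolding V by (rule eq_neg_iff_add_eq_0[THEN iffD2])
qed

section \<open>Identification of \<open>D_{b,n}\<close>\<close>

lemma cnj_gauss_pow [simp]: "cnj (gauss_pow k x) = gauss_pow k x"
  by (simp add: gauss_pow_def)

lemma integral_cong_nonzero:
  fixes f g :: "real^'n::finite \<Rightarrow> complex"
  assumes "f \<in> borel_measurable borel" "g \<in> borel_measurable borel" "\<And>x. x \<noteq> 0 \<Longrightarrow> f x = g x"
  shows "(LINT x|lborel. f x) = (LINT x|lborel. g x)"
proof (rule integral_cong_AE)
  show "AE x in lborel. f x = g x"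
    using AE_lborel_singleton[of "0::real^'n"] by eventually_elim (rule assms(3))
qed (use assms in simp_all)

text \<open>The sesquilinear pairing turned into a bilinear one: apply \<open>D_op_pairing\<close> to the conjugate polynomial.\<close>
lemma D_op_weighted_integral:
  fixes f p :: "real^'n::finite \<Rightarrow> complex"
  assumes b: "b > - real CARD('n) / 2"
    and G: "is_universal_cover_SL2 G \<pi>"
    and R: "is_radial_Euler b R"
    and Omega: "is_Omega G \<pi> b R \<Omega>"
    and smooth: "smooth_vectors_are_schwartz G \<pi> b \<Omega>"
    and f: "f \<in> schwartz" and p: "p \<in> harmonic_poly m"
  shows "(LINT x|lborel. of_real (norm x powr (2 * b)) * (D_op G \<pi> b \<Omega> n f x * test_fun k p x)) =
    - (LINT x|lborel. of_real (norm x powr (2 * b)) *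
        (f x * (partial n (test_fun k p) x + 2 * of_real b * (gauss_pow k x * lowering n m p x))))"
proof -
  let ?p = "\<lambda>x. cnj (p x)"
  have cp: "cpoly p" using p by (simp add: harmonic_poly_iff)
  note D = D_op_schwartz[OF b G R Omega smooth f, of n]
  have t: "test_fun k ?p = (\<lambda>x. cnj (test_fun k p x))" by (rule ext) (simp add: test_fun_def)
  have cnj1: "cnj (test_fun k ?p x) = test_fun k p x" for x by (simp add: t)
  have cnj2: "cnj (partial n (test_fun k ?p) x + 2 * of_real b * (gauss_pow k x * lowering n m ?p x)) =
      partial n (test_fun k p) x + 2 * of_real b * (gauss_pow k x * lowering n m p x)" for x
    by (simp add: t lowering_def partial_cnj[OF differentiable_test_fun[OF cp]] partial_cnj[OF cpoly_differentiable[OF cp]])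
  note [measurable] = differentiable_borel_measurable[OF differentiable_gauss_pow[of k]]
    differentiable_borel_measurable[OF differentiable_test_fun[OF cp], of k]
    differentiable_borel_measurable[OF differentiable_partial_test_fun[OF cp], of n k]
    schwartz_measurable[OF f] schwartz_measurable[OF D] cpoly_measurable[OF cpoly_partial[OF cp], of n]
  have [measurable]: "lowering n m p \<in> borel_measurable borel" unfolding lowering_def by measurable
  have "L2_inner (weighted b) (D_op G \<pi> b \<Omega> n f) (test_fun k ?p) =
      (LINT x|lborel. of_real (norm x powr (2 * b)) * (D_op G \<pi> b \<Omega> n f x * test_fun k p x))"
    unfolding L2_inner_def cnj1 by (rule integral_weighted(1)) measurable
  moreover have "L2_inner (weighted b) f (\<lambda>x. partial n (test_fun k ?p) x + 2 * of_real b * (gauss_pow k x * lowering n m ?p x)) =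
      (LINT x|lborel. of_real (norm x powr (2 * b)) * (f x * (partial n (test_fun k p) x + 2 * of_real b * (gauss_pow k x * lowering n m p x))))"
    unfolding L2_inner_def cnj2 by (rule integral_weighted(1)) measurable
  ultimately show ?thesis
    using D_op_pairing[OF b G R Omega smooth f harmonic_poly_cnj[OF p], of n k] by (simp only:)
qed

text \<open>A bound that depends on \<open>|x|\<close> only and is itself a polynomial, so that its product with the Gaussian is integrable.\<close>
lemma cpoly_partial_radial_bound:
  fixes p :: "real^'n::finite \<Rightarrow> complex"
  assumes "cpoly p"
  shows "\<exists>B :: real^'n \<Rightarrow> real. (\<forall>k x z. norm z \<le> norm x \<longrightarrow> cmod (partial k p z) \<le> B x) \<and> cpoly (\<lambda>x. complex_of_real (B x))"
proof -
  have "\<forall>k. \<exists>C d. C \<ge> 0 \<and> (\<forall>x. cmod (partial k p x) \<le> C * (1 + norm x) ^ d)"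
    using cpoly_bound[OF cpoly_partial[OF assms]] by blast
  then obtain C d where C: "\<And>k. C k \<ge> 0" "\<And>k x. cmod (partial k p x) \<le> C k * (1 + norm x) ^ d k" by metis
  define B where "B x = (\<Sum>k\<in>UNIV. C k * (2 + (norm x)\<^sup>2) ^ d k)" for x :: "real^'n"
  show ?thesis
  proof (intro exI[of _ B] conjI allI impI)
    fix k and x z :: "real^'n" assume z: "norm z \<le> norm x"
    have "norm z \<le> 1 + (norm x)\<^sup>2"
    proof -
      have "2 * norm x \<le> 1 + (norm x)\<^sup>2" using sum_squares_bound[of 1 "norm x"] by simp
      then show ?thesis using z norm_ge_zero[of x] by linarith
    qed
    then have "C k * (1 + norm z) ^ d k \<le> C k * (2 + (norm x)\<^sup>2) ^ d k" by (intro mult_left_mono power_mono C(1)) auto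
    also have "\<dots> \<le> B x" unfolding B_def by (rule member_le_sum) (use C(1) in auto)
    finally show "cmod (partial k p z) \<le> B x" using C(2)[of k z] by linarith
  next
    have "(\<lambda>x. complex_of_real (B x)) = (\<lambda>x. \<Sum>k\<in>UNIV. of_real (C k) * (2 + of_real ((norm x)\<^sup>2)) ^ d k)"
      by (simp add: B_def fun_eq_iff)
    then show "cpoly (\<lambda>x. complex_of_real (B x))"
      by (simp only:) (intro cpoly_sum cpoly.intros cpoly_power cpoly_norm_sq)
  qed
qed

text \<open>The duality of the reflection integral yields \<open>2 b x\<^sub>n |x|\<^sup>s\<^sup>-\<^sup>2\<close>, which is subtracted from the derivative \<open>s x\<^sub>n |x|\<^sup>s\<^sup>-\<^sup>2\<close> of the weight. This explains the factor \<open>s - 2 b\<close>, which is the even number \<open>2 K\<close> in the application.\<close>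
lemma reflection_operator_weighted_integral:
  fixes f p :: "real^'n::finite \<Rightarrow> complex"
  assumes f: "f \<in> schwartz" and p: "p \<in> harmonic_poly m" and s: "s > 2"
  shows "(LINT x|lborel. (partial n f x + of_real (b / sphere_vol TYPE('n)) * refl_int n f x) * (of_real (norm x powr s) * test_fun j p x)) =
    - (LINT x|lborel. f x * (of_real (norm x powr s) * partial n (test_fun j p) x
        + of_real (s - 2 * b) * (of_real (norm x powr (s - 2)) * (of_real (x $ n) * test_fun j p x))
        + 2 * of_real b * (of_real (norm x powr s) * (gauss_pow j x * lowering n m p x))))"
proof -
  let ?v = "sphere_vol TYPE('n)"
  have v: "?v > 0" by (rule sphere_vol_pos)
  let ?\<rho> = "\<lambda>a x. complex_of_real (norm (x :: real^'n) powr a)"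
  let ?q = "\<lambda>x. of_real ((norm x)\<^sup>2) ^ j * p x" and ?l = "\<lambda>x. of_real ((norm x)\<^sup>2) ^ j * lowering n m p x"
  let ?xq = "\<lambda>x. of_real (x $ n) * ?q x" and ?dq = "\<lambda>x. partial n ?q x - of_real (x $ n) * ?q x"
  have cp: "cpoly p" "cpoly (lowering n m p)" using p lowering_harmonic[OF p, of n] by (simp_all add: harmonic_poly_iff)
  have c: "cpoly ?q" "cpoly ?l" "cpoly ?xq" "cpoly ?dq"
    by (intro cpoly_diff cpoly_partial cpoly.intros cpoly_test_fun cp)+
  obtain B :: "real^'n \<Rightarrow> real" where B: "\<And>k x z. norm z \<le> norm x \<Longrightarrow> cmod (partial k p z) \<le> B x" "cpoly (\<lambda>x. complex_of_real (B x))"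
    using cpoly_partial_radial_bound[OF cp(1)] by auto
  obtain C where C: "C > 0" "\<And>x. norm x ^ 0 * cmod (f x) \<le> C" by (rule schwartz_decay[OF f, of 0]) blast
  then have C': "cmod (f x) \<le> C" for x by simp
  obtain C1 where C1: "C1 > 0" "\<And>x. norm x ^ 0 * cmod (partial n f x) \<le> C1" by (rule schwartz_decay[OF schwartz_partial[OF f], of 0 n]) blast
  then have C1': "cmod (partial n f x) \<le> C1" for x by simp
  obtain C2 where C2: "\<And>x. cmod (refl_int n f x) \<le> C2" using refl_int_bounded_continuous(2)[OF f] by blast
  note m = schwartz_measurable[OF f] schwartz_measurable[OF schwartz_partial[OF f]]
    borel_measurable_continuous_onI[OF refl_int_bounded_continuous(1)[OF f], of n]
  have a: "s > - real CARD('n)" "s - 2 > - real CARD('n)" "s - 1 > - real CARD('n)" using s by auto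
  note int = integrable_bounded_powr_gauss[OF m(1) C'] integrable_bounded_powr_gauss[OF m(2) C1'] integrable_bounded_powr_gauss[OF m(3) C2]
  have test_fun: "test_fun j p x = gauss_pow 0 x * ?q x" for x by (simp only: test_fun_eq)
  have gpl: "gauss_pow j x * lowering n m p x = gauss_pow 0 x * ?l x" for x by (simp only: gauss_pow_eq[of j] mult.assoc)
  let ?A = "LINT x|lborel. f x * (?\<rho> s x * (gauss_pow 0 x * ?dq x))"
  let ?X = "LINT x|lborel. f x * (?\<rho> (s - 2) x * (gauss_pow 0 x * ?xq x))"
  let ?Y = "LINT x|lborel. f x * (?\<rho> s x * (gauss_pow 0 x * ?l x))"
  have 1: "(LINT x|lborel. partial n f x * (?\<rho> s x * (gauss_pow 0 x * ?q x))) = - (?A + of_real s * ?X)"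
  proof -
    have "(LINT x|lborel. f x * (?\<rho> s x * (gauss_pow 0 x * ?dq x) + of_real s * (?\<rho> (s - 2) x * (gauss_pow 0 x * ?xq x)))) = ?A + of_real s * ?X"
      unfolding distrib_left mult.left_commute[of "f _" "of_real s"]
      by (subst Bochner_Integration.integral_add) (auto intro!: integrable_mult_right int c a simp only: integral_mult_right_zero)
    then show ?thesis unfolding integral_weighted_by_parts[OF f c(1) s] partial_gauss_mult[OF c(1)] by (simp only:)
  qed
  have 2: "(LINT x|lborel. refl_int n f x * (?\<rho> s x * (gauss_pow 0 x * ?q x))) = of_real (2 * ?v) * (?X - ?Y)"
  proof -
    let ?rad = "\<lambda>x. ?\<rho> s x * gauss_pow j x"
    note [measurable] = differentiable_borel_measurable[OF differentiable_gauss_pow[of j]]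
    have radp: "?rad x * p x = ?\<rho> s x * (gauss_pow 0 x * ?q x)" for x by (simp only: gauss_pow_eq[of j] mult.assoc)
    have one: "\<And>x. cmod ((\<lambda>x::real^'n. 1) x) \<le> 1" by simp
    note int1 = integrable_bounded_powr_gauss[OF borel_measurable_const one, unfolded mult_1]
    have "(LINT x|lborel. refl_int n f x * (?rad x * p x)) =
        (LINT x|lborel. f x * (of_real 2 * of_real (?v * (x $ n / (norm x)\<^sup>2)) * (?rad x * p x) - ?rad x * refl_int n p x))"
    proof (rule integral_refl_int_duality[OF f cpoly_differentiable[OF cp(1)] cpoly_continuous[OF cpoly_partial[OF cp(1)]] B(1)])
      show "?rad \<in> borel_measurable borel" by measurable
      show "?rad (reflection \<xi> x) = ?rad x" if "norm \<xi> = 1" for \<xi> x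
        by (simp only: gauss_pow_def norm_reflection[OF that])
      show "integrable lborel (\<lambda>x. ?rad x * p x)" unfolding radp by (rule int1[OF c(1) a(1)])
      have "?\<rho> (-1) x * (?rad x * p x) = ?\<rho> (s - 1) x * (gauss_pow 0 x * ?q x)" for x
      proof -
        have "norm x powr (-1) * norm x powr s = norm x powr (s - 1)"
            unfolding powr_add[symmetric] by (rule arg_cong[of _ _ "\<lambda>a. norm x powr a"]) simp
        then have "?\<rho> (-1) x * ?\<rho> s x = ?\<rho> (s - 1) x" unfolding of_real_mult[symmetric] by (simp only:)
        then show ?thesis unfolding radp mult.assoc[symmetric] by (simp only:)
      qed
      then show "integrable lborel (\<lambda>x. ?\<rho> (-1) x * (?rad x * p x))" by (simp only: int1[OF c(1) a(3)])
      have "?rad x * of_real (B x) = ?\<rho> s x * (gauss_pow 0 x * (of_real ((norm x)\<^sup>2) ^ j * of_real (B x)))" for x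
        by (simp only: gauss_pow_eq[of j] mult.assoc)
      then show "integrable lborel (\<lambda>x. ?rad x * of_real (B x))" by (simp only: int1[OF cpoly_test_fun[OF B(2)] a(1)])
    qed
    also have "\<dots> = (LINT x|lborel. of_real (2 * ?v) * (f x * (?\<rho> (s - 2) x * (gauss_pow 0 x * ?xq x)) - f x * (?\<rho> s x * (gauss_pow 0 x * ?l x))))"
    proof (rule integral_cong_AE)
      note [measurable] = m(1) cpoly_measurable[OF cp(1)] cpoly_measurable[OF c(1)] cpoly_measurable[OF c(2)] gauss_measurable
        refl_int_borel_measurable[OF cpoly_continuous[OF cpoly_partial[OF cp(1)]]]
      show "(\<lambda>x. f x * (of_real 2 * of_real (?v * (x $ n / (norm x)\<^sup>2)) * (?rad x * p x) - ?rad x * refl_int n p x)) \<in> borel_measurable lborel" by measurable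
      show "(\<lambda>x. of_real (2 * ?v) * (f x * (?\<rho> (s - 2) x * (gauss_pow 0 x * ?xq x)) - f x * (?\<rho> s x * (gauss_pow 0 x * ?l x)))) \<in> borel_measurable lborel" by measurable
      show "AE x in lborel. f x * (of_real 2 * of_real (?v * (x $ n / (norm x)\<^sup>2)) * (?rad x * p x) - ?rad x * refl_int n p x) =
          of_real (2 * ?v) * (f x * (?\<rho> (s - 2) x * (gauss_pow 0 x * ?xq x)) - f x * (?\<rho> s x * (gauss_pow 0 x * ?l x)))"
        using AE_lborel_singleton[of "0::real^'n"]
      proof eventually_elim
        case (elim x)
        have "norm x powr s = norm x powr (s - 2) * (norm x)\<^sup>2" using elim powr_add_even[of "norm x" "s - 2" 1] by simp
        then have "x $ n / (norm x)\<^sup>2 * norm x powr s = x $ n * norm x powr (s - 2)" using elim by simp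
        then have e: "complex_of_real (x $ n / (norm x)\<^sup>2) * ?\<rho> s x = of_real (x $ n) * ?\<rho> (s - 2) x" unfolding of_real_mult[symmetric] by (simp only:)
        have "of_real 2 * of_real (?v * (x $ n / (norm x)\<^sup>2)) * (?rad x * p x) = of_real (2 * ?v) * ((complex_of_real (x $ n / (norm x)\<^sup>2) * ?\<rho> s x) * (gauss_pow 0 x * ?q x))"
          unfolding radp by (simp only: of_real_mult mult.assoc)
        also have "\<dots> = of_real (2 * ?v) * (?\<rho> (s - 2) x * (gauss_pow 0 x * ?xq x))" unfolding e by (simp only: mult_ac)
        finally have 1: "of_real 2 * of_real (?v * (x $ n / (norm x)\<^sup>2)) * (?rad x * p x) = of_real (2 * ?v) * (?\<rho> (s - 2) x * (gauss_pow 0 x * ?xq x))" .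
        have 2: "?rad x * refl_int n p x = of_real (2 * ?v) * (?\<rho> s x * (gauss_pow 0 x * ?l x))"
          unfolding refl_int_harmonic[OF p elim] gauss_pow_eq[of j] by (simp only: mult_ac)
        show ?case unfolding 1 2 by (simp only: right_diff_distrib mult_ac)
      qed
    qed
    also have "\<dots> = of_real (2 * ?v) * (?X - ?Y)"
      by (subst integral_mult_right_zero, subst Bochner_Integration.integral_diff) (auto intro!: int c a simp del: of_real_power)
    finally show ?thesis unfolding radp .
  qed
  have L: "(LINT x|lborel. (partial n f x + of_real (b / ?v) * refl_int n f x) * (?\<rho> s x * test_fun j p x)) = - (?A + of_real s * ?X) + of_real (b / ?v) * (of_real (2 * ?v) * (?X - ?Y))"
    unfolding test_fun 1[symmetric] 2[symmetric] distrib_right mult.assoc[of "of_real (b / ?v)"]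
    by (subst Bochner_Integration.integral_add) (auto intro!: integrable_mult_right int c a simp only: integral_mult_right_zero)
  have "(LINT x|lborel. f x * (?\<rho> s x * partial n (test_fun j p) x + of_real (s - 2 * b) * (?\<rho> (s - 2) x * (of_real (x $ n) * test_fun j p x))
        + 2 * of_real b * (?\<rho> s x * (gauss_pow j x * lowering n m p x)))) =
      (LINT x|lborel. f x * (?\<rho> s x * (gauss_pow 0 x * ?dq x)) + of_real (s - 2 * b) * (f x * (?\<rho> (s - 2) x * (gauss_pow 0 x * ?xq x)))
        + 2 * of_real b * (f x * (?\<rho> s x * (gauss_pow 0 x * ?l x))))"
    unfolding test_fun_eq[of j p] partial_gauss_mult[OF c(1)] gpl
    by (rule Bochner_Integration.integral_cong[OF refl]) (simp only: distrib_left mult_ac)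
  also have "\<dots> = ?A + of_real (s - 2 * b) * ?X + 2 * of_real b * ?Y"
  proof -
    have i: "integrable lborel (\<lambda>x. f x * (?\<rho> s x * (gauss_pow 0 x * ?dq x)))"
      "integrable lborel (\<lambda>x. of_real (s - 2 * b) * (f x * (?\<rho> (s - 2) x * (gauss_pow 0 x * ?xq x))))"
      "integrable lborel (\<lambda>x. 2 * of_real b * (f x * (?\<rho> s x * (gauss_pow 0 x * ?l x))))"
      by (intro integrable_mult_right int c a)+
    show ?thesis
      unfolding Bochner_Integration.integral_add[OF Bochner_Integration.integrable_add[OF i(1,2)] i(3)] Bochner_Integration.integral_add[OF i(1,2)] integral_mult_right_zero ..
  qed
  finally have Rr: "(LINT x|lborel. f x * (?\<rho> s x * partial n (test_fun j p) x + of_real (s - 2 * b) * (?\<rho> (s - 2) x * (of_real (x $ n) * test_fun j p x))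
        + 2 * of_real b * (?\<rho> s x * (gauss_pow j x * lowering n m p x)))) = ?A + of_real (s - 2 * b) * ?X + 2 * of_real b * ?Y" .
  have bv: "complex_of_real (b / ?v) * of_real (2 * ?v) = 2 * of_real b" using v by simp
  have "- (A + of_real s * X) + of_real (b / ?v) * (of_real (2 * ?v) * (X - Y)) = - (A + of_real (s - 2 * b) * X + 2 * of_real b * Y)" for A X Y :: complex
    unfolding mult.assoc[symmetric] bv by (simp add: algebra_simps)
  then show ?thesis unfolding L Rr .
qed

text \<open>With \<open>s = 2 b + 2 K\<close> one has \<open>|x|\<^sup>2\<^sup>b test_fun (K + j) p = |x|\<^sup>s test_fun j p\<close>, and the derivative of \<open>|x|\<^sup>2\<^sup>K\<close> accounts for the term with \<open>s - 2 b\<close> in \<open>reflection_operator_weighted_integral\<close>. Hence both operators have the same pairing with the test functions.\<close>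
lemma D_op_eq_refl_int:
  fixes f :: "real^'n::finite \<Rightarrow> complex"
  assumes b: "b > - real CARD('n) / 2"
    and G: "is_universal_cover_SL2 G \<pi>"
    and R: "is_radial_Euler b R"
    and Omega: "is_Omega G \<pi> b R \<Omega>"
    and smooth: "smooth_vectors_are_schwartz G \<pi> b \<Omega>"
    and f: "f \<in> schwartz"
  shows "D_op G \<pi> b \<Omega> n f x = partial n f x + of_real (b / sphere_vol TYPE('n)) * refl_int n f x"
proof -
  let ?D = "D_op G \<pi> b \<Omega> n f"
  let ?T = "\<lambda>x. partial n f x + of_real (b / sphere_vol TYPE('n)) * refl_int n f x"
  note D = D_op_schwartz[OF b G R Omega smooth f, of n]
  \<comment> \<open>The choice of \<open>K\<close> makes \<open>s > 2\<close>, as integration by parts requires.\<close>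
  obtain K :: nat where K0: "real K > max 0 (1 - b)" using reals_Archimedean2 by blast
  define s where "s = 2 * b + 2 * real K"
  have K: "K > 0" "s > 2" "2 * b + 2 * real K > 0" using K0 by (auto simp: s_def)
  have Tc: "continuous_on UNIV ?T"
    by (intro continuous_on_add continuous_on_mult continuous_on_const schwartz_continuous[OF schwartz_partial[OF f]] refl_int_bounded_continuous[OF f])
  obtain C0 where C0: "\<And>x. norm x ^ 0 * cmod (?D x) \<le> C0" using schwartz_decay[OF D, of 0] by metis
  obtain C1 where C1: "\<And>x. cmod (partial n f x) \<le> C1" using schwartz_partial_bound[OF f] by metis
  obtain C2 where C2: "\<And>x. cmod (refl_int n f x) \<le> C2" using refl_int_bounded_continuous(2)[OF f] by blast
  have Tb: "cmod (?T x) \<le> C1 + \<bar>b / sphere_vol TYPE('n)\<bar> * C2" for x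
    by (rule order_trans[OF norm_triangle_ineq]) (unfold norm_mult norm_of_real, intro add_mono mult_left_mono C1 C2 abs_ge_zero)
  have "?D x - ?T x = 0"
  proof (rule test_functions_dense[OF b K(3) K(1)])
    show "continuous_on UNIV (\<lambda>x. ?D x - ?T x)" by (intro continuous_on_diff schwartz_continuous[OF D] Tc)
    show "cmod (?D x - ?T x) \<le> C0 + (C1 + \<bar>b / sphere_vol TYPE('n)\<bar> * C2)" for x
      using norm_triangle_ineq4[of "?D x" "?T x"] C0[of x] Tb[of x] by simp
    fix j m p assume p: "(p :: real^'n \<Rightarrow> complex) \<in> harmonic_poly m"
    have cp: "cpoly p" using p by (simp add: harmonic_poly_iff)
    let ?\<rho> = "\<lambda>a x. complex_of_real (norm (x :: real^'n) powr a)"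
    have w: "?\<rho> (2 * b) x * u = ?\<rho> s x * v" if "x \<noteq> 0" "u = of_real ((norm x)\<^sup>2) ^ K * v" for x :: "real^'n" and u v
    proof -
      have "?\<rho> s x = ?\<rho> (2 * b) x * of_real ((norm x)\<^sup>2) ^ K"
        using that(1) powr_add_even[of "norm x" "2 * b" K] by (simp add: s_def)
      then show ?thesis unfolding that(2) by (simp only: mult.assoc)
    qed
    have gpK: "gauss_pow (K + j) x = of_real ((norm x)\<^sup>2) ^ K * gauss_pow j x" for x :: "real^'n"
      by (simp only: gauss_pow_eq[of "K + j"] gauss_pow_eq[of j] power_add mult_ac)
    have testK: "test_fun (K + j) p x = of_real ((norm x)\<^sup>2) ^ K * test_fun j p x" for x
      by (simp only: test_fun_def gpK mult.assoc)
    have w1: "?\<rho> (2 * b) x * (h * test_fun (K + j) p x) = h * (?\<rho> s x * test_fun j p x)" if "x \<noteq> 0" for x h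
      unfolding mult.left_commute[of "?\<rho> (2 * b) x" h] w[OF that testK] ..
    have w2: "?\<rho> (2 * b) x * (f x * (partial n (test_fun (K + j) p) x + 2 * of_real b * (gauss_pow (K + j) x * lowering n m p x))) =
        f x * (?\<rho> s x * partial n (test_fun j p) x + of_real (s - 2 * b) * (?\<rho> (s - 2) x * (of_real (x $ n) * test_fun j p x))
          + 2 * of_real b * (?\<rho> s x * (gauss_pow j x * lowering n m p x)))" if x: "x \<noteq> 0" for x
    proof -
      obtain K' where K': "K = Suc K'" using K(1) gr0_implies_Suc by blast
      let ?N = "\<lambda>x::real^'n. complex_of_real ((norm x)\<^sup>2)"
      have Nd: "(\<lambda>x. ?N x ^ K) differentiable (at x)" by (intro cpoly_differentiable cpoly_power cpoly_norm_sq)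
      have "partial n (test_fun (K + j) p) x = partial n (\<lambda>x. ?N x ^ K) x * test_fun j p x + ?N x ^ K * partial n (test_fun j p) x"
        unfolding testK[abs_def] by (rule partial_mult[OF Nd differentiable_test_fun[OF cp]])
      also have "partial n (\<lambda>x. ?N x ^ K) x = of_nat K * ?N x ^ K' * (2 * of_real (x $ n))"
      proof -
        have "(?N has_derivative (\<lambda>h. \<Sum>k\<in>UNIV. of_real (h $ k) * partial k ?N x)) (at x)"
          by (rule has_derivative_partial[OF cpoly_differentiable[OF cpoly_norm_sq]])
        from partial_eqI[OF has_derivative_power[OF this, of K], of n]
        show ?thesis by (simp add: K' partial_norm_sq axis_def if_distrib if_distribR cong: if_cong del: of_real_power)
      qed
      finally have d: "partial n (test_fun (K + j) p) x = of_nat K * ?N x ^ K' * (2 * of_real (x $ n)) * test_fun j p x + ?N x ^ K * partial n (test_fun j p) x" .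
      have \<rho>': "?\<rho> (2 * b) x * ?N x ^ K' = ?\<rho> (s - 2) x"
      proof -
        have "s - 2 = 2 * b + 2 * real K'" by (simp add: s_def K')
        then show ?thesis using x powr_add_even[of "norm x" "2 * b" K'] by simp
      qed
      have sK: "complex_of_real (s - 2 * b) = of_nat K * 2" by (simp add: s_def)
      have e1: "?\<rho> (2 * b) x * (of_nat K * ?N x ^ K' * (2 * of_real (x $ n)) * test_fun j p x) = of_real (s - 2 * b) * (?\<rho> (s - 2) x * (of_real (x $ n) * test_fun j p x))"
        unfolding sK \<rho>'[symmetric] by (simp only: mult_ac)
      have e2: "?\<rho> (2 * b) x * (?N x ^ K * partial n (test_fun j p) x) = ?\<rho> s x * partial n (test_fun j p) x"
        by (rule w[OF x refl])
      have e3: "?\<rho> (2 * b) x * (2 * of_real b * (gauss_pow (K + j) x * lowering n m p x)) = 2 * of_real b * (?\<rho> s x * (gauss_pow j x * lowering n m p x))"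
      proof -
        have g: "gauss_pow (K + j) x * lowering n m p x = of_real ((norm x)\<^sup>2) ^ K * (gauss_pow j x * lowering n m p x)" by (simp only: gpK mult.assoc)
        show ?thesis unfolding mult.left_commute[of "?\<rho> (2 * b) x" "2 * of_real b"] w[OF x g] ..
      qed
      show ?thesis unfolding d mult.left_commute[of "?\<rho> (2 * b) x" "f x"] distrib_left[of "?\<rho> (2 * b) x"] e1 e2 e3
        by (simp only: add.commute[of "?\<rho> s x * partial n (test_fun j p) x"])
    qed
    have cK: "cpoly (\<lambda>x. of_real ((norm x)\<^sup>2) ^ j * p x)" by (rule cpoly_test_fun[OF cp])
    have test_fun: "test_fun j p x = gauss_pow 0 x * (of_real ((norm x)\<^sup>2) ^ j * p x)" for x by (simp only: test_fun_eq)
    have s0: "s > - real CARD('n)" using K by simp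
    have iD: "integrable lborel (\<lambda>x. ?D x * (?\<rho> s x * test_fun j p x))"
      unfolding test_fun using C0 by (intro integrable_bounded_powr_gauss[OF schwartz_measurable[OF D] _ cK s0, of C0]) simp
    have iT: "integrable lborel (\<lambda>x. ?T x * (?\<rho> s x * test_fun j p x))"
      unfolding test_fun by (rule integrable_bounded_powr_gauss[OF borel_measurable_continuous_onI[OF Tc] Tb cK s0])
    note [measurable] = schwartz_measurable[OF f] schwartz_measurable[OF D] borel_measurable_continuous_onI[OF Tc]
      differentiable_borel_measurable[OF differentiable_test_fun[OF cp]] differentiable_borel_measurable[OF differentiable_partial_test_fun[OF cp]]
      differentiable_borel_measurable[OF differentiable_gauss_pow] cpoly_measurable[OF cpoly_partial[OF cp]]
    have [measurable]: "lowering n m p \<in> borel_measurable borel" unfolding lowering_def by measurable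
    have "(LINT x|lborel. ?D x * (?\<rho> s x * test_fun j p x)) = (LINT x|lborel. ?\<rho> (2 * b) x * (?D x * test_fun (K + j) p x))"
      proof (rule integral_cong_nonzero)
   show "(\<lambda>x. ?D x * (?\<rho> s x * test_fun j p x)) \<in> borel_measurable borel" by measurable
 show "(\<lambda>x. ?\<rho> (2 * b) x * (?D x * test_fun (K + j) p x)) \<in> borel_measurable borel" by measurable
qed (rule w1[symmetric])
    also have "\<dots> = - (LINT x|lborel. ?\<rho> (2 * b) x * (f x * (partial n (test_fun (K + j) p) x + 2 * of_real b * (gauss_pow (K + j) x * lowering n m p x))))"
      by (rule D_op_weighted_integral[OF b G R Omega smooth f p])
    also have "(LINT x|lborel. ?\<rho> (2 * b) x * (f x * (partial n (test_fun (K + j) p) x + 2 * of_real b * (gauss_pow (K + j) x * lowering n m p x)))) =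
        (LINT x|lborel. f x * (?\<rho> s x * partial n (test_fun j p) x + of_real (s - 2 * b) * (?\<rho> (s - 2) x * (of_real (x $ n) * test_fun j p x))
          + 2 * of_real b * (?\<rho> s x * (gauss_pow j x * lowering n m p x))))"
      by (rule integral_cong_nonzero, measurable, measurable, rule w2)
    also have "- \<dots> = (LINT x|lborel. ?T x * (?\<rho> s x * test_fun j p x))"
      by (rule reflection_operator_weighted_integral[OF f p K(2), symmetric])
    finally have eq: "(LINT x|lborel. ?D x * (?\<rho> s x * test_fun j p x)) = (LINT x|lborel. ?T x * (?\<rho> s x * test_fun j p x))" .
    have "(LINT x|lborel. ?\<rho> (2 * b) x * ((?D x - ?T x) * test_fun (K + j) p x)) = (LINT x|lborel. ?D x * (?\<rho> s x * test_fun j p x) - ?T x * (?\<rho> s x * test_fun j p x))"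
      by (rule integral_cong_nonzero, measurable, measurable, subst w1, assumption, rule left_diff_distrib)
    also have "\<dots> = 0" unfolding Bochner_Integration.integral_diff[OF iD iT] eq by simp
    finally show "(LINT x|lborel. ?\<rho> (2 * b) x * ((?D x - ?T x) * test_fun (K + j) p x)) = 0" .
  qed
  then show ?thesis by simp
qed

section \<open>The integral over the sphere of radius \<open>|x|\<close>\<close>

lemma scale_measure_eq_density: "scale_measure c M = density M (\<lambda>_. c)"
  by (rule measure_eqI) (simp_all add: emeasure_density_const)

text \<open>Write \<open>x = r e\<close> and \<open>y = r \<eta>\<close>, and substitute \<open>\<eta> = \<sigma>\<^sub>\<xi> e\<close>. By \<open>distr_reflection_sphere\<close> the substitution absorbs \<open>|e - \<eta>|\<^sup>2\<^sup>-\<^sup>N\<close> from \<open>|x - y|\<^sup>-\<^sup>N\<close>; the remaining \<open>(e\<^sub>n - \<eta>\<^sub>n) / |e - \<eta>|\<^sup>2\<close> equals \<open>\<xi>\<^sub>n / (2 \<langle>\<xi>, e\<rangle>)\<close> since \<open>e - \<sigma>\<^sub>\<xi> e = 2 \<langle>\<xi>, e\<rangle> \<xi>\<close>.\<close>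
lemma reflection_integral_spherical:
  fixes f :: "real^'n::finite \<Rightarrow> complex"
  assumes f: "f \<in> schwartz" and x: "x \<noteq> 0"
  shows "integrable (sphere_measure_radius (norm x))
      (\<lambda>y. of_real ((x $ n - y $ n) / norm (x - y) ^ CARD('n)) * (f x - f y))"
    and "(LINT y|sphere_measure_radius (norm x). of_real ((x $ n - y $ n) / norm (x - y) ^ CARD('n)) * (f x - f y)) =
      1 / 2 * refl_int n f x"
proof -
  define r where "r = norm x"
  define e where "e = sgn x"
  have r: "r > 0" and e: "norm e = 1" using x by (simp_all add: r_def e_def norm_sgn)
  have xre: "x = r *\<^sub>R e" by (simp only: r_def e_def norm_sgn_eq_self)
  note [measurable] = schwartz_measurable[OF f]
  let ?G = "\<lambda>y. complex_of_real ((x $ n - y $ n) / norm (x - y) ^ CARD('n)) * (f x - f y)"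
  let ?g = "\<lambda>\<eta>. complex_of_real ((e $ n - \<eta> $ n) / (norm (e - \<eta>))\<^sup>2 / r) * (f x - f (r *\<^sub>R \<eta>))"
  let ?S = "sphere_measure :: (real^'n) measure"
  let ?c = "\<lambda>\<eta>. norm (e - \<eta>) powr (2 - real CARD('n))"
  have [measurable]: "?G \<in> borel_measurable borel" "?g \<in> borel_measurable borel" by measurable
  have [measurable]: "(\<lambda>\<eta>. reflection \<eta> e) \<in> ?S \<rightarrow>\<^sub>M borel"
    using measurable_reflection_arg[of e] by (subst measurable_cong_sets[OF sets_sphere_measure refl])
  \<comment> \<open>At \<open>\<eta> = e\<close> both sides are zero, because the factor \<open>e\<^sub>n - \<eta>\<^sub>n\<close> vanishes.\<close>
  have point: "(r powr (real CARD('n) - 2)) *\<^sub>R ?G (r *\<^sub>R \<eta>) = ?c \<eta> *\<^sub>R ?g \<eta>" for \<eta>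
  proof (cases "\<eta> = e")
    case True
    then show ?thesis by (simp add: xre)
  next
    case False
    define u where "u = norm (e - \<eta>)"
    have u: "u > 0" using False by (simp add: u_def)
    have "norm (x - r *\<^sub>R \<eta>) = r * u"
      unfolding xre scaleR_diff_right[symmetric] norm_scaleR u_def using r by simp
    moreover have "x $ n - (r *\<^sub>R \<eta>) $ n = r * (e $ n - \<eta> $ n)" by (simp add: xre right_diff_distrib)
    moreover have "r powr (real CARD('n) - 2) = r ^ CARD('n) / r\<^sup>2" "u powr (2 - real CARD('n)) = u\<^sup>2 / u ^ CARD('n)"
      using r u by (simp_all add: powr_diff powr_realpow)
    moreover have "r ^ CARD('n) / r\<^sup>2 * (r * a / (r * u) ^ CARD('n)) = u\<^sup>2 / u ^ CARD('n) * (a / u\<^sup>2 / r)" for a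
      using r u by (simp add: power_mult_distrib power2_eq_square)
    ultimately have "r powr (real CARD('n) - 2) * ((x $ n - (r *\<^sub>R \<eta>) $ n) / norm (x - r *\<^sub>R \<eta>) ^ CARD('n)) =
        ?c \<eta> * ((e $ n - \<eta> $ n) / (norm (e - \<eta>))\<^sup>2 / r)"
      unfolding u_def by (simp only:)
    then show ?thesis unfolding scaleR_conv_of_real mult.assoc[symmetric] of_real_mult[symmetric] by (simp only:)
  qed
  have refl: "?g (reflection \<xi> e) = 1 / 2 * (of_real (\<xi> $ n) * reflection_quotient f x \<xi>)"
    if "norm \<xi> = 1" "x \<bullet> \<xi> \<noteq> 0" for \<xi>
  proof -
    define c where "c = \<xi> \<bullet> e"
    have xc: "\<xi> \<bullet> x = r * c" by (simp add: xre c_def)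
    have c: "c \<noteq> 0" using that(2) xc by (simp add: inner_commute)
    have d: "e - reflection \<xi> e = (2 * c) *\<^sub>R \<xi>" by (simp add: reflection_def c_def inner_commute)
    have "e $ n - reflection \<xi> e $ n = 2 * c * \<xi> $ n"
      using arg_cong[OF d, of "\<lambda>v. v $ n"] by simp
    moreover have "(norm (e - reflection \<xi> e))\<^sup>2 = 4 * c\<^sup>2"
      unfolding d using that(1) by (simp add: power_mult_distrib)
    ultimately have a: "(e $ n - reflection \<xi> e $ n) / (norm (e - reflection \<xi> e))\<^sup>2 / r = 1 / 2 * (\<xi> $ n / (\<xi> \<bullet> x))"
      using c r by (simp add: xc power2_eq_square)
    have b: "r *\<^sub>R reflection \<xi> e = reflection \<xi> x" unfolding xre reflection_scaleR ..
    have q: "reflection_quotient f x \<xi> = (f x - f (reflection \<xi> x)) / of_real (\<xi> \<bullet> x)"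
      using that(2) by (intro reflection_quotient_eq schwartz_differentiable f) (simp add: inner_commute)
    have "of_real (1 / 2 * (u / v)) * z = 1 / 2 * (of_real u * (z / of_real v))" for u v :: real and z :: complex
      by simp
    then show ?thesis unfolding a b q .
  qed
  have reflAE: "AE \<xi> in ?S. ?g (reflection \<xi> e) = 1 / 2 * (of_real (\<xi> $ n) * reflection_quotient f x \<xi>)"
    using AE_sphere_measure_norm AE_sphere_inner_nonzero[OF x] by eventually_elim (rule refl)
  have rq [measurable]: "(\<lambda>\<xi>. of_real (\<xi> $ n) * reflection_quotient f x \<xi>) \<in> borel_measurable ?S"
    by (rule borel_measurable_integrable[OF integrable_refl_quotient[OF f]])
  have "integrable ?S (\<lambda>\<xi>. 1 / 2 * (of_real (\<xi> $ n) * reflection_quotient f x \<xi>))"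
    by (intro integrable_mult_right integrable_refl_quotient f)
  then have "integrable ?S (\<lambda>\<xi>. ?g (reflection \<xi> e))"
    using reflAE by (subst integrable_cong_AE[OF _ _ reflAE]) measurable
  then have "integrable (density ?S (\<lambda>\<eta>. ennreal (?c \<eta>))) ?g"
    unfolding distr_reflection_sphere[OF e, symmetric] by (subst integrable_distr_eq) measurable
  then have "integrable ?S (\<lambda>\<eta>. ?c \<eta> *\<^sub>R ?g \<eta>)"
    by (subst (asm) integrable_density) auto
  then have int: "integrable ?S (\<lambda>\<eta>. (r powr (real CARD('n) - 2)) *\<^sub>R ?G (r *\<^sub>R \<eta>))" by (simp only: point)
  then have "integrable (density ?S (\<lambda>_. ennreal (r powr (real CARD('n) - 2)))) (\<lambda>\<eta>. ?G (r *\<^sub>R \<eta>))"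
    by (subst integrable_density) auto
  then show "integrable (sphere_measure_radius (norm x)) ?G"
    unfolding sphere_measure_radius_def r_def[symmetric] scale_measure_eq_density by (subst integrable_distr_eq) auto
  have "(LINT y|sphere_measure_radius (norm x). ?G y) = (LINT \<eta>|density ?S (\<lambda>_. ennreal (r powr (real CARD('n) - 2))). ?G (r *\<^sub>R \<eta>))"
    unfolding sphere_measure_radius_def r_def[symmetric] scale_measure_eq_density by (rule integral_distr) auto
  also have "\<dots> = (LINT \<eta>|?S. (r powr (real CARD('n) - 2)) *\<^sub>R ?G (r *\<^sub>R \<eta>))"
    by (rule integral_density) auto
  also have "\<dots> = (LINT \<eta>|?S. ?c \<eta> *\<^sub>R ?g \<eta>)" by (simp only: point)
  also have "\<dots> = (LINT \<eta>|density ?S (\<lambda>\<eta>. ennreal (?c \<eta>)). ?g \<eta>)"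
    by (rule integral_density[symmetric]) auto
  also have "\<dots> = (LINT \<xi>|?S. ?g (reflection \<xi> e))"
    unfolding distr_reflection_sphere[OF e, symmetric] by (rule integral_distr) auto
  also have "\<dots> = (LINT \<xi>|?S. 1 / 2 * (of_real (\<xi> $ n) * reflection_quotient f x \<xi>))"
    by (rule integral_cong_AE[OF _ _ reflAE]) measurable
  also have "\<dots> = 1 / 2 * refl_int n f x" unfolding refl_int_def by (rule integral_mult_right_zero)
  finally show "(LINT y|sphere_measure_radius (norm x). ?G y) = 1 / 2 * refl_int n f x" .
qed

theorem theorem3p3p1:
  fixes b :: real and n :: "'n::finite" and f :: "real^'n \<Rightarrow> complex"
    and G :: "('g::topological_space) monoid" and \<pi> :: "'g \<Rightarrow> real^2^2"
    and R :: "(real^'n \<Rightarrow> complex) \<Rightarrow> real^'n \<Rightarrow> complex"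
    and \<Omega> :: "'g \<Rightarrow> (real^'n \<Rightarrow> complex) \<Rightarrow> real^'n \<Rightarrow> complex"
  assumes b: "b > - real CARD('n) / 2"
    and G: "is_universal_cover_SL2 G \<pi>"
    and R: "is_radial_Euler b R"
    and Omega: "is_Omega G \<pi> b R \<Omega>"
    and smooth: "smooth_vectors_are_schwartz G \<pi> b \<Omega>"
    and f: "f \<in> schwartz"
  shows "(\<forall>x. x \<noteq> 0 \<longrightarrow>
           integrable (sphere_measure_radius (norm x))
             (\<lambda>y. of_real ((x $ n - y $ n) / norm (x - y) ^ CARD('n)) * (f x - f y)) \<and>
           D_op G \<pi> b \<Omega> n f x = partial n f x + of_real (2 * b / sphere_vol TYPE('n)) *
             (LINT y|sphere_measure_radius (norm x).
                of_real ((x $ n - y $ n) / norm (x - y) ^ CARD('n)) * (f x - f y)))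
       \<and> (\<forall>x.
           integrable sphere_measure (\<lambda>\<xi>. of_real (\<xi> $ n) * reflection_quotient f x \<xi>) \<and>
           D_op G \<pi> b \<Omega> n f x = partial n f x + of_real (b / sphere_vol TYPE('n)) *
             (LINT \<xi>|sphere_measure. of_real (\<xi> $ n) * reflection_quotient f x \<xi>))"
proof -
  have D: "D_op G \<pi> b \<Omega> n f x = partial n f x + of_real (b / sphere_vol TYPE('n)) * refl_int n f x" for x
    by (rule D_op_eq_refl_int[OF b G R Omega smooth f])
  show ?thesis
  proof (intro conjI allI impI)
    fix x :: "real^'n" assume x: "x \<noteq> 0"
    show "integrable (sphere_measure_radius (norm x)) (\<lambda>y. of_real ((x $ n - y $ n) / norm (x - y) ^ CARD('n)) * (f x - f y))"
      by (rule reflection_integral_spherical(1)[OF f x])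
    show "D_op G \<pi> b \<Omega> n f x = partial n f x + of_real (2 * b / sphere_vol TYPE('n)) *
        (LINT y|sphere_measure_radius (norm x). of_real ((x $ n - y $ n) / norm (x - y) ^ CARD('n)) * (f x - f y))"
      unfolding D reflection_integral_spherical(2)[OF f x] by simp
  next
    fix x :: "real^'n"
    show "integrable sphere_measure (\<lambda>\<xi>. of_real (\<xi> $ n) * reflection_quotient f x \<xi>)"
      by (rule integrable_refl_quotient[OF f])
    show "D_op G \<pi> b \<Omega> n f x = partial n f x + of_real (b / sphere_vol TYPE('n)) *
        (LINT \<xi>|sphere_measure. of_real (\<xi> $ n) * reflection_quotient f x \<xi>)"
      unfolding D refl_int_def ..
  qed
qed

end
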